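(* Let $d,m\ge1$, let $\alpha>-\frac d2$ be a real number and let $W_1,\dots,W_m\subset\mathbb{R}^d$ be convex bodies. Let $(\epsilon_t)_{t>0}$ be positive real numbers with $\epsilon_t\to0$ as $t\to\infty$. Let $\tilde F_t=(\tilde F_t^{(1)},\dots,\tilde F_t^{(m)})$ be as defined in the context and let $C=(C_{ij})_{1\le i,j\le m}$ with $C_{ij}:=|W_i\cap W_j|$. Then $C$ is the asymptotic covariance matrix of $\tilde F_t$, i.e. $\lim_{t\to\infty}\operatorname{Cov}(\tilde F_t^{(i)},\tilde F_t^{(j)})=|W_i\cap W_j|$ for all $1\le i,j\le m$. Moreover, assume that $t^2\epsilon_t^d\to\infty$ as $t\to\infty$ and let $X\sim\mathcal{N}(0,C)$ be a centred Gaussian vector with covariance matrix $C$. Then: (1) If $\alpha>-\frac d4$, there is a constant $c_1>0$ such that for all $t\ge1$ large enough $$d_3(\tilde F_t,X)\le c_1\left(\epsilon_t+\left(t^{-1/2}\vee(t^2\epsilon_t^d)^{-1/2}\right)\right).$$ (2) If $-\frac d2<\alpha\le-\frac d4$, then for any $1<p<-\frac{d}{2\alpha}$ there is a constant $c_2>0$ such that for all $t\ge1$ large enough $$d_3(\tilde F_t,X)\le c_2\left(\epsilon_t+\left(t^{-1+1/p}\vee(t^2\epsilon_t^d)^{-1+1/p}\right)\right).$$ (3) If the matrix $C$ is positive definite, then the bounds in (1) and (2) (under the respective assumptions on $\alpha$ and $p$) also hold with $d_2(\tilde F_t,X)$ in place of $d_3(\tilde F_t,X)$, for different constants $c_1,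c_2>0$.
   Context: A convex body is a compact convex set with non-empty interior; $|\cdot|$ of a set is Lebesgue measure; $\kappa_d$ is the volume of the unit ball in $\mathbb{R}^d$; $a\vee b=\max(a,b)$; $\|\cdot\|$ is the Euclidean norm. For $t>0$, $\eta^t$ is a Poisson measure on $\mathbb{R}^d$ with intensity $t\,dx$, and $\eta^t_{|W}$ is its restriction to $W$. For $1\le i\le m$, $$F_t^{(i)}:=\frac12\sum_{x,y\in\eta^t_{|W_i}}\mathbf{1}_{\{0<\|x-y\|<\epsilon_t\}}\|x-y\|^\alpha$$ (sum over ordered pairs of points), and $$\tilde F_t^{(i)}:=t^{-1}\epsilon_t^{-\alpha-d/2}\left(\tfrac12\sigma_1+\sigma_2t\epsilon_t^d\right)^{-1/2}\left(F_t^{(i)}-\mathbb{E}F_t^{(i)}\right),\qquad \sigma_1:=\frac{d\kappa_d}{d+2\alpha},\quad \sigma_2:=\left(\frac{d\kappa_d}{\alpha+d}\right)^2 .$$ Distances: for $\phi:\mathbb{R}^m\to\mathbb{R}$ of class $\mathcal{C}^k$, $\|\phi^{(k)}\|_\infty$ is the maximum over all $k$-th order partial derivatives of their sup-norms. $\mathcal{H}^{(2)}_m$ is the set of $\mathcal{C}^2$ functions $h:\mathbb{R}^m\to\mathbb{R}$ with $|h(x)-h(y)|\le\|x-y\|$ for all $x,y$ and $\sup_x\|\operatorname{Hess}h(x)\|_{op}\le1$ ($\|\cdot\|_{op}$ the operator norm). $\mathcal{H}^{(3)}_m$ is the set of $\mathcal{C}^3$ functions $h:\mathbb{R}^m\to\mathbb{R}$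 with $\|h^{(2)}\|_\infty\le1$ and $\|h^{(3)}\|_\infty\le1$. For $k\in\{2,3\}$, $d_k(X,Y):=\sup_{h\in\mathcal{H}^{(k)}_m}|\mathbb{E}h(X)-\mathbb{E}h(Y)|$ (for random vectors with finite first moment of the norm if $k=2$, finite second moment if $k=3$). The constants do not depend on $t$ (they may depend on all other data, including $p$ in case (2)). *)

theory Defs
  imports "HOL-Probability.Probability"
begin

section \<open>Convex bodies\<close>

definition convex_body :: "'a::euclidean_space set \<Rightarrow> bool" where
  "convex_body K \<longleftrightarrow> compact K \<and> convex K \<and> interior K \<noteq> {}"

section \<open>Poisson measures\<close>

text \<open>
  A point configuration is a locally finite measure with values in the natural numbers
  (and infinity on unbounded sets), i.e. a locally finite sum of Dirac measures.
\<close>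

definition point_configuration :: "'a::euclidean_space measure \<Rightarrow> bool" where
  "point_configuration \<mu> \<longleftrightarrow>
     sets \<mu> = sets borel \<and>
     (\<forall>B\<in>sets borel. emeasure \<mu> B = \<infinity> \<or> (\<exists>k::nat. emeasure \<mu> B = of_nat k)) \<and>
     (\<forall>B\<in>sets borel. bounded B \<longrightarrow> emeasure \<mu> B < \<infinity>)"

text \<open>
  The Poisson weights are written out, rather than taken from \<open>poisson_pmf\<close>, because the latter
  only behaves as intended for a strictly positive rate; here the rate is 0 for null sets \<open>B\<close>,
  and then (with \<open>0 ^ 0 = 1\<close>) the formula gives the point mass at 0.
\<close>

definition poisson_measure ::
    "'w measure \<Rightarrow> ('w \<Rightarrow> 'a::euclidean_space measure) \<Rightarrow> 'a measure \<Rightarrow> bool" where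
  "poisson_measure M \<eta> \<Lambda> \<longleftrightarrow>
     prob_space M \<and>
     (\<forall>\<omega>\<in>space M. point_configuration (\<eta> \<omega>)) \<and>
     (\<forall>B\<in>sets borel. (\<lambda>\<omega>. emeasure (\<eta> \<omega>) B) \<in> borel_measurable M) \<and>
     (\<forall>B\<in>sets borel. emeasure \<Lambda> B < \<infinity> \<longrightarrow>
        (\<forall>k::nat. measure M {\<omega>\<in>space M. emeasure (\<eta> \<omega>) B = of_nat k}
                    = measure \<Lambda> B ^ k / fact k * exp (- measure \<Lambda> B))) \<and>
     (\<forall>\<B>. finite \<B> \<longrightarrow> \<B> \<subseteq> sets borel \<longrightarrow> disjoint \<B> \<longrightarrow>
        prob_space.indep_vars M (\<lambda>_. borel) (\<lambda>B \<omega>. emeasure (\<eta> \<omega>) B) \<B>)"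

definition points :: "'a::euclidean_space measure \<Rightarrow> 'a set" where
  "points \<mu> = {x. emeasure \<mu> {x} \<noteq> 0}"

section \<open>Edge functionals of the random geometric graph\<close>

text \<open>
  Points are counted with their multiplicity \<open>measure \<mu> {x}\<close>, as usual for sums over the points
  of a counting measure; for a Poisson measure with diffuse intensity all multiplicities are
  almost surely 1. For bounded \<open>W\<close> the sums are finite.
\<close>

definition edge_functional ::
    "real \<Rightarrow> real \<Rightarrow> 'a::euclidean_space set \<Rightarrow> 'a measure \<Rightarrow> real" where
  "edge_functional \<alpha> r W \<mu> =
     1 / 2 * (\<Sum>x\<in>points \<mu> \<inter> W. \<Sum>y\<in>points \<mu> \<inter> W.
        measure \<mu> {x} * measure \<mu> {y} *
        (if 0 < norm (x - y) \<and> norm (x - y) < r then norm (x - y) powr \<alpha> else 0))"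

definition sigma1 :: "'a::euclidean_space itself \<Rightarrow> real \<Rightarrow> real" where
  "sigma1 _ \<alpha> = real DIM('a) * measure lborel (ball (0::'a) 1) / (real DIM('a) + 2 * \<alpha>)"

definition sigma2 :: "'a::euclidean_space itself \<Rightarrow> real \<Rightarrow> real" where
  "sigma2 _ \<alpha> = (real DIM('a) * measure lborel (ball (0::'a) 1) / (\<alpha> + real DIM('a)))\<^sup>2"

definition normalized_edge_functional ::
    "'w measure \<Rightarrow> ('w \<Rightarrow> 'a::euclidean_space measure) \<Rightarrow> real \<Rightarrow> real \<Rightarrow> real \<Rightarrow> 'a set
      \<Rightarrow> 'w \<Rightarrow> real" where
  "normalized_edge_functional M \<eta> \<alpha> t r W \<omega> =
     t powr (-1) * r powr (- \<alpha> - real DIM('a) / 2) *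
     (1 / 2 * sigma1 TYPE('a) \<alpha> + sigma2 TYPE('a) \<alpha> * t * r ^ DIM('a)) powr (-1 / 2) *
     (edge_functional \<alpha> r W (\<eta> \<omega>) - (\<integral>\<omega>'. edge_functional \<alpha> r W (\<eta> \<omega>') \<partial>M))"

definition normalized_edge_vector ::
    "'w measure \<Rightarrow> ('w \<Rightarrow> 'a::euclidean_space measure) \<Rightarrow> real \<Rightarrow> real \<Rightarrow> real \<Rightarrow> ('m::finite \<Rightarrow> 'a set)
      \<Rightarrow> 'w \<Rightarrow> real ^ 'm" where
  "normalized_edge_vector M \<eta> \<alpha> t r W \<omega> =
     (\<chi> i. normalized_edge_functional M \<eta> \<alpha> t r (W i) \<omega>)"

section \<open>Covariances and Gaussian vectors\<close>

definition covariance :: "'w measure \<Rightarrow> ('w \<Rightarrow> real) \<Rightarrow> ('w \<Rightarrow> real) \<Rightarrow> real" where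
  "covariance M X Y = (\<integral>\<omega>. (X \<omega> - (\<integral>\<omega>'. X \<omega>' \<partial>M)) * (Y \<omega> - (\<integral>\<omega>'. Y \<omega>' \<partial>M)) \<partial>M)"

definition intersection_matrix :: "('m::finite \<Rightarrow> 'a::euclidean_space set) \<Rightarrow> real ^ 'm ^ 'm" where
  "intersection_matrix W = (\<chi> i j. measure lborel (W i \<inter> W j))"

definition positive_definite :: "real ^ 'm ^ 'm \<Rightarrow> bool" where
  "positive_definite A \<longleftrightarrow> transpose A = A \<and> (\<forall>u. u \<noteq> 0 \<longrightarrow> 0 < u \<bullet> (A *v u))"

text \<open>
  Every linear combination of the components is normally distributed, where point masses
  (\<open>s = 0\<close>) count as normal distributions; so the covariance matrix may be singular.
\<close>

definition gaussian_vector :: "'w measure \<Rightarrow> ('w \<Rightarrow> real ^ 'm) \<Rightarrow> bool" where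
  "gaussian_vector M X \<longleftrightarrow>
     prob_space M \<and> X \<in> borel_measurable M \<and>
     (\<forall>u. \<exists>\<mu> s. (s = 0 \<and> (AE \<omega> in M. u \<bullet> X \<omega> = \<mu>)) \<or>
                (0 < s \<and> distributed M lborel (\<lambda>\<omega>. u \<bullet> X \<omega>) (normal_density \<mu> s)))"

definition centred_gaussian_vector ::
    "'w measure \<Rightarrow> ('w \<Rightarrow> real ^ 'm) \<Rightarrow> real ^ 'm ^ 'm \<Rightarrow> bool" where
  "centred_gaussian_vector M X C \<longleftrightarrow>
     gaussian_vector M X \<and>
     (\<forall>i. (\<integral>\<omega>. X \<omega> $ i \<partial>M) = 0) \<and>
     (\<forall>i j. covariance M (\<lambda>\<omega>. X \<omega> $ i) (\<lambda>\<omega>. X \<omega> $ j) = C $ i $ j)"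

section \<open>The distances\<close>

definition partial_deriv :: "'m::finite \<Rightarrow> (real ^ 'm \<Rightarrow> real) \<Rightarrow> real ^ 'm \<Rightarrow> real" where
  "partial_deriv i f x = frechet_derivative f (at x) (axis i 1)"

primrec C_k :: "nat \<Rightarrow> (real ^ 'm::finite \<Rightarrow> real) \<Rightarrow> bool" where
  "C_k 0 f \<longleftrightarrow> continuous_on UNIV f"
| "C_k (Suc k) f \<longleftrightarrow> f differentiable_on UNIV \<and> (\<forall>i. C_k k (partial_deriv i f))"

text \<open>
  \<open>deriv_norm k f\<close> is the maximum of the sup-norms of the \<open>k\<close>-th order partial derivatives, each
  given by the list of the \<open>k\<close> directions.
\<close>

definition deriv_norm :: "nat \<Rightarrow> (real ^ 'm::finite \<Rightarrow> real) \<Rightarrow> ennreal" where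
  "deriv_norm k f =
     (SUP is\<in>{is. length is = k}. SUP x. ennreal \<bar>foldr partial_deriv is f x\<bar>)"

definition hessian :: "(real ^ 'm::finite \<Rightarrow> real) \<Rightarrow> real ^ 'm \<Rightarrow> real ^ 'm ^ 'm" where
  "hessian f x = (\<chi> i j. partial_deriv i (partial_deriv j f) x)"

definition H2 :: "(real ^ 'm::finite \<Rightarrow> real) set" where
  "H2 = {h. C_k 2 h \<and> (\<forall>x y. \<bar>h x - h y\<bar> \<le> norm (x - y)) \<and>
            (\<forall>x. onorm (\<lambda>v. hessian h x *v v) \<le> 1)}"

definition H3 :: "(real ^ 'm::finite \<Rightarrow> real) set" where
  "H3 = {h. C_k 3 h \<and> deriv_norm 2 h \<le> 1 \<and> deriv_norm 3 h \<le> 1}"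

text \<open>
  The supremum is taken in \<^typ>\<open>ennreal\<close>: it may be infinite, and then a bound by a real number
  must fail.
\<close>

definition dist_wrt ::
    "('e \<Rightarrow> real) set \<Rightarrow> 'w measure \<Rightarrow> ('w \<Rightarrow> 'e) \<Rightarrow> 'v measure \<Rightarrow> ('v \<Rightarrow> 'e) \<Rightarrow> ennreal" where
  "dist_wrt H M X N Y = (SUP h\<in>H. ennreal \<bar>(\<integral>\<omega>. h (X \<omega>) \<partial>M) - (\<integral>\<omega>. h (Y \<omega>) \<partial>N)\<bar>)"

definition d2 :: "'w measure \<Rightarrow> ('w \<Rightarrow> real ^ 'm::finite) \<Rightarrow> 'v measure \<Rightarrow> ('v \<Rightarrow> real ^ 'm) \<Rightarrow> ennreal"
  where "d2 = dist_wrt H2"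

definition d3 :: "'w measure \<Rightarrow> ('w \<Rightarrow> real ^ 'm::finite) \<Rightarrow> 'v measure \<Rightarrow> ('v \<Rightarrow> real ^ 'm) \<Rightarrow> ennreal"
  where "d3 = dist_wrt H3"

end

theory Submission imports Defs
begin

text \<open>
  Edges of the random geometric graph are counted by a quadratic form in the Poisson counts of small
  cells, and the functional is the increasing limit of such forms when the cells shrink. For a
  quadratic form \<open>V\<close> in independent Poisson counts the identity \<open>E (N\<^sub>k H(N)) = l\<^sub>k E (H(N + e\<^sub>k))\<close> gives an
  integration by parts formula for \<open>E (V \<bullet> g(V))\<close>. Its main term involves a random matrix \<open>\<Gamma>\<close> with
  expectation \<open>Cov V\<close> and small variance, and its error term is controlled by moments of order \<open>2 + q\<close> of the
  row sums of the kernel; \<open>q = 1\<close> is admissible if \<open>\<alpha> > - d / 4\<close>, and some \<open>q \<ge> 2 (1 - 1 / p)\<close> otherwise.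
  This is applied along the path \<open>sin \<theta> V + cos \<theta> X\<close> from the Gaussian vector \<open>X\<close> to \<open>V\<close>. There the averaged
  Hessian of a test function is Lipschitz, either because the test function has bounded third
  derivatives, or because shifting a nondegenerate Gaussian vector changes its law by little in total
  variation; in both cases the constants grow at most like \<open>1 / cos \<theta>\<close>, which the derivative of the path
  compensates. The term \<open>\<epsilon>\<^sub>t\<close> comes from the points at distance less than \<open>\<epsilon>\<^sub>t\<close> from the boundary.
\<close>

text \<open>The singularity of the kernel for negative \<alpha> shapes the proof: its powers are
  integrable only for orders below -d / \<alpha>, and \<alpha> > -d / 2 guarantees no more than
  order 2. Hence the variance of \<open>\<Gamma>\<close> has to be bounded by row moments of order 1
  and 2. This works because \<open>\<Gamma>\<close> weights the cells with their rates instead of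
  their counts, so that in its coefficients two kernel values are always averaged over a common
  cell. For the same reason a Taylor remainder of third order is too large: a Hessian that is
  bounded and Lipschitz is also Hoelder continuous of order q \<le> 1, which replaces order 3 by 2 +
  q at the price (2 + q) \<alpha> > -d. The Poisson measure is described by its values on disjoint
  sets alone. Passing to finitely many counts turns the calculus into finite sums; taking on each
  pair of cells the infimum of the kernel makes the approximation monotone under refinement, so that
  values, means and covariances converge without truncating the singularity.\<close>

section \<open>Functionals of independent Poisson counts\<close>

text \<open>In contrast to \<^const>\<open>poisson_pmf\<close>, the rate may be 0.\<close>

definition pois :: "real \<Rightarrow> nat pmf" where
  "pois l = (if 0 < l then poisson_pmf l else return_pmf 0)"

text \<open>The weights satisfy (y + 1) p(y + 1) = l p(y), so an index shift gives the identity,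
  which is the source of all later formulas. At rate 0 the law is the point mass at 0 and both sides
  vanish.\<close>

lemma nn_integral_pois:
  assumes "0 \<le> l"
  shows "(\<integral>\<^sup>+y. of_nat y * \<phi> y \<partial>pois l) = ennreal l * (\<integral>\<^sup>+y. \<phi> (Suc y) \<partial>pois l)"
proof (cases "0 < l")
  case True
  have *: "ennreal (pmf (poisson_pmf l) (Suc y)) * of_nat (Suc y) = ennreal l * ennreal (pmf (poisson_pmf l) y)" for y
  proof -
    have "pmf (poisson_pmf l) (Suc y) * real (Suc y) = l * pmf (poisson_pmf l) y"
      using True by (simp add: field_simps del: of_nat_Suc)
    then show ?thesis
      by (metis assms ennreal_mult ennreal_of_nat_eq_real_of_nat of_nat_0_le_iff pmf_nonneg)
  qed
  have "(\<integral>\<^sup>+y. of_nat y * \<phi> y \<partial>pois l) = (\<Sum>y. ennreal (pmf (poisson_pmf l) y) * (of_nat y * \<phi> y))"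
    using True by (simp add: pois_def nn_integral_measure_pmf nn_integral_count_space_nat)
  also have "\<dots> = (\<Sum>y. ennreal (pmf (poisson_pmf l) (Suc y)) * (of_nat (Suc y) * \<phi> (Suc y)))"
    by (subst suminf_offset[where i=1]) auto
  also have "\<dots> = (\<Sum>y. ennreal l * (ennreal (pmf (poisson_pmf l) y) * \<phi> (Suc y)))"
    by (simp only: mult.assoc[symmetric] *)
  also have "\<dots> = ennreal l * (\<integral>\<^sup>+y. \<phi> (Suc y) \<partial>pois l)"
    using True by (simp add: pois_def nn_integral_measure_pmf nn_integral_count_space_nat ennreal_suminf_cmult)
  finally show ?thesis .
next
  case False
  then show ?thesis using assms by (simp add: pois_def)
qed

locale poisson_counts =
  fixes J :: "'j set" and l :: "'j \<Rightarrow> real"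
  assumes fin: "finite J" and rate_nonneg: "\<And>j. 0 \<le> l j"
begin

definition P :: "('j \<Rightarrow> nat) pmf" where
  "P = Pi_pmf J 0 (\<lambda>j. pois (l j))"

definition inc :: "'j \<Rightarrow> ('j \<Rightarrow> nat) \<Rightarrow> 'j \<Rightarrow> nat" where
  "inc k N = N(k := Suc (N k))"

lemma inc_simps [simp]: "inc k N k = Suc (N k)" "j \<noteq> k \<Longrightarrow> inc k N j = N j"
  by (auto simp: inc_def)

text \<open>Mecke equation for finitely many cells: by independence the one-dimensional identity is
  applied to coordinate \<open>k\<close> with the other coordinates frozen, so \<open>H\<close> may
  depend on all counts.\<close>

lemma nn_integral_count:
  assumes "k \<in> J"
  shows "(\<integral>\<^sup>+N. of_nat (N k) * H N \<partial>P) = ennreal (l k) * (\<integral>\<^sup>+N. H (inc k N) \<partial>P)"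
proof -
  define Q where "Q = Pi_pmf (J - {k}) 0 (\<lambda>j. pois (l j))"
  have P: "P = map_pmf (\<lambda>(y, f). f(k := y)) (pair_pmf (pois (l k)) Q)"
    unfolding P_def Q_def using fin assms
    by (subst Pi_pmf_insert[symmetric]) (auto simp: insert_absorb)
  have "(\<integral>\<^sup>+N. of_nat (N k) * H N \<partial>P)
      = (\<integral>\<^sup>+y. of_nat y * (\<integral>\<^sup>+f. H (f(k := y)) \<partial>Q) \<partial>pois (l k))"
    unfolding P by (simp add: nn_integral_pair_pmf' nn_integral_cmult)
  also have "\<dots> = ennreal (l k) * (\<integral>\<^sup>+y. (\<integral>\<^sup>+f. H (f(k := Suc y)) \<partial>Q) \<partial>pois (l k))"
    by (rule nn_integral_pois[OF rate_nonneg])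
  also have "\<dots> = ennreal (l k) * (\<integral>\<^sup>+N. H (inc k N) \<partial>P)"
    unfolding P by (simp add: nn_integral_pair_pmf' inc_def)
  finally show ?thesis .
qed

text \<open>The nonnegative case is read as an equality of two measures on configurations, the
  weighted law and the shifted law. Real \<open>H\<close> are then integrated against the same
  measure on both sides; where \<open>H\<close> is not integrable, both Bochner integrals are
  0.\<close>

lemma integral_count:
  fixes H :: "('j \<Rightarrow> nat) \<Rightarrow> real"
  assumes "k \<in> J"
  shows "(\<integral>N. real (N k) * H N \<partial>P) = l k * (\<integral>N. H (inc k N) \<partial>P)"
proof -
  have "density (measure_pmf P) (\<lambda>N. ennreal (real (N k)))
      = density (distr (measure_pmf P) (count_space UNIV) (inc k)) (\<lambda>_. ennreal (l k))" (is "?L = ?R")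
  proof (rule measure_eqI)
    fix A assume "A \<in> sets ?L"
    have "emeasure ?L A = (\<integral>\<^sup>+N. of_nat (N k) * indicator A N \<partial>P)"
      by (subst emeasure_density) (auto simp: ennreal_of_nat_eq_real_of_nat)
    also have "\<dots> = ennreal (l k) * (\<integral>\<^sup>+N. indicator A (inc k N) \<partial>P)"
      by (rule nn_integral_count[OF assms])
    also have "\<dots> = emeasure ?R A"
      by (subst emeasure_density, simp, simp, subst nn_integral_distr)
         (auto simp: nn_integral_cmult)
    finally show "emeasure ?L A = emeasure ?R A" .
  qed simp
  then have "(\<integral>N. H N \<partial>?L) = (\<integral>N. H N \<partial>?R)" by simp
  moreover have "(\<integral>N. H N \<partial>?L) = (\<integral>N. real (N k) * H N \<partial>P)"
    by (subst integral_real_density) auto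
  moreover have "(\<integral>N. H N \<partial>?R) = l k * (\<integral>N. H (inc k N) \<partial>P)"
    by (subst integral_real_density) (auto simp: rate_nonneg integral_distr)
  ultimately show ?thesis by simp
qed

text \<open>Reference functional for growth conditions. The summand 1 makes its powers monotone in
  the exponent and lets one added point at most double it.\<close>

definition tot :: "('j \<Rightarrow> nat) \<Rightarrow> real" where
  "tot N = 1 + (\<Sum>j\<in>J. real (N j))"

lemma tot_ge1: "1 \<le> tot N" by (simp add: tot_def sum_nonneg)

lemma tot_inc: "tot (inc k N) \<le> 2 * tot N" "tot N \<le> tot (inc k N)"
proof -
  have "tot (inc k N) = tot N + (\<Sum>j\<in>J. if j = k then 1 else 0)"
    unfolding tot_def inc_def by (simp add: sum.distrib[symmetric]) (rule sum.cong, auto)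
  moreover have "(\<Sum>j\<in>J. if j = k then 1 else (0::real)) \<le> 1"
    using fin by simp
  moreover have "(\<Sum>j\<in>J. if j = k then 1 else (0::real)) \<ge> 0"
    by (intro sum_nonneg) auto
  ultimately show "tot (inc k N) \<le> 2 * tot N" "tot N \<le> tot (inc k N)" using tot_ge1[of N] by linarith+
qed

text \<open>Induction on the exponent: one factor is written as 1 plus the sum of the counts, the
  Mecke equation removes each count, and the shift costs only a factor 2 ^ r.\<close>

lemma nn_integral_tot_power: "(\<integral>\<^sup>+N. ennreal (tot N ^ r) \<partial>P) < \<infinity>"
proof (induction r)
  case (Suc r)
  have "ennreal (tot N ^ Suc r) = ennreal (tot N ^ r) + (\<Sum>j\<in>J. of_nat (N j) * ennreal (tot N ^ r))" for N
  proof -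
    have "tot N ^ Suc r = tot N ^ r + (\<Sum>j\<in>J. real (N j) * tot N ^ r)"
      by (simp add: sum_distrib_right[symmetric] tot_def algebra_simps)
    moreover have "0 \<le> tot N ^ r" using tot_ge1[of N] by simp
    ultimately show ?thesis
      by (simp add: ennreal_plus sum_nonneg ennreal_mult' ennreal_of_nat_eq_real_of_nat sum_ennreal[symmetric] del: sum_ennreal)
  qed
  then have "(\<integral>\<^sup>+N. ennreal (tot N ^ Suc r) \<partial>P)
     = (\<integral>\<^sup>+N. ennreal (tot N ^ r) \<partial>P) + (\<Sum>j\<in>J. ennreal (l j) * (\<integral>\<^sup>+N. ennreal (tot (inc j N) ^ r) \<partial>P))"
    by (simp add: nn_integral_add nn_integral_sum nn_integral_count)
  also have "\<dots> \<le> (\<integral>\<^sup>+N. ennreal (tot N ^ r) \<partial>P) + (\<Sum>j\<in>J. ennreal (l j) * (\<integral>\<^sup>+N. ennreal (2^r) * ennreal (tot N ^ r) \<partial>P))"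
  proof (intro add_left_mono sum_mono mult_left_mono nn_integral_mono)
    fix j N
    have "tot (inc j N) ^ r \<le> (2 * tot N) ^ r" using tot_inc(1)[of j N] tot_ge1[of "inc j N"] by (intro power_mono) auto
    then show "ennreal (tot (inc j N) ^ r) \<le> ennreal (2^r) * ennreal (tot N ^ r)"
      using tot_ge1[of N] by (subst ennreal_mult[symmetric]) (auto simp: power_mult_distrib)
  qed auto
  also have "\<dots> < \<infinity>" using Suc by (auto simp: nn_integral_cmult ennreal_mult_less_top fin)
  finally show ?case .
qed simp

text \<open>Serves as a certificate of integrability under \<open>P\<close>. It is stable under ring
  operations, absolute values, nonnegative powers and the shift \<open>inc\<close>, so that
  expectations can be split and shifted by syntactic rules.\<close>

definition pbounded :: "(('j \<Rightarrow> nat) \<Rightarrow> real) \<Rightarrow> bool" where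
  "pbounded H \<longleftrightarrow> (\<exists>c r. \<forall>N. \<bar>H N\<bar> \<le> c * tot N ^ r)"

lemma pboundedI: "(\<And>N. \<bar>H N\<bar> \<le> c * tot N ^ r) \<Longrightarrow> pbounded H"
  unfolding pbounded_def by blast

lemma pboundedE:
  assumes "pbounded H"
  obtains c r where "0 \<le> c" "\<And>N r'. r \<le> r' \<Longrightarrow> \<bar>H N\<bar> \<le> c * tot N ^ r'"
proof -
  obtain c r where *: "\<And>N. \<bar>H N\<bar> \<le> c * tot N ^ r" using assms unfolding pbounded_def by blast
  have "\<bar>H N\<bar> \<le> \<bar>c\<bar> * tot N ^ r'" if "r \<le> r'" for N r'
  proof -
    have "\<bar>H N\<bar> \<le> \<bar>c\<bar> * tot N ^ r" using *[of N] tot_ge1[of N]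
      by (meson abs_ge_self dual_order.trans mult_right_mono zero_le_power le_trans zero_le_one)
    also have "\<dots> \<le> \<bar>c\<bar> * tot N ^ r'" using that tot_ge1[of N] by (intro mult_left_mono power_increasing) auto
    finally show ?thesis .
  qed
  then show ?thesis using that[of "\<bar>c\<bar>" r] by auto
qed

lemma pbounded_le: "pbounded G \<Longrightarrow> (\<And>N. \<bar>H N\<bar> \<le> \<bar>G N\<bar>) \<Longrightarrow> pbounded H"
  unfolding pbounded_def by (meson order_trans)

lemma pbounded_const [simp, intro]: "pbounded (\<lambda>_. c)"
  by (rule pboundedI[of _ "\<bar>c\<bar>" 0]) simp

lemma pbounded_tot [simp, intro]: "pbounded tot"
  using tot_ge1 by (intro pboundedI[of _ 1 1]) (auto simp: order.trans[OF zero_le_one])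

lemma pbounded_add [intro]:
  assumes "pbounded H" "pbounded G" shows "pbounded (\<lambda>N. H N + G N)"
proof -
  obtain c r where 1: "0 \<le> c" "\<And>N r'. r \<le> r' \<Longrightarrow> \<bar>H N\<bar> \<le> c * tot N ^ r'" using pboundedE[OF assms(1)] by blast
  obtain c' q where 2: "0 \<le> c'" "\<And>N r'. q \<le> r' \<Longrightarrow> \<bar>G N\<bar> \<le> c' * tot N ^ r'" using pboundedE[OF assms(2)] by blast
  show ?thesis
    using 1(2)[of "max r q"] 2(2)[of "max r q"]
    by (intro pboundedI[of _ "c + c'" "max r q"]) (auto simp: distrib_right intro: order.trans[OF abs_triangle_ineq] add_mono)
qed

lemma pbounded_mult [intro]:
  assumes "pbounded H" "pbounded G" shows "pbounded (\<lambda>N. H N * G N)"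
proof -
  obtain c r where 1: "0 \<le> c" "\<And>N r'. r \<le> r' \<Longrightarrow> \<bar>H N\<bar> \<le> c * tot N ^ r'" using pboundedE[OF assms(1)] by blast
  obtain c' q where 2: "0 \<le> c'" "\<And>N r'. q \<le> r' \<Longrightarrow> \<bar>G N\<bar> \<le> c' * tot N ^ r'" using pboundedE[OF assms(2)] by blast
  have "\<bar>H N * G N\<bar> \<le> (c * tot N ^ r) * (c' * tot N ^ q)" for N
    unfolding abs_mult using 1(1) tot_ge1[of N] by (intro mult_mono 1 2) auto
  then show ?thesis by (intro pboundedI[of _ "c * c'" "r + q"]) (simp add: power_add ac_simps)
qed

lemma pbounded_abs [intro]: "pbounded H \<Longrightarrow> pbounded (\<lambda>N. \<bar>H N\<bar>)"
  by (erule pbounded_le) simp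

lemma pbounded_uminus [intro]: "pbounded H \<Longrightarrow> pbounded (\<lambda>N. - H N)"
  by (erule pbounded_le) simp

lemma pbounded_diff [intro]: "pbounded H \<Longrightarrow> pbounded G \<Longrightarrow> pbounded (\<lambda>N. H N - G N)"
  using pbounded_add[of H "\<lambda>N. - G N"] by auto

lemma pbounded_sum [intro]: "(\<And>i. i \<in> I \<Longrightarrow> pbounded (H i)) \<Longrightarrow> pbounded (\<lambda>N. \<Sum>i\<in>I. H i N)"
  by (induction I rule: infinite_finite_induct) auto

lemma pbounded_power [intro]: "pbounded H \<Longrightarrow> pbounded (\<lambda>N. H N ^ n)"
  by (induction n) auto

lemma pbounded_count [intro]: "j \<in> J \<Longrightarrow> pbounded (\<lambda>N. real (N j))"
  by (rule pbounded_le[OF pbounded_tot]) (auto simp: tot_def fin intro!: member_le_sum order.trans[OF _ abs_ge_self] add_increasing)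

lemma pbounded_inc:
  assumes "pbounded H" shows "pbounded (\<lambda>N. H (inc k N))"
proof -
  obtain c r where 1: "0 \<le> c" "\<And>N r'. r \<le> r' \<Longrightarrow> \<bar>H N\<bar> \<le> c * tot N ^ r'" using pboundedE[OF assms] by blast
  have "\<bar>H (inc k N)\<bar> \<le> c * 2^r * tot N ^ r" for N
  proof -
    have "\<bar>H (inc k N)\<bar> \<le> c * tot (inc k N) ^ r" by (rule 1) simp
    also have "\<dots> \<le> c * (2 * tot N) ^ r"
      using 1(1) tot_inc(1)[of k N] tot_ge1[of "inc k N"] by (intro mult_left_mono power_mono) auto
    finally show ?thesis by (simp add: power_mult_distrib)
  qed
  then show ?thesis by (rule pboundedI)
qed

lemma pbounded_powr [intro]:
  assumes "pbounded H" "0 \<le> a" "\<And>N. 0 \<le> H N" shows "pbounded (\<lambda>N. H N powr a)"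
proof -
  obtain n where n: "a \<le> real n" using real_arch_simple by blast
  have "H N powr a \<le> (1 + H N) ^ n" for N
  proof -
    have "H N powr a \<le> (1 + H N) powr a" using assms by (intro powr_mono2) auto
    also have "\<dots> \<le> (1 + H N) powr real n" using n assms(3)[of N] by (intro powr_mono) auto
    also have "\<dots> = (1 + H N) ^ n" by (rule powr_realpow) (use assms(3)[of N] in linarith)
    finally show ?thesis .
  qed
  then show ?thesis
    by (intro pbounded_le[OF pbounded_power[OF pbounded_add[OF pbounded_const[of 1] assms(1)], of n]])
       (simp add: order.trans[OF _ abs_ge_self])
qed

lemma integrable_pbounded [intro]:
  assumes "pbounded H" shows "integrable P H"
proof -
  obtain c r where 1: "0 \<le> c" "\<And>N r'. r \<le> r' \<Longrightarrow> \<bar>H N\<bar> \<le> c * tot N ^ r'" using pboundedE[OF assms] by blast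
  have "integrable P (\<lambda>N. tot N ^ r)"
    using nn_integral_tot_power[of r] tot_ge1 by (intro integrableI_nonneg AE_I2) (auto intro!: zero_le_power simp: order.trans[OF zero_le_one tot_ge1])
  then have "integrable P (\<lambda>N. c * tot N ^ r)" by simp
  then show ?thesis
    by (rule Bochner_Integration.integrable_bound) (use 1 in \<open>auto intro!: AE_I2 order.trans[OF _ abs_ge_self]\<close>)
qed

abbreviation E :: "(('j \<Rightarrow> nat) \<Rightarrow> real) \<Rightarrow> real" where
  "E H \<equiv> (\<integral>N. H N \<partial>P)"

text \<open>Integration by parts with respect to one count: multiplication by a centred count turns
  into a difference operator.\<close>

lemma E_centred_count:
  assumes "k \<in> J" "pbounded H"
  shows "E (\<lambda>N. (real (N k) - l k) * H N) = l k * E (\<lambda>N. H (inc k N) - H N)"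
proof -
  have "E (\<lambda>N. (real (N k) - l k) * H N) = E (\<lambda>N. real (N k) * H N) - E (\<lambda>N. l k * H N)"
    unfolding left_diff_distrib by (intro Bochner_Integration.integral_diff integrable_pbounded pbounded_mult pbounded_count pbounded_const assms)
  also have "\<dots> = l k * (E (\<lambda>N. H (inc k N)) - E H)"
    using assms by (simp add: integral_count right_diff_distrib)
  also have "\<dots> = l k * E (\<lambda>N. H (inc k N) - H N)"
    by (subst Bochner_Integration.integral_diff) (rule integrable_pbounded pbounded_inc assms refl)+
  finally show ?thesis .
qed

lemma E_count: "k \<in> J \<Longrightarrow> E (\<lambda>N. real (N k)) = l k"
  using integral_count[of k "\<lambda>_. 1"] by simp

lemmas pbounded_intros = pbounded_const pbounded_add pbounded_mult pbounded_diff pbounded_uminus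
  pbounded_sum pbounded_power pbounded_count pbounded_abs

lemma E_add: "pbounded G \<Longrightarrow> pbounded H \<Longrightarrow> E (\<lambda>N. G N + H N) = E G + E H"
  by (intro Bochner_Integration.integral_add integrable_pbounded)

lemma E_diff: "pbounded G \<Longrightarrow> pbounded H \<Longrightarrow> E (\<lambda>N. G N - H N) = E G - E H"
  by (intro Bochner_Integration.integral_diff integrable_pbounded)

lemma E_sum: "(\<And>i. i \<in> I \<Longrightarrow> pbounded (H i)) \<Longrightarrow> E (\<lambda>N. \<Sum>i\<in>I. H i N) = (\<Sum>i\<in>I. E (H i))"
  by (intro Bochner_Integration.integral_sum integrable_pbounded)

lemma E_mono: "pbounded G \<Longrightarrow> pbounded H \<Longrightarrow> (\<And>N. G N \<le> H N) \<Longrightarrow> E G \<le> E H"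
  by (intro integral_mono integrable_pbounded)

text \<open>The variance of the absolute value of \<open>H\<close> is nonnegative; this is expanded
  around its mean \<open>a\<close>.\<close>

lemma E_abs_le_sqrt:
  assumes "pbounded H" shows "E (\<lambda>N. \<bar>H N\<bar>) \<le> sqrt (E (\<lambda>N. H N ^ 2))"
proof (rule real_le_rsqrt)
  define a where "a = E (\<lambda>N. \<bar>H N\<bar>)"
  have "0 \<le> E (\<lambda>N. (\<bar>H N\<bar> - a) ^ 2)" by (intro Bochner_Integration.integral_nonneg) auto
  also have "\<dots> = E (\<lambda>N. H N ^ 2 - (2 * a * \<bar>H N\<bar> - a ^ 2))"
  proof -
    have "(\<bar>x\<bar> - a) ^ 2 = x ^ 2 - (2 * a * \<bar>x\<bar> - a ^ 2)" for x :: real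
      by (simp add: power2_diff)
    then show ?thesis by simp
  qed
  also have "\<dots> = E (\<lambda>N. H N ^ 2) - (2 * a * a - a ^ 2)"
    using assms by (simp add: E_diff pbounded_intros a_def)
  finally show "(E (\<lambda>N. \<bar>H N\<bar>))\<^sup>2 \<le> E (\<lambda>N. H N ^ 2)" by (simp add: a_def power2_eq_square)
qed

section \<open>Linear functionals and moments of weighted sums of counts\<close>

definition lin :: "('j \<Rightarrow> real) \<Rightarrow> ('j \<Rightarrow> nat) \<Rightarrow> real" where
  "lin b N = (\<Sum>k\<in>J. b k * (real (N k) - l k))"

lemma pbounded_lin: "pbounded (lin b)"
  unfolding lin_def by (intro pbounded_intros)

lemma lin_inc: "k \<in> J \<Longrightarrow> lin b (inc k N) = lin b N + b k"
proof -
  assume k: "k \<in> J"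
  have "lin b (inc k N) = (\<Sum>j\<in>J. b j * (real (N j) - l j) + (if j = k then b j else 0))"
    unfolding lin_def by (rule sum.cong) (auto simp: inc_def algebra_simps)
  then show ?thesis using k fin by (simp add: sum.distrib lin_def)
qed

lemma E_lin_mult:
  assumes "pbounded H"
  shows "E (\<lambda>N. lin b N * H N) = (\<Sum>k\<in>J. b k * l k * E (\<lambda>N. H (inc k N) - H N))"
proof -
  have "E (\<lambda>N. lin b N * H N) = E (\<lambda>N. \<Sum>k\<in>J. b k * ((real (N k) - l k) * H N))"
    by (simp add: lin_def sum_distrib_right mult.assoc)
  also have "\<dots> = (\<Sum>k\<in>J. b k * E (\<lambda>N. (real (N k) - l k) * H N))"
    using assms by (subst E_sum) (auto intro!: pbounded_intros)
  finally show ?thesis using assms by (simp add: E_centred_count mult.assoc)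
qed

lemma E_lin: "E (lin b) = 0"
  using E_lin_mult[of "\<lambda>_. 1" b] by simp

lemma E_lin_lin: "E (\<lambda>N. lin b N * lin c N) = (\<Sum>k\<in>J. b k * c k * l k)"
  by (subst E_lin_mult[OF pbounded_lin]) (auto intro!: sum.cong simp: lin_inc)

text \<open>A bound of Rosenthal type, by powers of the mean of \<open>T\<close> and by the jump
  moments \<open>\<nu>\<close>. The Mecke equation lowers exponents by one: E T^(1 + a) is the sum
  of b_k l_k E (T + b_k)^a. It is used for a = q and a = 1 + q, after which only E T^q is left. The
  factor \<open>T N + \<mu>\<close> is the one that accompanies the Taylor remainder in the
  integration by parts formula.\<close>

lemma rosenthal_inequality:
  assumes b: "\<And>k. 0 \<le> b k" and q: "0 < q" "q \<le> 1"
  defines "\<mu> \<equiv> \<Sum>k\<in>J. b k * l k" and "\<nu> \<equiv> \<lambda>a. \<Sum>k\<in>J. b k powr a * l k"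
    and "T \<equiv> \<lambda>N. \<Sum>k\<in>J. b k * real (N k)"
  shows "E (\<lambda>N. (T N + \<mu>) * T N powr (1 + q))
    \<le> 10 * \<mu> powr (2 + q) + 5 * (\<mu> * \<nu> (1 + q)) + 4 * \<nu> (2 + q)"
proof -
  have T0: "0 \<le> T N" for N unfolding T_def by (intro sum_nonneg mult_nonneg_nonneg b) auto
  have \<mu>0: "0 \<le> \<mu>" unfolding \<mu>_def by (intro sum_nonneg mult_nonneg_nonneg b rate_nonneg)
  have pT: "pbounded T" unfolding T_def by (intro pbounded_intros)
  have pTp: "pbounded (\<lambda>N. T N powr a)" if "0 \<le> a" for a by (rule pbounded_powr[OF pT that T0])
  have pTb: "pbounded (\<lambda>N. (T N + b k) powr a)" if "0 \<le> a" for a k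
    by (rule pbounded_powr[OF pbounded_add[OF pT pbounded_const] that]) (simp add: T0 b)
  note pb = pbounded_intros pT
  have T_inc: "T (inc k N) = T N + b k" if "k \<in> J" for k N
  proof -
    have "T N = lin b N + \<mu>" for N unfolding T_def lin_def \<mu>_def by (simp add: sum.distrib[symmetric] algebra_simps)
    then show ?thesis using that by (simp add: lin_inc)
  qed
  have powr_Suc: "x powr (1 + a) = x * x powr a" if "0 \<le> x" for x a :: real
    using that by (cases "x = 0") (auto simp: powr_add)
  have step: "E (\<lambda>N. T N powr (1 + a)) = (\<Sum>k\<in>J. b k * l k * E (\<lambda>N. (T N + b k) powr a))" if a: "0 \<le> a" for a
  proof -
    have "E (\<lambda>N. T N powr (1 + a)) = E (\<lambda>N. \<Sum>k\<in>J. b k * (real (N k) * T N powr a))"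
      by (simp add: powr_Suc T0) (simp add: T_def sum_distrib_right mult.assoc)
    also have "\<dots> = (\<Sum>k\<in>J. b k * E (\<lambda>N. real (N k) * T N powr a))"
      using pTp[OF a] by (subst E_sum) (auto intro!: pb)
    finally show ?thesis by (simp add: integral_count T_inc mult.assoc)
  qed
  \<comment> \<open>For z between 0 and x + y the ratio z / (x + y) is at most its q-th power, as q
    \<le> 1; this is added for z = x and z = y.\<close>
  have subadd: "(x + y) powr q \<le> x powr q + y powr q" if "0 \<le> x" "0 \<le> y" for x y :: real
  proof (cases "x + y = 0")
    case False
    then have s: "0 < x + y" using that by simp
    have frac: "z * (x + y) powr q \<le> (x + y) * z powr q" if "0 \<le> z" "z \<le> x + y" for z
    proof (cases "z = 0")
      case False
      have "(z / (x + y)) powr 1 \<le> (z / (x + y)) powr q" using that q s by (intro powr_mono') auto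
      then show ?thesis using that False s by (simp add: powr_divide field_simps)
    qed simp
    have "(x + y) * (x + y) powr q \<le> (x + y) * (x powr q + y powr q)"
      using frac[of x] frac[of y] that by (simp add: algebra_simps)
    then show ?thesis using s by simp
  qed simp
  have quasi: "(x + y) powr (1 + q) \<le> 4 * (x powr (1 + q) + y powr (1 + q))" if "0 \<le> x" "0 \<le> y" for x y :: real
  proof -
    have "(x + y) powr (1 + q) \<le> (2 * max x y) powr (1 + q)" using that q by (intro powr_mono2) auto
    also have "\<dots> = 2 powr (1 + q) * max x y powr (1 + q)" using that by (simp add: powr_mult)
    also have "\<dots> \<le> 2 powr 2 * (x powr (1 + q) + y powr (1 + q))"
      using q by (intro mult_mono powr_mono) (auto simp: max_def)
    finally show ?thesis by simp
  qed
  \<comment> \<open>E T^q \<le> 2 \<mu>^q, from s^q \<le> 1 + s at s = T / \<mu>, which has mean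
    1.\<close>
  have Tq: "\<mu> * E (\<lambda>N. T N powr q) \<le> 2 * \<mu> powr (1 + q)"
  proof (cases "\<mu> = 0")
    case False
    then have \<mu>: "0 < \<mu>" using \<mu>0 by simp
    have "E (\<lambda>N. T N powr q) \<le> E (\<lambda>N. \<mu> powr q * (1 + (1 / \<mu>) * T N))"
    proof (intro E_mono pTp pb)
      fix N
      have "(T N / \<mu>) powr q \<le> (1 + T N / \<mu>) powr q" using \<mu> T0[of N] q by (intro powr_mono2) auto
      also have "\<dots> \<le> (1 + T N / \<mu>) powr 1" using \<mu> T0[of N] q by (intro powr_mono) auto
      also have "\<dots> = 1 + T N / \<mu>" using \<mu> T0[of N] by simp
      finally show "T N powr q \<le> \<mu> powr q * (1 + (1 / \<mu>) * T N)" using \<mu> T0[of N] by (simp add: powr_divide field_simps)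
    qed (use q in auto)
    also have "\<dots> = \<mu> powr q * (1 + (1 / \<mu>) * E T)"
      using pbounded_mult[OF pbounded_const[of "1 / \<mu>"] pT] by (simp add: E_add)
    also have "E T = \<mu>" unfolding T_def \<mu>_def by (subst E_sum) (auto intro!: pb simp: E_count)
    finally show ?thesis using \<mu> by (simp add: powr_Suc)
  qed simp
  have 1: "E (\<lambda>N. T N powr (1 + q)) \<le> 2 * \<mu> powr (1 + q) + \<nu> (1 + q)"
  proof -
    have "E (\<lambda>N. T N powr (1 + q)) \<le> (\<Sum>k\<in>J. b k * l k * (E (\<lambda>N. T N powr q) + b k powr q))"
      unfolding step[OF less_imp_le[OF q(1)]]
    proof (intro sum_mono mult_left_mono)
      fix k
      have "E (\<lambda>N. (T N + b k) powr q) \<le> E (\<lambda>N. T N powr q + b k powr q)"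
        using q by (intro E_mono pTb pb pTp subadd T0 b) auto
      also have "\<dots> = E (\<lambda>N. T N powr q) + b k powr q"
        using q by (subst E_add) (auto intro: pTp)
      finally show "E (\<lambda>N. (T N + b k) powr q) \<le> E (\<lambda>N. T N powr q) + b k powr q" .
    qed (simp add: b rate_nonneg)
    also have "\<dots> = \<mu> * E (\<lambda>N. T N powr q) + \<nu> (1 + q)"
      unfolding \<mu>_def \<nu>_def by (simp add: powr_Suc b distrib_left sum.distrib sum_distrib_right ac_simps)
    finally show ?thesis using Tq by simp
  qed
  have 2: "E (\<lambda>N. T N powr (1 + (1 + q))) \<le> 4 * (\<mu> * E (\<lambda>N. T N powr (1 + q))) + 4 * \<nu> (2 + q)"
  proof -
    have "E (\<lambda>N. T N powr (1 + (1 + q))) \<le> (\<Sum>k\<in>J. b k * l k * (4 * (E (\<lambda>N. T N powr (1 + q)) + b k powr (1 + q))))"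
      unfolding step[OF add_nonneg_nonneg[OF zero_le_one less_imp_le[OF q(1)]]]
    proof (intro sum_mono mult_left_mono)
      fix k
      have "E (\<lambda>N. (T N + b k) powr (1 + q)) \<le> E (\<lambda>N. 4 * (T N powr (1 + q) + b k powr (1 + q)))"
        using q by (intro E_mono pTb pb pTp quasi T0 b) auto
      also have "\<dots> = 4 * (E (\<lambda>N. T N powr (1 + q)) + b k powr (1 + q))"
        using q by (simp add: E_add pTp pb)
      finally show "E (\<lambda>N. (T N + b k) powr (1 + q)) \<le> 4 * (E (\<lambda>N. T N powr (1 + q)) + b k powr (1 + q))" .
    qed (simp add: b rate_nonneg)
    also have "\<dots> = 4 * (\<mu> * E (\<lambda>N. T N powr (1 + q))) + 4 * (\<Sum>k\<in>J. b k * b k powr (1 + q) * l k)"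
      unfolding \<mu>_def by (simp add: distrib_left sum.distrib sum_distrib_right sum_distrib_left ac_simps)
    also have "(\<Sum>k\<in>J. b k * b k powr (1 + q) * l k) = \<nu> (2 + q)"
      unfolding \<nu>_def using powr_Suc[OF b, of _ "1 + q"] by (simp add: add.assoc[symmetric])
    finally show ?thesis .
  qed
  have "E (\<lambda>N. (T N + \<mu>) * T N powr (1 + q)) = E (\<lambda>N. T N powr (1 + (1 + q))) + \<mu> * E (\<lambda>N. T N powr (1 + q))"
  proof -
    have "E (\<lambda>N. (T N + \<mu>) * T N powr (1 + q)) = E (\<lambda>N. T N powr (1 + (1 + q)) + \<mu> * T N powr (1 + q))"
      by (simp only: powr_Suc[OF T0, of _ "1 + q"] distrib_right)
    also have "\<dots> = E (\<lambda>N. T N powr (1 + (1 + q))) + E (\<lambda>N. \<mu> * T N powr (1 + q))"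
      using q by (intro E_add pb pTp) auto
    finally show ?thesis by simp
  qed
  \<comment> \<open>5 = 4 + 1: four from the recursion with exponent 1 + q, one from the summand
    with the factor \<open>\<mu>\<close>. The 2 in the bound for E T^q then makes it 10.\<close>
  also have "\<dots> \<le> 5 * (\<mu> * E (\<lambda>N. T N powr (1 + q))) + 4 * \<nu> (2 + q)" using 2 by simp
  also have "\<dots> \<le> 5 * (\<mu> * (2 * \<mu> powr (1 + q) + \<nu> (1 + q))) + 4 * \<nu> (2 + q)"
    using mult_left_mono[OF 1 \<mu>0] by simp
  also have "\<dots> = 10 * \<mu> powr (2 + q) + 5 * (\<mu> * \<nu> (1 + q)) + 4 * \<nu> (2 + q)"
    using powr_Suc[OF \<mu>0, of "1 + q"] by (simp add: algebra_simps)
  finally show ?thesis .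
qed

section \<open>Second-order functionals of the counts and their variances\<close>

definition quad :: "('j \<Rightarrow> 'j \<Rightarrow> real) \<Rightarrow> ('j \<Rightarrow> nat) \<Rightarrow> real" where
  "quad c N = (\<Sum>k\<in>J. (real (N k) - l k) * lin (c k) N)"

lemma pbounded_quad: "pbounded (quad c)"
  unfolding quad_def by (intro pbounded_intros pbounded_lin)

text \<open>Adding a point to cell k changes the form by twice \<open>lin (c k)\<close>, by
  symmetry, and leaves \<open>lin (c k)\<close> itself unchanged, as the diagonal of
  \<open>c\<close> vanishes. So integration by parts against the outer centred count leaves the
  variances of the \<open>lin (c k)\<close>.\<close>

lemma E_quad_square:
  assumes sym: "\<And>k q. c k q = c q k" and diag: "\<And>k. c k k = 0"
  shows "E (\<lambda>N. quad c N ^ 2) = 2 * (\<Sum>k\<in>J. \<Sum>q\<in>J. (c k q)\<^sup>2 * l k * l q)"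
proof -
  have inc_quad: "quad c (inc k N) = quad c N + 2 * lin (c k) N" if k: "k \<in> J" for k N
  proof -
    have "quad c (inc k N) = (\<Sum>j\<in>J. ((real (N j) - l j) + (if j = k then 1 else 0)) * (lin (c j) N + c j k))"
      unfolding quad_def
    proof (intro sum.cong refl)
      fix j
      show "(real (inc k N j) - l j) * lin (c j) (inc k N)
          = (real (N j) - l j + (if j = k then 1 else 0)) * (lin (c j) N + c j k)"
        using k by (cases "j = k") (simp_all add: lin_inc)
    qed
    also have "\<dots> = quad c N + lin (c k) N + (\<Sum>j\<in>J. if j = k then lin (c j) N + c j k else 0)"
      unfolding quad_def lin_def[of "c k"] sum.distrib[symmetric]
    proof (intro sum.cong refl)
      fix j
      show "(real (N j) - l j + (if j = k then 1 else 0)) * (lin (c j) N + c j k) =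
          (real (N j) - l j) * lin (c j) N + c k j * (real (N j) - l j) + (if j = k then lin (c j) N + c j k else 0)"
        using sym[of j k] by (simp add: algebra_simps)
    qed
    finally show ?thesis using k fin diag by simp
  qed
  have "E (\<lambda>N. quad c N ^ 2) = E (\<lambda>N. \<Sum>k\<in>J. (real (N k) - l k) * (lin (c k) N * quad c N))"
    by (simp add: power2_eq_square quad_def[of c] sum_distrib_right mult.assoc)
  also have "\<dots> = (\<Sum>k\<in>J. E (\<lambda>N. (real (N k) - l k) * (lin (c k) N * quad c N)))"
    by (intro E_sum pbounded_intros pbounded_lin pbounded_quad)
  also have "\<dots> = (\<Sum>k\<in>J. l k * E (\<lambda>N. 2 * (lin (c k) N * lin (c k) N)))"
  proof (intro sum.cong refl)
    fix k assume k: "k \<in> J"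
    show "E (\<lambda>N. (real (N k) - l k) * (lin (c k) N * quad c N)) = l k * E (\<lambda>N. 2 * (lin (c k) N * lin (c k) N))"
      using k by (subst E_centred_count)
        (auto intro!: pbounded_intros pbounded_lin pbounded_quad Bochner_Integration.integral_cong
          simp: lin_inc diag inc_quad algebra_simps)
  qed
  also have "\<dots> = 2 * (\<Sum>k\<in>J. \<Sum>q\<in>J. (c k q)\<^sup>2 * l k * l q)"
    by (simp add: E_lin_lin sum_distrib_left power2_eq_square ac_simps)
  finally show ?thesis .
qed

text \<open>The diagonal part of a quadratic form in the centred counts, made centred. It is kept
  apart from \<open>quad\<close> because the increment of a squared count contains an additional
  constant, which accounts for the 1 in the factor 1 + 2 l of its second moment.\<close>

definition diagonal :: "('j \<Rightarrow> real) \<Rightarrow> ('j \<Rightarrow> nat) \<Rightarrow> real" where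
  "diagonal d N = (\<Sum>k\<in>J. d k * ((real (N k) - l k)\<^sup>2 - l k))"

lemma pbounded_diagonal: "pbounded (diagonal d)"
  unfolding diagonal_def by (intro pbounded_intros)

text \<open>Integration by parts with respect to one of the two centred factors; the correction - l
  cancels the term in which the difference falls on the other factor.\<close>

lemma E_centred_count_square:
  assumes k: "k \<in> J" and "pbounded H"
  shows "E (\<lambda>N. ((real (N k) - l k)\<^sup>2 - l k) * H N) = l k * E (\<lambda>N. (real (N k) - l k + 1) * (H (inc k N) - H N))"
proof -
  note pb = pbounded_intros assms
  have "E (\<lambda>N. ((real (N k) - l k)\<^sup>2 - l k) * H N)
      = E (\<lambda>N. (real (N k) - l k) * ((real (N k) - l k) * H N)) - E (\<lambda>N. l k * H N)"
    by (subst E_diff[symmetric]) (auto intro!: pb simp: algebra_simps power2_eq_square)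
  also have "E (\<lambda>N. (real (N k) - l k) * ((real (N k) - l k) * H N))
      = l k * E (\<lambda>N. (real (N k) - l k + 1) * (H (inc k N) - H N) + H N)"
    by (subst E_centred_count) (auto intro!: pb Bochner_Integration.integral_cong k simp: algebra_simps)
  also have "\<dots> = l k * E (\<lambda>N. (real (N k) - l k + 1) * (H (inc k N) - H N)) + E (\<lambda>N. l k * H N)"
    by (subst E_add) (auto intro!: pb pbounded_inc[OF assms(2)] simp: algebra_simps)
  finally show ?thesis by simp
qed

lemma E_diagonal_square:
  "E (\<lambda>N. diagonal d N ^ 2) = (\<Sum>k\<in>J. (d k)\<^sup>2 * l k * (1 + 2 * l k))"
proof -
  have inc_diagonal: "diagonal d (inc k N) - diagonal d N = d k * (2 * (real (N k) - l k) + 1)" if k: "k \<in> J" for k N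
  proof -
    have "diagonal d (inc k N) = (\<Sum>j\<in>J. d j * ((real (N j) - l j)\<^sup>2 - l j) + (if j = k then d j * (2 * (real (N j) - l j) + 1) else 0))"
      unfolding diagonal_def by (rule sum.cong) (auto simp: inc_def algebra_simps power2_eq_square)
    then show ?thesis using k fin by (simp add: sum.distrib diagonal_def)
  qed
  have 1: "E (\<lambda>N. (real (N k) - l k + 1) * (2 * (real (N k) - l k) + 1)) = 1 + 2 * l k" if k: "k \<in> J" for k
  proof -
    have "E (\<lambda>N. (real (N k) - l k + 1) * (2 * (real (N k) - l k) + 1))
        = E (\<lambda>N. (real (N k) - l k) * (2 * (real (N k) - l k) + 3) + 1)"
      by (simp add: algebra_simps)
    also have "\<dots> = E (\<lambda>N. (real (N k) - l k) * (2 * (real (N k) - l k) + 3)) + 1"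
      using k by (subst E_add) (auto intro!: pbounded_intros)
    also have "E (\<lambda>N. (real (N k) - l k) * (2 * (real (N k) - l k) + 3)) = 2 * l k"
      using k by (subst E_centred_count) (auto intro!: pbounded_intros simp: algebra_simps)
    finally show ?thesis by simp
  qed
  have "E (\<lambda>N. diagonal d N ^ 2) = E (\<lambda>N. \<Sum>k\<in>J. d k * (((real (N k) - l k)\<^sup>2 - l k) * diagonal d N))"
    by (simp add: power2_eq_square diagonal_def[of d] sum_distrib_right mult.assoc)
  also have "\<dots> = (\<Sum>k\<in>J. d k * E (\<lambda>N. ((real (N k) - l k)\<^sup>2 - l k) * diagonal d N))"
    by (subst E_sum) (auto intro!: pbounded_intros pbounded_diagonal)
  also have "\<dots> = (\<Sum>k\<in>J. d k * (l k * (d k * (1 + 2 * l k))))"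
  proof (intro sum.cong refl)
    fix k assume k: "k \<in> J"
    have "E (\<lambda>N. ((real (N k) - l k)\<^sup>2 - l k) * diagonal d N)
        = l k * E (\<lambda>N. d k * ((real (N k) - l k + 1) * (2 * (real (N k) - l k) + 1)))"
      by (simp only: E_centred_count_square[OF k pbounded_diagonal] inc_diagonal[OF k] mult.left_commute)
    then show "d k * E (\<lambda>N. ((real (N k) - l k)\<^sup>2 - l k) * diagonal d N) = d k * (l k * (d k * (1 + 2 * l k)))"
      using 1[OF k] by simp
  qed
  finally show ?thesis by (simp add: power2_eq_square ac_simps)
qed

end

section \<open>Quadratic forms of nonnegative symmetric kernels with vanishing diagonal\<close>

locale poisson_kernel = poisson_counts J l for J :: "'j set" and l :: "'j \<Rightarrow> real" +
  fixes f :: "'m::finite \<Rightarrow> 'j \<Rightarrow> 'j \<Rightarrow> real"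
  assumes f_nonneg: "\<And>i j k. 0 \<le> f i j k"
    and f_sym: "\<And>i j k. f i j k = f i k j"
    and f_diag: "\<And>i j. f i j j = 0"
begin

definition S :: "'m \<Rightarrow> 'j \<Rightarrow> ('j \<Rightarrow> nat) \<Rightarrow> real" where
  "S i j N = (\<Sum>k\<in>J. f i j k * real (N k))"

definition m :: "'m \<Rightarrow> 'j \<Rightarrow> real" where
  "m i j = (\<Sum>k\<in>J. f i j k * l k)"

definition Q :: "'m \<Rightarrow> ('j \<Rightarrow> nat) \<Rightarrow> real" where
  "Q i N = 1/2 * (\<Sum>j\<in>J. real (N j) * S i j N)"

definition V :: "('j \<Rightarrow> nat) \<Rightarrow> real ^ 'm" where
  "V N = (\<chi> i. Q i N - E (Q i))"

text \<open>A random covariance: when \<open>G\<close> is the component \<open>V N $ k\<close>, the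
  integration by parts formula has the mean of \<open>\<Gamma> i k\<close> on its right-hand side.
  The cells enter with the rates \<open>l j\<close>, so this is a polynomial of degree 2 in the
  counts.\<close>

definition \<Gamma> :: "'m \<Rightarrow> 'm \<Rightarrow> ('j \<Rightarrow> nat) \<Rightarrow> real" where
  "\<Gamma> i k N = 1/2 * (\<Sum>j\<in>J. l j * (S i j N + m i j) * S k j N)"

text \<open>Closed form of the covariance. The first summand stems from pairs of edges with one
  common vertex, the second from pairs of equal edges; 1/2 corrects for the two orders of the end
  points of an edge.\<close>

definition \<gamma> :: "'m \<Rightarrow> 'm \<Rightarrow> real" where
  "\<gamma> i k = (\<Sum>j\<in>J. l j * (m i j * m k j + 1/2 * (\<Sum>q\<in>J. f i j q * f k j q * l q)))"

lemma pbounded_S: "pbounded (S i j)"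
  unfolding S_def by (intro pbounded_intros)

lemma pbounded_Q: "pbounded (Q i)"
  unfolding Q_def by (intro pbounded_intros pbounded_S)

lemma pbounded_V: "pbounded (\<lambda>N. V N $ i)"
  unfolding V_def by (auto intro!: pbounded_intros pbounded_Q)

lemma pbounded_\<Gamma>: "pbounded (\<Gamma> i k)"
  unfolding \<Gamma>_def by (intro pbounded_intros pbounded_S)

lemma S_nonneg: "0 \<le> S i j N" and m_nonneg: "0 \<le> m i j"
  unfolding S_def m_def by (auto intro!: sum_nonneg mult_nonneg_nonneg f_nonneg rate_nonneg)

lemma S_eq_lin: "S i j N = m i j + lin (f i j) N"
  unfolding S_def m_def lin_def by (simp add: sum.distrib[symmetric] algebra_simps)

lemma S_inc: "k \<in> J \<Longrightarrow> S i j (inc k N) = S i j N + f i j k"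
  by (simp add: S_eq_lin lin_inc)

text \<open>The added point forms no edge inside its own cell because the diagonal vanishes; every
  edge to another cell is met twice in the double sum, and the 1/2 in \<open>Q\<close> leaves one
  \<open>S\<close>.\<close>

lemma Q_inc:
  assumes "j \<in> J" shows "Q i (inc j N) = Q i N + S i j N"
proof -
  have "(\<Sum>k\<in>J. real (inc j N k) * S i k (inc j N))
      = (\<Sum>k\<in>J. real (N k) * S i k N + f i j k * real (N k) + (if k = j then S i k N else 0))"
  proof (intro sum.cong refl)
    fix k
    show "real (inc j N k) * S i k (inc j N)
        = real (N k) * S i k N + f i j k * real (N k) + (if k = j then S i k N else 0)"
      using assms f_sym[of i k j] by (cases "k = j") (simp_all add: S_inc f_diag algebra_simps)
  qed
  also have "\<dots> = (\<Sum>k\<in>J. real (N k) * S i k N) + 2 * S i j N"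
    using assms fin by (simp add: sum.distrib S_def[of i j])
  finally show ?thesis by (simp add: Q_def)
qed

lemma V_inc: "j \<in> J \<Longrightarrow> V (inc j N) = V N + (\<chi> i. S i j N)"
  by (simp add: V_def Q_inc vec_eq_iff)

lemma E_S: "E (S i j) = m i j"
  unfolding S_eq_lin[abs_def] by (subst E_add) (auto intro!: pbounded_intros pbounded_lin simp: E_lin)

lemma E_S_S: "E (\<lambda>N. S i j N * S k j N) = m i j * m k j + (\<Sum>q\<in>J. f i j q * f k j q * l q)"
proof -
  have "E (\<lambda>N. S i j N * S k j N) = E (\<lambda>N. (m i j * m k j + (m i j * lin (f k j) N + m k j * lin (f i j) N)) + lin (f i j) N * lin (f k j) N)"
    by (simp add: S_eq_lin algebra_simps)
  then show ?thesis
    by (simp add: E_add pbounded_intros pbounded_lin E_lin E_lin_lin)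
qed

lemma E_\<Gamma>: "E (\<Gamma> i k) = \<gamma> i k"
proof -
  have "E (\<Gamma> i k) = E (\<lambda>N. 1/2 * (\<Sum>j\<in>J. l j * (S i j N * S k j N + m i j * S k j N)))"
    by (simp add: \<Gamma>_def[abs_def] algebra_simps)
  also have "\<dots> = 1/2 * (\<Sum>j\<in>J. l j * (E (\<lambda>N. S i j N * S k j N) + m i j * m k j))"
    by (simp add: E_sum E_add pbounded_intros pbounded_S E_S)
  finally show ?thesis by (simp add: \<gamma>_def E_S_S sum_distrib_left algebra_simps)
qed

text \<open>The Mecke equation in the outer count. The factor \<open>S i j\<close> survives the
  shift unchanged since the diagonal of \<open>f\<close> vanishes.\<close>

lemma E_Q_mult:
  assumes G: "pbounded G"
  shows "E (\<lambda>N. Q i N * G N) = 1/2 * (\<Sum>j\<in>J. l j * E (\<lambda>N. S i j N * G (inc j N)))"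
proof -
  have "E (\<lambda>N. Q i N * G N) = E (\<lambda>N. 1/2 * (\<Sum>j\<in>J. real (N j) * (S i j N * G N)))"
    by (simp add: Q_def sum_distrib_left sum_distrib_right ac_simps)
  also have "\<dots> = 1/2 * (\<Sum>j\<in>J. E (\<lambda>N. real (N j) * (S i j N * G N)))"
    using G by (simp add: E_sum pbounded_intros pbounded_S)
  also have "\<dots> = 1/2 * (\<Sum>j\<in>J. l j * E (\<lambda>N. S i j N * G (inc j N)))"
    by (simp add: integral_count S_inc f_diag)
  finally show ?thesis .
qed

lemma E_Q: "E (Q i) = 1/2 * (\<Sum>j\<in>J. l j * m i j)"
  using E_Q_mult[of "\<lambda>_. 1" i] by (simp add: E_S)

text \<open>This is the Malliavin integration by parts formula: \<open>1/2 * (S i j + m i j)\<close> is minus the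
  difference operator applied to the pseudo-inverse of the Ornstein--Uhlenbeck generator at \<open>V\<close>.\<close>

lemma E_V_mult:
  assumes G: "pbounded G"
  shows "E (\<lambda>N. V N $ i * G N) = 1/2 * (\<Sum>j\<in>J. l j * E (\<lambda>N. (S i j N + m i j) * (G (inc j N) - G N)))"
proof -
  note pb = pbounded_intros pbounded_S pbounded_lin G pbounded_inc[OF G]
  \<comment> \<open>Each \<open>lin (f i j)\<close> is integrated by parts once more; exchanging the
    two sums and using the symmetry of \<open>f\<close> collects the kernel values into the row mean
    \<open>m i k\<close>.\<close>
  have sym: "(\<Sum>j\<in>J. l j * E (\<lambda>N. lin (f i j) N * G N)) = (\<Sum>k\<in>J. l k * m i k * E (\<lambda>N. G (inc k N) - G N))"
  proof -
    have "(\<Sum>j\<in>J. l j * E (\<lambda>N. lin (f i j) N * G N))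
        = (\<Sum>j\<in>J. \<Sum>k\<in>J. l j * (f i j k * l k * E (\<lambda>N. G (inc k N) - G N)))"
      by (simp add: E_lin_mult[OF G] sum_distrib_left)
    also have "\<dots> = (\<Sum>k\<in>J. \<Sum>j\<in>J. l j * (f i j k * l k * E (\<lambda>N. G (inc k N) - G N)))"
      by (rule sum.swap)
    finally show ?thesis
      by (simp add: m_def sum_distrib_left sum_distrib_right f_sym[of i] ac_simps)
  qed
  have "E (\<lambda>N. V N $ i * G N) = E (\<lambda>N. Q i N * G N) - E (Q i) * E G"
    by (simp add: V_def left_diff_distrib E_diff pb pbounded_Q)
  also have "\<dots> = 1/2 * (\<Sum>j\<in>J. l j * (E (\<lambda>N. S i j N * G (inc j N)) - m i j * E G))"
    unfolding E_Q_mult[OF G] E_Q right_diff_distrib sum_subtractf by (simp add: sum_distrib_right mult.assoc)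
  also have "\<dots> = 1/2 * (\<Sum>j\<in>J. l j * (E (\<lambda>N. S i j N * (G (inc j N) - G N)) + E (\<lambda>N. lin (f i j) N * G N)))"
  proof (intro arg_cong2[where f="(*)"] refl sum.cong)
    fix j
    have "E (\<lambda>N. S i j N * (G (inc j N) - G N)) + E (\<lambda>N. lin (f i j) N * G N)
        = E (\<lambda>N. S i j N * (G (inc j N) - G N) + lin (f i j) N * G N)"
      by (intro E_add[symmetric] pb)
    also have "\<dots> = E (\<lambda>N. S i j N * G (inc j N) - m i j * G N)"
      by (simp add: S_eq_lin algebra_simps)
    also have "\<dots> = E (\<lambda>N. S i j N * G (inc j N)) - m i j * E G"
      by (subst E_diff) (auto intro!: pb)
    finally show "E (\<lambda>N. S i j N * G (inc j N)) - m i j * E G = E (\<lambda>N. S i j N * (G (inc j N) - G N)) + E (\<lambda>N. lin (f i j) N * G N)" by simp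
  qed
  also have "\<dots> = 1/2 * (\<Sum>j\<in>J. l j * (E (\<lambda>N. S i j N * (G (inc j N) - G N)) + m i j * E (\<lambda>N. G (inc j N) - G N)))"
    by (simp add: distrib_left sum.distrib sym mult.assoc)
  also have "\<dots> = 1/2 * (\<Sum>j\<in>J. l j * E (\<lambda>N. (S i j N + m i j) * (G (inc j N) - G N)))"
    by (simp add: distrib_right E_add pb pbounded_inc[OF G])
  finally show ?thesis .
qed

text \<open>Integration by parts with \<open>G\<close> a component of \<open>V\<close>, whose
  increment is \<open>S\<close>; what remains is the mean of \<open>\<Gamma>\<close>.\<close>

lemma E_V_V: "E (\<lambda>N. V N $ i * V N $ k) = \<gamma> i k"
proof -
  have "E (\<lambda>N. V N $ i * V N $ k) = 1/2 * (\<Sum>j\<in>J. l j * E (\<lambda>N. (S i j N + m i j) * S k j N))"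
    by (simp add: E_V_mult[OF pbounded_V] V_inc)
  also have "\<dots> = E (\<Gamma> i k)"
    by (simp add: \<Gamma>_def[abs_def] E_sum pbounded_intros pbounded_S mult.assoc)
  finally show ?thesis by (simp add: E_\<Gamma>)
qed

text \<open>Insert S = m + lin and sort by degree in the centred counts; each of the three random
  parts has an explicit second moment. The coefficients \<open>c0\<close> of degree 2 are
  symmetrised for \<open>quad\<close>, and the means of the diagonal squares supply the second
  summand of \<open>\<gamma>\<close>.\<close>

lemma \<Gamma>_decomposition:
  fixes i k
  defines "c0 \<equiv> \<lambda>p q. 1/2 * (\<Sum>j\<in>J. l j * f i j p * f k j q)"
  shows "\<Gamma> i k N = \<gamma> i k + lin (\<lambda>p. 1/2 * (\<Sum>j\<in>J. l j * (2 * m i j * f k j p + m k j * f i j p))) N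
    + quad (\<lambda>p q. if p = q then 0 else 1/2 * (c0 p q + c0 q p)) N + diagonal (\<lambda>p. c0 p p) N"
proof -
  define \<xi> where "\<xi> p = real (N p) - l p" for p
  have lin: "lin b N = (\<Sum>p\<in>J. b p * \<xi> p)" for b by (simp add: lin_def \<xi>_def)
  have "\<Gamma> i k N = 1/2 * (\<Sum>j\<in>J. l j * (2 * m i j * m k j + (2 * m i j * lin (f k j) N + m k j * lin (f i j) N) + lin (f i j) N * lin (f k j) N))"
    by (simp add: \<Gamma>_def S_eq_lin algebra_simps)
  also have "\<dots> = (\<Sum>j\<in>J. l j * (m i j * m k j)) + 1/2 * (\<Sum>j\<in>J. l j * (2 * m i j * lin (f k j) N + m k j * lin (f i j) N))
       + 1/2 * (\<Sum>j\<in>J. l j * (lin (f i j) N * lin (f k j) N))"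
    by (simp add: distrib_left sum.distrib sum_distrib_left mult.assoc)
  also have "1/2 * (\<Sum>j\<in>J. l j * (2 * m i j * lin (f k j) N + m k j * lin (f i j) N))
     = lin (\<lambda>p. 1/2 * (\<Sum>j\<in>J. l j * (2 * m i j * f k j p + m k j * f i j p))) N"
  proof -
    have "(\<Sum>j\<in>J. l j * (2 * m i j * lin (f k j) N + m k j * lin (f i j) N))
       = (\<Sum>j\<in>J. \<Sum>p\<in>J. l j * (2 * m i j * f k j p + m k j * f i j p) * \<xi> p)"
      unfolding lin by (simp add: sum_distrib_left sum.distrib[symmetric] algebra_simps)
    also have "\<dots> = (\<Sum>p\<in>J. \<Sum>j\<in>J. l j * (2 * m i j * f k j p + m k j * f i j p) * \<xi> p)"
      by (rule sum.swap)
    finally show ?thesis unfolding lin by (simp add: sum_distrib_right sum_distrib_left mult.assoc)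
  qed
  also have "1/2 * (\<Sum>j\<in>J. l j * (lin (f i j) N * lin (f k j) N)) = (\<Sum>p\<in>J. \<Sum>q\<in>J. c0 p q * (\<xi> p * \<xi> q))"
  proof -
    have "1/2 * (\<Sum>j\<in>J. l j * (lin (f i j) N * lin (f k j) N))
       = (\<Sum>j\<in>J. \<Sum>p\<in>J. \<Sum>q\<in>J. 1/2 * (l j * f i j p * f k j q) * (\<xi> p * \<xi> q))"
      unfolding lin sum_product by (simp add: sum_distrib_left ac_simps)
    also have "\<dots> = (\<Sum>p\<in>J. \<Sum>q\<in>J. \<Sum>j\<in>J. 1/2 * (l j * f i j p * f k j q) * (\<xi> p * \<xi> q))"
      by (subst sum.swap, rule sum.cong, simp, rule sum.swap)
    finally show ?thesis unfolding c0_def by (simp add: sum_distrib_right sum_distrib_left ac_simps)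
  qed
  also have "(\<Sum>p\<in>J. \<Sum>q\<in>J. c0 p q * (\<xi> p * \<xi> q)) = (\<Sum>p\<in>J. \<Sum>q\<in>J. 1/2 * (c0 p q + c0 q p) * (\<xi> p * \<xi> q))"
  proof -
    have "(\<Sum>p\<in>J. \<Sum>q\<in>J. c0 p q * (\<xi> p * \<xi> q)) = (\<Sum>p\<in>J. \<Sum>q\<in>J. c0 q p * (\<xi> p * \<xi> q))"
      by (subst sum.swap) (simp add: ac_simps)
    then show ?thesis by (simp add: algebra_simps sum.distrib sum_distrib_left[symmetric] sum_divide_distrib[symmetric] add_divide_distrib)
  qed
  also have "\<dots> = quad (\<lambda>p q. if p = q then 0 else 1/2 * (c0 p q + c0 q p)) N + (\<Sum>p\<in>J. c0 p p * (\<xi> p)\<^sup>2)"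
  proof -
    have "(\<Sum>q\<in>J. 1/2 * (c0 p q + c0 q p) * (\<xi> p * \<xi> q))
       = \<xi> p * lin (\<lambda>q. if p = q then 0 else 1/2 * (c0 p q + c0 q p)) N + c0 p p * (\<xi> p)\<^sup>2" if p: "p \<in> J" for p
    proof -
      have "(\<Sum>q\<in>J. 1/2 * (c0 p q + c0 q p) * (\<xi> p * \<xi> q))
        = (\<Sum>q\<in>J. \<xi> p * ((if p = q then 0 else 1/2 * (c0 p q + c0 q p)) * \<xi> q) + (if q = p then c0 p p * (\<xi> p)\<^sup>2 else 0))"
        by (intro sum.cong) (auto simp: power2_eq_square)
      then show ?thesis using p fin by (simp add: sum.distrib lin sum_distrib_left)
    qed
    then show ?thesis unfolding quad_def \<xi>_def[symmetric] by (simp add: sum.distrib)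
  qed
  also have "(\<Sum>p\<in>J. c0 p p * (\<xi> p)\<^sup>2) = diagonal (\<lambda>p. c0 p p) N + (\<Sum>p\<in>J. c0 p p * l p)"
    unfolding diagonal_def \<xi>_def[symmetric] by (simp add: algebra_simps sum_subtractf)
  also have "(\<Sum>p\<in>J. c0 p p * l p) = (\<Sum>j\<in>J. l j * (1/2 * (\<Sum>q\<in>J. f i j q * f k j q * l q)))"
    unfolding c0_def by (simp add: sum_distrib_left sum_distrib_right sum_divide_distrib, subst sum.swap, simp add: ac_simps)
  finally show ?thesis
    by (simp add: \<gamma>_def distrib_left sum.distrib)
qed

text \<open>The L1 norm is bounded by the L2 norm. After all rows have been estimated, each of the
  three second moments is a sum over one free cell, hence proportional to the total rate; this is
  the origin of its square root. The coefficients are averages of two kernel values over a common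
  cell, so row sums of the kernel and of its square suffice.\<close>

lemma E_abs_\<Gamma>_le:
  assumes M: "\<And>i j. j \<in> J \<Longrightarrow> m i j \<le> M" "0 \<le> M"
    and M2: "\<And>i j. j \<in> J \<Longrightarrow> (\<Sum>q\<in>J. (f i j q)\<^sup>2 * l q) \<le> M2" "0 \<le> M2"
    and le1: "\<And>j. j \<in> J \<Longrightarrow> l j \<le> 1"
  shows "E (\<lambda>N. \<bar>\<Gamma> i k N - \<gamma> i k\<bar>) \<le> sqrt (\<Sum>j\<in>J. l j) * (3/2 * M\<^sup>2 + M * sqrt M2 + M2)"
proof -
  define \<Lambda> where "\<Lambda> = (\<Sum>j\<in>J. l j)"
  define c0 where "c0 p q = 1/2 * (\<Sum>j\<in>J. l j * f i j p * f k j q)" for p q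
  define b where "b p = 1/2 * (\<Sum>j\<in>J. l j * (2 * m i j * f k j p + m k j * f i j p))" for p
  define c where "c p q = (if p = q then 0 else 1/2 * (c0 p q + c0 q p))" for p q
  note nn = f_nonneg rate_nonneg m_nonneg
  have \<Lambda>0: "0 \<le> \<Lambda>" unfolding \<Lambda>_def by (intro sum_nonneg rate_nonneg)
  have row: "(\<Sum>j\<in>J. l j * f i' j p) \<le> M" if "p \<in> J" for i' p
    using M(1)[OF that, of i'] by (simp add: m_def f_sym[of i' p] mult.commute)
  have row2: "(\<Sum>j\<in>J. l j * (f i' j p)\<^sup>2) \<le> M2" if "p \<in> J" for i' p
    using M2(1)[OF that, of i'] by (simp add: f_sym[of i' p] mult.commute)
  have b0: "0 \<le> b p" for p unfolding b_def by (intro mult_nonneg_nonneg sum_nonneg add_nonneg_nonneg nn) auto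
  have b: "b p \<le> 3/2 * M\<^sup>2" if p: "p \<in> J" for p
  proof -
    have "b p \<le> 1/2 * (\<Sum>j\<in>J. l j * (2 * M * f k j p + M * f i j p))"
      unfolding b_def using M by (intro mult_left_mono sum_mono add_mono mult_right_mono nn) auto
    also have "\<dots> = M * (\<Sum>j\<in>J. l j * f k j p) + 1/2 * (M * (\<Sum>j\<in>J. l j * f i j p))"
      by (simp add: sum.distrib sum_distrib_left algebra_simps)
    also have "\<dots> \<le> M * M + 1/2 * (M * M)"
      using M p by (intro add_mono mult_left_mono row) auto
    finally show ?thesis by (simp add: power2_eq_square)
  qed
  have c00: "0 \<le> c0 p q" for p q unfolding c0_def by (intro mult_nonneg_nonneg sum_nonneg nn) auto
  \<comment> \<open>The inequality 2 x y \<le> x^2 + y^2 reduces the mixed product to row sums of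
    squares.\<close>
  have c0: "c0 p q \<le> M2 / 2" if "p \<in> J" "q \<in> J" for p q
  proof -
    have "c0 p q \<le> 1/2 * (\<Sum>j\<in>J. l j * (1/2 * ((f i j p)\<^sup>2 + (f k j q)\<^sup>2)))"
      unfolding c0_def mult.assoc
    proof (intro mult_left_mono sum_mono nn)
      fix j show "f i j p * f k j q \<le> 1/2 * ((f i j p)\<^sup>2 + (f k j q)\<^sup>2)"
        using sum_squares_bound[of "f i j p" "f k j q"] by simp
    qed auto
    also have "\<dots> = 1/4 * ((\<Sum>j\<in>J. l j * (f i j p)\<^sup>2) + (\<Sum>j\<in>J. l j * (f k j q)\<^sup>2))"
      by (simp add: distrib_left sum.distrib sum_divide_distrib[symmetric] add_divide_distrib)
    also have "\<dots> \<le> 1/4 * (M2 + M2)"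
      using that by (intro mult_left_mono add_mono row2) auto
    finally show ?thesis by simp
  qed
  have rowc: "(\<Sum>q\<in>J. c0 p q * l q) \<le> M\<^sup>2/2" "(\<Sum>q\<in>J. c0 q p * l q) \<le> M\<^sup>2/2" if p: "p \<in> J" for p
  proof -
    have "(\<Sum>q\<in>J. c0 p q * l q) = 1/2 * (\<Sum>j\<in>J. l j * f i j p * m k j)"
      unfolding c0_def m_def by (simp add: sum_distrib_left sum_distrib_right sum_divide_distrib, subst sum.swap, simp add: ac_simps)
    also have "\<dots> \<le> 1/2 * (\<Sum>j\<in>J. l j * f i j p * M)"
      using M by (intro mult_left_mono sum_mono mult_nonneg_nonneg nn) auto
    also have "\<dots> \<le> 1/2 * (M * M)"
      unfolding sum_distrib_right[symmetric] using M row[OF p] by (intro mult_left_mono mult_right_mono) auto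
    finally show "(\<Sum>q\<in>J. c0 p q * l q) \<le> M\<^sup>2/2" by (simp add: power2_eq_square)
    have "(\<Sum>q\<in>J. c0 q p * l q) = 1/2 * (\<Sum>j\<in>J. l j * f k j p * m i j)"
      unfolding c0_def m_def by (simp add: sum_distrib_left sum_distrib_right sum_divide_distrib, subst sum.swap, simp add: ac_simps)
    also have "\<dots> \<le> 1/2 * (\<Sum>j\<in>J. l j * f k j p * M)"
      using M by (intro mult_left_mono sum_mono mult_nonneg_nonneg nn) auto
    also have "\<dots> \<le> 1/2 * (M * M)"
      unfolding sum_distrib_right[symmetric] using M row[OF p] by (intro mult_left_mono mult_right_mono) auto
    finally show "(\<Sum>q\<in>J. c0 q p * l q) \<le> M\<^sup>2/2" by (simp add: power2_eq_square)
  qed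
  have "E (\<lambda>N. lin b N ^ 2) = (\<Sum>p\<in>J. (b p)\<^sup>2 * l p)"
    by (simp add: power2_eq_square E_lin_lin)
  also have "\<dots> \<le> (\<Sum>p\<in>J. (3/2 * M\<^sup>2)\<^sup>2 * l p)"
    using b b0 by (intro sum_mono mult_right_mono power_mono nn) auto
  finally have 1: "E (\<lambda>N. lin b N ^ 2) \<le> \<Lambda> * (3/2 * M\<^sup>2)\<^sup>2"
    by (simp add: \<Lambda>_def sum_distrib_right mult.commute)
  have "E (\<lambda>N. quad c N ^ 2) = 2 * (\<Sum>p\<in>J. \<Sum>q\<in>J. (c p q)\<^sup>2 * l p * l q)"
    by (rule E_quad_square) (auto simp: c_def add.commute)
  \<comment> \<open>One factor of the square is estimated by its maximum \<open>M2/2\<close>; the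
    other is kept, because its row sums are bounded by a multiple of
    \<open>M\<^sup>2\<close>.\<close>
  also have "\<dots> \<le> 2 * (\<Sum>p\<in>J. \<Sum>q\<in>J. (M2/2 * (1/2 * (c0 p q + c0 q p))) * l p * l q)"
  proof (intro mult_left_mono sum_mono mult_right_mono nn)
    fix p q assume "p \<in> J" "q \<in> J"
    then have "1/2 * (c0 p q + c0 q p) \<le> M2/2" using c0[of p q] c0[of q p] by simp
    moreover have "0 \<le> 1/2 * (c0 p q + c0 q p)" using c00[of p q] c00[of q p] by simp
    ultimately show "(c p q)\<^sup>2 \<le> M2/2 * (1/2 * (c0 p q + c0 q p))"
      unfolding c_def power2_eq_square using M2(2) by (auto intro: mult_right_mono)
  qed auto
  also have "\<dots> = M2 / 2 * (\<Sum>p\<in>J. l p * ((\<Sum>q\<in>J. c0 p q * l q) + (\<Sum>q\<in>J. c0 q p * l q)))"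
    by (simp add: sum_distrib_left sum.distrib[symmetric] algebra_simps)
  also have "\<dots> \<le> M2 / 2 * (\<Sum>p\<in>J. l p * (M\<^sup>2/2 + M\<^sup>2/2))"
    using M2(2) by (intro mult_left_mono sum_mono add_mono rowc nn) auto
  also have "\<dots> = 1/2 * (\<Lambda> * (M * sqrt M2)\<^sup>2)"
    using M2(2) by (simp add: \<Lambda>_def sum_distrib_right[symmetric] power_mult_distrib)
  also have "\<dots> \<le> \<Lambda> * (M * sqrt M2)\<^sup>2" using \<Lambda>0 by simp
  finally have 2: "E (\<lambda>N. quad c N ^ 2) \<le> \<Lambda> * (M * sqrt M2)\<^sup>2" .
  \<comment> \<open>Rates at most 1 give 1 + 2 l \<le> 3.\<close>
  have "E (\<lambda>N. diagonal (\<lambda>p. c0 p p) N ^ 2) \<le> (\<Sum>p\<in>J. (M2/2)\<^sup>2 * l p * 3)"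
    unfolding E_diagonal_square using c0 c00 le1
    by (intro sum_mono mult_mono mult_right_mono power_mono mult_nonneg_nonneg) (auto simp: rate_nonneg add_nonneg_nonneg)
  also have "\<dots> = 3/4 * (\<Lambda> * M2\<^sup>2)"
    by (simp add: \<Lambda>_def sum_distrib_left sum_distrib_right power_divide ac_simps)
  also have "\<dots> \<le> \<Lambda> * M2\<^sup>2" using \<Lambda>0 by (simp add: mult_left_le_one_le)
  finally have 3: "E (\<lambda>N. diagonal (\<lambda>p. c0 p p) N ^ 2) \<le> \<Lambda> * M2\<^sup>2" .
  have L1: "E (\<lambda>N. \<bar>H N\<bar>) \<le> sqrt \<Lambda> * a" if "pbounded H" "E (\<lambda>N. H N ^ 2) \<le> \<Lambda> * a\<^sup>2" "0 \<le> a" for H a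
    using order.trans[OF E_abs_le_sqrt[OF that(1)] real_sqrt_le_mono[OF that(2)]] that(3) by (simp add: real_sqrt_mult)
  have "E (\<lambda>N. \<bar>\<Gamma> i k N - \<gamma> i k\<bar>) \<le> E (\<lambda>N. \<bar>lin b N\<bar> + \<bar>quad c N\<bar> + \<bar>diagonal (\<lambda>p. c0 p p) N\<bar>)"
  proof (intro E_mono)
    fix N show "\<bar>\<Gamma> i k N - \<gamma> i k\<bar> \<le> \<bar>lin b N\<bar> + \<bar>quad c N\<bar> + \<bar>diagonal (\<lambda>p. c0 p p) N\<bar>"
      unfolding \<Gamma>_decomposition[of i k N] b_def[abs_def] c_def[abs_def] c0_def[abs_def] by linarith
  qed (intro pbounded_intros pbounded_\<Gamma> pbounded_lin pbounded_quad pbounded_diagonal)+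
  also have "\<dots> = E (\<lambda>N. \<bar>lin b N\<bar>) + E (\<lambda>N. \<bar>quad c N\<bar>) + E (\<lambda>N. \<bar>diagonal (\<lambda>p. c0 p p) N\<bar>)"
    by (simp add: E_add pbounded_intros pbounded_lin pbounded_quad pbounded_diagonal)
  also have "\<dots> \<le> sqrt \<Lambda> * (3/2 * M\<^sup>2) + sqrt \<Lambda> * (M * sqrt M2) + sqrt \<Lambda> * M2"
    using 1 2 3 M(2) M2(2) by (intro add_mono L1 pbounded_lin pbounded_quad pbounded_diagonal) auto
  finally show ?thesis by (simp add: \<Lambda>_def distrib_left)
qed

text \<open>Integration by parts for each component with G = g_i(V). The increment of G is expanded
  by \<open>taylor\<close> with y the vector of the \<open>S\<close>. The linear part produces
  \<open>\<Gamma>\<close>, which is replaced by \<open>C\<close> at the cost of its fluctuation and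
  of the covariance error; the remainder, summed over the components, yields the row totals. On the
  path \<open>\<kappa>\<close> becomes sin \<theta>, \<open>g\<close> the averaged gradient and
  \<open>H\<close> the averaged Hessian.\<close>

lemma stein_bound:
  fixes g :: "'m \<Rightarrow> real ^ 'm \<Rightarrow> real" and H :: "'m \<Rightarrow> 'm \<Rightarrow> real ^ 'm \<Rightarrow> real" and C :: "real ^ 'm ^ 'm"
  assumes taylor: "\<And>i x y. \<bar>g i (x + y) - g i x - \<kappa> * (\<Sum>r\<in>UNIV. y $ r * H i r x)\<bar>
        \<le> \<kappa> * D * (\<Sum>r\<in>UNIV. \<bar>y $ r\<bar>) powr (1 + q)"
    and H: "\<And>i r x. \<bar>H i r x\<bar> \<le> 1" and \<kappa>: "0 \<le> \<kappa>" and D: "0 \<le> D" and q: "0 < q" "q \<le> 1"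
  shows "\<bar>(\<Sum>i\<in>UNIV. E (\<lambda>N. V N $ i * g i (V N))) - \<kappa> * (\<Sum>i\<in>UNIV. \<Sum>r\<in>UNIV. C $ i $ r * E (\<lambda>N. H i r (V N)))\<bar>
    \<le> \<kappa> * ((\<Sum>i\<in>UNIV. \<Sum>r\<in>UNIV. E (\<lambda>N. \<bar>\<Gamma> i r N - \<gamma> i r\<bar>) + \<bar>\<gamma> i r - C $ i $ r\<bar>)
        + D / 2 * (\<Sum>j\<in>J. l j * E (\<lambda>N. ((\<Sum>i\<in>UNIV. S i j N) + (\<Sum>i\<in>UNIV. m i j)) * (\<Sum>i\<in>UNIV. S i j N) powr (1 + q))))"
proof -
  define T where "T j N = (\<Sum>i\<in>UNIV. S i j N)" for j N
  define R where "R i j N = g i (V (inc j N)) - g i (V N) - \<kappa> * (\<Sum>r\<in>UNIV. S r j N * H i r (V N))" for i j N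
  have T0: "0 \<le> T j N" for j N unfolding T_def by (intro sum_nonneg S_nonneg)
  have pT: "pbounded (T j)" for j unfolding T_def by (intro pbounded_intros pbounded_S)
  have pTq: "pbounded (\<lambda>N. T j N powr (1 + q))" for j using q by (intro pbounded_powr pT T0) auto
  have pH: "pbounded (\<lambda>N. H i r (V N))" for i r by (rule pbounded_le[OF pbounded_const[of 1]]) (simp add: H)
  have pV: "pbounded (\<lambda>N. \<Sum>r\<in>UNIV. \<bar>V N $ r\<bar>)" by (intro pbounded_intros pbounded_V)
  \<comment> \<open>Polynomial growth of \<open>g\<close> is read off from its expansion at
    0.\<close>
  have pg: "pbounded (\<lambda>N. g i (V N))" for i
  proof (rule pbounded_le)
    show "pbounded (\<lambda>N. \<bar>g i 0\<bar> + \<kappa> * (\<Sum>r\<in>UNIV. \<bar>V N $ r\<bar>) + \<kappa> * D * (\<Sum>r\<in>UNIV. \<bar>V N $ r\<bar>) powr (1 + q))"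
      using q by (intro pbounded_add pbounded_mult pbounded_const pV pbounded_powr sum_nonneg) auto
    fix N
    have "\<bar>\<Sum>r\<in>UNIV. V N $ r * H i r 0\<bar> \<le> (\<Sum>r\<in>UNIV. \<bar>V N $ r\<bar>)"
      by (rule order.trans[OF sum_abs]) (intro sum_mono, simp add: abs_mult mult_left_le H)
    then have "\<bar>\<kappa> * (\<Sum>r\<in>UNIV. V N $ r * H i r 0)\<bar> \<le> \<kappa> * (\<Sum>r\<in>UNIV. \<bar>V N $ r\<bar>)"
      using \<kappa> by (simp add: abs_mult mult_left_mono)
    then show "\<bar>g i (V N)\<bar> \<le> \<bar>\<bar>g i 0\<bar> + \<kappa> * (\<Sum>r\<in>UNIV. \<bar>V N $ r\<bar>) + \<kappa> * D * (\<Sum>r\<in>UNIV. \<bar>V N $ r\<bar>) powr (1 + q)\<bar>"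
      using taylor[of i 0 "V N"] by simp
  qed
  have pR: "pbounded (R i j)" for i j
    unfolding R_def by (intro pbounded_intros pbounded_inc[OF pg] pg pbounded_S pH)
  have R: "\<bar>R i j N\<bar> \<le> \<kappa> * D * T j N powr (1 + q)" if "j \<in> J" for i j N
    using taylor[of i "V N" "\<chi> r. S r j N"] that by (simp add: R_def V_inc T_def S_nonneg)
  note pb = pbounded_intros pbounded_S pH pR
  have main: "E (\<lambda>N. V N $ i * g i (V N)) = \<kappa> * (\<Sum>r\<in>UNIV. E (\<lambda>N. \<Gamma> i r N * H i r (V N)))
      + 1/2 * (\<Sum>j\<in>J. l j * E (\<lambda>N. (S i j N + m i j) * R i j N))" for i
  proof -
    have "E (\<lambda>N. V N $ i * g i (V N)) = 1/2 * (\<Sum>j\<in>J. l j * E (\<lambda>N. (S i j N + m i j) * (g i (V (inc j N)) - g i (V N))))"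
      by (rule E_V_mult[OF pg])
    also have "\<dots> = 1/2 * (\<Sum>j\<in>J. l j * E (\<lambda>N. (\<Sum>r\<in>UNIV. \<kappa> * ((S i j N + m i j) * S r j N * H i r (V N))) + (S i j N + m i j) * R i j N))"
      by (simp add: R_def sum_distrib_left algebra_simps)
    also have "\<dots> = 1/2 * (\<Sum>j\<in>J. l j * ((\<Sum>r\<in>UNIV. \<kappa> * E (\<lambda>N. (S i j N + m i j) * S r j N * H i r (V N))) + E (\<lambda>N. (S i j N + m i j) * R i j N)))"
      by (simp add: E_add E_sum pb)
    also have "\<dots> = \<kappa> * (\<Sum>r\<in>UNIV. 1/2 * (\<Sum>j\<in>J. l j * E (\<lambda>N. (S i j N + m i j) * S r j N * H i r (V N)))) + 1/2 * (\<Sum>j\<in>J. l j * E (\<lambda>N. (S i j N + m i j) * R i j N))"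
      by (simp add: distrib_left sum.distrib sum_distrib_left sum_divide_distrib, subst sum.swap, simp add: ac_simps)
    also have "(\<Sum>r\<in>UNIV. 1/2 * (\<Sum>j\<in>J. l j * E (\<lambda>N. (S i j N + m i j) * S r j N * H i r (V N)))) = (\<Sum>r\<in>UNIV. E (\<lambda>N. \<Gamma> i r N * H i r (V N)))"
    proof (intro sum.cong refl)
      fix r
      have "E (\<lambda>N. \<Gamma> i r N * H i r (V N)) = E (\<lambda>N. 1/2 * (\<Sum>j\<in>J. l j * ((S i j N + m i j) * S r j N * H i r (V N))))"
        by (simp add: \<Gamma>_def sum_distrib_right mult.assoc)
      then show "1/2 * (\<Sum>j\<in>J. l j * E (\<lambda>N. (S i j N + m i j) * S r j N * H i r (V N))) = E (\<lambda>N. \<Gamma> i r N * H i r (V N))"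
        by (simp add: E_sum pb)
    qed
    finally show ?thesis .
  qed
  have 1: "\<bar>E (\<lambda>N. \<Gamma> i r N * H i r (V N)) - C $ i $ r * E (\<lambda>N. H i r (V N))\<bar>
      \<le> E (\<lambda>N. \<bar>\<Gamma> i r N - \<gamma> i r\<bar>) + \<bar>\<gamma> i r - C $ i $ r\<bar>" for i r
  proof -
    have "E (\<lambda>N. \<Gamma> i r N * H i r (V N)) - C $ i $ r * E (\<lambda>N. H i r (V N)) = E (\<lambda>N. (\<Gamma> i r N - C $ i $ r) * H i r (V N))"
      by (simp add: left_diff_distrib E_diff pb pbounded_\<Gamma>)
    also have "\<bar>\<dots>\<bar> \<le> E (\<lambda>N. \<bar>\<Gamma> i r N - C $ i $ r\<bar>)"
      by (rule order.trans[OF integral_abs_bound], intro E_mono pb pbounded_\<Gamma>) (simp add: abs_mult mult_left_le H)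
    also have "\<dots> \<le> E (\<lambda>N. \<bar>\<Gamma> i r N - \<gamma> i r\<bar> + \<bar>\<gamma> i r - C $ i $ r\<bar>)"
      by (intro E_mono pb pbounded_\<Gamma>) linarith
    also have "\<dots> = E (\<lambda>N. \<bar>\<Gamma> i r N - \<gamma> i r\<bar>) + \<bar>\<gamma> i r - C $ i $ r\<bar>"
      by (subst E_add) (auto intro!: pbounded_abs pbounded_diff pbounded_\<Gamma> pbounded_const)
    finally show ?thesis .
  qed
  have 2: "\<bar>E (\<lambda>N. (S i j N + m i j) * R i j N)\<bar> \<le> \<kappa> * D * E (\<lambda>N. (S i j N + m i j) * T j N powr (1 + q))" if "j \<in> J" for i j
  proof -
    have "\<bar>E (\<lambda>N. (S i j N + m i j) * R i j N)\<bar> \<le> E (\<lambda>N. \<kappa> * D * ((S i j N + m i j) * T j N powr (1 + q)))"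
    proof (rule order.trans[OF integral_abs_bound], intro E_mono pb pTq)
      fix N
      show "\<bar>(S i j N + m i j) * R i j N\<bar> \<le> \<kappa> * D * ((S i j N + m i j) * T j N powr (1 + q))"
        using mult_left_mono[OF R[OF that, of i N], of "S i j N + m i j"] S_nonneg[of i j N] m_nonneg[of i j]
        by (simp add: abs_mult ac_simps)
    qed
    then show ?thesis by simp
  qed
  have eq: "(\<Sum>i\<in>UNIV. E (\<lambda>N. V N $ i * g i (V N))) - \<kappa> * (\<Sum>i\<in>UNIV. \<Sum>r\<in>UNIV. C $ i $ r * E (\<lambda>N. H i r (V N)))
     = \<kappa> * (\<Sum>i\<in>UNIV. \<Sum>r\<in>UNIV. E (\<lambda>N. \<Gamma> i r N * H i r (V N)) - C $ i $ r * E (\<lambda>N. H i r (V N)))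
      + 1/2 * (\<Sum>i\<in>UNIV. \<Sum>j\<in>J. l j * E (\<lambda>N. (S i j N + m i j) * R i j N))" (is "?lhs = ?A + ?B")
    unfolding main by (simp add: sum.distrib sum_subtractf right_diff_distrib sum_distrib_left)
  have A: "\<bar>?A\<bar> \<le> \<kappa> * (\<Sum>i\<in>UNIV. \<Sum>r\<in>UNIV. E (\<lambda>N. \<bar>\<Gamma> i r N - \<gamma> i r\<bar>) + \<bar>\<gamma> i r - C $ i $ r\<bar>)"
    unfolding abs_mult abs_of_nonneg[OF \<kappa>]
    by (intro mult_left_mono \<kappa> order.trans[OF sum_abs] sum_mono 1)
  have "\<bar>?B\<bar> \<le> 1/2 * (\<Sum>i\<in>UNIV. \<Sum>j\<in>J. l j * (\<kappa> * D * E (\<lambda>N. (S i j N + m i j) * T j N powr (1 + q))))"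
    unfolding abs_mult using 2
    by (intro mult_mono order.trans[OF sum_abs] sum_mono) (auto simp: abs_mult rate_nonneg intro!: mult_left_mono sum_nonneg)
  also have "\<dots> = \<kappa> * (D / 2 * (\<Sum>j\<in>J. l j * (\<Sum>i\<in>UNIV. E (\<lambda>N. (S i j N + m i j) * T j N powr (1 + q)))))"
    by (subst sum.swap) (simp add: sum_distrib_left sum_divide_distrib ac_simps)
  also have "\<dots> = \<kappa> * (D / 2 * (\<Sum>j\<in>J. l j * E (\<lambda>N. (T j N + (\<Sum>i\<in>UNIV. m i j)) * T j N powr (1 + q))))"
    by (subst E_sum[symmetric]) (auto intro!: pb pTq[unfolded T_def] simp: T_def sum.distrib sum_distrib_right[symmetric])
  finally show ?thesis unfolding eq T_def[symmetric] distrib_left[of \<kappa>]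
    using A by linarith
qed

end

section \<open>The standard Gaussian measure\<close>

definition gauss_density :: "'b::euclidean_space \<Rightarrow> real" where
  "gauss_density x = (\<Prod>b\<in>Basis. std_normal_density (x \<bullet> b))"

definition gauss :: "'b::euclidean_space measure" where
  "gauss = density lborel (\<lambda>x. ennreal (gauss_density x))"

lemma norm_square_eq_sum: "(norm x)\<^sup>2 = (\<Sum>b\<in>Basis. (x \<bullet> b)\<^sup>2)"
  unfolding power2_norm_eq_inner by (subst euclidean_inner) (simp add: power2_eq_square)

lemma gauss_density_eq:
  "gauss_density (x::'b::euclidean_space) = (1 / sqrt (2 * pi)) ^ DIM('b) * exp (- (norm x)\<^sup>2 / 2)"
proof -
  have "- (norm x)\<^sup>2 / 2 = (\<Sum>b\<in>Basis. - (x \<bullet> b)\<^sup>2 / 2)"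
    by (simp add: norm_square_eq_sum sum_negf sum_divide_distrib)
  then show ?thesis
    by (simp add: gauss_density_def std_normal_density_def prod_dividef exp_sum power_divide)
qed

lemma gauss_density_pos: "0 < gauss_density x"
  by (simp add: gauss_density_eq)

lemma gauss_density_nonneg [simp]: "0 \<le> gauss_density x"
  using gauss_density_pos[of x] by simp

lemma continuous_gauss_density: "continuous_on S gauss_density"
  unfolding gauss_density_eq[abs_def] by (intro continuous_intros) auto

lemma measurable_gauss_density [measurable]: "gauss_density \<in> borel_measurable borel"
  by (intro borel_measurable_continuous_onI continuous_gauss_density)

lemma sets_gauss [simp, measurable_cong]: "sets gauss = sets borel"
  and space_gauss [simp]: "space gauss = UNIV"
  by (simp_all add: gauss_def)

lemma integral_lborel_prod:
  fixes f :: "'b::euclidean_space \<Rightarrow> real \<Rightarrow> complex"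
  assumes "\<And>b. b \<in> Basis \<Longrightarrow> integrable lborel (f b)"
  shows "(\<integral>x. (\<Prod>b\<in>Basis. f b (x \<bullet> b)) \<partial>lborel) = (\<Prod>b\<in>Basis. \<integral>x. f b x \<partial>lborel)"
proof -
  have [measurable]: "f b \<in> borel_measurable borel" if "b \<in> Basis" for b
    using borel_measurable_integrable[OF assms[OF that]] by simp
  interpret product_sigma_finite "\<lambda>_::'b. lborel :: real measure" ..
  have "(\<integral>x. (\<Prod>b\<in>Basis. f b (x \<bullet> b)) \<partial>lborel)
     = (\<integral>g. (\<Prod>b\<in>Basis. f b ((\<Sum>b\<in>Basis. g b *\<^sub>R b) \<bullet> b)) \<partial>(\<Pi>\<^sub>M b\<in>Basis. lborel))"
    by (subst lborel_eq) (subst integral_distr, simp_all)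
  also have "\<dots> = (\<integral>g. (\<Prod>b\<in>Basis. f b (g b)) \<partial>(\<Pi>\<^sub>M b\<in>(Basis::'b set). lborel))"
    by (intro Bochner_Integration.integral_cong prod.cong refl) simp
  also have "\<dots> = (\<Prod>b\<in>Basis. \<integral>x. f b x \<partial>lborel)"
    by (rule product_integral_prod) (use assms in auto)
  finally show ?thesis .
qed

interpretation gauss: prob_space "gauss :: 'b::euclidean_space measure"
proof
  have "emeasure gauss (space (gauss :: 'b measure)) = (\<integral>\<^sup>+x. (\<Prod>b\<in>(Basis::'b set). ennreal (std_normal_density (x \<bullet> b))) \<partial>lborel)"
    unfolding gauss_def by (subst emeasure_density) (auto simp: gauss_density_def prod_ennreal)
  also have "\<dots> = (\<Prod>b\<in>(Basis::'b set). \<integral>\<^sup>+x. ennreal (std_normal_density x) \<partial>lborel)"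
    by (rule nn_integral_lborel_prod) auto
  also have "\<dots> = 1"
    using prob_space.emeasure_space_1[OF prob_space_normal_density[of 1 0]] by (simp add: emeasure_density)
  finally show "emeasure gauss (space (gauss :: 'b measure)) = 1" .
qed

lemma measure_gauss_UNIV [simp]: "measure gauss UNIV = 1"
  using gauss.prob_space by simp

text \<open>Density and exponential both factor over the coordinates, so the one-dimensional
  characteristic function suffices.\<close>

lemma char_gauss:
  "(\<integral>z. iexp (u \<bullet> z) \<partial>gauss) = complex_of_real (exp (- (norm u)\<^sup>2 / 2))"
  for u :: "'b::euclidean_space"
proof -
  have int: "integrable lborel (\<lambda>y. complex_of_real (std_normal_density y) * iexp (t * y))" for t
    by (rule Bochner_Integration.integrable_bound[OF integrable_std_normal_moment[of 0]]) (auto simp: norm_mult)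
  have 1: "(\<integral>y. complex_of_real (std_normal_density y) * iexp (t * y) \<partial>lborel) = complex_of_real (exp (- t\<^sup>2 / 2))" for t
  proof -
    have "char std_normal_distribution t = (\<integral>y. std_normal_density y *\<^sub>R iexp (t * y) \<partial>lborel)"
      unfolding char_def by (subst integral_density) auto
    then show ?thesis by (simp add: char_std_normal_distribution scaleR_conv_of_real)
  qed
  have "(\<integral>z. iexp (u \<bullet> z) \<partial>gauss) = (\<integral>z. gauss_density z *\<^sub>R iexp (u \<bullet> z) \<partial>lborel)"
    unfolding gauss_def by (subst integral_density) auto
  also have "\<dots> = (\<integral>z. (\<Prod>b\<in>Basis. complex_of_real (std_normal_density (z \<bullet> b)) * iexp ((u \<bullet> b) * (z \<bullet> b))) \<partial>lborel)"
  proof (intro Bochner_Integration.integral_cong refl)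
    fix z :: 'b
    have "iexp (u \<bullet> z) = (\<Prod>b\<in>Basis. iexp ((u \<bullet> b) * (z \<bullet> b)))"
      by (simp add: euclidean_inner[of u z] exp_sum[symmetric] sum_distrib_left)
    then show "gauss_density z *\<^sub>R iexp (u \<bullet> z) = (\<Prod>b\<in>Basis. complex_of_real (std_normal_density (z \<bullet> b)) * iexp ((u \<bullet> b) * (z \<bullet> b)))"
      by (simp add: gauss_density_def scaleR_conv_of_real prod.distrib)
  qed
  also have "\<dots> = (\<Prod>b\<in>Basis. complex_of_real (exp (- (u \<bullet> b)\<^sup>2 / 2)))"
    by (subst integral_lborel_prod[OF int]) (simp only: 1)
  also have "\<dots> = complex_of_real (exp (- (norm u)\<^sup>2 / 2))"
    by (simp only: norm_square_eq_sum of_real_prod[symmetric] exp_sum[OF finite_Basis, symmetric] sum_negf[symmetric] sum_divide_distrib)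
  finally show ?thesis .
qed

text \<open>Cameron--Martin formula, by completing the square in the density. Integrability is
  stated separately because the equality of Bochner integrals does not give it.\<close>

lemma gauss_translate:
  fixes f :: "'b::euclidean_space \<Rightarrow> real"
  assumes [measurable]: "f \<in> borel_measurable borel"
  shows "(\<integral>z. f (z + w) \<partial>gauss) = (\<integral>z. f z * exp (w \<bullet> z - (norm w)\<^sup>2 / 2) \<partial>gauss)"
    and "integrable gauss (\<lambda>z. f (z + w)) \<longleftrightarrow> integrable gauss (\<lambda>z. f z * exp (w \<bullet> z - (norm w)\<^sup>2 / 2))"
proof -
  have shift: "gauss_density (z - w) = gauss_density z * exp (w \<bullet> z - (norm w)\<^sup>2 / 2)" for z
    unfolding gauss_density_eq mult.assoc exp_add[symmetric] power2_norm_eq_inner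
    by (simp add: inner_diff inner_commute algebra_simps add_divide_distrib diff_divide_distrib)
  have lb: "lborel = distr lborel borel ((+) (- w))" by (simp add: lborel_distr_plus)
  have "(\<integral>z. f (z + w) \<partial>gauss) = (\<integral>z. gauss_density z * f (z + w) \<partial>lborel)"
    unfolding gauss_def by (subst integral_density) auto
  also have "\<dots> = (\<integral>z. gauss_density z * f (z + w) \<partial>distr lborel borel ((+) (- w)))" using lb by simp
  also have "\<dots> = (\<integral>z. gauss_density (z - w) * f z \<partial>lborel)"
    by (subst integral_distr) (auto simp: algebra_simps)
  also have "\<dots> = (\<integral>z. f z * exp (w \<bullet> z - (norm w)\<^sup>2 / 2) \<partial>gauss)"
    unfolding gauss_def by (subst integral_density) (auto simp: shift ac_simps)
  finally show "(\<integral>z. f (z + w) \<partial>gauss) = (\<integral>z. f z * exp (w \<bullet> z - (norm w)\<^sup>2 / 2) \<partial>gauss)" .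
  have "integrable gauss (\<lambda>z. f (z + w)) \<longleftrightarrow> integrable lborel (\<lambda>z. gauss_density z * f (z + w))"
    unfolding gauss_def by (subst integrable_density) auto
  also have "\<dots> \<longleftrightarrow> integrable (distr lborel borel ((+) (- w))) (\<lambda>z. gauss_density z * f (z + w))" using lb by simp
  also have "\<dots> \<longleftrightarrow> integrable lborel (\<lambda>z. gauss_density (z - w) * f z)"
    by (subst integrable_distr_eq) (auto simp: algebra_simps)
  also have "\<dots> \<longleftrightarrow> integrable gauss (\<lambda>z. f z * exp (w \<bullet> z - (norm w)\<^sup>2 / 2))"
    unfolding gauss_def by (subst integrable_density) (auto simp: shift ac_simps)
  finally show "integrable gauss (\<lambda>z. f (z + w)) \<longleftrightarrow> integrable gauss (\<lambda>z. f z * exp (w \<bullet> z - (norm w)\<^sup>2 / 2))" .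
qed

text \<open>Translate the constant function 1: the total mass stays 1, and this evaluates the
  exponential moment.\<close>

lemma gauss_exp:
  fixes w :: "'b::euclidean_space"
  shows "integrable gauss (\<lambda>z. exp (w \<bullet> z))" "(\<integral>z. exp (w \<bullet> z) \<partial>gauss) = exp ((norm w)\<^sup>2 / 2)"
proof -
  have *: "exp (w \<bullet> z - (norm w)\<^sup>2 / 2) = exp (w \<bullet> z) * exp (- (norm w)\<^sup>2 / 2)" for z
    by (simp add: exp_add[symmetric])
  show 1: "integrable gauss (\<lambda>z. exp (w \<bullet> z))"
    using gauss_translate(2)[of "\<lambda>_. 1" w] by (simp add: *)
  show "(\<integral>z. exp (w \<bullet> z) \<partial>gauss) = exp ((norm w)\<^sup>2 / 2)"
  proof -
    have "1 = (\<integral>z. exp (w \<bullet> z) * exp (- (norm w)\<^sup>2 / 2) \<partial>gauss)"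
      using gauss_translate(1)[of "\<lambda>_. 1" w] unfolding * by simp
    also have "\<dots> = (\<integral>z. exp (w \<bullet> z) \<partial>gauss) * exp (- (norm w)\<^sup>2 / 2)" by simp
    finally show ?thesis by (simp add: exp_minus field_simps)
  qed
qed

text \<open>Exponential moments dominate powers: x^n \<le> n! exp x, and the norm is at most the
  dimension times the largest absolute coordinate. Summing over all coordinates and both signs makes
  the majorant independent of which one is largest.\<close>

lemma integrable_gauss_norm_power: "integrable gauss (\<lambda>z::'b::euclidean_space. norm z ^ n)"
proof (rule Bochner_Integration.integrable_bound)
  have "integrable gauss (\<lambda>z::'b. exp (real DIM('b) *\<^sub>R b \<bullet> z) + exp (- (real DIM('b) *\<^sub>R b) \<bullet> z))" for b :: 'b
    by (intro Bochner_Integration.integrable_add gauss_exp(1))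
  then show "integrable gauss (\<lambda>z::'b. fact n * (\<Sum>b\<in>Basis. exp (real DIM('b) *\<^sub>R b \<bullet> z) + exp (- (real DIM('b) *\<^sub>R b) \<bullet> z)))"
    by simp
  show "AE z in gauss. norm (norm z ^ n) \<le> norm (fact n * (\<Sum>b\<in>Basis. exp (real DIM('b) *\<^sub>R b \<bullet> (z::'b)) + exp (- (real DIM('b) *\<^sub>R b) \<bullet> z)))"
  proof (rule AE_I2)
    fix z :: 'b
    define M where "M = Max ((\<lambda>b. \<bar>z \<bullet> b\<bar>) ` Basis)"
    have M: "\<bar>z \<bullet> b\<bar> \<le> M" if "b \<in> Basis" for b unfolding M_def using that by simp
    have "M \<in> (\<lambda>b. \<bar>z \<bullet> b\<bar>) ` Basis" unfolding M_def by (rule Max_in) auto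
    then obtain b where b: "b \<in> Basis" "M = \<bar>z \<bullet> b\<bar>" by auto
    have "norm z \<le> (\<Sum>b\<in>Basis. \<bar>z \<bullet> b\<bar>)" by (rule norm_le_l1)
    also have "\<dots> \<le> real DIM('b) * M" using sum_bounded_above[of Basis "\<lambda>b. \<bar>z \<bullet> b\<bar>" M] M by simp
    finally have nz: "norm z \<le> real DIM('b) * M" .
    have "norm z ^ n / fact n \<le> exp (norm z)"
    proof -
      have "norm z ^ n / fact n = (\<Sum>k\<in>{n}. norm z ^ k /\<^sub>R fact k)" by (simp add: divide_inverse)
      also have "\<dots> \<le> (\<Sum>k. norm z ^ k /\<^sub>R fact k)"
        by (intro sum_le_suminf summable_exp_generic) auto
      finally show ?thesis by (simp add: exp_def)
    qed
    then have "norm z ^ n \<le> fact n * exp (norm z)" by (simp add: field_simps)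
    also have "\<dots> \<le> fact n * exp (real DIM('b) * \<bar>z \<bullet> b\<bar>)" using nz b by simp
    also have "\<dots> \<le> fact n * (exp (real DIM('b) *\<^sub>R b \<bullet> z) + exp (- (real DIM('b) *\<^sub>R b) \<bullet> z))"
      by (intro mult_left_mono) (auto simp: abs_if inner_commute add_increasing add_increasing2)
    also have "\<dots> \<le> fact n * (\<Sum>b\<in>Basis. exp (real DIM('b) *\<^sub>R b \<bullet> z) + exp (- (real DIM('b) *\<^sub>R b) \<bullet> z))"
      using b by (intro mult_left_mono member_le_sum) (auto intro: add_nonneg_nonneg)
    finally show "norm (norm z ^ n) \<le> norm (fact n * (\<Sum>b\<in>Basis. exp (real DIM('b) *\<^sub>R b \<bullet> z) + exp (- (real DIM('b) *\<^sub>R b) \<bullet> z)))"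
      by (simp add: order.trans[OF _ abs_ge_self])
  qed
qed simp

lemma integrable_gauss_bound:
  fixes f :: "'b::euclidean_space \<Rightarrow> 'c::{banach, second_countable_topology}"
  assumes [measurable]: "f \<in> borel_measurable borel" and f: "\<And>z. norm (f z) \<le> c * (1 + norm z) ^ n"
  shows "integrable gauss f"
proof (rule Bochner_Integration.integrable_bound)
  have "(1 + norm z) ^ n = (\<Sum>k\<le>n. of_nat (n choose k) * norm z ^ (n - k))" for z :: 'b
    by (simp add: binomial_ring)
  then show "integrable gauss (\<lambda>z::'b. c * (1 + norm z) ^ n)"
    by (simp add: integrable_gauss_norm_power)
  show "AE z in gauss. norm (f z) \<le> norm (c * (1 + norm z) ^ n)"
    by (rule AE_I2) (simp add: order.trans[OF f abs_ge_self])
qed simp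

text \<open>Total variation between a Gaussian measure and its shift. By translation the difference
  is the integral of \<open>k\<close> against \<open>Y\<close>, the density minus 1, and the second
  moment of \<open>Y\<close> is exp(|w|^2) - 1. This is at most 2 |w|^2 for |w| \<le> 1; for larger
  shifts the trivial bound 2 suffices.\<close>

lemma gauss_shift_bound:
  fixes k :: "'b::euclidean_space \<Rightarrow> real"
  assumes [measurable]: "k \<in> borel_measurable borel" and k: "\<And>z. \<bar>k z\<bar> \<le> 1"
  shows "\<bar>(\<integral>z. k (z + w) \<partial>gauss) - (\<integral>z. k z \<partial>gauss)\<bar> \<le> 2 * norm w"
proof (cases "norm w \<le> 1 \<and> w \<noteq> 0")
  case True
  then have w: "0 < norm w" "norm w \<le> 1" by auto
  define Y where "Y z = exp (w \<bullet> z - (norm w)\<^sup>2 / 2) - 1" for z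
  have e: "exp (w \<bullet> z - (norm w)\<^sup>2 / 2) = exp (w \<bullet> z) * exp (- (norm w)\<^sup>2 / 2)" for z by (simp add: exp_add[symmetric])
  have e2: "(Y z)\<^sup>2 = exp ((2 *\<^sub>R w) \<bullet> z) * exp (- (norm w)\<^sup>2) - 2 * (exp (w \<bullet> z) * exp (- (norm w)\<^sup>2 / 2)) + 1" for z
  proof -
    have "(Y z)\<^sup>2 = exp (w \<bullet> z - (norm w)\<^sup>2 / 2) * exp (w \<bullet> z - (norm w)\<^sup>2 / 2) - 2 * exp (w \<bullet> z - (norm w)\<^sup>2 / 2) + 1"
      by (simp add: Y_def power2_eq_square algebra_simps)
    then show ?thesis by (simp add: exp_add[symmetric])
  qed
  have [measurable]: "Y \<in> borel_measurable borel" unfolding Y_def by measurable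
  have iY: "integrable gauss Y" unfolding Y_def e using gauss_exp(1)[of w] by simp
  have iY2: "integrable gauss (\<lambda>z. (Y z)\<^sup>2)" unfolding e2
    by (intro Bochner_Integration.integrable_add Bochner_Integration.integrable_diff
        Bochner_Integration.integrable_mult_right Bochner_Integration.integrable_mult_left gauss_exp(1)) auto
  have "(\<integral>z. (Y z)\<^sup>2 \<partial>gauss) = exp ((norm (2 *\<^sub>R w))\<^sup>2 / 2) * exp (- (norm w)\<^sup>2) - 2 * (exp ((norm w)\<^sup>2 / 2) * exp (- (norm w)\<^sup>2 / 2)) + 1"
    unfolding e2 using gauss_exp[of w] gauss_exp[of "2 *\<^sub>R w"] gauss.prob_space by simp
  also have "\<dots> = exp ((norm w)\<^sup>2) - 1" by (simp add: exp_add[symmetric] power_mult_distrib)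
  also have "\<dots> \<le> 2 * (norm w)\<^sup>2"
  proof -
    have y: "0 \<le> (norm w)\<^sup>2" "(norm w)\<^sup>2 \<le> 1" using w by (auto simp: power_le_one)
    have "exp ((norm w)\<^sup>2) \<le> 1 + (norm w)\<^sup>2 + ((norm w)\<^sup>2)\<^sup>2" by (rule exp_bound[OF y])
    moreover have "((norm w)\<^sup>2)\<^sup>2 \<le> (norm w)\<^sup>2 * 1"
      unfolding power2_eq_square[of "(norm w)\<^sup>2"] by (intro mult_left_mono y)
    ultimately show ?thesis by simp
  qed
  finally have Y2: "(\<integral>z. (Y z)\<^sup>2 \<partial>gauss) \<le> 2 * (norm w)\<^sup>2" .
  have ik: "integrable gauss k" by (rule integrable_gauss_bound[of _ 1 0]) (auto simp: k)
  have ikY: "integrable gauss (\<lambda>z. k z * Y z)"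
    by (rule Bochner_Integration.integrable_bound[OF iY]) (auto simp: abs_mult mult_left_le_one_le k)
  have "(\<integral>z. k (z + w) \<partial>gauss) - (\<integral>z. k z \<partial>gauss) = (\<integral>z. k z * Y z + k z \<partial>gauss) - (\<integral>z. k z \<partial>gauss)"
    by (subst gauss_translate) (auto simp: Y_def algebra_simps)
  also have "\<dots> = (\<integral>z. k z * Y z \<partial>gauss)" using ik ikY by simp
  \<comment> \<open>Arithmetic-geometric mean with weight |w|, in place of the Cauchy--Schwarz
    inequality; it leads to 3/2 |w|.\<close>
  also have "\<bar>\<dots>\<bar> \<le> (\<integral>z. 1/2 * (norm w + (Y z)\<^sup>2 / norm w) \<partial>gauss)"
  proof (rule order.trans[OF integral_abs_bound], rule integral_mono)
    fix z
    have "\<bar>k z * Y z\<bar> \<le> \<bar>Y z\<bar>" using k[of z] by (simp add: abs_mult mult_left_le_one_le)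
    also have "\<bar>Y z\<bar> \<le> 1/2 * (norm w + (Y z)\<^sup>2 / norm w)"
      using sum_squares_bound[of "norm w" "\<bar>Y z\<bar>"] w by (simp add: field_simps power2_eq_square)
    finally show "\<bar>k z * Y z\<bar> \<le> 1/2 * (norm w + (Y z)\<^sup>2 / norm w)" .
  qed (use ikY iY2 in auto)
  also have "\<dots> = 1/2 * (norm w + (\<integral>z. (Y z)\<^sup>2 \<partial>gauss) / norm w)" using iY2 gauss.prob_space by simp
  also have "\<dots> \<le> 1/2 * (norm w + (2 * (norm w)\<^sup>2) / norm w)" using w Y2 by (intro mult_left_mono add_left_mono divide_right_mono) auto
  also have "\<dots> \<le> 2 * norm w" using w by (simp add: power2_eq_square)
  finally show ?thesis .
next
  case False
  have 1: "\<bar>\<integral>z. k (z + v) \<partial>gauss\<bar> \<le> 1" for v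
  proof -
    have "\<bar>\<integral>z. k (z + v) \<partial>gauss\<bar> \<le> (\<integral>z. 1 \<partial>(gauss::'b measure))"
      by (rule order.trans[OF integral_abs_bound], rule integral_mono)
         (auto simp: k intro!: integrable_gauss_bound[of _ 1 0])
    then show ?thesis using gauss.prob_space by simp
  qed
  show ?thesis using False 1[of w] 1[of 0] by auto
qed

text \<open>By translation invariance the integral of f(z + b) - f(z) vanishes. By the fundamental
  theorem of calculus and Fubini it equals the average over a unit step of the integrals of
  translates of f', each of which is the integral of f'. This replaces a discussion of boundary
  terms at infinity.\<close>

lemma integral_directional_derivative:
  fixes f f' :: "'b::euclidean_space \<Rightarrow> real"
  assumes der: "\<And>z r. ((\<lambda>r. f (z + r *\<^sub>R b)) has_real_derivative f' (z + r *\<^sub>R b)) (at r)"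
    and cont: "continuous_on UNIV f'" and f: "integrable lborel f" and f': "integrable lborel f'"
  shows "(\<integral>z. f' z \<partial>lborel) = 0"
proof -
  have [measurable]: "f \<in> borel_measurable borel" "f' \<in> borel_measurable borel"
    using f f' by (auto dest: borel_measurable_integrable)
  have tr: "(\<integral>z. g (z + w) \<partial>lborel) = (\<integral>z. g z \<partial>lborel)" "integrable lborel g \<Longrightarrow> integrable lborel (\<lambda>z. g (z + w))"
    if [measurable]: "g \<in> borel_measurable borel" for g :: "'b \<Rightarrow> real" and w
  proof -
    have lb: "lborel = distr lborel borel ((+) w)" by (simp add: lborel_distr_plus)
    have "(\<integral>z. g z \<partial>lborel) = (\<integral>z. g z \<partial>distr lborel borel ((+) w))" using lb by simp
    also have "\<dots> = (\<integral>z. g (z + w) \<partial>lborel)" by (subst integral_distr) (auto simp: add.commute)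
    finally show "(\<integral>z. g (z + w) \<partial>lborel) = (\<integral>z. g z \<partial>lborel)" ..
    assume "integrable lborel g"
    then have "integrable (distr lborel borel ((+) w)) g" using lb by simp
    then show "integrable lborel (\<lambda>z. g (z + w))" by (subst (asm) integrable_distr_eq) (auto simp: add.commute)
  qed
  have ftc: "f (z + b) - f z = (\<integral>r. f' (z + r *\<^sub>R b) * indicator {0..1} r \<partial>lborel)" for z
  proof -
    have "has_bochner_integral lborel (\<lambda>r. f' (z + r *\<^sub>R b) * indicator {0..1} r) (f (z + 1 *\<^sub>R b) - f (z + 0 *\<^sub>R b))"
    proof (rule has_bochner_integral_FTC_Icc_real)
      fix r :: real
      show "isCont (\<lambda>r. f' (z + r *\<^sub>R b)) r"
        by (rule continuous_at_compose[of _ _ f', unfolded comp_def] isCont_o2[where g=f'])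
           (use cont in \<open>auto simp: continuous_on_eq_continuous_at intro!: continuous_intros\<close>)
    qed (use der in auto)
    then show ?thesis by (simp add: has_bochner_integral_integral_eq)
  qed
  have int: "integrable (lborel \<Otimes>\<^sub>M lborel) (\<lambda>(r, z). f' (z + r *\<^sub>R b) * indicator {0..1} (r::real))"
  proof (rule lborel_pair.Fubini_integrable)
    show "(\<lambda>(r, z). f' (z + r *\<^sub>R b) * indicator {0..1} (r::real)) \<in> borel_measurable (lborel \<Otimes>\<^sub>M lborel)"
      by measurable
    have "(\<integral>z. norm (f' (z + r *\<^sub>R b) * indicator {0..1} r) \<partial>lborel) = (\<integral>z. \<bar>f' z\<bar> \<partial>lborel) * indicator {0..1} r" for r :: real
      using tr(1)[of "\<lambda>z. \<bar>f' z\<bar>" "r *\<^sub>R b"] by (simp add: abs_mult indicator_def)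
    then show "integrable lborel (\<lambda>r. \<integral>z. norm (case (r, z) of (r, z) \<Rightarrow> f' (z + r *\<^sub>R b) * indicator {0..1} (r::real)) \<partial>lborel)"
      by simp
    show "AE r in lborel. integrable lborel (\<lambda>z. case (r, z) of (r, z) \<Rightarrow> f' (z + r *\<^sub>R b) * indicator {0..1} (r::real))"
      using tr(2)[of f'] f' by auto
  qed
  have "0 = (\<integral>z. f (z + b) - f z \<partial>lborel)" using f tr[of f b] by simp
  also have "\<dots> = (\<integral>z. \<integral>r. f' (z + r *\<^sub>R b) * indicator {0..1} r \<partial>lborel \<partial>lborel)" by (simp add: ftc)
  also have "\<dots> = (\<integral>r. \<integral>z. f' (z + r *\<^sub>R b) * indicator {0..1} r \<partial>lborel \<partial>lborel)"
    using lborel_pair.Fubini_integral[OF int] by simp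
  also have "\<dots> = (\<integral>r. (\<integral>z. f' z \<partial>lborel) * indicator {0..1} r \<partial>(lborel::real measure))"
    using tr(1)[of f'] by simp
  also have "\<dots> = (\<integral>z. f' z \<partial>lborel)" by simp
  finally show ?thesis by simp
qed

text \<open>The directional derivative of the product of \<open>K\<close> with the Gaussian density
  is the density times K' - (z . b) K, so its Lebesgue integral vanishes.\<close>

lemma gauss_integration_by_parts:
  fixes K K' :: "'b::euclidean_space \<Rightarrow> real"
  assumes der: "\<And>z r. ((\<lambda>r. K (z + r *\<^sub>R b)) has_real_derivative K' (z + r *\<^sub>R b)) (at r)"
    and cK: "continuous_on UNIV K" and cK': "continuous_on UNIV K'"
    and K: "\<And>z. \<bar>K z\<bar> \<le> c * (1 + norm z)" and K': "\<And>z. \<bar>K' z\<bar> \<le> c'"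
  shows "(\<integral>z. (z \<bullet> b) * K z \<partial>gauss) = (\<integral>z. K' z \<partial>gauss)"
proof -
  have [measurable]: "K \<in> borel_measurable borel" "K' \<in> borel_measurable borel"
    using cK cK' by (auto intro: borel_measurable_continuous_onI)
  have c0: "0 \<le> c" using K[of 0] by simp
  have iK: "integrable gauss K" by (rule integrable_gauss_bound[of _ c 1]) (auto simp: K)
  have iK': "integrable gauss K'" by (rule integrable_gauss_bound[of _ c' 0]) (auto simp: K')
  have izK: "integrable gauss (\<lambda>z. (z \<bullet> b) * K z)"
  proof (rule integrable_gauss_bound[of _ "norm b * c" 2])
    fix z
    have "\<bar>z \<bullet> b\<bar> \<le> norm b * (1 + norm z)" using Cauchy_Schwarz_ineq2[of z b] norm_ge_zero[of b]
      unfolding distrib_left mult.commute[of "norm z"] by linarith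
    then have "\<bar>z \<bullet> b\<bar> * \<bar>K z\<bar> \<le> (norm b * (1 + norm z)) * (c * (1 + norm z))"
      using K by (intro mult_mono) auto
    then show "norm ((z \<bullet> b) * K z) \<le> norm b * c * (1 + norm z)\<^sup>2"
      by (simp add: abs_mult power2_eq_square ac_simps)
  qed simp
  have dens: "integrable lborel (\<lambda>z. gauss_density z * f z) \<longleftrightarrow> integrable gauss f"
     "(\<integral>z. gauss_density z * f z \<partial>lborel) = (\<integral>z. f z \<partial>gauss)" if [measurable]: "f \<in> borel_measurable borel" for f :: "'b \<Rightarrow> real"
    unfolding gauss_def by (simp_all add: integrable_density integral_density)
  have "(\<integral>z. gauss_density z * (K' z - (z \<bullet> b) * K z) \<partial>lborel) = 0"
  proof (rule integral_directional_derivative[where f="\<lambda>z. gauss_density z * K z" and b=b])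
    fix z :: 'b and r :: real
    have "((\<lambda>r. gauss_density (z + r *\<^sub>R b)) has_real_derivative - ((z + r *\<^sub>R b) \<bullet> b) * gauss_density (z + r *\<^sub>R b)) (at r)"
    proof -
      define p where "p r = - (z \<bullet> z + 2 * r * (z \<bullet> b) + r\<^sup>2 * (b \<bullet> b)) / 2" for r
      have eq: "gauss_density (z + r *\<^sub>R b) = (1 / sqrt (2 * pi)) ^ DIM('b) * exp (p r)" for r
        by (simp add: gauss_density_eq power2_norm_eq_inner p_def inner_add inner_commute algebra_simps power2_eq_square[of r])
      have "(p has_real_derivative - ((z + r *\<^sub>R b) \<bullet> b)) (at r)"
        unfolding p_def by (auto intro!: derivative_eq_intros simp: inner_add inner_commute field_simps)
      from DERIV_cmult[OF DERIV_fun_exp[OF this], of "(1 / sqrt (2 * pi)) ^ DIM('b)"] show ?thesis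
        unfolding eq by (rule DERIV_cong) simp
    qed
    from DERIV_mult[OF this der[of z r]]
    show "((\<lambda>r. gauss_density (z + r *\<^sub>R b) * K (z + r *\<^sub>R b)) has_real_derivative
        gauss_density (z + r *\<^sub>R b) * (K' (z + r *\<^sub>R b) - ((z + r *\<^sub>R b) \<bullet> b) * K (z + r *\<^sub>R b))) (at r)"
      by (simp add: algebra_simps)
  qed (use cK cK' iK izK iK' in \<open>auto intro!: continuous_intros continuous_gauss_density simp: dens\<close>)
  then have "(\<integral>z. K' z - (z \<bullet> b) * K z \<partial>gauss) = 0" by (simp add: dens)
  then show ?thesis using iK' izK by simp
qed

section \<open>Uniqueness of characteristic functions and Gaussian vectors\<close>

text \<open>Convolution with a small Gaussian measure. The Gaussian density is a multiple of its own
  Fourier transform, so by Fubini the density of the smoothed measure is computed from the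
  characteristic function alone. Hence both smoothed measures agree, and letting the scale tend to 0
  recovers the integrals of \<open>f\<close>.\<close>

lemma char_eq_imp_integral_eq_bounded:
  fixes \<mu> \<nu> :: "'b::euclidean_space measure" and f :: "'b \<Rightarrow> real"
  assumes \<mu>: "prob_space \<mu>" "sets \<mu> = sets borel" and \<nu>: "prob_space \<nu>" "sets \<nu> = sets borel"
    and char: "\<And>u. (\<integral>x. iexp (u \<bullet> x) \<partial>\<mu>) = (\<integral>x. iexp (u \<bullet> x) \<partial>\<nu>)"
    and cont: "continuous_on UNIV f" and bdd: "\<And>x. \<bar>f x\<bar> \<le> B"
  shows "(\<integral>x. f x \<partial>\<mu>) = (\<integral>x. f x \<partial>\<nu>)"
proof -
  have [measurable]: "f \<in> borel_measurable borel" using cont by (rule borel_measurable_continuous_onI)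
  note [measurable_cong] = \<mu>(2) \<nu>(2)
  define c where "c = (1 / sqrt (2 * pi)) ^ DIM('b)"
  have c: "0 < c" by (simp add: c_def)
  \<comment> \<open>Up to the factor s^(-d), the density at y of the convolution of \<rho> with the
    law of s z.\<close>
  define G where "G s \<rho> y = (\<integral>x. gauss_density ((y - x) /\<^sub>R s) \<partial>\<rho>)" for s :: real and \<rho> and y :: 'b
  have G_eq: "complex_of_real (G s \<rho> y) = c * (\<integral>z. iexp ((y /\<^sub>R s) \<bullet> z) * (\<integral>x. iexp ((- z /\<^sub>R s) \<bullet> x) \<partial>\<rho>) \<partial>gauss)"
    if \<rho>: "prob_space \<rho>" "sets \<rho> = sets borel" for s \<rho> y
  proof -
    interpret \<rho>: prob_space \<rho> by fact
    note [measurable_cong] = \<rho>(2)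
    interpret pair_prob_space "gauss :: 'b measure" \<rho> ..
    have "complex_of_real (G s \<rho> y) = (\<integral>x. complex_of_real (gauss_density ((y - x) /\<^sub>R s)) \<partial>\<rho>)"
      unfolding G_def by simp
    also have "\<dots> = (\<integral>x. c * (\<integral>z. iexp (((y - x) /\<^sub>R s) \<bullet> z) \<partial>gauss) \<partial>\<rho>)"
      by (simp only: char_gauss gauss_density_eq c_def) simp
    also have "\<dots> = c * (\<integral>x. (\<integral>z. iexp (((y - x) /\<^sub>R s) \<bullet> z) \<partial>gauss) \<partial>\<rho>)" by simp
    also have "(\<integral>x. (\<integral>z. iexp (((y - x) /\<^sub>R s) \<bullet> z) \<partial>gauss) \<partial>\<rho>) = (\<integral>z. (\<integral>x. iexp (((y - x) /\<^sub>R s) \<bullet> z) \<partial>\<rho>) \<partial>gauss)"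
    proof (rule Fubini_integral)
      show "integrable (gauss \<Otimes>\<^sub>M \<rho>) (\<lambda>(z, x). iexp (((y - x) /\<^sub>R s) \<bullet> z))"
        by (rule integrable_const_bound[of _ 1]) (auto simp: case_prod_beta)
    qed
    also have "\<dots> = (\<integral>z. iexp ((y /\<^sub>R s) \<bullet> z) * (\<integral>x. iexp ((- z /\<^sub>R s) \<bullet> x) \<partial>\<rho>) \<partial>gauss)"
    proof (intro Bochner_Integration.integral_cong refl)
      fix z
      have "iexp (((y - x) /\<^sub>R s) \<bullet> z) = iexp ((y /\<^sub>R s) \<bullet> z) * iexp ((- z /\<^sub>R s) \<bullet> x)" for x
        by (simp add: exp_add[symmetric] inner_diff_left inner_diff_right inner_commute algebra_simps)
      then show "(\<integral>x. iexp (((y - x) /\<^sub>R s) \<bullet> z) \<partial>\<rho>) = iexp ((y /\<^sub>R s) \<bullet> z) * (\<integral>x. iexp ((- z /\<^sub>R s) \<bullet> x) \<partial>\<rho>)"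
        by simp
    qed
    finally show ?thesis .
  qed
  have G: "G s \<mu> y = G s \<nu> y" for s y
  proof -
    have "complex_of_real (G s \<mu> y) = complex_of_real (G s \<nu> y)"
      by (simp only: G_eq[OF \<mu>] G_eq[OF \<nu>] char)
    then show ?thesis by simp
  qed
  have smooth: "(\<integral>x. \<integral>z. f (x + s *\<^sub>R z) \<partial>gauss \<partial>\<rho>) = inverse s ^ DIM('b) * (\<integral>y. f y * G s \<rho> y \<partial>lborel)"
    if \<rho>: "prob_space \<rho>" "sets \<rho> = sets borel" and s: "0 < s" for s \<rho>
  proof -
    interpret \<rho>: prob_space \<rho> by fact
    note [measurable_cong] = \<rho>(2)
    interpret pair_sigma_finite lborel \<rho> ..
    have inner: "(\<integral>z. f (x + s *\<^sub>R z) \<partial>gauss) = inverse s ^ DIM('b) * (\<integral>y. f y * gauss_density ((y - x) /\<^sub>R s) \<partial>lborel)"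
      and int: "integrable lborel (\<lambda>y. f y * gauss_density ((y - x) /\<^sub>R s))"
      and int1: "integrable lborel (\<lambda>y. gauss_density ((y - x) /\<^sub>R s))"
      and nrm: "(\<integral>y. norm (gauss_density ((y - x) /\<^sub>R s)) \<partial>lborel) = s ^ DIM('b)" for x
    proof -
      have lb: "(lborel :: 'b measure) = density (distr lborel borel (\<lambda>z. x + s *\<^sub>R z)) (\<lambda>_. \<bar>s\<bar> ^ DIM('b))"
        using s by (intro lborel_affine) simp
      have sub: "(\<integral>y. h y * gauss_density ((y - x) /\<^sub>R s) \<partial>lborel) = s ^ DIM('b) * (\<integral>z. h (x + s *\<^sub>R z) \<partial>gauss)"
        "integrable gauss (\<lambda>z. h (x + s *\<^sub>R z)) \<Longrightarrow> integrable lborel (\<lambda>y. h y * gauss_density ((y - x) /\<^sub>R s))"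
        if [measurable]: "h \<in> borel_measurable borel" for h :: "'b \<Rightarrow> real"
      proof -
        have "(\<integral>y. h y * gauss_density ((y - x) /\<^sub>R s) \<partial>lborel)
            = (\<integral>y. h y * gauss_density ((y - x) /\<^sub>R s) \<partial>density (distr lborel borel (\<lambda>z. x + s *\<^sub>R z)) (\<lambda>_. \<bar>s\<bar> ^ DIM('b)))"
          using lb by simp
        also have "\<dots> = s ^ DIM('b) * (\<integral>z. h (x + s *\<^sub>R z) * gauss_density z \<partial>lborel)"
          using s by (subst integral_real_density, simp_all) (subst integral_distr, simp_all)
        also have "(\<integral>z. h (x + s *\<^sub>R z) * gauss_density z \<partial>lborel) = (\<integral>z. h (x + s *\<^sub>R z) \<partial>gauss)"
          unfolding gauss_def by (subst integral_density) (auto simp: ac_simps)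
        finally show "(\<integral>y. h y * gauss_density ((y - x) /\<^sub>R s) \<partial>lborel) = s ^ DIM('b) * (\<integral>z. h (x + s *\<^sub>R z) \<partial>gauss)" .
        assume "integrable gauss (\<lambda>z. h (x + s *\<^sub>R z))"
        then have "integrable lborel (\<lambda>z. h (x + s *\<^sub>R z) * gauss_density z)"
          unfolding gauss_def by (subst (asm) integrable_density) (auto simp: ac_simps)
        then have "integrable (density (distr lborel borel (\<lambda>z. x + s *\<^sub>R z)) (\<lambda>_. \<bar>s\<bar> ^ DIM('b))) (\<lambda>y. h y * gauss_density ((y - x) /\<^sub>R s))"
          using s by (subst integrable_real_density, simp_all) (subst integrable_distr_eq, simp_all)
        then show "integrable lborel (\<lambda>y. h y * gauss_density ((y - x) /\<^sub>R s))" using lb by simp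
      qed
      have "integrable gauss (\<lambda>z. f (x + s *\<^sub>R z))" by (rule integrable_gauss_bound[of _ B 0]) (auto simp: bdd)
      then show "integrable lborel (\<lambda>y. f y * gauss_density ((y - x) /\<^sub>R s))" by (intro sub) auto
      show "(\<integral>z. f (x + s *\<^sub>R z) \<partial>gauss) = inverse s ^ DIM('b) * (\<integral>y. f y * gauss_density ((y - x) /\<^sub>R s) \<partial>lborel)"
        using s by (subst sub) (auto simp: power_inverse)
      show "(\<integral>y. norm (gauss_density ((y - x) /\<^sub>R s)) \<partial>lborel) = s ^ DIM('b)"
        using sub(1)[of "\<lambda>_. 1"] by simp
      show "integrable lborel (\<lambda>y. gauss_density ((y - x) /\<^sub>R s))"
        using sub(2)[of "\<lambda>_. 1"] by simp
    qed
    have "(\<integral>x. \<integral>z. f (x + s *\<^sub>R z) \<partial>gauss \<partial>\<rho>) = inverse s ^ DIM('b) * (\<integral>x. \<integral>y. f y * gauss_density ((y - x) /\<^sub>R s) \<partial>lborel \<partial>\<rho>)"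
      by (simp add: inner)
    also have "(\<integral>x. \<integral>y. f y * gauss_density ((y - x) /\<^sub>R s) \<partial>lborel \<partial>\<rho>) = (\<integral>y. \<integral>x. f y * gauss_density ((y - x) /\<^sub>R s) \<partial>\<rho> \<partial>lborel)"
    proof (rule Fubini_integral)
      have "integrable (\<rho> \<Otimes>\<^sub>M lborel) (\<lambda>(x, y). f y * gauss_density ((y - x) /\<^sub>R s))"
      proof (rule pair_sigma_finite.Fubini_integrable)
        show "pair_sigma_finite \<rho> (lborel :: 'b measure)" ..
        show "integrable \<rho> (\<lambda>x. \<integral>y. norm (case (x, y) of (x, y) \<Rightarrow> f y * gauss_density ((y - x) /\<^sub>R s)) \<partial>lborel)"
        proof (rule \<rho>.integrable_const_bound[of _ "B * s ^ DIM('b)"])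
          show "AE x in \<rho>. norm (\<integral>y. norm (case (x, y) of (x, y) \<Rightarrow> f y * gauss_density ((y - x) /\<^sub>R s)) \<partial>lborel) \<le> B * s ^ DIM('b)"
          proof (rule AE_I2)
            fix x :: 'b
            have "(\<integral>y. norm (f y * gauss_density ((y - x) /\<^sub>R s)) \<partial>lborel) \<le> (\<integral>y. B * norm (gauss_density ((y - x) /\<^sub>R s)) \<partial>lborel)"
              using bdd by (intro integral_mono integrable_norm int Bochner_Integration.integrable_mult_right int1)
                (auto simp: abs_mult intro!: mult_right_mono)
            then show "norm (\<integral>y. norm (case (x, y) of (x, y) \<Rightarrow> f y * gauss_density ((y - x) /\<^sub>R s)) \<partial>lborel) \<le> B * s ^ DIM('b)"
              using nrm[of x] by simp
          qed
        qed measurable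
        show "AE x in \<rho>. integrable lborel (\<lambda>y. case (x, y) of (x, y) \<Rightarrow> f y * gauss_density ((y - x) /\<^sub>R s))"
          using int by simp
      qed measurable
      then show "integrable (lborel \<Otimes>\<^sub>M \<rho>) (\<lambda>(y, x). f y * gauss_density ((y - x) /\<^sub>R s))"
        by (subst integrable_product_swap_iff[symmetric]) (simp add: case_prod_beta)
    qed
    also have "\<dots> = (\<integral>y. f y * G s \<rho> y \<partial>lborel)" by (simp add: G_def)
    finally show ?thesis .
  qed
  have lim: "(\<lambda>n. \<integral>x. \<integral>z. f (x + (1 / Suc n) *\<^sub>R z) \<partial>gauss \<partial>\<rho>) \<longlonglongrightarrow> (\<integral>x. f x \<partial>\<rho>)"
    if \<rho>: "prob_space \<rho>" "sets \<rho> = sets borel" for \<rho>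
  proof -
    interpret \<rho>: prob_space \<rho> by fact
    note [measurable_cong] = \<rho>(2)
    have 1: "(\<lambda>n. \<integral>z. f (x + (1 / Suc n) *\<^sub>R z) \<partial>gauss) \<longlonglongrightarrow> f x" for x
    proof -
      have "(\<lambda>n. \<integral>z. f (x + (1 / Suc n) *\<^sub>R z) \<partial>gauss) \<longlonglongrightarrow> (\<integral>z. f x \<partial>(gauss :: 'b measure))"
      proof (rule integral_dominated_convergence[where w="\<lambda>_. B"])
        show "AE z in gauss. (\<lambda>n. f (x + (1 / Suc n) *\<^sub>R z)) \<longlonglongrightarrow> f x"
        proof (rule AE_I2)
          fix z :: 'b
          have "(\<lambda>n. x + (1 / Suc n) *\<^sub>R z) \<longlonglongrightarrow> x + 0 *\<^sub>R z"
            by (intro tendsto_intros LIMSEQ_Suc lim_1_over_n)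
          then show "(\<lambda>n. f (x + (1 / Suc n) *\<^sub>R z)) \<longlonglongrightarrow> f x"
            using cont by (intro isCont_tendsto_compose[where g=f]) (auto simp: continuous_on_eq_continuous_at)
        qed
      qed (use bdd in auto)
      then show ?thesis by simp
    qed
    have 2: "\<bar>\<integral>z. f (x + s *\<^sub>R z) \<partial>gauss\<bar> \<le> B" for x s
    proof -
      have "\<bar>\<integral>z. f (x + s *\<^sub>R z) \<partial>gauss\<bar> \<le> (\<integral>z. B \<partial>(gauss :: 'b measure))"
        by (rule order.trans[OF integral_abs_bound], rule integral_mono)
           (auto simp: bdd intro!: integrable_gauss_bound[of _ B 0])
      then show ?thesis by simp
    qed
    show ?thesis
      by (rule integral_dominated_convergence[where w="\<lambda>_. B"]) (use 1 2 in auto)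
  qed
  have "(\<lambda>n. \<integral>x. \<integral>z. f (x + (1 / Suc n) *\<^sub>R z) \<partial>gauss \<partial>\<mu>) = (\<lambda>n. \<integral>x. \<integral>z. f (x + (1 / Suc n) *\<^sub>R z) \<partial>gauss \<partial>\<nu>)"
    by (simp add: smooth[OF \<mu>] smooth[OF \<nu>] G)
  then show ?thesis using lim[OF \<mu>] lim[OF \<nu>] by (metis LIMSEQ_unique)
qed

text \<open>Truncation at the levels n and -n preserves continuity and reduces to bounded functions;
  |f| dominates the passage to the limit.\<close>

lemma char_eq_imp_integral_eq:
  fixes \<mu> \<nu> :: "'b::euclidean_space measure" and f :: "'b \<Rightarrow> real"
  assumes \<mu>: "prob_space \<mu>" "sets \<mu> = sets borel" and \<nu>: "prob_space \<nu>" "sets \<nu> = sets borel"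
    and char: "\<And>u. (\<integral>x. iexp (u \<bullet> x) \<partial>\<mu>) = (\<integral>x. iexp (u \<bullet> x) \<partial>\<nu>)"
    and cont: "continuous_on UNIV f" and int: "integrable \<mu> f" "integrable \<nu> f"
  shows "(\<integral>x. f x \<partial>\<mu>) = (\<integral>x. f x \<partial>\<nu>)"
proof -
  define g where "g n x = max (- real n) (min (real n) (f x))" for n x
  have lim: "(\<lambda>n. \<integral>x. g n x \<partial>\<rho>) \<longlonglongrightarrow> (\<integral>x. f x \<partial>\<rho>)" if "integrable \<rho> f" for \<rho>
  proof (rule integral_dominated_convergence[where w="\<lambda>x. \<bar>f x\<bar>"])
    have [measurable]: "f \<in> borel_measurable \<rho>" using that by auto
    show "g n \<in> borel_measurable \<rho>" for n unfolding g_def by measurable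
    show "AE x in \<rho>. (\<lambda>n. g n x) \<longlonglongrightarrow> f x"
    proof (rule AE_I2, rule tendsto_eventually)
      fix x
      obtain n0 where "\<bar>f x\<bar> \<le> real n0" using real_arch_simple by blast
      then have "g n x = f x" if "n0 \<le> n" for n using that by (auto simp: g_def)
      then show "\<forall>\<^sub>F n in sequentially. g n x = f x" unfolding eventually_sequentially by blast
    qed
  qed (use that in \<open>auto simp: g_def\<close>)
  have "(\<integral>x. g n x \<partial>\<mu>) = (\<integral>x. g n x \<partial>\<nu>)" for n
    unfolding g_def
    by (rule char_eq_imp_integral_eq_bounded[OF \<mu> \<nu> char, where B="real n"])
       (use cont in \<open>auto intro!: continuous_intros\<close>)
  then show ?thesis using lim[OF int(1)] lim[OF int(2)] by (metis (no_types, lifting) LIMSEQ_unique ext)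
qed

text \<open>Symmetric elimination. \<open>T\<close> contains the indices of the rows that may be
  nonzero. One step subtracts the rank-one matrix of the pivot column; the Schur complement is again
  positive semidefinite and has its nonzero rows in a smaller set. Pivots may vanish, so singular
  matrices are covered.\<close>

lemma psd_factorization:
  fixes c :: "'m::finite \<Rightarrow> 'm \<Rightarrow> real"
  assumes "finite T" and "\<And>i j. c i j = c j i" and "\<And>u. 0 \<le> (\<Sum>i\<in>UNIV. \<Sum>j\<in>UNIV. u i * u j * c i j)"
    and "\<And>i j. i \<notin> T \<Longrightarrow> c i j = 0"
  shows "\<exists>a. \<forall>i j. c i j = (\<Sum>k\<in>T. a k i * a k j)"
  using assms
proof (induction T arbitrary: c)
  case (insert k T)
  define q where "q u = (\<Sum>i\<in>UNIV. \<Sum>j\<in>UNIV. u i * u j * c i j)" for u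
  have q0: "0 \<le> q u" for u unfolding q_def by (rule insert.prems)
  have sym: "c i j = c j i" for i j by (rule insert.prems)
  have q_add: "q (\<lambda>i. u i + (if i = k then t else 0)) = q u + 2 * t * (\<Sum>i\<in>UNIV. u i * c i k) + t\<^sup>2 * c k k" for u t
  proof -
    have "q (\<lambda>i. u i + (if i = k then t else 0)) = (\<Sum>i\<in>UNIV. (\<Sum>j\<in>UNIV. u i * u j * c i j) + u i * t * c i k
        + (if i = k then (\<Sum>j\<in>UNIV. t * u j * c k j) + t\<^sup>2 * c k k else 0))"
      unfolding q_def
    proof (intro sum.cong refl)
      fix i
      have "(\<Sum>j\<in>UNIV. (u i + (if i = k then t else 0)) * (u j + (if j = k then t else 0)) * c i j)
         = (\<Sum>j\<in>UNIV. u i * u j * c i j + (if j = k then u i * t * c i k else 0) + (if i = k then t * u j * c k j else 0) + (if j = k then if i = k then t\<^sup>2 * c k k else 0 else 0))"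
        by (intro sum.cong refl) (auto simp: algebra_simps power2_eq_square)
      then show "(\<Sum>j\<in>UNIV. (u i + (if i = k then t else 0)) * (u j + (if j = k then t else 0)) * c i j)
         = (\<Sum>j\<in>UNIV. u i * u j * c i j) + u i * t * c i k + (if i = k then (\<Sum>j\<in>UNIV. t * u j * c k j) + t\<^sup>2 * c k k else 0)"
        by (simp add: sum.distrib)
    qed
    also have "\<dots> = q u + (\<Sum>i\<in>UNIV. u i * t * c i k) + (\<Sum>j\<in>UNIV. t * u j * c k j) + t\<^sup>2 * c k k"
      by (simp add: sum.distrib q_def)
    also have "(\<Sum>j\<in>UNIV. t * u j * c k j) = t * (\<Sum>i\<in>UNIV. u i * c i k)"
      by (simp add: sum_distrib_left sym[of k] mult.assoc)
    also have "(\<Sum>i\<in>UNIV. u i * t * c i k) = t * (\<Sum>i\<in>UNIV. u i * c i k)"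
      by (simp add: sum_distrib_left ac_simps)
    finally show ?thesis by simp
  qed
  show ?case
  proof (cases "c k k = 0")
    case True
    \<comment> \<open>A zero pivot forces its column to vanish: otherwise a unit vector is moved
      along k by t, with t chosen such that q e + 2 t c_jk = -1, and the form becomes
      negative.\<close>
    have ckj: "c j k = 0" for j
    proof (rule ccontr)
      assume nz: "c j k \<noteq> 0"
      define e where "e i = (if i = j then 1 else 0 :: real)" for i
      have "(\<Sum>i\<in>UNIV. e i * c i k) = (\<Sum>i\<in>UNIV. if i = j then c i k else 0)" by (intro sum.cong) (auto simp: e_def)
      then have 1: "(\<Sum>i\<in>UNIV. e i * c i k) = c j k" by simp
      have "q (\<lambda>i. e i + (if i = k then - (q e + 1) / (2 * c j k) else 0)) = - 1"
        unfolding q_add 1 True using nz by (simp add: field_simps)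
      then show False using q0[of "\<lambda>i. e i + (if i = k then - (q e + 1) / (2 * c j k) else 0)"] by simp
    qed
    have "c i j = 0" if "i \<notin> T" for i j
      using insert.prems(3)[of i j] that ckj[of j] sym[of k j] by (cases "i = k") auto
    then obtain a where a: "\<forall>i j. c i j = (\<Sum>k\<in>T. a k i * a k j)"
      using insert.IH[of c] insert.prems by blast
    have "c i j = (\<Sum>l\<in>insert k T. (a(k := \<lambda>_. 0)) l i * (a(k := \<lambda>_. 0)) l j)" for i j
    proof -
      have "(\<Sum>l\<in>T. (a(k := \<lambda>_. 0)) l i * (a(k := \<lambda>_. 0)) l j) = (\<Sum>l\<in>T. a l i * a l j)"
        using insert.hyps by (intro sum.cong) auto
      then show ?thesis using insert.hyps a by simp
    qed
    then show ?thesis by blast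
  next
    case False
    define e where "e i = (if i = k then 1 else 0 :: real)" for i
    have "q e = (\<Sum>i\<in>UNIV. if i = k then (\<Sum>j\<in>UNIV. if j = k then c i j else 0) else 0)"
      unfolding q_def by (intro sum.cong refl) (simp add: e_def if_distrib[of "\<lambda>x. x * _"] cong: if_cong)
    then have "q e = c k k" by simp
    then have ckk: "0 < c k k" using q0[of e] False by simp
    define c' where "c' i j = c i j - c i k * c j k / c k k" for i j
    have "0 \<le> (\<Sum>i\<in>UNIV. \<Sum>j\<in>UNIV. u i * u j * c' i j)" for u
    proof -
      define w where "w = (\<Sum>i\<in>UNIV. u i * c i k)"
      have "(\<Sum>i\<in>UNIV. \<Sum>j\<in>UNIV. u i * u j * c' i j) = q u - (\<Sum>i\<in>UNIV. \<Sum>j\<in>UNIV. (u i * c i k) * (u j * c j k)) / c k k"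
        unfolding q_def c'_def by (simp add: algebra_simps sum_subtractf sum_divide_distrib)
      also have "\<dots> = q u - w\<^sup>2 / c k k" by (simp add: sum_product[symmetric] w_def power2_eq_square)
      \<comment> \<open>The Schur complement is the value of the form at the shift of coordinate k
        that minimises it.\<close>
      also have "\<dots> = q (\<lambda>i. u i + (if i = k then - (w / c k k) else 0))"
        unfolding q_add w_def[symmetric] using ckk by (simp add: field_simps power2_eq_square)
      finally show ?thesis using q0 by simp
    qed
    moreover have "c' i j = c' j i" for i j using sym[of i j] by (simp add: c'_def ac_simps)
    moreover have "c' i j = 0" if "i \<notin> T" for i j
      using insert.prems(3)[of i] that ckk sym[of k j] by (cases "i = k") (auto simp: c'_def)
    ultimately obtain a where a: "\<forall>i j. c' i j = (\<Sum>k\<in>T. a k i * a k j)"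
      using insert.IH[of c'] by blast
    define b where "b = a(k := \<lambda>i. c i k / sqrt (c k k))"
    have "c i j = (\<Sum>l\<in>insert k T. b l i * b l j)" for i j
    proof -
      have "(\<Sum>l\<in>T. b l i * b l j) = (\<Sum>l\<in>T. a l i * a l j)"
        using insert.hyps by (intro sum.cong) (auto simp: b_def)
      then have "(\<Sum>l\<in>insert k T. b l i * b l j) = c i k / sqrt (c k k) * (c j k / sqrt (c k k)) + c' i j"
        using insert.hyps a by (simp add: b_def)
      also have "\<dots> = c i j" using ckk by (simp add: c'_def)
      finally show ?thesis by simp
    qed
    then show ?thesis by blast
  qed
qed simp

text \<open>Both alternatives are written as Y = \<mu> + s Z almost everywhere. In the degenerate
  case Z = 0 is chosen, so the second moment of Z is known to be 1 only for s \<noteq> 0; it enters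
  the conclusion multiplied by s^2.\<close>

lemma normal_variable_facts:
  fixes Y :: "'w \<Rightarrow> real"
  assumes "prob_space M" and [measurable]: "Y \<in> borel_measurable M"
    and Y: "(s = 0 \<and> (AE \<omega> in M. Y \<omega> = \<mu>)) \<or> (0 < s \<and> distributed M lborel Y (normal_density \<mu> s))"
  shows "integrable M Y" "integrable M (\<lambda>\<omega>. (Y \<omega>)\<^sup>2)" "(\<integral>\<omega>. Y \<omega> \<partial>M) = \<mu>"
    "(\<integral>\<omega>. (Y \<omega>)\<^sup>2 \<partial>M) = \<mu>\<^sup>2 + s\<^sup>2" "(\<integral>\<omega>. iexp (Y \<omega>) \<partial>M) = iexp \<mu> * exp (- s\<^sup>2 / 2)"
proof -
  interpret prob_space M by fact
  have "\<exists>Z. Z \<in> borel_measurable M \<and> (AE \<omega> in M. Y \<omega> = \<mu> + s * Z \<omega>) \<and> integrable M Z \<and> integrable M (\<lambda>\<omega>. (Z \<omega>)\<^sup>2)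
    \<and> (\<integral>\<omega>. Z \<omega> \<partial>M) = 0 \<and> (s \<noteq> 0 \<longrightarrow> (\<integral>\<omega>. (Z \<omega>)\<^sup>2 \<partial>M) = 1) \<and> (\<integral>\<omega>. iexp (s * Z \<omega>) \<partial>M) = exp (- s\<^sup>2 / 2)"
  proof (cases "s = 0")
    case True
    then show ?thesis using Y prob_space by (intro exI[of _ "\<lambda>_. 0"]) auto
  next
    case False
    with Y have s: "0 < s" and D: "distributed M lborel Y (normal_density \<mu> s)" by auto
    define Z where "Z \<omega> = (Y \<omega> - \<mu>) / s" for \<omega>
    have [measurable]: "Z \<in> borel_measurable M" unfolding Z_def by measurable
    have DZ: "distributed M lborel Z std_normal_density"
      using D s unfolding Z_def by (subst (asm) normal_standard_normal_convert) auto
    have dist: "distr M lborel Z = std_normal_distribution" using DZ by (rule distributed_distr_eq_density)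
    have *: "integrable M (\<lambda>\<omega>. (Z \<omega>) ^ k)" "(\<integral>\<omega>. (Z \<omega>) ^ k \<partial>M) = (\<integral>x. std_normal_density x * x ^ k \<partial>lborel)" for k
    proof -
      show "integrable M (\<lambda>\<omega>. (Z \<omega>) ^ k)"
        using distributed_integrable[OF DZ, of "\<lambda>x. x ^ k"] integrable_std_normal_moment[of k] by simp
      show "(\<integral>\<omega>. (Z \<omega>) ^ k \<partial>M) = (\<integral>x. std_normal_density x * x ^ k \<partial>lborel)"
        using distributed_integral[OF DZ, of "\<lambda>x. x ^ k"] by simp
    qed
    have "(\<integral>\<omega>. iexp (s * Z \<omega>) \<partial>M) = (\<integral>x. iexp (s * x) \<partial>distr M lborel Z)"
      by (subst integral_distr) auto
    also have "\<dots> = exp (- s\<^sup>2 / 2)"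
      using char_std_normal_distribution unfolding char_def dist by (simp add: fun_eq_iff)
    finally have "(\<integral>\<omega>. iexp (s * Z \<omega>) \<partial>M) = exp (- s\<^sup>2 / 2)" .
    moreover have "Y \<omega> = \<mu> + s * Z \<omega>" for \<omega> using s by (simp add: Z_def)
    ultimately show ?thesis
      using *[of 1] *[of 2] integral_std_normal_moment_odd[of 0] integral_std_normal_moment_even[of 1]
      by (intro exI[of _ Z]) (auto simp: fact_2)
  qed
  then obtain Z where [measurable]: "Z \<in> borel_measurable M" and YZ: "AE \<omega> in M. Y \<omega> = \<mu> + s * Z \<omega>"
    and Z: "integrable M Z" "integrable M (\<lambda>\<omega>. (Z \<omega>)\<^sup>2)" "(\<integral>\<omega>. Z \<omega> \<partial>M) = 0" "s \<noteq> 0 \<longrightarrow> (\<integral>\<omega>. (Z \<omega>)\<^sup>2 \<partial>M) = 1"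
      "(\<integral>\<omega>. iexp (s * Z \<omega>) \<partial>M) = exp (- s\<^sup>2 / 2)" by blast
  have sq: "(\<mu> + s * z)\<^sup>2 = \<mu>\<^sup>2 + 2 * \<mu> * s * z + s\<^sup>2 * z\<^sup>2" for z by (simp add: power2_eq_square algebra_simps)
  have "integrable M Y \<longleftrightarrow> integrable M (\<lambda>\<omega>. \<mu> + s * Z \<omega>)" by (rule integrable_cong_AE) (use YZ in auto)
  then show "integrable M Y" using Z by simp
  have "integrable M (\<lambda>\<omega>. (Y \<omega>)\<^sup>2) \<longleftrightarrow> integrable M (\<lambda>\<omega>. (\<mu> + s * Z \<omega>)\<^sup>2)" by (rule integrable_cong_AE) (use YZ in auto)
  then show "integrable M (\<lambda>\<omega>. (Y \<omega>)\<^sup>2)" using Z unfolding sq by simp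
  have "(\<integral>\<omega>. Y \<omega> \<partial>M) = (\<integral>\<omega>. \<mu> + s * Z \<omega> \<partial>M)" by (rule integral_cong_AE) (use YZ in auto)
  then show "(\<integral>\<omega>. Y \<omega> \<partial>M) = \<mu>" using Z prob_space by simp
  have "(\<integral>\<omega>. (Y \<omega>)\<^sup>2 \<partial>M) = (\<integral>\<omega>. (\<mu> + s * Z \<omega>)\<^sup>2 \<partial>M)" by (rule integral_cong_AE) (use YZ in auto)
  then show "(\<integral>\<omega>. (Y \<omega>)\<^sup>2 \<partial>M) = \<mu>\<^sup>2 + s\<^sup>2" using Z prob_space unfolding sq by (cases "s = 0") auto
  have "(\<integral>\<omega>. iexp (Y \<omega>) \<partial>M) = (\<integral>\<omega>. iexp \<mu> * iexp (s * Z \<omega>) \<partial>M)"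
    by (rule integral_cong_AE) (use YZ in \<open>auto simp: exp_add[symmetric] algebra_simps\<close>)
  then show "(\<integral>\<omega>. iexp (Y \<omega>) \<partial>M) = iexp \<mu> * exp (- s\<^sup>2 / 2)" using Z(5) by simp
qed

text \<open>The characteristic function at u involves only the normal variable u . X, hence it is
  exp(-q(u) / 2) with q the quadratic form of \<open>C\<close>. As q(u) is a second moment,
  \<open>C\<close> factors as \<open>A\<close> times its transpose, and the image of the standard
  Gaussian measure under \<open>A\<close> has the same characteristic function. Quadratic growth of
  h is the growth of the test functions.\<close>

lemma centred_gaussian_vector_representation:
  fixes X :: "'w \<Rightarrow> real ^ 'm::finite"
  assumes "centred_gaussian_vector N X C"
  obtains A :: "real ^ 'm ^ 'm"
    where "\<And>i j. C $ i $ j = (\<Sum>p\<in>UNIV. A $ i $ p * A $ j $ p)"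
      and "\<And>h c. continuous_on UNIV h \<Longrightarrow> (\<And>x. \<bar>h x\<bar> \<le> c * (1 + norm x)\<^sup>2) \<Longrightarrow>
         (\<integral>\<omega>. h (X \<omega>) \<partial>N) = (\<integral>z. h (A *v z) \<partial>gauss)"
proof -
  have N: "prob_space N" and X [measurable]: "X \<in> borel_measurable N"
    and lin: "\<And>u. \<exists>\<mu> s. (s = 0 \<and> (AE \<omega> in N. u \<bullet> X \<omega> = \<mu>)) \<or> (0 < s \<and> distributed N lborel (\<lambda>\<omega>. u \<bullet> X \<omega>) (normal_density \<mu> s))"
    and mean: "\<And>i. (\<integral>\<omega>. X \<omega> $ i \<partial>N) = 0"
    and cov: "\<And>i j. covariance N (\<lambda>\<omega>. X \<omega> $ i) (\<lambda>\<omega>. X \<omega> $ j) = C $ i $ j"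
    using assms unfolding centred_gaussian_vector_def gaussian_vector_def by auto
  interpret prob_space N by fact
  have facts: "integrable N (\<lambda>\<omega>. u \<bullet> X \<omega>)" "integrable N (\<lambda>\<omega>. (u \<bullet> X \<omega>)\<^sup>2)"
    "\<exists>\<mu> s. (\<integral>\<omega>. u \<bullet> X \<omega> \<partial>N) = \<mu> \<and> (\<integral>\<omega>. (u \<bullet> X \<omega>)\<^sup>2 \<partial>N) = \<mu>\<^sup>2 + s\<^sup>2 \<and> (\<integral>\<omega>. iexp (u \<bullet> X \<omega>) \<partial>N) = iexp \<mu> * exp (- s\<^sup>2 / 2)" for u
  proof -
    obtain \<mu> s where *: "(s = 0 \<and> (AE \<omega> in N. u \<bullet> X \<omega> = \<mu>)) \<or> (0 < s \<and> distributed N lborel (\<lambda>\<omega>. u \<bullet> X \<omega>) (normal_density \<mu> s))"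
      using lin by blast
    have [measurable]: "(\<lambda>\<omega>. u \<bullet> X \<omega>) \<in> borel_measurable N" by measurable
    note f = normal_variable_facts[OF N this *]
    show "integrable N (\<lambda>\<omega>. u \<bullet> X \<omega>)" "integrable N (\<lambda>\<omega>. (u \<bullet> X \<omega>)\<^sup>2)" by (fact f)+
    show "\<exists>\<mu> s. (\<integral>\<omega>. u \<bullet> X \<omega> \<partial>N) = \<mu> \<and> (\<integral>\<omega>. (u \<bullet> X \<omega>)\<^sup>2 \<partial>N) = \<mu>\<^sup>2 + s\<^sup>2 \<and> (\<integral>\<omega>. iexp (u \<bullet> X \<omega>) \<partial>N) = iexp \<mu> * exp (- s\<^sup>2 / 2)"
      using f by blast
  qed
  have X1: "integrable N (\<lambda>\<omega>. X \<omega> $ i)" and X2: "integrable N (\<lambda>\<omega>. (X \<omega> $ i)\<^sup>2)" for i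
    using facts(1,2)[of "axis i 1"] by (simp_all add: inner_axis' )
  have [measurable]: "(\<lambda>\<omega>. X \<omega> $ i) \<in> borel_measurable N" for i using X1 by auto
  have XX: "integrable N (\<lambda>\<omega>. X \<omega> $ i * X \<omega> $ j)" for i j
  proof (rule Bochner_Integration.integrable_bound)
    show "integrable N (\<lambda>\<omega>. (X \<omega> $ i)\<^sup>2 + (X \<omega> $ j)\<^sup>2)" using X2 by simp
    have "\<bar>a * b\<bar> \<le> a\<^sup>2 + b\<^sup>2" for a b :: real
    proof -
      have "2 * \<bar>a\<bar> * \<bar>b\<bar> \<le> \<bar>a\<bar>\<^sup>2 + \<bar>b\<bar>\<^sup>2" by (rule sum_squares_bound)
      moreover have "0 \<le> \<bar>a\<bar> * \<bar>b\<bar>" by simp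
      ultimately have "\<bar>a\<bar> * \<bar>b\<bar> \<le> \<bar>a\<bar>\<^sup>2 + \<bar>b\<bar>\<^sup>2" by linarith
      then show ?thesis by (simp add: abs_mult)
    qed
    then show "AE \<omega> in N. norm (X \<omega> $ i * X \<omega> $ j) \<le> norm ((X \<omega> $ i)\<^sup>2 + (X \<omega> $ j)\<^sup>2)" by simp
  qed simp
  have C: "C $ i $ j = (\<integral>\<omega>. X \<omega> $ i * X \<omega> $ j \<partial>N)" for i j
    using cov[of i j] by (simp add: covariance_def mean)
  define q where "q u = (\<Sum>i\<in>UNIV. \<Sum>j\<in>UNIV. u $ i * u $ j * C $ i $ j)" for u :: "real ^ 'm"
  have E2: "(\<integral>\<omega>. (u \<bullet> X \<omega>)\<^sup>2 \<partial>N) = q u" for u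
  proof -
    have "(u \<bullet> x)\<^sup>2 = (\<Sum>i\<in>UNIV. \<Sum>j\<in>UNIV. u $ i * u $ j * (x $ i * x $ j))" for x
      by (simp add: inner_vec_def power2_eq_square sum_product mult_ac)
    then show ?thesis using XX by (simp add: q_def C)
  qed
  have charX: "(\<integral>\<omega>. iexp (u \<bullet> X \<omega>) \<partial>N) = exp (- q u / 2)" for u
  proof -
    obtain \<mu> s where *: "(\<integral>\<omega>. u \<bullet> X \<omega> \<partial>N) = \<mu>" "(\<integral>\<omega>. (u \<bullet> X \<omega>)\<^sup>2 \<partial>N) = \<mu>\<^sup>2 + s\<^sup>2" "(\<integral>\<omega>. iexp (u \<bullet> X \<omega>) \<partial>N) = iexp \<mu> * exp (- s\<^sup>2 / 2)"
      using facts(3)[of u] by blast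
    have "(\<integral>\<omega>. u \<bullet> X \<omega> \<partial>N) = 0" using X1 by (simp add: inner_vec_def mean)
    then have "\<mu> = 0" using *(1) by simp
    then show ?thesis using *(2,3) E2[of u] by simp
  qed
  obtain a where a: "\<forall>i j. C $ i $ j = (\<Sum>k\<in>(UNIV :: 'm set). a k i * a k j)"
  proof -
    have "0 \<le> (\<Sum>i\<in>UNIV. \<Sum>j\<in>UNIV. u i * u j * C $ i $ j)" for u
    proof -
      have "0 \<le> q (\<chi> i. u i)" unfolding E2[symmetric] by (rule Bochner_Integration.integral_nonneg) simp
      then show ?thesis by (simp add: q_def)
    qed
    then have "\<exists>a. \<forall>i j. C $ i $ j = (\<Sum>k\<in>(UNIV :: 'm set). a k i * a k j)"
      using psd_factorization[of "UNIV :: 'm set" "\<lambda>i j. C $ i $ j"] by (simp add: C mult.commute)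
    then show ?thesis using that by blast
  qed
  define A :: "real ^ 'm ^ 'm" where "A = (\<chi> i p. a p i)"
  have A: "C $ i $ j = (\<Sum>p\<in>UNIV. A $ i $ p * A $ j $ p)" for i j using a by (simp add: A_def)
  have measA [measurable]: "(\<lambda>z. A *v z) \<in> borel \<rightarrow>\<^sub>M borel"
    by (intro borel_measurable_continuous_onI linear_continuous_on matrix_vector_mul_bounded_linear)
  have qA: "q u = (norm (transpose A *v u))\<^sup>2" for u
  proof -
    have "(norm (transpose A *v u))\<^sup>2 = (\<Sum>p\<in>UNIV. (\<Sum>i\<in>UNIV. u $ i * A $ i $ p) * (\<Sum>j\<in>UNIV. u $ j * A $ j $ p))"
      by (simp add: power2_norm_eq_inner inner_vec_def matrix_vector_mult_def transpose_def mult.commute)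
    also have "\<dots> = (\<Sum>p\<in>UNIV. \<Sum>i\<in>UNIV. \<Sum>j\<in>UNIV. u $ i * u $ j * (A $ i $ p * A $ j $ p))"
      by (simp add: sum_product ac_simps)
    also have "\<dots> = (\<Sum>i\<in>UNIV. \<Sum>j\<in>UNIV. \<Sum>p\<in>UNIV. u $ i * u $ j * (A $ i $ p * A $ j $ p))"
      by (subst sum.swap, rule sum.cong, simp, rule sum.swap)
    finally show ?thesis by (simp add: q_def A sum_distrib_left)
  qed
  show ?thesis
  proof (rule that[OF A])
    fix h :: "real ^ 'm \<Rightarrow> real" and c
    assume h: "continuous_on UNIV h" and c: "\<And>x. \<bar>h x\<bar> \<le> c * (1 + norm x)\<^sup>2"
    have [measurable]: "h \<in> borel_measurable borel" using h by (rule borel_measurable_continuous_onI)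
    define \<mu> \<nu> where "\<mu> = distr N borel X" and "\<nu> = distr gauss borel (\<lambda>z. A *v z)"
    have "(\<integral>x. h x \<partial>\<mu>) = (\<integral>x. h x \<partial>\<nu>)"
    proof (rule char_eq_imp_integral_eq)
      show "prob_space \<mu>" unfolding \<mu>_def by (rule prob_space_distr) simp
      show "prob_space \<nu>" unfolding \<nu>_def by (rule gauss.prob_space_distr) simp
      show "(\<integral>x. iexp (u \<bullet> x) \<partial>\<mu>) = (\<integral>x. iexp (u \<bullet> x) \<partial>\<nu>)" for u
      proof -
        have "(\<integral>x. iexp (u \<bullet> x) \<partial>\<nu>) = (\<integral>z. iexp ((transpose A *v u) \<bullet> z) \<partial>gauss)"
        proof -
          have "(transpose A *v u) \<bullet> z = u \<bullet> (A *v z)" for z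
            by (simp only: transpose_matrix_vector dot_lmul_matrix)
          then show ?thesis unfolding \<nu>_def by (subst integral_distr) auto
        qed
        also have "\<dots> = exp (- q u / 2)" by (simp only: char_gauss qA)
        also have "\<dots> = (\<integral>x. iexp (u \<bullet> x) \<partial>\<mu>)"
          unfolding \<mu>_def by (subst integral_distr, simp, simp) (rule charX[symmetric])
        finally show ?thesis by simp
      qed
      show "integrable \<mu> h"
      proof -
        have "integrable N (\<lambda>\<omega>. h (X \<omega>))"
        proof (rule Bochner_Integration.integrable_bound)
          have "(norm x)\<^sup>2 = (\<Sum>i\<in>UNIV. (x $ i)\<^sup>2)" for x :: "real ^ 'm"
            unfolding power2_norm_eq_inner inner_vec_def by (simp add: power2_eq_square)
          then show "integrable N (\<lambda>\<omega>. \<bar>c\<bar> * (2 + 2 * (norm (X \<omega>))\<^sup>2))" using X2 by simp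
          show "AE \<omega> in N. norm (h (X \<omega>)) \<le> norm (\<bar>c\<bar> * (2 + 2 * (norm (X \<omega>))\<^sup>2))"
          proof (rule AE_I2)
            fix \<omega>
            have "\<bar>h (X \<omega>)\<bar> \<le> \<bar>c\<bar> * (1 + norm (X \<omega>))\<^sup>2"
              using c[of "X \<omega>"] by (meson abs_ge_self mult_right_mono order.trans zero_le_power2)
            also have "(1 + norm (X \<omega>))\<^sup>2 \<le> 2 + 2 * (norm (X \<omega>))\<^sup>2"
              using sum_squares_bound[of 1 "norm (X \<omega>)"] by (simp add: power2_eq_square algebra_simps)
            finally show "norm (h (X \<omega>)) \<le> norm (\<bar>c\<bar> * (2 + 2 * (norm (X \<omega>))\<^sup>2))"
              by (simp add: mult_left_mono abs_mult)
          qed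
        qed measurable
        then show ?thesis unfolding \<mu>_def by (subst integrable_distr_eq) auto
      qed
      show "integrable \<nu> h"
      proof -
        have "integrable gauss (\<lambda>z. h (A *v z))"
        proof (rule integrable_gauss_bound[of _ "\<bar>c\<bar> * (1 + onorm ((*v) A))\<^sup>2" 2])
          fix z
          have o: "norm (A *v z) \<le> onorm ((*v) A) * norm z" by (rule onorm) (rule matrix_vector_mul_bounded_linear)
          have o0: "0 \<le> onorm ((*v) A)" by (rule onorm_pos_le) (rule matrix_vector_mul_bounded_linear)
          have "\<bar>h (A *v z)\<bar> \<le> \<bar>c\<bar> * (1 + norm (A *v z))\<^sup>2"
            using c[of "A *v z"] by (meson abs_ge_self mult_right_mono order.trans zero_le_power2)
          also have "\<dots> \<le> \<bar>c\<bar> * ((1 + onorm ((*v) A)) * (1 + norm z))\<^sup>2"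
          proof (intro mult_left_mono power_mono)
            have "1 + norm (A *v z) \<le> 1 + onorm ((*v) A) * norm z + (onorm ((*v) A) + norm z)" using o o0 norm_ge_zero[of z] by linarith
            then show "1 + norm (A *v z) \<le> (1 + onorm ((*v) A)) * (1 + norm z)" by (simp add: algebra_simps)
          qed auto
          finally show "norm (h (A *v z)) \<le> \<bar>c\<bar> * (1 + onorm ((*v) A))\<^sup>2 * (1 + norm z)\<^sup>2"
            by (simp add: power_mult_distrib mult.assoc)
        qed measurable
        then show ?thesis unfolding \<nu>_def by (subst integrable_distr_eq) auto
      qed
    qed (auto simp: \<mu>_def \<nu>_def h)
    then show "(\<integral>\<omega>. h (X \<omega>) \<partial>N) = (\<integral>z. h (A *v z) \<partial>gauss)"
      unfolding \<mu>_def \<nu>_def by (simp add: integral_distr)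
  qed
qed

section \<open>Gaussian interpolation\<close>

text \<open>Dominated convergence for the difference quotients, which the mean value theorem bounds
  by the same \<open>g\<close> as the derivatives.\<close>

lemma has_real_derivative_integral:
  fixes f f' :: "real \<Rightarrow> 'z \<Rightarrow> real"
  assumes int: "\<And>r. integrable M (f r)" and [measurable]: "\<And>r. f' r \<in> borel_measurable M"
    and der: "\<And>r z. ((\<lambda>r. f r z) has_real_derivative f' r z) (at r)"
    and bound: "\<And>r z. \<bar>f' r z\<bar> \<le> g z" and g: "integrable M g"
  shows "((\<lambda>r. \<integral>z. f r z \<partial>M) has_real_derivative (\<integral>z. f' r z \<partial>M)) (at r)"
  unfolding has_field_derivative_iff tendsto_at_iff_sequentially comp_def
proof (intro allI impI)
  fix u :: "nat \<Rightarrow> real" assume u: "\<forall>n. u n \<in> UNIV - {r}" and lim: "u \<longlonglongrightarrow> r"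
  have [measurable]: "f r \<in> borel_measurable M" for r using int by auto
  have ne: "u n \<noteq> r" for n using u by simp
  have eq: "((\<integral>z. f (u n) z \<partial>M) - (\<integral>z. f r z \<partial>M)) / (u n - r) = (\<integral>z. (f (u n) z - f r z) / (u n - r) \<partial>M)" for n
    using int by simp
  show "(\<lambda>n. ((\<integral>z. f (u n) z \<partial>M) - (\<integral>z. f r z \<partial>M)) / (u n - r)) \<longlonglongrightarrow> (\<integral>z. f' r z \<partial>M)"
    unfolding eq
  proof (rule integral_dominated_convergence[where w=g])
    show "AE z in M. (\<lambda>n. (f (u n) z - f r z) / (u n - r)) \<longlonglongrightarrow> f' r z"
    proof (rule AE_I2)
      fix z
      have "\<forall>X. (\<forall>i. X i \<in> UNIV - {r}) \<longrightarrow> X \<longlonglongrightarrow> r \<longrightarrow> ((\<lambda>y. (f y z - f r z) / (y - r)) \<circ> X) \<longlonglongrightarrow> f' r z"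
        using der[where r=r and z=z] unfolding has_field_derivative_iff tendsto_at_iff_sequentially .
      then show "(\<lambda>n. (f (u n) z - f r z) / (u n - r)) \<longlonglongrightarrow> f' r z"
        using u lim by (auto simp: comp_def)
    qed
    show "AE z in M. norm ((f (u n) z - f r z) / (u n - r)) \<le> g z" for n
    proof (rule AE_I2)
      fix z
      have mvt: "\<bar>f b z - f a z\<bar> \<le> g z * (b - a)" if ab: "a < b" for a b
      proof -
        obtain \<xi> where "f b z - f a z = (b - a) * f' \<xi> z"
          using MVT2[OF ab, of "\<lambda>r. f r z" "\<lambda>r. f' r z"] der by blast
        then show ?thesis using bound[of \<xi> z] ab by (simp add: abs_mult mult.commute)
      qed
      consider "u n < r" | "r < u n" using ne[of n] by linarith
      then show "norm ((f (u n) z - f r z) / (u n - r)) \<le> g z"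
        using mvt[of "u n" r] mvt[of r "u n"] by cases (auto simp: abs_minus_commute divide_simps)
    qed
  qed (use g in auto)
qed

text \<open>Common form of the two classes of test functions: gradient \<open>h1\<close> and
  continuous Hessian \<open>h2\<close> with entries bounded by 1. The derivatives are parameters,
  which keeps iterated Frechet derivatives out of the argument.\<close>

locale test_function =
  fixes h :: "real ^ 'm::finite \<Rightarrow> real" and h1 :: "'m \<Rightarrow> real ^ 'm \<Rightarrow> real"
    and h2 :: "'m \<Rightarrow> 'm \<Rightarrow> real ^ 'm \<Rightarrow> real"
  assumes der1: "\<And>x. (h has_derivative (\<lambda>y. \<Sum>i\<in>UNIV. y $ i * h1 i x)) (at x)"
    and der2: "\<And>i x. (h1 i has_derivative (\<lambda>y. \<Sum>r\<in>UNIV. y $ r * h2 i r x)) (at x)"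
    and cont2: "\<And>i r. continuous_on UNIV (h2 i r)"
    and bdd2: "\<And>i r x. \<bar>h2 i r x\<bar> \<le> 1"
begin

lemma cont: "continuous_on UNIV h" and cont1: "continuous_on UNIV (h1 i)"
  using der1 der2 by (auto intro!: continuous_at_imp_continuous_on has_derivative_continuous)

lemma measurable_h [measurable]: "h \<in> borel_measurable borel" "h1 i \<in> borel_measurable borel" "h2 i r \<in> borel_measurable borel"
  using cont cont1 cont2 by (auto intro: borel_measurable_continuous_onI)

lemma der1_comp:
  assumes "\<And>i. ((\<lambda>t. x t $ i) has_real_derivative x' i) (at t)"
  shows "((\<lambda>t. h (x t)) has_real_derivative (\<Sum>i\<in>UNIV. x' i * h1 i (x t))) (at t)"
proof -
  have "((\<lambda>t. x t $ i) has_derivative (\<lambda>s. s * x' i)) (at t)" for i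
    using assms[of i] unfolding has_field_derivative_def by (simp add: mult_commute_abs)
  then have "(x has_derivative (\<lambda>s. s *\<^sub>R (\<chi> i. x' i))) (at t)"
    by (subst has_derivative_componentwise_within) (auto simp: Basis_vec_def inner_axis)
  from has_derivative_compose[OF this der1[of "x t"]]
  show ?thesis unfolding has_field_derivative_def
    by (rule has_derivative_eq_rhs) (auto simp: sum_distrib_left mult_ac intro!: ext)
qed

lemma der2_comp:
  assumes "\<And>i. ((\<lambda>t. x t $ i) has_real_derivative x' i) (at t)"
  shows "((\<lambda>t. h1 j (x t)) has_real_derivative (\<Sum>i\<in>UNIV. x' i * h2 j i (x t))) (at t)"
proof -
  have "((\<lambda>t. x t $ i) has_derivative (\<lambda>s. s * x' i)) (at t)" for i
    using assms[of i] unfolding has_field_derivative_def by (simp add: mult_commute_abs)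
  then have "(x has_derivative (\<lambda>s. s *\<^sub>R (\<chi> i. x' i))) (at t)"
    by (subst has_derivative_componentwise_within) (auto simp: Basis_vec_def inner_axis)
  from has_derivative_compose[OF this der2[of j "x t"]]
  show ?thesis unfolding has_field_derivative_def
    by (rule has_derivative_eq_rhs) (auto simp: sum_distrib_left mult_ac intro!: ext)
qed

lemma sum_abs_le_norm: "(\<Sum>i\<in>UNIV. \<bar>x $ i\<bar>) \<le> CARD('m) * norm x" for x :: "real ^ 'm"
  using sum_bounded_above[of UNIV "\<lambda>i. \<bar>x $ i\<bar>" "norm x"] by (simp add: component_le_norm_cart)

text \<open>Mean value theorem on the segment from 0, for the gradient and with its bound for
  \<open>h\<close>. Quadratic growth matches the second moments that are available for the
  functionals.\<close>

lemma growth: "\<exists>c\<ge>0. (\<forall>i x. \<bar>h1 i x\<bar> \<le> c * (1 + norm x)) \<and> (\<forall>x. \<bar>h x\<bar> \<le> c * (1 + norm x)\<^sup>2)"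
proof -
  define c1 where "c1 = (\<Sum>i\<in>UNIV. \<bar>h1 i 0\<bar>) + CARD('m)"
  have c1: "0 \<le> c1" unfolding c1_def by (simp add: sum_nonneg)
  have 1: "\<bar>h1 i x\<bar> \<le> c1 * (1 + norm x)" for i x
  proof -
    obtain \<xi> where "h1 i (1 *\<^sub>R x) - h1 i (0 *\<^sub>R x) = (1 - 0) * (\<Sum>r\<in>UNIV. x $ r * h2 i r (\<xi> *\<^sub>R x))"
      using MVT2[of 0 1 "\<lambda>t. h1 i (t *\<^sub>R x)" "\<lambda>t. \<Sum>r\<in>UNIV. x $ r * h2 i r (t *\<^sub>R x)"]
      by (force intro!: der2_comp derivative_eq_intros)
    then have "\<bar>h1 i x\<bar> \<le> \<bar>h1 i 0\<bar> + \<bar>\<Sum>r\<in>UNIV. x $ r * h2 i r (\<xi> *\<^sub>R x)\<bar>" by simp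
    also have "\<bar>\<Sum>r\<in>UNIV. x $ r * h2 i r (\<xi> *\<^sub>R x)\<bar> \<le> (\<Sum>r\<in>UNIV. \<bar>x $ r\<bar>)"
      by (rule order.trans[OF sum_abs]) (intro sum_mono, simp add: abs_mult mult_left_le bdd2)
    also have "\<dots> \<le> CARD('m) * norm x" by (rule sum_abs_le_norm)
    also have "\<bar>h1 i 0\<bar> \<le> (\<Sum>i\<in>UNIV. \<bar>h1 i 0\<bar>)" by (rule member_le_sum) auto
    also have "(\<Sum>i\<in>UNIV. \<bar>h1 i 0\<bar>) + CARD('m) * norm x \<le> c1 * (1 + norm x)"
      unfolding c1_def by (simp add: algebra_simps sum_nonneg)
    finally show ?thesis by simp
  qed
  define c where "c = c1 + \<bar>h 0\<bar> + CARD('m) * c1"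
  have 2: "\<bar>h x\<bar> \<le> c * (1 + norm x)\<^sup>2" for x
  proof -
    obtain \<xi> where \<xi>: "0 < \<xi>" "\<xi> < 1" "h (1 *\<^sub>R x) - h (0 *\<^sub>R x) = (1 - 0) * (\<Sum>r\<in>UNIV. x $ r * h1 r (\<xi> *\<^sub>R x))"
      using MVT2[of 0 1 "\<lambda>t. h (t *\<^sub>R x)" "\<lambda>t. \<Sum>r\<in>UNIV. x $ r * h1 r (t *\<^sub>R x)"]
      by (force intro!: der1_comp derivative_eq_intros)
    then have "\<bar>h x\<bar> \<le> \<bar>h 0\<bar> + \<bar>\<Sum>r\<in>UNIV. x $ r * h1 r (\<xi> *\<^sub>R x)\<bar>" by simp
    also have "\<bar>\<Sum>r\<in>UNIV. x $ r * h1 r (\<xi> *\<^sub>R x)\<bar> \<le> (\<Sum>r\<in>UNIV. \<bar>x $ r\<bar> * (c1 * (1 + norm x)))"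
    proof (rule order.trans[OF sum_abs], intro sum_mono)
      fix r
      have "\<bar>h1 r (\<xi> *\<^sub>R x)\<bar> \<le> c1 * (1 + norm (\<xi> *\<^sub>R x))" by (rule 1)
      also have "\<dots> \<le> c1 * (1 + norm x)" using \<xi> c1 by (intro mult_left_mono) (auto simp: mult_left_le_one_le)
      finally show "\<bar>x $ r * h1 r (\<xi> *\<^sub>R x)\<bar> \<le> \<bar>x $ r\<bar> * (c1 * (1 + norm x))" by (simp add: abs_mult mult_left_mono)
    qed
    also have "\<dots> = (\<Sum>r\<in>UNIV. \<bar>x $ r\<bar>) * (c1 * (1 + norm x))" by (simp add: sum_distrib_right)
    also have "\<dots> \<le> (CARD('m) * (1 + norm x)) * (c1 * (1 + norm x))"
      using c1 sum_abs_le_norm[of x] by (intro mult_right_mono) (auto simp: algebra_simps intro: order.trans)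
    also have "\<bar>h 0\<bar> \<le> \<bar>h 0\<bar> * (1 + norm x)\<^sup>2" by (simp add: mult_le_cancel_left1)
    also have "\<bar>h 0\<bar> * (1 + norm x)\<^sup>2 + CARD('m) * (1 + norm x) * (c1 * (1 + norm x)) \<le> c * (1 + norm x)\<^sup>2"
    proof -
      have "CARD('m) * (1 + norm x) * (c1 * (1 + norm x)) = CARD('m) * c1 * (1 + norm x)\<^sup>2"
        by (simp add: power2_eq_square ac_simps)
      moreover have "0 \<le> c1 * (1 + norm x)\<^sup>2" using c1 by simp
      ultimately show ?thesis unfolding c_def distrib_right by linarith
    qed
    finally show ?thesis by simp
  qed
  have "c1 \<le> c" "0 \<le> c" unfolding c_def using c1 by auto
  have "\<bar>h1 i x\<bar> \<le> c * (1 + norm x)" for i x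
    using 1[of i x] mult_right_mono[OF \<open>c1 \<le> c\<close>, of "1 + norm x"] by simp
  then show ?thesis using \<open>0 \<le> c\<close> 2 by blast
qed

end

locale interpolation = test_function h h1 h2
  for h :: "real ^ 'm::finite \<Rightarrow> real" and h1 h2 +
  fixes A :: "real ^ 'm ^ 'm"
begin

text \<open>At \<theta> = 0 this is the Gaussian vector, at \<theta> = pi / 2 the point x. The
  trigonometric weights are smooth up to both end points, and their squares add up to 1.\<close>

definition W :: "real \<Rightarrow> real ^ 'm \<Rightarrow> real ^ 'm \<Rightarrow> real ^ 'm" where
  "W \<theta> x z = sin \<theta> *\<^sub>R x + cos \<theta> *\<^sub>R (A *v z)"

definition K :: "real \<Rightarrow> 'm \<Rightarrow> real ^ 'm \<Rightarrow> real" where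
  "K \<theta> i x = (\<integral>z. h1 i (W \<theta> x z) \<partial>gauss)"

definition H :: "real \<Rightarrow> 'm \<Rightarrow> 'm \<Rightarrow> real ^ 'm \<Rightarrow> real" where
  "H \<theta> i r x = (\<integral>z. h2 i r (W \<theta> x z) \<partial>gauss)"

lemma continuous_W [continuous_intros]: "continuous_on S (W \<theta> x)"
  unfolding W_def by (intro continuous_intros linear_continuous_on matrix_vector_mul_bounded_linear)

lemma measurable_W [measurable]: "W \<theta> x \<in> borel \<rightarrow>\<^sub>M borel"
  by (intro borel_measurable_continuous_onI continuous_W)

definition a where "a = onorm ((*v) A)"

lemma norm_A: "norm (A *v z) \<le> a * norm z" and a_nonneg: "0 \<le> a"
  unfolding a_def by (auto intro: onorm onorm_pos_le matrix_vector_mul_bounded_linear)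

lemma one_plus_le: "1 + norm x + norm (A *v z) \<le> (1 + norm x) * (1 + a) * (1 + norm z)"
proof -
  have "1 + norm x + norm (A *v z) \<le> 1 + norm x + a * norm z" using norm_A[of z] by simp
  also have "\<dots> \<le> (1 + norm x) * (1 + a) * (1 + norm z)"
    using a_nonneg by (simp add: algebra_simps)
  finally show ?thesis .
qed

lemma norm_W: "norm (W \<theta> x z) \<le> norm x + norm (A *v z)"
proof -
  have "norm (W \<theta> x z) \<le> \<bar>sin \<theta>\<bar> * norm x + \<bar>cos \<theta>\<bar> * norm (A *v z)"
    unfolding W_def by (rule norm_triangle_le) simp
  also have "\<dots> \<le> 1 * norm x + 1 * norm (A *v z)" by (intro add_mono mult_right_mono) auto
  finally show ?thesis by simp
qed

lemma continuous_h_W: "continuous_on UNIV (\<lambda>z. h1 i (W \<theta> x z))" "continuous_on UNIV (\<lambda>z. h2 i r (W \<theta> x z))"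
  by (auto intro!: continuous_on_compose2[OF cont1] continuous_on_compose2[OF cont2] continuous_intros)

lemma integrable_h:
  "integrable gauss (\<lambda>z. h (W \<theta> x z))" "integrable gauss (\<lambda>z. h1 i (W \<theta> x z))" "integrable gauss (\<lambda>z. h2 i r (W \<theta> x z))"
  "integrable gauss (\<lambda>z. z $ p * h1 i (W \<theta> x z))"
  and h_bound: "\<exists>c\<ge>0. \<forall>\<theta> x. \<bar>\<integral>z. h (W \<theta> x z) \<partial>gauss\<bar> \<le> c * (1 + norm x)\<^sup>2"
proof -
  obtain c where c: "0 \<le> c" "\<And>i x. \<bar>h1 i x\<bar> \<le> c * (1 + norm x)" "\<And>x. \<bar>h x\<bar> \<le> c * (1 + norm x)\<^sup>2" using growth by blast
  have le: "1 + norm (W \<theta> x z) \<le> (1 + norm x) * (1 + a) * (1 + norm z)" for \<theta> x z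
    using norm_W[of \<theta> x z] one_plus_le[of x z] by simp
  have h: "\<bar>h (W \<theta> x z)\<bar> \<le> (c * ((1 + norm x) * (1 + a))\<^sup>2) * (1 + norm z)\<^sup>2" for \<theta> x z
  proof -
    have "\<bar>h (W \<theta> x z)\<bar> \<le> c * (1 + norm (W \<theta> x z))\<^sup>2" by (rule c)
    also have "\<dots> \<le> c * ((1 + norm x) * (1 + a) * (1 + norm z))\<^sup>2"
      using c(1) le by (intro mult_left_mono power_mono) auto
    finally show ?thesis by (simp add: power_mult_distrib ac_simps)
  qed
  have h1: "\<bar>h1 i (W \<theta> x z)\<bar> \<le> (c * ((1 + norm x) * (1 + a))) * (1 + norm z)" for i \<theta> x z
  proof -
    have "\<bar>h1 i (W \<theta> x z)\<bar> \<le> c * (1 + norm (W \<theta> x z))" by (rule c)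
    also have "\<dots> \<le> c * ((1 + norm x) * (1 + a) * (1 + norm z))"
      using c(1) le by (intro mult_left_mono power_mono) auto
    finally show ?thesis by (simp add: ac_simps)
  qed
  show int: "integrable gauss (\<lambda>z. h (W \<theta> x z))" for \<theta> x
    by (rule integrable_gauss_bound[OF _ h[unfolded real_norm_def[symmetric]]]) measurable
  show "integrable gauss (\<lambda>z. h1 i (W \<theta> x z))"
    by (rule integrable_gauss_bound[of _ "c * ((1 + norm x) * (1 + a))" 1]) (use h1 in auto)
  show "integrable gauss (\<lambda>z. h2 i r (W \<theta> x z))"
    by (rule integrable_gauss_bound[of _ 1 0]) (auto simp: bdd2)
  show "integrable gauss (\<lambda>z. z $ p * h1 i (W \<theta> x z))"
  proof (rule integrable_gauss_bound[of _ "c * ((1 + norm x) * (1 + a))" 2])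
    fix z
    have "\<bar>z $ p\<bar> \<le> 1 + norm z" using component_le_norm_cart[of z p] by simp
    then have "\<bar>z $ p\<bar> * \<bar>h1 i (W \<theta> x z)\<bar> \<le> (1 + norm z) * ((c * ((1 + norm x) * (1 + a))) * (1 + norm z))"
      using h1 by (intro mult_mono) auto
    then show "norm (z $ p * h1 i (W \<theta> x z)) \<le> c * ((1 + norm x) * (1 + a)) * (1 + norm z)\<^sup>2"
      by (simp add: abs_mult power2_eq_square ac_simps)
  qed (intro borel_measurable_continuous_onI continuous_intros continuous_h_W)
  define I where "I = (\<integral>z. (1 + norm (z :: real ^ 'm))\<^sup>2 \<partial>gauss)"
  have I: "integrable gauss (\<lambda>z::real ^ 'm. (1 + norm z)\<^sup>2)" by (rule integrable_gauss_bound[of _ 1 2]) auto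
  have "\<bar>\<integral>z. h (W \<theta> x z) \<partial>gauss\<bar> \<le> c * (1 + a)\<^sup>2 * I * (1 + norm x)\<^sup>2" for \<theta> x
  proof -
    have "\<bar>\<integral>z. h (W \<theta> x z) \<partial>gauss\<bar> \<le> (\<integral>z. (c * ((1 + norm x) * (1 + a))\<^sup>2) * (1 + norm (z::real ^ 'm))\<^sup>2 \<partial>gauss)"
      by (rule order.trans[OF integral_abs_bound], rule integral_mono) (use int I h in auto)
    then show ?thesis by (simp add: I_def power_mult_distrib ac_simps)
  qed
  moreover have "0 \<le> I" unfolding I_def by (rule Bochner_Integration.integral_nonneg) simp
  ultimately show "\<exists>c\<ge>0. \<forall>\<theta> x. \<bar>\<integral>z. h (W \<theta> x z) \<partial>gauss\<bar> \<le> c * (1 + norm x)\<^sup>2"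
    using c(1) by (intro exI[of _ "c * (1 + a)\<^sup>2 * I"]) auto
qed

lemma H_le: "\<bar>H \<theta> i r x\<bar> \<le> 1"
proof -
  have "\<bar>H \<theta> i r x\<bar> \<le> (\<integral>z. 1 \<partial>(gauss :: (real ^ 'm) measure))"
    unfolding H_def by (rule order.trans[OF integral_abs_bound], rule integral_mono) (use integrable_h(3) bdd2 in auto)
  then show ?thesis by simp
qed

text \<open>Gaussian integration by parts in coordinate p; the chain rule through \<open>W\<close>
  yields the factor cos \<theta>.\<close>

lemma integration_by_parts_h1:
  "(\<integral>z. z $ p * h1 i (W \<theta> x z) \<partial>gauss) = cos \<theta> * (\<Sum>r\<in>UNIV. A $ r $ p * H \<theta> i r x)"
proof -
  obtain c where c: "0 \<le> c" "\<And>i x. \<bar>h1 i x\<bar> \<le> c * (1 + norm x)" using growth by blast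
  have "(\<integral>z. (z \<bullet> axis p 1) * h1 i (W \<theta> x z) \<partial>gauss) = (\<integral>z. (\<Sum>r\<in>UNIV. cos \<theta> * A $ r $ p * h2 i r (W \<theta> x z)) \<partial>gauss)"
  proof (rule gauss_integration_by_parts[where c="c * ((1 + norm x) * (1 + a))" and c'="\<Sum>r\<in>UNIV. \<bar>A $ r $ p\<bar>"])
    fix z r
    have "W \<theta> x (z + t *\<^sub>R axis p 1) $ j = W \<theta> x z $ j + t * (cos \<theta> * A $ j $ p)" for t j
      by (simp add: W_def matrix_vector_right_distrib matrix_vector_mult_scaleR matrix_vector_mult_basis column_def algebra_simps)
    then show "((\<lambda>t. h1 i (W \<theta> x (z + t *\<^sub>R axis p 1))) has_real_derivative
        (\<Sum>j\<in>UNIV. cos \<theta> * A $ j $ p * h2 i j (W \<theta> x (z + r *\<^sub>R axis p 1)))) (at r)"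
      by (intro der2_comp) (auto intro!: derivative_eq_intros)
    have "\<bar>h1 i (W \<theta> x z)\<bar> \<le> c * (1 + norm (W \<theta> x z))" by (rule c)
    also have "\<dots> \<le> c * ((1 + norm x) * (1 + a) * (1 + norm z))"
      using c(1) norm_W[of \<theta> x z] one_plus_le[of x z] by (intro mult_left_mono) auto
    finally show "\<bar>h1 i (W \<theta> x z)\<bar> \<le> c * ((1 + norm x) * (1 + a)) * (1 + norm z)" by (simp add: ac_simps)
    have "\<bar>cos \<theta> * A $ r $ p * h2 i r (W \<theta> x z)\<bar> \<le> 1 * \<bar>A $ r $ p\<bar> * 1" for r
      unfolding abs_mult by (intro mult_mono) (auto simp: bdd2)
    then show "\<bar>\<Sum>r\<in>UNIV. cos \<theta> * A $ r $ p * h2 i r (W \<theta> x z)\<bar> \<le> (\<Sum>r\<in>UNIV. \<bar>A $ r $ p\<bar>)"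
      by (intro order.trans[OF sum_abs] sum_mono) simp
  qed (intro continuous_intros continuous_h_W)+
  then show ?thesis
    by (simp add: inner_axis H_def integrable_h sum_distrib_left ac_simps)
qed

text \<open>The derivative of \<open>W\<close> is cos \<theta> x - sin \<theta> A z. In the second
  term z is integrated by parts; this brings in cos \<theta> and, summed over the coordinates of z,
  the matrix \<open>C\<close>. So cos \<theta> is common to both terms. The second claim is the
  majorant for differentiating under the expectation over the random x.\<close>

lemma derivative_inner:
  assumes C: "\<And>i j. C $ i $ j = (\<Sum>p\<in>UNIV. A $ i $ p * A $ j $ p)"
  shows "((\<lambda>\<theta>. \<integral>z. h (W \<theta> x z) \<partial>gauss) has_real_derivative
     cos \<theta> * ((\<Sum>i\<in>UNIV. x $ i * K \<theta> i x) - sin \<theta> * (\<Sum>i\<in>UNIV. \<Sum>r\<in>UNIV. C $ i $ r * H \<theta> i r x))) (at \<theta>)"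
    and "\<exists>c. \<forall>\<theta> x. \<bar>cos \<theta> * ((\<Sum>i\<in>UNIV. x $ i * K \<theta> i x) - sin \<theta> * (\<Sum>i\<in>UNIV. \<Sum>r\<in>UNIV. C $ i $ r * H \<theta> i r x))\<bar> \<le> c * (1 + norm x)\<^sup>2"
proof -
  obtain c where c: "0 \<le> c" "\<And>i x. \<bar>h1 i x\<bar> \<le> c * (1 + norm x)" using growth by blast
  define D where "D \<theta> x z = (\<Sum>i\<in>UNIV. (cos \<theta> * x $ i - sin \<theta> * (A *v z) $ i) * h1 i (W \<theta> x z))" for \<theta> x z
  define b where "b = CARD('m) * (c * (1 + a)\<^sup>2)"
  have b0: "0 \<le> b" unfolding b_def using c(1) by simp
  have D: "\<bar>D \<theta> x z\<bar> \<le> b * (1 + norm x)\<^sup>2 * (1 + norm z)\<^sup>2" for \<theta> x z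
  proof -
    define R where "R = (1 + norm x) * (1 + a) * (1 + norm z)"
    have R: "1 + norm x + norm (A *v z) \<le> R" unfolding R_def by (rule one_plus_le)
    have "\<bar>D \<theta> x z\<bar> \<le> (\<Sum>i\<in>(UNIV::'m set). R * (c * R))"
      unfolding D_def
    proof (intro order.trans[OF sum_abs] sum_mono)
      fix i
      have "\<bar>cos \<theta> * x $ i - sin \<theta> * (A *v z) $ i\<bar> \<le> \<bar>cos \<theta>\<bar> * \<bar>x $ i\<bar> + \<bar>sin \<theta>\<bar> * \<bar>(A *v z) $ i\<bar>"
        unfolding abs_mult[symmetric] by (rule abs_triangle_ineq4)
      also have "\<dots> \<le> 1 * norm x + 1 * norm (A *v z)" by (intro add_mono mult_mono component_le_norm_cart) auto
      also have "\<dots> \<le> R" using R by simp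
      finally have 1: "\<bar>cos \<theta> * x $ i - sin \<theta> * (A *v z) $ i\<bar> \<le> R" .
      have "\<bar>h1 i (W \<theta> x z)\<bar> \<le> c * (1 + norm (W \<theta> x z))" by (rule c)
      also have "\<dots> \<le> c * R" using c(1) norm_W[of \<theta> x z] R by (intro mult_left_mono) auto
      finally show "\<bar>(cos \<theta> * x $ i - sin \<theta> * (A *v z) $ i) * h1 i (W \<theta> x z)\<bar> \<le> R * (c * R)"
        unfolding abs_mult using 1 by (intro mult_mono) auto
    qed
    also have "\<dots> = b * (1 + norm x)\<^sup>2 * (1 + norm z)\<^sup>2" by (simp add: b_def R_def power2_eq_square ac_simps)
    finally show ?thesis .
  qed
  have Dm: "D \<theta> x \<in> borel_measurable borel" for \<theta> x
    unfolding D_def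
    by (intro borel_measurable_continuous_onI continuous_intros continuous_h_W linear_continuous_on matrix_vector_mul_bounded_linear)
  have I: "integrable gauss (\<lambda>z::real ^ 'm. (1 + norm z)\<^sup>2)" by (rule integrable_gauss_bound[of _ 1 2]) auto
  have eq: "(\<integral>z. D \<theta> x z \<partial>gauss) = cos \<theta> * ((\<Sum>i\<in>UNIV. x $ i * K \<theta> i x) - sin \<theta> * (\<Sum>i\<in>UNIV. \<Sum>r\<in>UNIV. C $ i $ r * H \<theta> i r x))" for \<theta> x
  proof -
    have "(\<integral>z. D \<theta> x z \<partial>gauss) = (\<integral>z. (\<Sum>i\<in>UNIV. cos \<theta> * x $ i * h1 i (W \<theta> x z) - sin \<theta> * (\<Sum>p\<in>UNIV. A $ i $ p * (z $ p * h1 i (W \<theta> x z)))) \<partial>gauss)"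
      unfolding D_def by (simp add: matrix_vector_mult_def algebra_simps sum_distrib_left sum_distrib_right)
    also have "\<dots> = (\<Sum>i\<in>UNIV. cos \<theta> * x $ i * K \<theta> i x - sin \<theta> * (\<Sum>p\<in>UNIV. A $ i $ p * (\<integral>z. z $ p * h1 i (W \<theta> x z) \<partial>gauss)))"
      by (simp add: integrable_h K_def)
    also have "\<dots> = (\<Sum>i\<in>UNIV. cos \<theta> * x $ i * K \<theta> i x - sin \<theta> * cos \<theta> * (\<Sum>r\<in>UNIV. C $ i $ r * H \<theta> i r x))"
    proof (intro sum.cong refl arg_cong2[where f="(-)"])
      fix i
      have "(\<Sum>p\<in>UNIV. A $ i $ p * (\<integral>z. z $ p * h1 i (W \<theta> x z) \<partial>gauss)) = (\<Sum>p\<in>UNIV. \<Sum>r\<in>UNIV. cos \<theta> * (A $ i $ p * A $ r $ p * H \<theta> i r x))"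
        by (simp add: integration_by_parts_h1 sum_distrib_left ac_simps)
      also have "\<dots> = cos \<theta> * (\<Sum>r\<in>UNIV. C $ i $ r * H \<theta> i r x)"
        by (subst sum.swap) (simp add: C sum_distrib_left sum_distrib_right)
      finally show "sin \<theta> * (\<Sum>p\<in>UNIV. A $ i $ p * (\<integral>z. z $ p * h1 i (W \<theta> x z) \<partial>gauss)) = sin \<theta> * cos \<theta> * (\<Sum>r\<in>UNIV. C $ i $ r * H \<theta> i r x)"
        by simp
    qed
    finally show ?thesis by (simp add: sum_subtractf sum_distrib_left algebra_simps)
  qed
  show "((\<lambda>\<theta>. \<integral>z. h (W \<theta> x z) \<partial>gauss) has_real_derivative
     cos \<theta> * ((\<Sum>i\<in>UNIV. x $ i * K \<theta> i x) - sin \<theta> * (\<Sum>i\<in>UNIV. \<Sum>r\<in>UNIV. C $ i $ r * H \<theta> i r x))) (at \<theta>)"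
    unfolding eq[symmetric]
  proof (rule has_real_derivative_integral[where g="\<lambda>z. b * (1 + norm x)\<^sup>2 * (1 + norm z)\<^sup>2"])
    show "((\<lambda>\<theta>. h (W \<theta> x z)) has_real_derivative D \<theta> x z) (at \<theta>)" for \<theta> z
      unfolding D_def
      by (rule der1_comp) (auto simp: W_def intro!: derivative_eq_intros)
  qed (use D Dm I integrable_h in auto)
  have "\<bar>\<integral>z. D \<theta> x z \<partial>gauss\<bar> \<le> (b * (\<integral>z. (1 + norm (z::real ^ 'm))\<^sup>2 \<partial>gauss)) * (1 + norm x)\<^sup>2" for \<theta> x
  proof -
    have "integrable gauss (D \<theta> x)" by (rule integrable_gauss_bound[OF Dm, of _ _ _ 2]) (use D in auto)
    note this [simp]
    have "\<bar>\<integral>z. D \<theta> x z \<partial>gauss\<bar> \<le> (\<integral>z. b * (1 + norm x)\<^sup>2 * (1 + norm (z::real ^ 'm))\<^sup>2 \<partial>gauss)"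
      by (rule order.trans[OF integral_abs_bound], rule integral_mono) (use D I in auto)
    then show ?thesis by (simp add: ac_simps)
  qed
  then show "\<exists>c. \<forall>\<theta> x. \<bar>cos \<theta> * ((\<Sum>i\<in>UNIV. x $ i * K \<theta> i x) - sin \<theta> * (\<Sum>i\<in>UNIV. \<Sum>r\<in>UNIV. C $ i $ r * H \<theta> i r x))\<bar> \<le> c * (1 + norm x)\<^sup>2"
    unfolding eq by blast
qed

text \<open>The constant is the length of the path: the mean value theorem compares the end points,
  so the derivative has to be estimated at interior angles only, where cos \<theta> > 0.\<close>

lemma interpolation_bound:
  fixes P :: "'w pmf" and V :: "'w \<Rightarrow> real ^ 'm"
  assumes C: "\<And>i j. C $ i $ j = (\<Sum>p\<in>UNIV. A $ i $ p * A $ j $ p)"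
    and V: "integrable P (\<lambda>\<omega>. (1 + norm (V \<omega>))\<^sup>2)"
    and bound: "\<And>\<theta>. 0 < \<theta> \<Longrightarrow> \<theta> < pi / 2 \<Longrightarrow>
      cos \<theta> * \<bar>\<integral>\<omega>. (\<Sum>i\<in>UNIV. V \<omega> $ i * K \<theta> i (V \<omega>)) - sin \<theta> * (\<Sum>i\<in>UNIV. \<Sum>r\<in>UNIV. C $ i $ r * H \<theta> i r (V \<omega>)) \<partial>P\<bar> \<le> B"
  shows "\<bar>(\<integral>\<omega>. h (V \<omega>) \<partial>P) - (\<integral>z. h (A *v z) \<partial>gauss)\<bar> \<le> pi / 2 * B"
proof -
  define \<Psi> where "\<Psi> \<theta> = (\<integral>\<omega>. (\<integral>z. h (W \<theta> (V \<omega>) z) \<partial>gauss) \<partial>P)" for \<theta>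
  define \<Psi>' where "\<Psi>' \<theta> \<omega> = cos \<theta> * ((\<Sum>i\<in>UNIV. V \<omega> $ i * K \<theta> i (V \<omega>)) - sin \<theta> * (\<Sum>i\<in>UNIV. \<Sum>r\<in>UNIV. C $ i $ r * H \<theta> i r (V \<omega>)))" for \<theta> \<omega>
  obtain c where c: "0 \<le> c" "\<And>\<theta> x. \<bar>\<integral>z. h (W \<theta> x z) \<partial>gauss\<bar> \<le> c * (1 + norm x)\<^sup>2" using h_bound by blast
  obtain c' where c': "\<And>\<theta> \<omega>. \<bar>\<Psi>' \<theta> \<omega>\<bar> \<le> c' * (1 + norm (V \<omega>))\<^sup>2"
    unfolding \<Psi>'_def using derivative_inner(2)[OF C] by blast
  have der: "(\<Psi> has_real_derivative (\<integral>\<omega>. \<Psi>' \<theta> \<omega> \<partial>P)) (at \<theta>)" for \<theta>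
    unfolding \<Psi>_def
  proof (rule has_real_derivative_integral[where g="\<lambda>\<omega>. c' * (1 + norm (V \<omega>))\<^sup>2"])
    show "integrable P (\<lambda>\<omega>. \<integral>z. h (W r (V \<omega>) z) \<partial>gauss)" for r
      by (rule Bochner_Integration.integrable_bound[of _ "\<lambda>\<omega>. c * (1 + norm (V \<omega>))\<^sup>2"])
         (use V c in \<open>auto intro!: AE_I2 order.trans[OF _ abs_ge_self]\<close>)
    show "((\<lambda>r. \<integral>z. h (W r (V \<omega>) z) \<partial>gauss) has_real_derivative \<Psi>' r \<omega>) (at r)" for r \<omega>
      unfolding \<Psi>'_def by (rule derivative_inner(1)[OF C])
  qed (use V c' in auto)
  obtain \<xi> where \<xi>: "0 < \<xi>" "\<xi> < pi / 2" "\<Psi> (pi / 2) - \<Psi> 0 = (pi / 2 - 0) * (\<integral>\<omega>. \<Psi>' \<xi> \<omega> \<partial>P)"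
    using MVT2[of 0 "pi / 2" \<Psi> "\<lambda>\<theta>. \<integral>\<omega>. \<Psi>' \<theta> \<omega> \<partial>P"] der pi_gt_zero by auto
  have "\<bar>\<integral>\<omega>. \<Psi>' \<xi> \<omega> \<partial>P\<bar> \<le> B"
    using bound[OF \<xi>(1,2)] cos_gt_zero[OF \<xi>(1,2)] unfolding \<Psi>'_def by (simp add: abs_mult)
  then have "\<bar>\<Psi> (pi / 2) - \<Psi> 0\<bar> \<le> pi / 2 * B"
    unfolding \<xi>(3) by (simp add: abs_mult)
  moreover have "\<Psi> (pi / 2) = (\<integral>\<omega>. h (V \<omega>) \<partial>P)" "\<Psi> 0 = (\<integral>z. h (A *v z) \<partial>gauss)"
    by (simp_all add: \<Psi>_def W_def)
  ultimately show ?thesis by simp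
qed

text \<open>The derivative of K in direction y is sin \<theta> times the sum of y_r H_r. The mean
  value theorem therefore leaves differences of \<open>H\<close> between two points of a segment,
  which the Hoelder modulus controls.\<close>

lemma K_taylor:
  assumes "0 \<le> \<theta>" "\<theta> \<le> pi / 2" and q: "0 < q" and D: "0 \<le> D"
    and mod: "\<And>i r x y. \<bar>H \<theta> i r (x + y) - H \<theta> i r x\<bar> \<le> D * (\<Sum>l\<in>UNIV. \<bar>y $ l\<bar>) powr q"
  shows "\<bar>K \<theta> i (x + y) - K \<theta> i x - sin \<theta> * (\<Sum>r\<in>UNIV. y $ r * H \<theta> i r x)\<bar>
    \<le> sin \<theta> * D * (\<Sum>l\<in>UNIV. \<bar>y $ l\<bar>) powr (1 + q)"
proof -
  define S where "S = (\<Sum>l\<in>UNIV. \<bar>y $ l\<bar>)"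
  have S: "0 \<le> S" unfolding S_def by (simp add: sum_nonneg)
  have sin: "0 \<le> sin \<theta>" using assms by (intro sin_ge_zero) auto
  have der: "((\<lambda>t. K \<theta> i (x + t *\<^sub>R y)) has_real_derivative sin \<theta> * (\<Sum>r\<in>UNIV. y $ r * H \<theta> i r (x + t *\<^sub>R y))) (at t)" for t
  proof -
    have "((\<lambda>t. \<integral>z. h1 i (W \<theta> (x + t *\<^sub>R y) z) \<partial>gauss) has_real_derivative (\<integral>z. (\<Sum>r\<in>UNIV. sin \<theta> * y $ r * h2 i r (W \<theta> (x + t *\<^sub>R y) z)) \<partial>gauss)) (at t)"
    proof (rule has_real_derivative_integral[where g="\<lambda>_. S"])
      show "((\<lambda>t. h1 i (W \<theta> (x + t *\<^sub>R y) z)) has_real_derivative (\<Sum>r\<in>UNIV. sin \<theta> * y $ r * h2 i r (W \<theta> (x + t *\<^sub>R y) z))) (at t)" for t z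
        by (rule der2_comp) (auto simp: W_def intro!: derivative_eq_intros)
      fix t z
      have "\<bar>sin \<theta> * y $ r * h2 i r (W \<theta> (x + t *\<^sub>R y) z)\<bar> \<le> 1 * \<bar>y $ r\<bar> * 1" for r
        unfolding abs_mult by (intro mult_mono) (auto simp: bdd2)
      then show "\<bar>\<Sum>r\<in>UNIV. sin \<theta> * y $ r * h2 i r (W \<theta> (x + t *\<^sub>R y) z)\<bar> \<le> S"
        unfolding S_def by (intro order.trans[OF sum_abs] sum_mono) simp
    qed (use integrable_h in auto)
    then show ?thesis by (simp add: K_def H_def integrable_h sum_distrib_left mult.assoc)
  qed
  obtain \<xi> where \<xi>: "0 < \<xi>" "\<xi> < 1" "K \<theta> i (x + 1 *\<^sub>R y) - K \<theta> i (x + 0 *\<^sub>R y) = (1 - 0) * (sin \<theta> * (\<Sum>r\<in>UNIV. y $ r * H \<theta> i r (x + \<xi> *\<^sub>R y)))"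
    using MVT2[of 0 1 "\<lambda>t. K \<theta> i (x + t *\<^sub>R y)" "\<lambda>t. sin \<theta> * (\<Sum>r\<in>UNIV. y $ r * H \<theta> i r (x + t *\<^sub>R y))"] der by force
  then have "K \<theta> i (x + y) - K \<theta> i x - sin \<theta> * (\<Sum>r\<in>UNIV. y $ r * H \<theta> i r x)
      = sin \<theta> * (\<Sum>r\<in>UNIV. y $ r * (H \<theta> i r (x + \<xi> *\<^sub>R y) - H \<theta> i r x))"
    by (simp add: right_diff_distrib sum_subtractf)
  also have "\<bar>\<dots>\<bar> \<le> sin \<theta> * (\<Sum>r\<in>UNIV. \<bar>y $ r\<bar> * (D * S powr q))"
    unfolding abs_mult abs_of_nonneg[OF sin]
  proof (intro mult_left_mono sin order.trans[OF sum_abs] sum_mono)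
    fix r
    have "\<bar>H \<theta> i r (x + \<xi> *\<^sub>R y) - H \<theta> i r x\<bar> \<le> D * (\<Sum>l\<in>UNIV. \<bar>(\<xi> *\<^sub>R y) $ l\<bar>) powr q" by (rule mod)
    also have "(\<Sum>l\<in>UNIV. \<bar>(\<xi> *\<^sub>R y) $ l\<bar>) = \<xi> * S" using \<xi> by (simp add: S_def abs_mult sum_distrib_left)
    also have "D * (\<xi> * S) powr q \<le> D * S powr q"
      using \<xi> S q D by (intro mult_left_mono powr_mono2) (auto simp: mult_left_le_one_le)
    finally show "\<bar>y $ r * (H \<theta> i r (x + \<xi> *\<^sub>R y) - H \<theta> i r x)\<bar> \<le> \<bar>y $ r\<bar> * (D * S powr q)"
      by (simp add: abs_mult mult_left_mono)
  qed
  also have "\<dots> = sin \<theta> * D * (S * S powr q)" by (simp add: sum_distrib_right[symmetric] S_def)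
  also have "S * S powr q = S powr (1 + q)" using S by (cases "S = 0") (auto simp: powr_add)
  finally show ?thesis by (simp add: S_def)
qed

end

text \<open>The interface between test functions and normal approximation: the Hessian averaged over
  the Gaussian part is Lipschitz with constant c / cos \<theta>. The constant may blow up at
  \<theta> = pi / 2, where the averaging disappears. \<open>interpolation.H\<close> is the averaged
  Hessian as seen from outside its locale.\<close>

definition regular :: "real \<Rightarrow> real ^ 'm ^ 'm \<Rightarrow> (real ^ 'm::finite \<Rightarrow> real) \<Rightarrow> bool" where
  "regular c A h \<longleftrightarrow> (\<exists>h1 h2. test_function h h1 h2 \<and>
     (\<forall>\<theta> i r x y. 0 < \<theta> \<longrightarrow> \<theta> < pi / 2 \<longrightarrow>
        \<bar>interpolation.H h2 A \<theta> i r (x + y) - interpolation.H h2 A \<theta> i r x\<bar> \<le> c / cos \<theta> * (\<Sum>l\<in>UNIV. \<bar>y $ l\<bar>)))"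

lemma regular_growth:
  assumes "regular c A h"
  shows "continuous_on UNIV h" and "\<exists>c\<ge>0. \<forall>x. \<bar>h x\<bar> \<le> c * (1 + norm x)\<^sup>2"
proof -
  obtain h1 h2 where "test_function h h1 h2" using assms unfolding regular_def by blast
  then interpret test_function h h1 h2 .
  show "continuous_on UNIV h" "\<exists>c\<ge>0. \<forall>x. \<bar>h x\<bar> \<le> c * (1 + norm x)\<^sup>2"
    using cont growth by blast+
qed

section \<open>Regularity of the test functions of the two distances\<close>

lemma partial_deriv_has_derivative:
  assumes "f differentiable_on UNIV"
  shows "(f has_derivative (\<lambda>y. \<Sum>i\<in>UNIV. y $ i * partial_deriv i f x)) (at x)"
proof -
  have D: "(f has_derivative frechet_derivative f (at x)) (at x)"
    using assms by (simp add: differentiable_on_def frechet_derivative_works)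
  then have lin: "linear (frechet_derivative f (at x))" by (simp add: has_derivative_linear)
  have "frechet_derivative f (at x) y = (\<Sum>i\<in>UNIV. y $ i * partial_deriv i f x)" for y
  proof -
    have "y = (\<Sum>i\<in>UNIV. y $ i *\<^sub>R axis i 1)"
      using basis_expansion[of y] by (simp add: scalar_mult_eq_scaleR)
    then have "frechet_derivative f (at x) y = frechet_derivative f (at x) (\<Sum>i\<in>UNIV. y $ i *\<^sub>R axis i 1)" by simp
    also have "\<dots> = (\<Sum>i\<in>UNIV. y $ i * partial_deriv i f x)"
      by (simp add: linear_sum[OF lin] linear_scale[OF lin] partial_deriv_def)
    finally show ?thesis .
  qed
  then show ?thesis using D by (metis (no_types, lifting) ext)
qed

lemma test_function_C2:
  assumes "C_k 2 h" and "\<And>i r x. \<bar>partial_deriv r (partial_deriv i h) x\<bar> \<le> 1"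
  shows "test_function h (\<lambda>i. partial_deriv i h) (\<lambda>i r. partial_deriv r (partial_deriv i h))"
  by unfold_locales
     (use assms in \<open>auto simp: numeral_2_eq_2 intro: partial_deriv_has_derivative\<close>)

context interpolation
begin

text \<open>Averaging preserves the Lipschitz constant 1 of the Hessian entries; the factor 1 / cos
  \<theta> \<ge> 1 brings the bound into the form shared with the other class.\<close>

lemma H_modulus_Lipschitz:
  assumes lip: "\<And>i r x y. \<bar>h2 i r (x + y) - h2 i r x\<bar> \<le> (\<Sum>l\<in>UNIV. \<bar>y $ l\<bar>)"
    and \<theta>: "0 < \<theta>" "\<theta> < pi / 2"
  shows "\<bar>H \<theta> i r (x + y) - H \<theta> i r x\<bar> \<le> 1 / cos \<theta> * (\<Sum>l\<in>UNIV. \<bar>y $ l\<bar>)"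
proof -
  have cos: "0 < cos \<theta>" using cos_gt_zero[OF \<theta>] .
  have "H \<theta> i r (x + y) - H \<theta> i r x = (\<integral>z. h2 i r (W \<theta> (x + y) z) - h2 i r (W \<theta> x z) \<partial>gauss)"
    unfolding H_def by (simp add: integrable_h)
  also have "\<bar>\<dots>\<bar> \<le> (\<integral>z. (\<Sum>l\<in>UNIV. \<bar>y $ l\<bar>) \<partial>(gauss :: (real ^ 'm) measure))"
  proof (rule order.trans[OF integral_abs_bound], rule integral_mono)
    fix z
    have "W \<theta> (x + y) z = W \<theta> x z + sin \<theta> *\<^sub>R y" by (simp add: W_def scaleR_add_right)
    then have "\<bar>h2 i r (W \<theta> (x + y) z) - h2 i r (W \<theta> x z)\<bar> \<le> (\<Sum>l\<in>UNIV. \<bar>(sin \<theta> *\<^sub>R y) $ l\<bar>)"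
      using lip[of i r "W \<theta> x z" "sin \<theta> *\<^sub>R y"] by simp
    also have "\<dots> \<le> (\<Sum>l\<in>UNIV. \<bar>y $ l\<bar>)" by (intro sum_mono) (simp add: abs_mult mult_left_le_one_le)
    finally show "\<bar>h2 i r (W \<theta> (x + y) z) - h2 i r (W \<theta> x z)\<bar> \<le> (\<Sum>l\<in>UNIV. \<bar>y $ l\<bar>)" .
  qed (use integrable_h in auto)
  also have "\<dots> = 1 * (\<Sum>l\<in>UNIV. \<bar>y $ l\<bar>)" by simp
  also have "\<dots> \<le> 1 / cos \<theta> * (\<Sum>l\<in>UNIV. \<bar>y $ l\<bar>)"
    using cos by (intro mult_right_mono) (auto simp: sum_nonneg)
  finally show ?thesis .
qed

text \<open>A shift of x by y is absorbed by the Gaussian variable: w is chosen such that cos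
  \<theta> A w = sin \<theta> y. The bound on total variation then asks only for bounded Hessian
  entries, at the price of tan \<theta> and of the norm of the right inverse
  \<open>B\<close>.\<close>

lemma H_modulus_shift:
  assumes B: "A ** B = mat 1" and \<theta>: "0 < \<theta>" "\<theta> < pi / 2"
  shows "\<bar>H \<theta> i r (x + y) - H \<theta> i r x\<bar> \<le> (2 * onorm ((*v) B)) / cos \<theta> * (\<Sum>l\<in>UNIV. \<bar>y $ l\<bar>)"
proof -
  have cos: "0 < cos \<theta>" using cos_gt_zero[OF \<theta>] .
  define w where "w = (sin \<theta> / cos \<theta>) *\<^sub>R (B *v y)"
  have "A *v w = (sin \<theta> / cos \<theta>) *\<^sub>R y"
    by (simp add: w_def matrix_vector_mult_scaleR matrix_vector_mul_assoc B)
  then have "W \<theta> (x + y) z = W \<theta> x (z + w)" for z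
    using cos by (simp add: W_def matrix_vector_right_distrib scaleR_add_right)
  then have "\<bar>H \<theta> i r (x + y) - H \<theta> i r x\<bar> \<le> 2 * norm w"
    unfolding H_def using gauss_shift_bound[of "\<lambda>z. h2 i r (W \<theta> x z)" w] bdd2 by simp
  also have "norm w \<le> 1 / cos \<theta> * (onorm ((*v) B) * (\<Sum>l\<in>UNIV. \<bar>y $ l\<bar>))"
  proof -
    have "norm w = \<bar>sin \<theta>\<bar> / cos \<theta> * norm (B *v y)" using cos by (simp add: w_def)
    also have "\<dots> \<le> 1 / cos \<theta> * (onorm ((*v) B) * norm y)"
      using cos by (intro mult_mono divide_right_mono onorm matrix_vector_mul_bounded_linear) auto
    also have "\<dots> \<le> 1 / cos \<theta> * (onorm ((*v) B) * (\<Sum>l\<in>UNIV. \<bar>y $ l\<bar>))"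
      using cos by (intro mult_left_mono norm_le_l1_cart onorm_pos_le matrix_vector_mul_bounded_linear) auto
    finally show ?thesis .
  qed
  finally show ?thesis by (simp add: ac_simps)
qed

end

text \<open>Third partial derivatives bounded by 1 make each Hessian entry Lipschitz for the sum
  norm, by the mean value theorem on a segment.\<close>

lemma H3_regular:
  assumes "h \<in> H3" shows "regular 1 A h"
proof -
  have C3: "C_k 3 h" and n2: "deriv_norm 2 h \<le> 1" and n3: "deriv_norm 3 h \<le> 1"
    using assms by (auto simp: H3_def)
  have bd: "\<bar>foldr partial_deriv is h x\<bar> \<le> 1" if "deriv_norm k h \<le> 1" "length is = k" for k "is" x
  proof -
    have "ennreal \<bar>foldr partial_deriv is h x\<bar> \<le> (SUP x. ennreal \<bar>foldr partial_deriv is h x\<bar>)"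
      by (rule SUP_upper) simp
    also have "\<dots> \<le> deriv_norm k h" unfolding deriv_norm_def using that by (intro SUP_upper) simp
    also have "\<dots> \<le> 1" by fact
    finally show ?thesis by (simp add: ennreal_le_1)
  qed
  have b2: "\<bar>partial_deriv r (partial_deriv i h) x\<bar> \<le> 1" for r i x
    using bd[OF n2, of "[r, i]"] by simp
  have b3: "\<bar>partial_deriv l (partial_deriv r (partial_deriv i h)) x\<bar> \<le> 1" for l r i x
    using bd[OF n3, of "[l, r, i]"] by simp
  have d3: "partial_deriv r (partial_deriv i h) differentiable_on UNIV" for r i
    using C3 by (simp add: numeral_3_eq_3)
  have C2: "C_k 2 h" using C3 by (auto simp: numeral_3_eq_3 numeral_2_eq_2 intro: differentiable_imp_continuous_on)
  interpret interpolation h "\<lambda>i. partial_deriv i h" "\<lambda>i r. partial_deriv r (partial_deriv i h)" A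
    using test_function_C2[OF C2 b2] by (simp add: interpolation_def)
  have lip: "\<bar>partial_deriv r (partial_deriv i h) (x + y) - partial_deriv r (partial_deriv i h) x\<bar> \<le> (\<Sum>l\<in>UNIV. \<bar>y $ l\<bar>)" for i r x y
  proof -
    let ?g = "partial_deriv r (partial_deriv i h)"
    have "((\<lambda>t. ?g (x + t *\<^sub>R y)) has_real_derivative (\<Sum>l\<in>UNIV. y $ l * partial_deriv l ?g (x + t *\<^sub>R y))) (at t)" for t
    proof -
      have "((\<lambda>t. x + t *\<^sub>R y) has_derivative (\<lambda>s. s *\<^sub>R y)) (at t)" by (auto intro!: derivative_eq_intros)
      from has_derivative_compose[OF this partial_deriv_has_derivative[OF d3, of _ _ "x + t *\<^sub>R y"]]
      show ?thesis unfolding has_field_derivative_def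
        by (rule has_derivative_eq_rhs) (auto simp: sum_distrib_left mult_ac intro!: ext)
    qed
    then obtain \<xi> where "?g (x + 1 *\<^sub>R y) - ?g (x + 0 *\<^sub>R y) = (1 - 0) * (\<Sum>l\<in>UNIV. y $ l * partial_deriv l ?g (x + \<xi> *\<^sub>R y))"
      using MVT2[of 0 1 "\<lambda>t. ?g (x + t *\<^sub>R y)" "\<lambda>t. \<Sum>l\<in>UNIV. y $ l * partial_deriv l ?g (x + t *\<^sub>R y)"] by force
    then have "\<bar>?g (x + y) - ?g x\<bar> = \<bar>\<Sum>l\<in>UNIV. y $ l * partial_deriv l ?g (x + \<xi> *\<^sub>R y)\<bar>" by simp
    also have "\<dots> \<le> (\<Sum>l\<in>UNIV. \<bar>y $ l\<bar>)"
      by (rule order.trans[OF sum_abs]) (intro sum_mono, simp add: abs_mult mult_left_le b3)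
    finally show ?thesis .
  qed
  show ?thesis unfolding regular_def using test_function_axioms H_modulus_Lipschitz[OF lip] by blast
qed

text \<open>An entry of the Hessian is a component of its action on a unit vector, hence bounded by
  the operator norm. The smoothing by the Gaussian vector takes the place of a third derivative;
  this is where the factor \<open>A\<close> has to be invertible.\<close>

lemma H2_regular:
  assumes "h \<in> H2" and B: "A ** B = mat 1" shows "regular (2 * onorm ((*v) B)) A h"
proof -
  have C2: "C_k 2 h" and on: "\<And>x. onorm (\<lambda>v. hessian h x *v v) \<le> 1"
    using assms by (auto simp: H2_def)
  have b2: "\<bar>partial_deriv r (partial_deriv i h) x\<bar> \<le> 1" for r i x
  proof -
    have "\<bar>partial_deriv r (partial_deriv i h) x\<bar> = \<bar>(hessian h x *v axis i 1) $ r\<bar>"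
      by (simp add: matrix_vector_mult_basis column_def hessian_def)
    also have "\<dots> \<le> norm (hessian h x *v axis i 1)" by (rule component_le_norm_cart)
    also have "\<dots> \<le> onorm ((*v) (hessian h x)) * norm (axis i (1::real))"
      by (rule onorm) (rule matrix_vector_mul_bounded_linear)
    also have "\<dots> \<le> 1" using on[of x] by simp
    finally show ?thesis .
  qed
  interpret interpolation h "\<lambda>i. partial_deriv i h" "\<lambda>i r. partial_deriv r (partial_deriv i h)" A
    using test_function_C2[OF C2 b2] by (simp add: interpolation_def)
  show ?thesis unfolding regular_def using test_function_axioms H_modulus_shift[OF B] by blast
qed

text \<open>A vector in the kernel of the transpose of \<open>A\<close> is isotropic for
  \<open>C\<close>, hence 0. Transposing the resulting left inverse gives a right inverse of
  \<open>A\<close>.\<close>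

lemma positive_definite_factor_invertible:
  fixes A C :: "real ^ 'm::finite ^ 'm"
  assumes pd: "positive_definite C" and C: "\<And>i j. C $ i $ j = (\<Sum>p\<in>UNIV. A $ i $ p * A $ j $ p)"
  obtains B where "A ** B = mat 1"
proof -
  have CA: "C = A ** transpose A"
    by (simp add: vec_eq_iff matrix_matrix_mult_def transpose_def C)
  have "inj ((*v) (transpose A))"
  proof (rule linear_injective_0[OF matrix_vector_mul_linear, THEN iffD2], intro allI impI, rule ccontr)
    fix u assume u: "transpose A *v u = 0" "u \<noteq> 0"
    have "C *v u = A *v (transpose A *v u)" by (simp only: CA matrix_vector_mul_assoc)
    then have "u \<bullet> (C *v u) = 0" using u by simp
    moreover have "0 < u \<bullet> (C *v u)" using pd u by (simp add: positive_definite_def)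
    ultimately show False by simp
  qed
  then obtain B where "B ** transpose A = mat 1"
    using matrix_left_invertible_injective[of "transpose A"] by auto
  then have "transpose (B ** transpose A) = mat 1" by simp
  then have "A ** transpose B = mat 1" by (simp add: matrix_transpose_mul)
  then show ?thesis using that by blast
qed

text \<open>Along the path, the integrand in \<open>interpolation_bound\<close> is the quantity that
  \<open>stein_bound\<close> estimates with \<kappa> = sin \<theta>. The modulus of order q that
  both steps require comes from interpolating the Lipschitz bound of \<open>regular\<close> with
  boundedness.\<close>

lemma (in poisson_kernel) normal_approximation:
  fixes A C :: "real ^ 'm ^ 'm"
  assumes reg: "regular c A h" and C: "\<And>i j. C $ i $ j = (\<Sum>p\<in>UNIV. A $ i $ p * A $ j $ p)"
    and q: "0 < q" "q \<le> 1" and c: "0 \<le> c"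
  shows "\<bar>E (\<lambda>N. h (V N)) - (\<integral>z. h (A *v z) \<partial>gauss)\<bar>
    \<le> pi / 2 * ((\<Sum>i\<in>UNIV. \<Sum>r\<in>UNIV. E (\<lambda>N. \<bar>\<Gamma> i r N - \<gamma> i r\<bar>) + \<bar>\<gamma> i r - C $ i $ r\<bar>)
        + c powr q * (\<Sum>j\<in>J. l j * E (\<lambda>N. ((\<Sum>i\<in>UNIV. S i j N) + (\<Sum>i\<in>UNIV. m i j)) * (\<Sum>i\<in>UNIV. S i j N) powr (1 + q))))"
proof -
  obtain h1 h2 where "test_function h h1 h2"
    and mod: "\<And>\<theta> i r x y. 0 < \<theta> \<Longrightarrow> \<theta> < pi / 2 \<Longrightarrow>
        \<bar>interpolation.H h2 A \<theta> i r (x + y) - interpolation.H h2 A \<theta> i r x\<bar> \<le> c / cos \<theta> * (\<Sum>l\<in>UNIV. \<bar>y $ l\<bar>)"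
    using reg unfolding regular_def by blast
  then interpret I: interpolation h h1 h2 A by (simp add: interpolation_def)
  define G where "G = (\<Sum>i\<in>UNIV. \<Sum>r\<in>UNIV. E (\<lambda>N. \<bar>\<Gamma> i r N - \<gamma> i r\<bar>) + \<bar>\<gamma> i r - C $ i $ r\<bar>)"
  define R where "R = (\<Sum>j\<in>J. l j * E (\<lambda>N. ((\<Sum>i\<in>UNIV. S i j N) + (\<Sum>i\<in>UNIV. m i j)) * (\<Sum>i\<in>UNIV. S i j N) powr (1 + q)))"
  have G0: "0 \<le> G" unfolding G_def by (intro sum_nonneg add_nonneg_nonneg Bochner_Integration.integral_nonneg) auto
  have R0: "0 \<le> R" unfolding R_def
    by (intro sum_nonneg mult_nonneg_nonneg rate_nonneg Bochner_Integration.integral_nonneg add_nonneg_nonneg S_nonneg m_nonneg) auto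
  have pV: "pbounded (\<lambda>N. \<Sum>r\<in>UNIV. \<bar>V N $ r\<bar>)" by (intro pbounded_intros pbounded_V)
  have intV: "integrable P (\<lambda>N. (1 + norm (V N))\<^sup>2)"
  proof (rule integrable_pbounded, rule pbounded_le)
    show "pbounded (\<lambda>N. (1 + (\<Sum>r\<in>UNIV. \<bar>V N $ r\<bar>))\<^sup>2)" by (intro pbounded_intros pV)
    show "\<bar>(1 + norm (V N))\<^sup>2\<bar> \<le> \<bar>(1 + (\<Sum>r\<in>UNIV. \<bar>V N $ r\<bar>))\<^sup>2\<bar>" for N
      using norm_le_l1_cart[of "V N"] by (simp add: power_mono)
  qed
  show ?thesis
    unfolding G_def[symmetric] R_def[symmetric]
  proof (rule I.interpolation_bound[OF C intV])
    fix \<theta> :: real assume \<theta>: "0 < \<theta>" "\<theta> < pi / 2"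
    have cos: "0 < cos \<theta>" "cos \<theta> \<le> 1" using cos_gt_zero[OF \<theta>] by auto
    have sin: "0 \<le> sin \<theta>" "sin \<theta> \<le> 1" using \<theta> by (auto intro: sin_ge_zero)
    \<comment> \<open>For s \<ge> 0 both bounds 2 and s together give at most 2 s powr q: the first
      is used for s \<ge> 1, the second for s < 1.\<close>
    define D where "D = 2 * (c / cos \<theta>) powr q"
    have D0: "0 \<le> D" by (simp add: D_def)
    have mod': "\<bar>I.H \<theta> i r (x + y) - I.H \<theta> i r x\<bar> \<le> D * (\<Sum>l\<in>UNIV. \<bar>y $ l\<bar>) powr q" for i r x y
    proof -
      define s where "s = c / cos \<theta> * (\<Sum>l\<in>UNIV. \<bar>y $ l\<bar>)"
      have s0: "0 \<le> s" unfolding s_def using c cos by (intro mult_nonneg_nonneg sum_nonneg) auto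
      have 1: "\<bar>I.H \<theta> i r (x + y) - I.H \<theta> i r x\<bar> \<le> s" unfolding s_def by (rule mod[OF \<theta>])
      have 2: "\<bar>I.H \<theta> i r (x + y) - I.H \<theta> i r x\<bar> \<le> 2" using I.H_le[of \<theta> i r x] I.H_le[of \<theta> i r "x + y"] by linarith
      have "\<bar>I.H \<theta> i r (x + y) - I.H \<theta> i r x\<bar> \<le> 2 * s powr q"
      proof (cases "1 \<le> s")
        case True
        then have "1 \<le> s powr q" using q by (simp add: ge_one_powr_ge_zero)
        then show ?thesis using 2 by linarith
      next
        case False
        have "s \<le> s powr q"
        proof (cases "s = 0")
          case False
          then have "s powr 1 \<le> s powr q" using q s0 \<open>\<not> 1 \<le> s\<close> by (intro powr_mono') auto
          then show ?thesis using s0 by simp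
        qed simp
        then show ?thesis using 1 s0 by linarith
      qed
      also have "s powr q = (c / cos \<theta>) powr q * (\<Sum>l\<in>UNIV. \<bar>y $ l\<bar>) powr q"
        unfolding s_def by (rule powr_mult)
      finally show ?thesis by (simp add: D_def)
    qed
    note taylor = I.K_taylor[OF less_imp_le[OF \<theta>(1)] less_imp_le[OF \<theta>(2)] q(1) D0 mod']
    note st = stein_bound[OF taylor I.H_le sin(1) D0 q, where C=C]
    have pH: "pbounded (\<lambda>N. I.H \<theta> i r (V N))" for i r
      by (rule pbounded_le[OF pbounded_const[of 1]]) (simp add: I.H_le)
    have pK: "pbounded (\<lambda>N. I.K \<theta> i (V N))" for i
    proof (rule pbounded_le)
      show "pbounded (\<lambda>N. \<bar>I.K \<theta> i 0\<bar> + sin \<theta> * (\<Sum>r\<in>UNIV. \<bar>V N $ r\<bar>) + sin \<theta> * D * (\<Sum>r\<in>UNIV. \<bar>V N $ r\<bar>) powr (1 + q))"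
        using q by (intro pbounded_add pbounded_mult pbounded_const pV pbounded_powr sum_nonneg) auto
      fix N
      have "\<bar>\<Sum>r\<in>UNIV. V N $ r * I.H \<theta> i r 0\<bar> \<le> (\<Sum>r\<in>UNIV. \<bar>V N $ r\<bar>)"
        by (rule order.trans[OF sum_abs]) (intro sum_mono, simp add: abs_mult mult_left_le I.H_le)
      then have "\<bar>sin \<theta> * (\<Sum>r\<in>UNIV. V N $ r * I.H \<theta> i r 0)\<bar> \<le> sin \<theta> * (\<Sum>r\<in>UNIV. \<bar>V N $ r\<bar>)"
        using sin by (simp add: abs_mult mult_left_mono)
      then show "\<bar>I.K \<theta> i (V N)\<bar> \<le> \<bar>\<bar>I.K \<theta> i 0\<bar> + sin \<theta> * (\<Sum>r\<in>UNIV. \<bar>V N $ r\<bar>) + sin \<theta> * D * (\<Sum>r\<in>UNIV. \<bar>V N $ r\<bar>) powr (1 + q)\<bar>"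
        using taylor[of i 0 "V N"] by simp
    qed
    have "E (\<lambda>N. (\<Sum>i\<in>UNIV. V N $ i * I.K \<theta> i (V N)) - sin \<theta> * (\<Sum>i\<in>UNIV. \<Sum>r\<in>UNIV. C $ i $ r * I.H \<theta> i r (V N)))
        = (\<Sum>i\<in>UNIV. E (\<lambda>N. V N $ i * I.K \<theta> i (V N))) - sin \<theta> * (\<Sum>i\<in>UNIV. \<Sum>r\<in>UNIV. C $ i $ r * E (\<lambda>N. I.H \<theta> i r (V N)))"
      by (simp add: E_diff E_sum pbounded_intros pbounded_V pK pH)
    then have "\<bar>E (\<lambda>N. (\<Sum>i\<in>UNIV. V N $ i * I.K \<theta> i (V N)) - sin \<theta> * (\<Sum>i\<in>UNIV. \<Sum>r\<in>UNIV. C $ i $ r * I.H \<theta> i r (V N)))\<bar>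
       \<le> sin \<theta> * (G + D / 2 * R)"
      using st unfolding G_def R_def by simp
    also have "\<dots> \<le> 1 * (G + D / 2 * R)" using sin G0 R0 D0 by (intro mult_right_mono) auto
    finally have "cos \<theta> * \<bar>E (\<lambda>N. (\<Sum>i\<in>UNIV. V N $ i * I.K \<theta> i (V N)) - sin \<theta> * (\<Sum>i\<in>UNIV. \<Sum>r\<in>UNIV. C $ i $ r * I.H \<theta> i r (V N)))\<bar>
        \<le> cos \<theta> * (G + D / 2 * R)" using cos by (intro mult_left_mono) auto
    also have "\<dots> = cos \<theta> * G + (cos \<theta> * (D / 2)) * R" by (simp add: algebra_simps)
    \<comment> \<open>Here the factor cos \<theta> of the derivative meets the blow-up of the
      modulus: cos \<theta> \<le> cos \<theta> powr q because q \<le> 1.\<close>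
    also have "cos \<theta> * (D / 2) \<le> c powr q"
    proof -
      have "cos \<theta> powr 1 \<le> cos \<theta> powr q" using cos q by (intro powr_mono') auto
      then have "cos \<theta> * c powr q \<le> cos \<theta> powr q * c powr q" using cos by (intro mult_right_mono) auto
      then have "cos \<theta> * (c powr q / cos \<theta> powr q) \<le> c powr q" using cos by (simp add: divide_simps mult.commute)
      then show ?thesis using c cos by (simp add: D_def powr_divide)
    qed
    also have "cos \<theta> * G \<le> 1 * G" using cos G0 by (intro mult_right_mono) auto
    finally show "cos \<theta> * \<bar>E (\<lambda>N. (\<Sum>i\<in>UNIV. V N $ i * I.K \<theta> i (V N)) - sin \<theta> * (\<Sum>i\<in>UNIV. \<Sum>r\<in>UNIV. C $ i $ r * I.H \<theta> i r (V N)))\<bar>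
        \<le> G + c powr q * R" using R0 by (simp add: mult_right_mono)
  qed
qed

section \<open>Radial integrals and inner parallel sets of convex bodies\<close>

text \<open>Polar coordinates without spheres: the image under the norm of Lebesgue measure on the
  ball is identified on half-lines from the ball volumes \<kappa> s^d, so it has density d \<kappa>
  s^(d - 1). A one-dimensional integral remains.\<close>

lemma nn_integral_radial_powr:
  fixes \<beta> r :: real
  assumes \<beta>: "- real DIM('a::euclidean_space) < \<beta>" and r: "0 < r"
  shows "(\<integral>\<^sup>+x. ennreal (if 0 < norm (x::'a) \<and> norm x < r then norm x powr \<beta> else 0) \<partial>lborel)
    = ennreal (DIM('a) * measure lborel (ball (0::'a) 1) / (DIM('a) + \<beta>) * r powr (DIM('a) + \<beta>))"
proof -
  define d where "d = DIM('a)"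
  define \<kappa> where "\<kappa> = measure lborel (ball (0::'a) 1)"
  have d: "0 < d" unfolding d_def by simp
  have \<kappa>0: "0 \<le> \<kappa>" unfolding \<kappa>_def by simp
  have em_ball: "emeasure lborel (ball (0::'a) s) = ennreal (\<kappa> * s ^ d)" if "0 \<le> s" for s
    unfolding \<kappa>_def d_def using emeasure_ball[OF that, of "0::'a"] by (simp add: content_ball)
  have em_cball: "emeasure lborel (cball (0::'a) s) = ennreal (\<kappa> * s ^ d)" if "0 \<le> s" for s
    unfolding \<kappa>_def d_def using emeasure_cball[OF that, of "0::'a"] by (simp add: content_ball)
  have [measurable]: "(indicator (ball 0 r) :: 'a \<Rightarrow> ennreal) \<in> borel_measurable borel"
    by (intro borel_measurable_indicator) simp
  define \<mu> where "\<mu> = distr (density lborel (indicator (ball (0::'a) r))) borel norm"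
  define \<nu> where "\<nu> = density lborel (\<lambda>s. ennreal (d * \<kappa> * s ^ (d - 1)) * indicator {0..r} s)"
  have "\<mu> = \<nu>"
  proof (rule measure_eqI_lessThan)
    have \<mu>: "emeasure \<mu> {x<..} = emeasure lborel (ball (0::'a) r \<inter> {y. x < norm y})" for x
    proof -
      have [measurable]: "{y::'a. x < norm y} \<in> sets borel" by measurable
      have "emeasure \<mu> {x<..} = emeasure (density lborel (indicator (ball (0::'a) r))) {y. x < norm y}"
        unfolding \<mu>_def by (subst emeasure_distr) (auto simp: vimage_def)
      also have "\<dots> = (\<integral>\<^sup>+y. indicator (ball 0 r \<inter> {y::'a. x < norm y}) y \<partial>lborel)"
      proof -
        have "emeasure (density lborel (indicator (ball (0::'a) r))) {y. x < norm y}
            = (\<integral>\<^sup>+y. indicator (ball 0 r) y * indicator {y::'a. x < norm y} y \<partial>lborel)"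
          by (rule emeasure_density) simp_all
        then show ?thesis by (simp only: indicator_inter_arith)
      qed
      also have "\<dots> = emeasure lborel (ball (0::'a) r \<inter> {y. x < norm y})"
        by (rule nn_integral_indicator) measurable
      finally show ?thesis .
    qed
    show "emeasure \<mu> {x<..} < \<infinity>" for x
    proof -
      have "emeasure \<mu> {x<..} \<le> emeasure lborel (ball (0::'a) r)" unfolding \<mu> by (intro emeasure_mono) auto
      also have "\<dots> < \<infinity>" using em_ball[of r] r by simp
      finally show ?thesis .
    qed
    fix x :: real
    define b where "b = max 0 x"
    have \<nu>: "emeasure \<nu> {x<..} = (\<integral>\<^sup>+s. ennreal (d * \<kappa> * s ^ (d - 1)) * indicator {b..r} s \<partial>lborel)"
    proof -
      have "emeasure \<nu> {x<..} = (\<integral>\<^sup>+s. ennreal (d * \<kappa> * s ^ (d - 1)) * indicator {0..r} s * indicator {x<..} s \<partial>lborel)"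
        unfolding \<nu>_def by (subst emeasure_density) auto
      also have "\<dots> = (\<integral>\<^sup>+s. ennreal (d * \<kappa> * s ^ (d - 1)) * indicator {b..r} s \<partial>lborel)"
        by (rule nn_integral_cong_AE, rule AE_mp[OF AE_lborel_singleton[of x]])
           (auto simp: indicator_def b_def max_def)
      finally show ?thesis .
    qed
    show "emeasure \<mu> {x<..} = emeasure \<nu> {x<..}"
    proof (cases "b < r")
      case False
      then have "ball (0::'a) r \<inter> {y. x < norm y} = {}" using r by (auto simp: b_def max_def split: if_splits)
      moreover have "emeasure \<nu> {x<..} = 0"
      proof -
        have "(\<integral>\<^sup>+s. ennreal (d * \<kappa> * s ^ (d - 1)) * indicator {b..r} s \<partial>lborel) = (\<integral>\<^sup>+s. 0 \<partial>(lborel :: real measure))"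
          by (rule nn_integral_cong_AE, rule AE_mp[OF AE_lborel_singleton[of r]], rule AE_I2)
             (use False in \<open>auto simp: indicator_def\<close>)
        then show ?thesis unfolding \<nu> by simp
      qed
      ultimately show ?thesis unfolding \<mu> by simp
    next
      case True
      have b0: "0 \<le> b" by (simp add: b_def)
      have "emeasure \<nu> {x<..} = ennreal (\<kappa> * r ^ d - \<kappa> * b ^ d)"
        unfolding \<nu>
      proof (rule nn_integral_FTC_Icc)
        fix s assume s: "s \<in> {b..r}"
        show "((\<lambda>s. \<kappa> * s ^ d) has_real_derivative d * \<kappa> * s ^ (d - 1)) (at s)"
          by (auto intro!: derivative_eq_intros)
        show "0 \<le> d * \<kappa> * s ^ (d - 1)" using \<kappa>0 b0 s by simp
      qed (use True in auto)
      also have "\<dots> = emeasure lborel (ball (0::'a) r) - emeasure lborel (if x < 0 then {} else cball (0::'a) x)"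
        using em_ball[of r] em_cball[of x] r d \<kappa>0 by (auto simp: b_def max_def ennreal_minus power_0_left)
      also have "\<dots> = emeasure lborel (ball (0::'a) r - (if x < 0 then {} else cball (0::'a) x))"
        using True em_cball[of x] by (intro emeasure_Diff[symmetric]) (auto simp: b_def max_def split: if_splits)
      also have "ball (0::'a) r - (if x < 0 then {} else cball (0::'a) x) = ball 0 r \<inter> {y. x < norm y}"
        by (auto intro: less_le_trans[OF _ norm_ge_zero])
      finally show ?thesis unfolding \<mu> by simp
    qed
  qed (auto simp: \<mu>_def \<nu>_def)
  have "(\<integral>\<^sup>+x. ennreal (if 0 < norm (x::'a) \<and> norm x < r then norm x powr \<beta> else 0) \<partial>lborel)
      = (\<integral>\<^sup>+x. indicator (ball (0::'a) r) x * ennreal (norm x powr \<beta>) \<partial>lborel)"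
    by (intro nn_integral_cong) (auto simp: indicator_def)
  also have "\<dots> = (\<integral>\<^sup>+s. ennreal (s powr \<beta>) \<partial>\<mu>)"
    unfolding \<mu>_def by (subst nn_integral_distr, simp, simp, subst nn_integral_density) auto
  also have "\<dots> = (\<integral>\<^sup>+s. ennreal (d * \<kappa> * s ^ (d - 1)) * indicator {0..r} s * ennreal (s powr \<beta>) \<partial>lborel)"
    unfolding \<open>\<mu> = \<nu>\<close> \<nu>_def by (subst nn_integral_density) auto
  also have "\<dots> = (\<integral>\<^sup>+s. ennreal (d * \<kappa> * (if s \<in> {0..r} then s powr (\<beta> + d - 1) else 0)) \<partial>lborel)"
  proof (rule nn_integral_cong_AE, rule AE_mp[OF AE_lborel_singleton[of 0]], rule AE_I2, rule impI)
    fix s :: real assume s: "s \<noteq> 0"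
    show "ennreal (d * \<kappa> * s ^ (d - 1)) * indicator {0..r} s * ennreal (s powr \<beta>) = ennreal (d * \<kappa> * (if s \<in> {0..r} then s powr (\<beta> + d - 1) else 0))"
    proof (cases "s \<in> {0..r}")
      case True
      then have "0 < s" using s by simp
      then have "s ^ (d - 1) * s powr \<beta> = s powr (\<beta> + d - 1)"
        using d by (simp add: powr_realpow[symmetric] powr_add[symmetric] of_nat_diff algebra_simps)
      then show ?thesis using True \<kappa>0 s by (simp add: ennreal_mult'[symmetric] mult.assoc)
    next
      case False
      then show ?thesis by (auto simp: indicator_def)
    qed
  qed
  also have "\<dots> = ennreal (d * \<kappa> * (r powr (\<beta> + d - 1 + 1) / (\<beta> + d - 1 + 1)))"
  proof (rule nn_integral_has_integral_lborel)
    have "((\<lambda>s. s powr (\<beta> + d - 1)) has_integral (r powr (\<beta> + d - 1 + 1) / (\<beta> + d - 1 + 1))) {0..r}"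
      using \<beta> r by (intro has_integral_powr_from_0) (auto simp: d_def)
    then have "((\<lambda>s. if s \<in> {0..r} then s powr (\<beta> + d - 1) else 0) has_integral (r powr (\<beta> + d - 1 + 1) / (\<beta> + d - 1 + 1))) UNIV"
      by (subst has_integral_restrict_UNIV)
    then show "((\<lambda>s. d * \<kappa> * (if s \<in> {0..r} then s powr (\<beta> + d - 1) else 0)) has_integral (d * \<kappa> * (r powr (\<beta> + d - 1 + 1) / (\<beta> + d - 1 + 1)))) UNIV"
      by (rule has_integral_mult_right)
  qed (use \<kappa>0 in auto)
  finally show ?thesis unfolding d_def \<kappa>_def by (simp add: ac_simps)
qed

text \<open>The inner set is \<open>K\<close> contracted by 1 - s towards the centre z of an
  inscribed ball of radius \<rho>, with s = e / \<rho>. Convexity gives each contracted point a ball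
  of radius e inside \<open>K\<close>; the proportion of volume lost is 1 - (1 - s)^d \<le> d s, by
  Bernoulli's inequality.\<close>

lemma inner_parallel_convex:
  fixes K :: "'a::euclidean_space set"
  assumes K: "compact K" "convex K" "interior K \<noteq> {}"
  obtains c r0 where "0 \<le> c" "0 < r0"
    "\<And>e. 0 < e \<Longrightarrow> e < r0 \<Longrightarrow> \<exists>G\<in>sets lborel. G \<subseteq> K \<and> (\<forall>x\<in>G. ball x e \<subseteq> K) \<and> measure lborel (K - G) \<le> c * e"
proof -
  obtain z \<rho> where \<rho>: "0 < \<rho>" "cball z \<rho> \<subseteq> K"
    using K(3) mem_interior_cball by blast
  define v where "v = measure lborel K"
  have v: "0 \<le> v" by (simp add: v_def)
  have Kb: "K \<in> sets borel" using K(1) by (simp add: compact_imp_closed)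
  show ?thesis
  proof (rule that[of "DIM('a) * v / \<rho>" \<rho>])
    fix e :: real assume e: "0 < e" "e < \<rho>"
    define s where "s = e / \<rho>"
    have s: "0 < s" "s < 1" using e by (auto simp: s_def)
    define G where "G = (\<lambda>y. (1 - s) *\<^sub>R y + s *\<^sub>R z) ` K"
    have G_compact: "compact G" unfolding G_def using K(1) by (intro compact_continuous_image continuous_intros)
    have ball: "ball x e \<subseteq> K" if "x \<in> G" for x
    proof
      fix w assume w: "w \<in> ball x e"
      obtain y where y: "y \<in> K" "x = (1 - s) *\<^sub>R y + s *\<^sub>R z" using \<open>x \<in> G\<close> by (auto simp: G_def)
      \<comment> \<open>The point of the inscribed ball that represents w as (1 - s) y + s
        u.\<close>
      define u where "u = z + (1 / s) *\<^sub>R (w - x)"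
      have "dist z u = norm (w - x) / s" using s by (simp add: u_def dist_norm)
      also have "\<dots> \<le> e / s" using w s by (intro divide_right_mono) (auto simp: dist_norm norm_minus_commute)
      also have "\<dots> = \<rho>" using e \<rho> by (simp add: s_def)
      finally have "u \<in> K" using \<rho> by auto
      then have "(1 - s) *\<^sub>R y + s *\<^sub>R u \<in> K" using y s K(2) by (intro convexD) auto
      moreover have "(1 - s) *\<^sub>R y + s *\<^sub>R u = w"
      proof -
        have "s *\<^sub>R u = s *\<^sub>R z + (w - x)" using s by (simp add: u_def scaleR_add_right)
        then show ?thesis by (simp add: y(2))
      qed
      ultimately show "w \<in> K" by simp
    qed
    have GK: "G \<subseteq> K" using ball e by (metis centre_in_ball subset_iff)
    have "measure lebesgue G = \<bar>1 - s\<bar> ^ DIM('a) * measure lebesgue K"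
      using measure_lebesgue_affine[of "1 - s" "s *\<^sub>R z" K] by (simp add: G_def)
    then have mG: "measure lborel G = (1 - s) ^ DIM('a) * v"
      using s Kb G_compact by (simp add: v_def measure_completion compact_imp_closed)
    have "measure lborel (K - G) = v - measure lborel G"
      unfolding v_def using Kb G_compact GK K(1)
      by (intro measure_Diff) (use emeasure_compact_finite[OF K(1)] in \<open>auto simp: compact_imp_closed\<close>)
    also have "\<dots> \<le> v - (1 - DIM('a) * s) * v"
      unfolding mG using Bernoulli_inequality[of "- s" "DIM('a)"] s v by (intro diff_left_mono mult_right_mono) auto
    also have "\<dots> = DIM('a) * v / \<rho> * e" using \<rho> by (simp add: s_def algebra_simps)
    finally have "measure lborel (K - G) \<le> DIM('a) * v / \<rho> * e" .
    then show "\<exists>G\<in>sets lborel. G \<subseteq> K \<and> (\<forall>x\<in>G. ball x e \<subseteq> K) \<and> measure lborel (K - G) \<le> DIM('a) * v / \<rho> * e"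
      using GK ball G_compact by (intro bexI[of _ G]) (auto simp: compact_imp_closed)
  qed (use \<rho> v in auto)
qed

section \<open>Point configurations are sums of point masses\<close>

lemma point_configuration_finite:
  assumes "point_configuration \<mu>" "bounded B" "B \<in> sets borel"
  shows "emeasure \<mu> B < \<infinity>" "\<exists>k::nat. emeasure \<mu> B = of_nat k"
  using assms unfolding point_configuration_def by (auto simp: less_top[symmetric])

text \<open>Masses are natural numbers: the mass of \<open>B\<close> in shrinking balls around a
  point tends to 0, hence drops below 1 and is then equal to 0. Compactness of the closure makes the
  local statement global.\<close>

lemma point_configuration_diffuse_part:
  fixes \<mu> :: "'a::euclidean_space measure"
  assumes \<mu>: "point_configuration \<mu>" and B: "bounded B" "B \<in> sets borel" and no: "\<And>x. x \<in> B \<Longrightarrow> emeasure \<mu> {x} = 0"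
  shows "emeasure \<mu> B = 0"
proof -
  have sets: "sets \<mu> = sets borel" using \<mu> by (simp add: point_configuration_def)
  have local: "\<exists>r>0. emeasure \<mu> (B \<inter> ball x r) = 0" for x
  proof -
    have "(\<lambda>n. emeasure \<mu> (B \<inter> ball x (1 / Suc n))) \<longlonglongrightarrow> emeasure \<mu> (\<Inter>n. B \<inter> ball x (1 / Suc n))"
    proof (rule Lim_emeasure_decseq)
      show "range (\<lambda>n. B \<inter> ball x (1 / Suc n)) \<subseteq> sets \<mu>" using B by (auto simp: sets)
      show "decseq (\<lambda>n. B \<inter> ball x (1 / Suc n))"
      proof (rule decseq_SucI)
        fix n
        have "1 / real (Suc (Suc n)) \<le> 1 / real (Suc n)" by (simp add: field_simps)
        then show "B \<inter> ball x (1 / real (Suc (Suc n))) \<subseteq> B \<inter> ball x (1 / real (Suc n))"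
          using subset_ball by blast
      qed
      show "emeasure \<mu> (B \<inter> ball x (1 / Suc n)) \<noteq> \<infinity>" for n
        using point_configuration_finite[OF \<mu>, of "B \<inter> ball x (1 / Suc n)"] B by (auto simp: bounded_Int)
    qed
    moreover have "emeasure \<mu> (\<Inter>n. B \<inter> ball x (1 / Suc n)) = 0"
    proof -
      have "(\<Inter>n. B \<inter> ball x (1 / Suc n)) \<subseteq> B \<inter> {x}"
      proof
        fix y assume y: "y \<in> (\<Inter>n. B \<inter> ball x (1 / Suc n))"
        have "dist x y \<le> 0"
        proof (rule ccontr)
          assume "\<not> dist x y \<le> 0"
          then obtain n where "1 / real (Suc n) < dist x y" using nat_approx_posE[of "dist x y"] by auto
          moreover have "y \<in> ball x (1 / Suc n)" using y by blast
          ultimately show False by simp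
        qed
        then show "y \<in> B \<inter> {x}" using y by auto
      qed
      then have "emeasure \<mu> (\<Inter>n. B \<inter> ball x (1 / Suc n)) \<le> emeasure \<mu> (B \<inter> {x})"
        using B by (intro emeasure_mono) (auto simp: sets)
      also have "emeasure \<mu> (B \<inter> {x}) = 0" using no[of x] by (cases "x \<in> B") auto
      finally show ?thesis by simp
    qed
    ultimately have "(\<lambda>n. emeasure \<mu> (B \<inter> ball x (1 / Suc n))) \<longlonglongrightarrow> 0" by simp
    then have "\<forall>\<^sub>F n in sequentially. emeasure \<mu> (B \<inter> ball x (1 / Suc n)) < 1" by (rule order_tendstoD) simp
    then obtain n where n: "emeasure \<mu> (B \<inter> ball x (1 / Suc n)) < 1" unfolding eventually_sequentially by blast
    obtain k :: nat where k: "emeasure \<mu> (B \<inter> ball x (1 / Suc n)) = of_nat k"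
      using point_configuration_finite(2)[OF \<mu>, of "B \<inter> ball x (1 / Suc n)"] B by (auto simp: bounded_Int)
    have "\<not> of_nat 1 \<le> (of_nat k :: ennreal)" using n k by (simp add: not_le)
    then have "k = 0" unfolding of_nat_le_iff by simp
    then show ?thesis using k by (intro exI[of _ "1 / Suc n"]) auto
  qed
  then obtain r where r: "\<And>x. 0 < r x" "\<And>x. emeasure \<mu> (B \<inter> ball x (r x)) = 0" by metis
  have c: "compact (closure B)" using B by simp
  have cover: "closure B \<subseteq> (\<Union>x\<in>UNIV. ball x (r x))"
  proof
    fix x show "x \<in> (\<Union>x\<in>UNIV. ball x (r x))" using r(1)[of x] by (intro UN_I[of x]) auto
  qed
  obtain D where D: "finite D" "closure B \<subseteq> (\<Union>x\<in>D. ball x (r x))"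
    by (rule compactE_image[OF c _ cover]) auto
  have "B \<subseteq> (\<Union>x\<in>D. B \<inter> ball x (r x))" using D(2) closure_subset[of B] by auto
  then have "emeasure \<mu> B \<le> emeasure \<mu> (\<Union>x\<in>D. B \<inter> ball x (r x))"
    using B D by (intro emeasure_mono) (auto simp: sets intro!: sets.finite_UN)
  also have "\<dots> \<le> (\<Sum>x\<in>D. emeasure \<mu> (B \<inter> ball x (r x)))"
    using B D by (intro emeasure_subadditive_finite) (auto simp: sets)
  finally show ?thesis using r(2) by simp
qed

text \<open>Every atom has mass at least 1, while \<open>B\<close> has finite mass.\<close>

lemma finite_points:
  fixes \<mu> :: "'a::euclidean_space measure"
  assumes \<mu>: "point_configuration \<mu>" and B: "bounded B" "B \<in> sets borel"
  shows "finite (points \<mu> \<inter> B)"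
proof (rule ccontr)
  assume inf: "infinite (points \<mu> \<inter> B)"
  have sets: "sets \<mu> = sets borel" using \<mu> by (simp add: point_configuration_def)
  obtain k :: nat where k: "emeasure \<mu> B = of_nat k" using point_configuration_finite(2)[OF \<mu> B] by blast
  obtain D where D: "D \<subseteq> points \<mu> \<inter> B" "finite D" "card D = Suc k"
    using infinite_arbitrarily_large[OF inf] by blast
  have "of_nat (Suc k) = (\<Sum>x\<in>D. 1 :: ennreal)" using D by simp
  also have "\<dots> \<le> (\<Sum>x\<in>D. emeasure \<mu> {x})"
  proof (intro sum_mono)
    fix x assume "x \<in> D"
    then have nz: "emeasure \<mu> {x} \<noteq> 0" using D by (auto simp: points_def)
    obtain n :: nat where "emeasure \<mu> {x} = of_nat n" using point_configuration_finite(2)[OF \<mu>, of "{x}"] by auto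
    moreover from this have "of_nat 1 \<le> (of_nat n :: ennreal)" using nz unfolding of_nat_le_iff by (cases n) auto
    ultimately show "1 \<le> emeasure \<mu> {x}" by simp
  qed
  also have "\<dots> = emeasure \<mu> D" using D by (subst emeasure_eq_sum_singleton) (auto simp: sets)
  also have "\<dots> \<le> emeasure \<mu> B" using D B by (intro emeasure_mono) (auto simp: sets)
  finally show False unfolding k of_nat_le_iff by simp
qed

lemma nn_integral_point_configuration:
  fixes \<mu> :: "'a::euclidean_space measure"
  assumes \<mu>: "point_configuration \<mu>" and B: "bounded B" "B \<in> sets borel"
    and g: "g \<in> borel_measurable borel"
  shows "(\<integral>\<^sup>+x\<in>B. g x \<partial>\<mu>) = (\<Sum>x\<in>points \<mu> \<inter> B. emeasure \<mu> {x} * g x)"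
proof -
  have sets [measurable_cong]: "sets \<mu> = sets borel" using \<mu> by (simp add: point_configuration_def)
  note [measurable] = g B(2)
  define D where "D = points \<mu> \<inter> B"
  have D: "finite D" unfolding D_def by (rule finite_points[OF \<mu> B])
  then have Db [measurable]: "D \<in> sets borel" by (simp add: finite_imp_closed)
  have "emeasure \<mu> (B - D) = 0"
  proof (rule point_configuration_diffuse_part[OF \<mu>])
    show "bounded (B - D)" by (rule bounded_subset[OF B(1)]) blast
    show "B - D \<in> sets borel" by simp
    show "emeasure \<mu> {x} = 0" if "x \<in> B - D" for x using that by (auto simp: D_def points_def)
  qed
  then have "B - D \<in> null_sets \<mu>" by (simp add: null_sets_def sets B(2) Db)
  then have "AE x in \<mu>. x \<notin> B - D" by (rule AE_not_in)
  then have "(\<integral>\<^sup>+x\<in>B. g x \<partial>\<mu>) = (\<integral>\<^sup>+x. (\<Sum>y\<in>D. g y * indicator {y} x) \<partial>\<mu>)"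
  proof (intro nn_integral_cong_AE, eventually_elim)
    fix x assume "x \<notin> B - D"
    moreover have "(\<Sum>y\<in>D. g y * indicator {y} x) = (\<Sum>y\<in>D. if y = x then g x else 0)"
      by (intro sum.cong) (auto simp: indicator_def)
    ultimately have "(\<Sum>y\<in>D. g y * indicator {y} x) = (if x \<in> D then g x else 0)"
      using D by simp
    moreover have "x \<in> D \<longleftrightarrow> x \<in> B" using \<open>x \<notin> B - D\<close> by (auto simp: D_def)
    ultimately show "g x * indicator B x = (\<Sum>y\<in>D. g y * indicator {y} x)"
      by (simp add: indicator_def)
  qed
  also have "\<dots> = (\<Sum>y\<in>D. emeasure \<mu> {y} * g y)"
  proof -
    have "(\<integral>\<^sup>+x. g y * indicator {y} x \<partial>\<mu>) = emeasure \<mu> {y} * g y" for y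
      by (subst nn_integral_cmult_indicator) (simp_all add: sets mult.commute)
    then show ?thesis by (subst nn_integral_sum) simp_all
  qed
  finally show ?thesis by (simp add: D_def)
qed

section \<open>Discretisation\<close>

locale cell_partition =
  fixes W :: "'m::finite \<Rightarrow> 'a::euclidean_space set"
  assumes bounded_W: "\<And>i. bounded (W i)" and borel_W: "\<And>i. W i \<in> sets borel"
    and nonempty_W: "\<And>i. W i \<noteq> {}"
begin

definition U :: "'a set" where "U = (\<Union>i. W i)"

text \<open>Dyadic cubes cut along the membership pattern in the sets \<open>W i\<close>. Thus all
  indicators of the \<open>W i\<close> are constant on each cell, and their boundaries do not
  disturb the approximation.\<close>

definition cell :: "nat \<Rightarrow> 'a \<Rightarrow> 'a set" where
  "cell n x = {y. (\<forall>b\<in>Basis. \<lfloor>2 ^ n * (y \<bullet> b)\<rfloor> = \<lfloor>2 ^ n * (x \<bullet> b)\<rfloor>) \<and> (\<forall>i. y \<in> W i \<longleftrightarrow> x \<in> W i)}"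

definition cells :: "nat \<Rightarrow> 'a set set" where "cells n = cell n ` U"

lemma bounded_U: "bounded U" and borel_U [measurable]: "U \<in> sets borel" and nonempty_U: "U \<noteq> {}"
  unfolding U_def using bounded_W borel_W nonempty_W by auto

lemma cell_refl: "x \<in> cell n x" by (simp add: cell_def)

lemma cell_eq_iff: "cell n x = cell n y \<longleftrightarrow> x \<in> cell n y"
  unfolding cell_def by (auto simp: set_eq_iff)

lemma cell_subset_U: "x \<in> U \<Longrightarrow> cell n x \<subseteq> U"
  unfolding cell_def U_def by auto

lemma cell_borel [measurable]: "cell n x \<in> sets borel"
proof -
  have 1: "{y. \<lfloor>2 ^ n * (y \<bullet> b)\<rfloor> = k} \<in> sets borel" for b :: 'a and k
  proof -
    have "{y. \<lfloor>2 ^ n * (y \<bullet> b)\<rfloor> = k} = {y. real_of_int k \<le> 2 ^ n * (y \<bullet> b)} \<inter> {y. 2 ^ n * (y \<bullet> b) < real_of_int k + 1}"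
      by (auto simp: floor_eq_iff)
    also have "\<dots> \<in> sets borel"
      by (intro sets.Int borel_closed borel_open closed_Collect_le open_Collect_less continuous_intros)
    finally show ?thesis .
  qed
  have 2: "{y. y \<in> W i \<longleftrightarrow> c} \<in> sets borel" for i c
    using borel_W[of i] by (cases c) (auto simp: Collect_neg_eq)
  have "cell n x = (\<Inter>b\<in>Basis. {y. \<lfloor>2 ^ n * (y \<bullet> b)\<rfloor> = \<lfloor>2 ^ n * (x \<bullet> b)\<rfloor>}) \<inter> (\<Inter>i. {y. y \<in> W i \<longleftrightarrow> x \<in> W i})"
    unfolding cell_def by blast
  also have "\<dots> \<in> sets borel"
    by (intro sets.Int sets.finite_INT 1 2) auto
  finally show ?thesis .
qed

lemma cellsE:
  assumes "A \<in> cells n" obtains x where "x \<in> U" "A = cell n x"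
  using assms unfolding cells_def by blast

lemma cells_borel: "A \<in> cells n \<Longrightarrow> A \<in> sets borel"
  by (erule cellsE) (simp add: cell_borel)

lemma cells_nonempty: "A \<in> cells n \<Longrightarrow> A \<noteq> {}"
  by (erule cellsE) (use cell_refl in blast)

lemma cells_subset_U: "A \<in> cells n \<Longrightarrow> A \<subseteq> U"
  by (erule cellsE) (simp add: cell_subset_U)

lemma cells_bounded: "A \<in> cells n \<Longrightarrow> bounded A"
  by (rule bounded_subset[OF bounded_U cells_subset_U])

lemma in_cells_iff:
  assumes "A \<in> cells n" shows "x \<in> A \<longleftrightarrow> x \<in> U \<and> cell n x = A"
proof -
  obtain y where y: "A = cell n y" using assms by (rule cellsE)
  show ?thesis using cell_eq_iff[of n x y] cells_subset_U[OF assms] cell_refl[of x n] unfolding y by blast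
qed

lemma cells_disjoint: "disjoint (cells n)"
  unfolding disjoint_def using in_cells_iff by blast

text \<open>A cell is determined by the floors and the membership pattern of any of its points, and
  on a bounded set only finitely many such codes occur.\<close>

lemma finite_cells: "finite (cells n)"
proof -
  obtain B where B: "\<And>x. x \<in> U \<Longrightarrow> norm x \<le> B" using bounded_U unfolding bounded_iff by blast
  define code where "code x = (restrict (\<lambda>b. \<lfloor>2 ^ n * (x \<bullet> b)\<rfloor>) Basis, {i. x \<in> W i})" for x
  define K where "K = \<lceil>2 ^ n * B\<rceil> + 1"
  have "code ` U \<subseteq> (\<Pi>\<^sub>E b\<in>Basis. {- K..K}) \<times> UNIV"
  proof -
    have "\<lfloor>2 ^ n * (x \<bullet> b)\<rfloor> \<in> {- K..K}" if "x \<in> U" "b \<in> Basis" for x b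
    proof -
      have "\<bar>x \<bullet> b\<bar> \<le> B" using B[OF that(1)] Basis_le_norm[OF that(2), of x] by linarith
      then have "\<bar>2 ^ n * (x \<bullet> b)\<bar> \<le> 2 ^ n * B" by (simp add: abs_mult)
      then have "- (2 ^ n * B) \<le> 2 ^ n * (x \<bullet> b)" "2 ^ n * (x \<bullet> b) \<le> 2 ^ n * B" by (simp_all only: abs_le_iff) linarith
      then show ?thesis unfolding K_def atLeastAtMost_iff by linarith
    qed
    then show ?thesis by (auto simp: code_def)
  qed
  then have "finite (code ` U)" by (rule finite_subset) (auto intro!: finite_PiE)
  moreover have "cell n x = {y. code y = code x}" for x
  proof -
    have "code y = code x \<longleftrightarrow> (\<forall>b\<in>Basis. \<lfloor>2 ^ n * (y \<bullet> b)\<rfloor> = \<lfloor>2 ^ n * (x \<bullet> b)\<rfloor>) \<and> (\<forall>i. y \<in> W i \<longleftrightarrow> x \<in> W i)" for y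
      unfolding code_def by (auto simp: fun_eq_iff restrict_def)
    then show ?thesis by (simp add: cell_def)
  qed
  then have "cells n = (\<lambda>c. {y. code y = c}) ` code ` U" by (simp add: cells_def image_image)
  ultimately show ?thesis by simp
qed

lemma cell_decseq: "cell (Suc n) x \<subseteq> cell n x"
proof
  fix y assume y: "y \<in> cell (Suc n) x"
  have "\<lfloor>2 ^ n * (y \<bullet> b)\<rfloor> = \<lfloor>2 ^ n * (x \<bullet> b)\<rfloor>" if "b \<in> Basis" for b
  proof -
    \<comment> \<open>The floor at level n is half of the floor at level n + 1, rounded down; so the
      dyadic cubes are nested.\<close>
    have *: "\<lfloor>2 ^ n * s\<rfloor> = \<lfloor>2 ^ Suc n * s\<rfloor> div 2" for s :: real
      using floor_divide_real_eq_div[of 2 "2 ^ Suc n * s"] by simp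
    show ?thesis using y that unfolding cell_def by (simp add: *)
  qed
  then show "y \<in> cell n x" using y unfolding cell_def by simp
qed

lemma cell_norm_le: "y \<in> cell n x \<Longrightarrow> norm (y - x) \<le> DIM('a) / 2 ^ n"
proof -
  assume y: "y \<in> cell n x"
  have "\<bar>(y - x) \<bullet> b\<bar> \<le> 1 / 2 ^ n" if "b \<in> Basis" for b
  proof -
    have "\<lfloor>2 ^ n * (y \<bullet> b)\<rfloor> = \<lfloor>2 ^ n * (x \<bullet> b)\<rfloor>" using y that by (simp add: cell_def)
    then have "\<bar>2 ^ n * (y \<bullet> b) - 2 ^ n * (x \<bullet> b)\<bar> \<le> 1" by linarith
    then have "2 ^ n * \<bar>(y - x) \<bullet> b\<bar> \<le> 1"
      unfolding right_diff_distrib[symmetric] abs_mult inner_diff_left by simp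
    then show ?thesis by (simp add: field_simps)
  qed
  then have "(\<Sum>b\<in>Basis. \<bar>(y - x) \<bullet> b\<bar>) \<le> (\<Sum>b\<in>(Basis::'a set). 1 / 2 ^ n)" by (intro sum_mono)
  then show ?thesis using norm_le_l1[of "y - x"] by simp
qed

lemma cell_diameter_null: "(\<lambda>n. c / 2 ^ n) \<longlonglongrightarrow> (0::real)"
  using tendsto_mult[OF tendsto_const[of c] LIMSEQ_power_zero[of "1/2 :: real"]] by (simp add: power_divide)

lemma measure_cells_null:
  assumes "0 < \<delta>" shows "\<forall>\<^sub>F n in sequentially. \<forall>A\<in>cells n. measure lborel A \<le> \<delta>"
proof -
  have "(\<lambda>n. unit_ball_vol DIM('a) * (DIM('a) / 2 ^ n) ^ DIM('a)) \<longlonglongrightarrow> unit_ball_vol DIM('a) * 0 ^ DIM('a)"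
    by (intro tendsto_intros cell_diameter_null)
  then have "(\<lambda>n. unit_ball_vol DIM('a) * (DIM('a) / 2 ^ n) ^ DIM('a)) \<longlonglongrightarrow> 0" by (simp add: power_0_left)
  then have "\<forall>\<^sub>F n in sequentially. unit_ball_vol DIM('a) * (DIM('a) / 2 ^ n) ^ DIM('a) < \<delta>"
    using assms by (rule order_tendstoD)
  then show ?thesis
  proof eventually_elim
    case (elim n)
    have "measure lborel A \<le> \<delta>" if "A \<in> cells n" for A
    proof -
      note A = that
      obtain x where x: "A = cell n x" using cellsE[OF A] by blast
      have "A \<subseteq> cball x (DIM('a) / 2 ^ n)" using cell_norm_le x by (auto simp: dist_norm norm_minus_commute)
      then have "measure lborel A \<le> measure lborel (cball x (DIM('a) / 2 ^ n))"
        by (intro measure_mono_fmeasurable) (use A in \<open>auto simp: cells_borel fmeasurable_compact\<close>)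
      also have "\<dots> = unit_ball_vol DIM('a) * (DIM('a) / 2 ^ n) ^ DIM('a)" by (rule content_cball) simp
      finally show ?thesis using elim by simp
    qed
    then show ?case by blast
  qed
qed

text \<open>Passes from finite sums over cells to integrals of step functions. It is applied both to
  the random configuration and to the intensity measure.\<close>

lemma sum_cells:
  assumes [measurable_cong]: "sets \<mu> = sets borel"
  shows "(\<Sum>A\<in>cells n. emeasure \<mu> A * \<psi> A) = (\<integral>\<^sup>+x\<in>U. \<psi> (cell n x) \<partial>\<mu>)"
    and "(\<lambda>x. \<psi> (cell n x) * indicator U x) \<in> borel_measurable borel"
proof -
  have eq: "(\<psi> (cell n x) :: ennreal) * indicator U x = (\<Sum>A\<in>cells n. \<psi> A * indicator A x)" for x
  proof (cases "x \<in> U")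
    case True
    have "(\<Sum>A\<in>cells n. \<psi> A * indicator A x) = (\<Sum>A\<in>cells n. if A = cell n x then \<psi> A else 0)"
      using True by (intro sum.cong refl) (auto simp: in_cells_iff indicator_def)
    then show ?thesis using True finite_cells by (simp add: cells_def)
  next
    case False
    then have "(\<Sum>A\<in>cells n. \<psi> A * indicator A x) = 0"
      by (intro sum.neutral) (auto simp: in_cells_iff indicator_def)
    then show ?thesis using False by simp
  qed
  have m: "(\<lambda>x. \<psi> A * indicator A x) \<in> borel_measurable borel" if "A \<in> cells n" for A
    using cells_borel[OF that] by measurable
  show "(\<lambda>x. \<psi> (cell n x) * indicator U x) \<in> borel_measurable borel"
    unfolding eq using m by (rule borel_measurable_sum)
  show "(\<Sum>A\<in>cells n. emeasure \<mu> A * \<psi> A) = (\<integral>\<^sup>+x\<in>U. \<psi> (cell n x) \<partial>\<mu>)"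
    unfolding eq
  proof (subst nn_integral_sum)
    show "(\<lambda>x. \<psi> A * indicator A x) \<in> borel_measurable \<mu>" if "A \<in> cells n" for A
      using m[OF that] by simp
    show "(\<Sum>A\<in>cells n. emeasure \<mu> A * \<psi> A) = (\<Sum>A\<in>cells n. \<integral>\<^sup>+x. \<psi> A * indicator A x \<partial>\<mu>)"
      by (intro sum.cong refl, subst nn_integral_cmult_indicator) (auto simp: assms cells_borel mult.commute)
  qed
qed

text \<open>Monotone convergence along the refinement; measurability of the limit function comes
  with it, as a limit of step functions.\<close>

lemma sum_cells_limit:
  assumes sets: "sets \<mu> = sets borel"
    and inc: "\<And>x. x \<in> U \<Longrightarrow> incseq (\<lambda>n. \<psi> n (cell n x) :: ennreal)"
    and lim: "\<And>x. x \<in> U \<Longrightarrow> (\<lambda>n. \<psi> n (cell n x)) \<longlonglongrightarrow> \<Psi> x"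
  shows "(\<lambda>n. \<Sum>A\<in>cells n. emeasure \<mu> A * \<psi> n A) \<longlonglongrightarrow> (\<integral>\<^sup>+x\<in>U. \<Psi> x \<partial>\<mu>)"
    and "incseq (\<lambda>n. \<Sum>A\<in>cells n. emeasure \<mu> A * \<psi> n A)"
    and "(\<lambda>x. \<Psi> x * indicator U x) \<in> borel_measurable borel"
proof -
  have inc': "incseq (\<lambda>n x. \<psi> n (cell n x) * indicator U x)"
  proof (rule incseq_SucI, rule le_funI)
    fix n x show "\<psi> n (cell n x) * indicator U x \<le> \<psi> (Suc n) (cell (Suc n) x) * indicator U x"
      using inc[of x] by (cases "x \<in> U") (auto simp: incseq_Suc_iff)
  qed
  have lim': "(\<lambda>n. \<psi> n (cell n x) * indicator U x) \<longlonglongrightarrow> \<Psi> x * indicator U x" for x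
    using lim[of x] by (cases "x \<in> U") auto
  show "(\<lambda>n. \<Sum>A\<in>cells n. emeasure \<mu> A * \<psi> n A) \<longlonglongrightarrow> (\<integral>\<^sup>+x\<in>U. \<Psi> x \<partial>\<mu>)"
    unfolding sum_cells(1)[OF sets]
    by (rule nn_integral_LIMSEQ[OF inc' _ lim']) (use sum_cells(2)[OF sets] sets in auto)
  show "incseq (\<lambda>n. \<Sum>A\<in>cells n. emeasure \<mu> A * \<psi> n A)"
    unfolding sum_cells(1)[OF sets] using inc' by (auto simp: incseq_def le_fun_def intro!: nn_integral_mono)
  show "(\<lambda>x. \<Psi> x * indicator U x) \<in> borel_measurable borel"
    by (rule borel_measurable_LIMSEQ_order[OF lim']) (rule sum_cells(2)[OF sets])
qed

end

section \<open>The edge kernel and its approximation from below\<close>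

locale edge_kernel = cell_partition W for W :: "'m::finite \<Rightarrow> 'a::euclidean_space set" +
  fixes \<nu> \<alpha> r :: real
  assumes \<nu>: "0 \<le> \<nu>" and r: "0 < r"
begin

definition ker :: "'a \<Rightarrow> 'a \<Rightarrow> real" where
  "ker x y = (if 0 < norm (x - y) \<and> norm (x - y) < r then norm (x - y) powr \<alpha> else 0)"

definition f :: "'m \<Rightarrow> 'a \<Rightarrow> 'a \<Rightarrow> real" where
  "f i x y = \<nu> * ker x y * indicator (W i) x * indicator (W i) y"

text \<open>The infimum makes the approximation increase under refinement, tames the singularity and
  vanishes on equal cells. The case distinction fixes the value 0 for empty sets, whose infimum in
  the reals is unspecified.\<close>

definition fn :: "'m \<Rightarrow> 'a set \<Rightarrow> 'a set \<Rightarrow> real" where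
  "fn i A B = (if A = {} \<or> B = {} then 0 else INF p\<in>A \<times> B. f i (fst p) (snd p))"

lemma ker_nonneg: "0 \<le> ker x y" by (simp add: ker_def)

lemma f_nonneg: "0 \<le> f i x y" using \<nu> by (simp add: f_def ker_nonneg)

lemma f_sym: "f i x y = f i y x" by (simp add: f_def ker_def norm_minus_commute)

lemma measurable_ker [measurable]: "(\<lambda>y. ker x y) \<in> borel_measurable borel"
  unfolding ker_def by measurable

lemma measurable_f [measurable]: "(\<lambda>y. f i x y) \<in> borel_measurable borel"
  using borel_W unfolding f_def by measurable

lemma fn_nonneg: "0 \<le> fn i A B"
  unfolding fn_def by (auto intro!: cINF_greatest f_nonneg)

lemma fn_le: "x \<in> A \<Longrightarrow> y \<in> B \<Longrightarrow> fn i A B \<le> f i x y"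
  unfolding fn_def by (auto intro!: cINF_lower2[of _ _ "(x, y)"] bdd_belowI2[of _ 0] f_nonneg)

lemma fn_sym: "fn i A B = fn i B A"
proof -
  have "(\<lambda>p. f i (fst p) (snd p)) ` (A \<times> B) = (\<lambda>p. f i (fst p) (snd p)) ` (B \<times> A)"
    using f_sym by (force simp: image_iff)
  then show ?thesis unfolding fn_def by auto
qed

lemma fn_diag: "fn i A A = 0"
proof (cases "A = {}")
  case False
  then obtain x where "x \<in> A" by blast
  then have "fn i A A \<le> f i x x" by (intro fn_le)
  then show ?thesis using fn_nonneg[of i A A] by (simp add: f_def ker_def)
qed (simp add: fn_def)

lemma fn_antimono:
  assumes "A' \<subseteq> A" "B' \<subseteq> B" "A' \<noteq> {}" "B' \<noteq> {}" shows "fn i A B \<le> fn i A' B'"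
proof -
  have "fn i A B \<le> (INF p\<in>A' \<times> B'. f i (fst p) (snd p))"
  proof (rule cINF_greatest)
    show "A' \<times> B' \<noteq> {}" using assms by simp
    fix p assume "p \<in> A' \<times> B'"
    then show "fn i A B \<le> f i (fst p) (snd p)" using assms by (intro fn_le) auto
  qed
  then show ?thesis using assms by (simp add: fn_def)
qed

lemma fn_incseq: "incseq (\<lambda>n. fn i (cell n x) (cell n y))"
  by (intro incseq_SucI fn_antimono cell_decseq) (use cell_refl in blast)+

text \<open>Where \<open>f\<close> is nonzero, the conditions on the distance are open and the cells
  respect \<open>W i\<close>, so continuity of s powr \<alpha> at s > 0 applies on small cells.
  Where \<open>f\<close> is 0, \<open>fn\<close> is squeezed between 0 and \<open>f\<close>; this
  covers the discontinuities at the distances 0 and r.\<close>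

lemma fn_tendsto: "(\<lambda>n. fn i (cell n x) (cell n y)) \<longlonglongrightarrow> f i x y"
proof (cases "f i x y = 0")
  case True
  then have "fn i (cell n x) (cell n y) = 0" for n
    using fn_le[OF cell_refl cell_refl, of i n x n y] fn_nonneg[of i "cell n x" "cell n y"] by simp
  then show ?thesis using True by simp
next
  case False
  define s0 where "s0 = norm (x - y)"
  have s0: "0 < s0" "s0 < r" and xy: "x \<in> W i" "y \<in> W i" and f: "f i x y = \<nu> * s0 powr \<alpha>"
    using False by (auto simp: f_def ker_def s0_def indicator_def split: if_splits)
  show ?thesis
  proof (rule LIMSEQ_I)
    fix e :: real assume e: "0 < e"
    have "((\<lambda>s. \<nu> * s powr \<alpha>) \<longlongrightarrow> \<nu> * s0 powr \<alpha>) (at s0)"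
      using s0 by (intro tendsto_intros) auto
    then obtain \<delta>1 where \<delta>1: "0 < \<delta>1" "\<And>s. s \<noteq> s0 \<Longrightarrow> \<bar>s - s0\<bar> < \<delta>1 \<Longrightarrow> \<bar>\<nu> * s powr \<alpha> - \<nu> * s0 powr \<alpha>\<bar> < e / 2"
      using e unfolding LIM_eq by (metis half_gt_zero real_norm_def)
    \<comment> \<open>Besides continuity, \<delta> ensures that the perturbed distance stays between
      0 and r.\<close>
    define \<delta> where "\<delta> = min \<delta>1 (min s0 (r - s0))"
    have \<delta>: "0 < \<delta>" using \<delta>1 s0 by (simp add: \<delta>_def)
    have "\<forall>\<^sub>F n in sequentially. 2 * DIM('a) / 2 ^ n < \<delta>"
      using cell_diameter_null \<delta> by (rule order_tendstoD)
    then obtain n0 where n0: "\<And>n. n0 \<le> n \<Longrightarrow> 2 * DIM('a) / 2 ^ n < \<delta>" unfolding eventually_sequentially by blast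
    show "\<exists>n0. \<forall>n\<ge>n0. norm (fn i (cell n x) (cell n y) - f i x y) < e"
    proof (intro exI allI impI)
      fix n assume n: "n0 \<le> n"
      have low: "f i x y - e / 2 \<le> f i (fst p) (snd p)" if p: "p \<in> cell n x \<times> cell n y" for p
      proof -
        define s where "s = norm (fst p - snd p)"
        have W: "fst p \<in> W i" "snd p \<in> W i" using p xy by (auto simp: cell_def)
        have "\<bar>s - s0\<bar> \<le> norm ((fst p - snd p) - (x - y))" unfolding s_def s0_def by (rule norm_triangle_ineq3)
        also have "(fst p - snd p) - (x - y) = (fst p - x) - (snd p - y)" by simp
        also have "norm \<dots> \<le> norm (fst p - x) + norm (snd p - y)" by (rule norm_triangle_ineq4)
        also have "\<dots> \<le> DIM('a) / 2 ^ n + DIM('a) / 2 ^ n" using p by (intro add_mono cell_norm_le) auto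
        also have "\<dots> < \<delta>" using n0[OF n] by simp
        finally have s: "\<bar>s - s0\<bar> < \<delta>" .
        then have "0 < s" "s < r" by (auto simp: \<delta>_def abs_if split: if_splits)
        then have "f i (fst p) (snd p) = \<nu> * s powr \<alpha>" using W by (simp add: f_def ker_def s_def[symmetric])
        moreover have "\<bar>\<nu> * s powr \<alpha> - \<nu> * s0 powr \<alpha>\<bar> \<le> e / 2"
          using \<delta>1(2)[of s] s e by (cases "s = s0") (auto simp: \<delta>_def)
        ultimately show ?thesis unfolding f by linarith
      qed
      have "f i x y - e / 2 \<le> (INF p\<in>cell n x \<times> cell n y. f i (fst p) (snd p))"
      proof (rule cINF_greatest)
        have "cell n x \<noteq> {}" "cell n y \<noteq> {}" using cell_refl by blast+
        then show "cell n x \<times> cell n y \<noteq> {}" by simp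
      qed (rule low)
      also have "\<dots> = fn i (cell n x) (cell n y)"
      proof -
        have "cell n x \<noteq> {}" "cell n y \<noteq> {}" using cell_refl by blast+
        then show ?thesis by (simp add: fn_def)
      qed
      finally show "norm (fn i (cell n x) (cell n y) - f i x y) < e"
        using fn_le[OF cell_refl cell_refl, of i n x n y] e by simp
    qed
  qed
qed

definition row :: "'a measure \<Rightarrow> 'm \<Rightarrow> 'a \<Rightarrow> ennreal" where
  "row \<mu> i x = (\<integral>\<^sup>+y\<in>U. ennreal (f i x y) \<partial>\<mu>)"

lemma row_limit:
  assumes "sets \<mu> = sets borel"
  shows "(\<lambda>n. \<Sum>B\<in>cells n. emeasure \<mu> B * ennreal (fn i (cell n x) B)) \<longlonglongrightarrow> row \<mu> i x"
    and "incseq (\<lambda>n. \<Sum>B\<in>cells n. emeasure \<mu> B * ennreal (fn i (cell n x) B))"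
proof -
  have 1: "incseq (\<lambda>n. ennreal (fn i (cell n x) (cell n y)))" for y
    using fn_incseq[of i x y] by (auto simp: incseq_def intro!: ennreal_leI)
  have 2: "(\<lambda>n. ennreal (fn i (cell n x) (cell n y))) \<longlonglongrightarrow> ennreal (f i x y)" for y
    by (intro tendsto_ennrealI fn_tendsto)
  show "(\<lambda>n. \<Sum>B\<in>cells n. emeasure \<mu> B * ennreal (fn i (cell n x) B)) \<longlonglongrightarrow> row \<mu> i x"
    unfolding row_def
    by (rule sum_cells_limit(1)[OF assms, where \<psi>="\<lambda>n B. ennreal (fn i (cell n x) B)"]) (rule 1 2)+
  show "incseq (\<lambda>n. \<Sum>B\<in>cells n. emeasure \<mu> B * ennreal (fn i (cell n x) B))"
    by (rule sum_cells_limit(2)[OF assms, where \<psi>="\<lambda>n B. ennreal (fn i (cell n x) B)"]) (rule 1 2)+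
qed

lemma double_sum_limit:
  assumes "sets \<mu> = sets borel"
  shows "(\<lambda>n. \<Sum>A\<in>cells n. emeasure \<mu> A * (\<Sum>B\<in>cells n. emeasure \<mu> B * ennreal (fn i A B))) \<longlonglongrightarrow> (\<integral>\<^sup>+x\<in>U. row \<mu> i x \<partial>\<mu>)"
    and "incseq (\<lambda>n. \<Sum>A\<in>cells n. emeasure \<mu> A * (\<Sum>B\<in>cells n. emeasure \<mu> B * ennreal (fn i A B)))"
    and "(\<lambda>x. row \<mu> i x * indicator U x) \<in> borel_measurable borel"
  using sum_cells_limit[OF assms, where \<psi>="\<lambda>n A. \<Sum>B\<in>cells n. emeasure \<mu> B * ennreal (fn i A B)" and \<Psi>="row \<mu> i"]
    row_limit[OF assms, of i] by blast+

text \<open>Integrals against a configuration are finite sums over its points with multiplicity; the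
  2 undoes the factor 1/2 of the edge functional.\<close>

lemma edge_functional_eq:
  assumes \<mu>: "point_configuration \<mu>"
  shows "(\<integral>\<^sup>+x\<in>U. row \<mu> i x \<partial>\<mu>) = ennreal (2 * \<nu> * edge_functional \<alpha> r (W i) \<mu>)"
proof -
  have sets: "sets \<mu> = sets borel" using \<mu> by (simp add: point_configuration_def)
  define D where "D = points \<mu> \<inter> U"
  have D: "finite D" unfolding D_def by (rule finite_points[OF \<mu> bounded_U borel_U])
  have em: "emeasure \<mu> {x} = ennreal (measure \<mu> {x})" for x
    using point_configuration_finite(1)[OF \<mu>, of "{x}"] by (simp add: emeasure_eq_ennreal_measure)
  have row: "row \<mu> i x = ennreal (\<Sum>y\<in>D. measure \<mu> {y} * f i x y)" for x
  proof -
    have "row \<mu> i x = (\<Sum>y\<in>D. emeasure \<mu> {y} * ennreal (f i x y))"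
      unfolding row_def D_def by (rule nn_integral_point_configuration[OF \<mu> bounded_U borel_U]) simp
    then show ?thesis by (simp add: em f_nonneg ennreal_mult'[symmetric] sum_ennreal)
  qed
  have "(\<integral>\<^sup>+x\<in>U. row \<mu> i x \<partial>\<mu>) = (\<integral>\<^sup>+x\<in>U. row \<mu> i x * indicator U x \<partial>\<mu>)"
    by (intro nn_integral_cong) (simp add: indicator_def)
  also have "\<dots> = (\<Sum>x\<in>D. emeasure \<mu> {x} * (row \<mu> i x * indicator U x))"
    unfolding D_def by (rule nn_integral_point_configuration[OF \<mu> bounded_U borel_U double_sum_limit(3)[OF sets]])
  also have "\<dots> = (\<Sum>x\<in>D. ennreal (measure \<mu> {x} * (\<Sum>y\<in>D. measure \<mu> {y} * f i x y)))"
    by (intro sum.cong refl) (simp add: row em D_def ennreal_mult'[symmetric])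
  also have "\<dots> = ennreal (\<Sum>x\<in>D. measure \<mu> {x} * (\<Sum>y\<in>D. measure \<mu> {y} * f i x y))"
    by (intro sum_ennreal mult_nonneg_nonneg sum_nonneg f_nonneg) auto
  also have "(\<Sum>x\<in>D. measure \<mu> {x} * (\<Sum>y\<in>D. measure \<mu> {y} * f i x y))
     = (\<Sum>x\<in>points \<mu> \<inter> W i. \<Sum>y\<in>points \<mu> \<inter> W i. \<nu> * (measure \<mu> {x} * measure \<mu> {y} * ker x y))"
  proof -
    have sub: "points \<mu> \<inter> W i \<subseteq> D" unfolding D_def U_def by auto
    have "(\<Sum>y\<in>D. measure \<mu> {x} * (measure \<mu> {y} * f i x y)) = (\<Sum>y\<in>points \<mu> \<inter> W i. measure \<mu> {x} * (measure \<mu> {y} * f i x y))" for x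
      by (rule sum.mono_neutral_right[OF D sub]) (auto simp: D_def f_def indicator_def)
    then have "(\<Sum>x\<in>D. \<Sum>y\<in>D. measure \<mu> {x} * (measure \<mu> {y} * f i x y))
        = (\<Sum>x\<in>D. \<Sum>y\<in>points \<mu> \<inter> W i. measure \<mu> {x} * (measure \<mu> {y} * f i x y))" by simp
    also have "\<dots> = (\<Sum>x\<in>points \<mu> \<inter> W i. \<Sum>y\<in>points \<mu> \<inter> W i. measure \<mu> {x} * (measure \<mu> {y} * f i x y))"
      by (rule sum.mono_neutral_right[OF D sub]) (auto simp: D_def f_def indicator_def)
    also have "\<dots> = (\<Sum>x\<in>points \<mu> \<inter> W i. \<Sum>y\<in>points \<mu> \<inter> W i. \<nu> * (measure \<mu> {x} * measure \<mu> {y} * ker x y))"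
      by (intro sum.cong refl) (simp add: f_def)
    finally show ?thesis by (simp add: sum_distrib_left)
  qed
  also have "\<dots> = 2 * \<nu> * edge_functional \<alpha> r (W i) \<mu>"
    unfolding edge_functional_def ker_def by (simp add: sum_distrib_left mult.assoc)
  finally show ?thesis .
qed

end

section \<open>Edge functionals of Poisson measures\<close>

lemma pmf_pois: "0 \<le> l \<Longrightarrow> pmf (pois l) k = l ^ k / fact k * exp (- l)"
  by (cases "l = 0") (auto simp: pois_def indicator_def power_0_left)

locale poisson_edges = edge_kernel W \<nu> \<alpha> r
  for W :: "'m::finite \<Rightarrow> 'a::euclidean_space set" and \<nu> \<alpha> r :: real +
  fixes t :: real and M :: "'w measure" and \<eta> :: "'w \<Rightarrow> 'a measure"
  assumes t: "0 < t" and poisson: "poisson_measure M \<eta> (density lborel (\<lambda>_. ennreal t))"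
begin

abbreviation \<Lambda> :: "'a measure" where "\<Lambda> \<equiv> density lborel (\<lambda>_. ennreal t)"

definition rate :: "'a set \<Rightarrow> real" where "rate A = t * measure lborel A"

lemma rate_nonneg: "0 \<le> rate A" using t by (simp add: rate_def)

sublocale D: poisson_kernel "cells n" rate fn for n
  by unfold_locales (simp_all add: finite_cells rate_nonneg fn_nonneg fn_sym fn_diag)

sublocale M: prob_space M
  using poisson by (simp add: poisson_measure_def)

lemma point_configuration_\<eta>: "\<omega> \<in> space M \<Longrightarrow> point_configuration (\<eta> \<omega>)"
  and measurable_\<eta>: "B \<in> sets borel \<Longrightarrow> (\<lambda>\<omega>. emeasure (\<eta> \<omega>) B) \<in> borel_measurable M"
  using poisson by (auto simp: poisson_measure_def)

lemma emeasure_\<Lambda>: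
  assumes "bounded A" "A \<in> sets borel" shows "emeasure \<Lambda> A = ennreal (rate A)"
proof -
  have "emeasure lborel A < \<infinity>" using assms(1) by (rule emeasure_bounded_finite)
  then have "emeasure lborel A = ennreal (measure lborel A)" by (simp add: emeasure_eq_ennreal_measure less_top)
  then show ?thesis using assms t by (simp add: emeasure_density_const rate_def ennreal_mult)
qed

lemma emeasure_\<Lambda>_cell: "A \<in> cells n \<Longrightarrow> emeasure \<Lambda> A = ennreal (rate A)"
  by (intro emeasure_\<Lambda> cells_bounded cells_borel)

text \<open>On a cell the mass is a natural number, so the floor only converts the type. The value 0
  off the cells agrees with the default value of \<open>Pi_pmf\<close> in the finite model.\<close>

definition cnt :: "nat \<Rightarrow> 'w \<Rightarrow> 'a set \<Rightarrow> nat" where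
  "cnt n \<omega> A = (if A \<in> cells n then nat \<lfloor>measure (\<eta> \<omega>) A\<rfloor> else 0)"

lemma emeasure_cnt:
  assumes "\<omega> \<in> space M" "A \<in> cells n" shows "emeasure (\<eta> \<omega>) A = of_nat (cnt n \<omega> A)"
proof -
  obtain k :: nat where k: "emeasure (\<eta> \<omega>) A = of_nat k"
    using point_configuration_finite(2)[OF point_configuration_\<eta>[OF assms(1)] cells_bounded[OF assms(2)] cells_borel[OF assms(2)]] by blast
  then have "measure (\<eta> \<omega>) A = real k" by (simp add: measure_def ennreal_of_nat_eq_real_of_nat)
  then show ?thesis using k assms(2) by (simp add: cnt_def)
qed

lemma prob_count:
  assumes A: "A \<in> cells n"
  shows "M.prob {\<omega>\<in>space M. emeasure (\<eta> \<omega>) A = of_nat k} = pmf (pois (rate A)) k"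
proof -
  have "emeasure \<Lambda> A < \<infinity>" "measure \<Lambda> A = rate A"
    using emeasure_\<Lambda>_cell[OF A] rate_nonneg by (simp_all add: measure_def)
  then show ?thesis
    using poisson cells_borel[OF A] by (simp add: poisson_measure_def pmf_pois[OF rate_nonneg])
qed

text \<open>The functions on all sets of points form an uncountable type. Those supported on the
  finitely many cells are countably many, so laws on them can be compared point by point.\<close>

definition supp :: "nat \<Rightarrow> ('a set \<Rightarrow> nat) set" where
  "supp n = {N. \<forall>A. A \<notin> cells n \<longrightarrow> N A = 0}"

lemma countable_supp: "countable (supp n)"
proof -
  have "supp n \<subseteq> (\<lambda>g A. if A \<in> cells n then g A else 0) ` (\<Pi>\<^sub>E A\<in>cells n. UNIV)"
  proof
    fix N assume N: "N \<in> supp n"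
    have "N = (\<lambda>A. if A \<in> cells n then restrict N (cells n) A else 0)"
      using N by (auto simp: supp_def fun_eq_iff)
    then show "N \<in> (\<lambda>g A. if A \<in> cells n then g A else 0) ` (\<Pi>\<^sub>E A\<in>cells n. UNIV)"
      by (rule image_eqI[where x="restrict N (cells n)"]) auto
  qed
  then show ?thesis
    by (rule countable_subset) (intro countable_image countable_PiE finite_cells, simp)
qed

lemma cnt_in_supp: "cnt n \<omega> \<in> supp n" by (simp add: supp_def cnt_def)

lemma cnt_eq:
  assumes a: "a \<in> supp n"
  shows "{\<omega>\<in>space M. cnt n \<omega> = a} = (\<Inter>A\<in>cells n. (\<lambda>\<omega>. emeasure (\<eta> \<omega>) A) -` {of_nat (a A)} \<inter> space M)"
proof -
  have ne: "cells n \<noteq> {}" using nonempty_U by (simp add: cells_def)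
  have "cnt n \<omega> = a \<longleftrightarrow> (\<forall>A\<in>cells n. emeasure (\<eta> \<omega>) A = of_nat (a A))" if \<omega>: "\<omega> \<in> space M" for \<omega>
  proof
    assume "cnt n \<omega> = a"
    then show "\<forall>A\<in>cells n. emeasure (\<eta> \<omega>) A = of_nat (a A)" using emeasure_cnt[OF \<omega>] by simp
  next
    assume *: "\<forall>A\<in>cells n. emeasure (\<eta> \<omega>) A = of_nat (a A)"
    show "cnt n \<omega> = a"
    proof
      fix A show "cnt n \<omega> A = a A"
      proof (cases "A \<in> cells n")
        case True
        then have "(of_nat (cnt n \<omega> A) :: ennreal) = of_nat (a A)" using * emeasure_cnt[OF \<omega> True] by simp
        then show ?thesis by (simp only: of_nat_eq_iff)
      qed (use a in \<open>simp add: cnt_def supp_def\<close>)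
    qed
  qed
  then have "\<omega> \<in> {\<omega>\<in>space M. cnt n \<omega> = a} \<longleftrightarrow> \<omega> \<in> (\<Inter>A\<in>cells n. (\<lambda>\<omega>. emeasure (\<eta> \<omega>) A) -` {of_nat (a A)} \<inter> space M)" for \<omega>
    using ne by (cases "\<omega> \<in> space M") simp_all
  then show ?thesis by (rule set_eqI)
qed

lemma measurable_cnt: "cnt n \<in> M \<rightarrow>\<^sub>M count_space (supp n)"
proof (subst measurable_count_space_eq_countable[OF countable_supp], intro conjI ballI)
  show "cnt n \<in> space M \<rightarrow> supp n" using cnt_in_supp by blast
  fix a assume a: "a \<in> supp n"
  have "cnt n -` {a} \<inter> space M = {\<omega>\<in>space M. cnt n \<omega> = a}" by auto
  also have "\<dots> \<in> sets M"
    unfolding cnt_eq[OF a]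
  proof (rule sets.finite_INT)
    show "(\<lambda>\<omega>. emeasure (\<eta> \<omega>) A) -` {of_nat (a A)} \<inter> space M \<in> sets M" if "A \<in> cells n" for A
      using measurable_\<eta>[OF cells_borel[OF that]] by (rule measurable_sets) simp
  next
    show "cells n \<noteq> {}" using nonempty_U by (simp add: cells_def)
  qed (rule finite_cells)
  finally show "cnt n -` {a} \<inter> space M \<in> sets M" .
qed

text \<open>An event \<open>cnt n \<omega> = a\<close> prescribes the masses of finitely many
  disjoint cells, so independence gives the product of the Poisson weights. The map on the right
  only moves a null set into \<open>supp n\<close>, to give both laws the same target space.\<close>

lemma distr_cnt:
  "distr M (count_space (supp n)) (cnt n) = distr (D.P n) (count_space (supp n)) (\<lambda>N. if N \<in> supp n then N else (\<lambda>_. 0))"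
proof (rule measure_eqI_countable[of _ "supp n"])
  let ?g = "\<lambda>N. if N \<in> supp n then N else (\<lambda>_. 0)"
  fix a assume a: "a \<in> supp n"
  have P: "measure_pmf (D.P n) = measure_pmf (Pi_pmf (cells n) 0 (\<lambda>A. pois (rate A)))" by (simp add: D.P_def)
  have supp: "set_pmf (D.P n) \<subseteq> supp n"
    unfolding D.P_def supp_def by (rule set_Pi_pmf_subset[OF finite_cells])
  have "emeasure (distr M (count_space (supp n)) (cnt n)) {a} = emeasure M {\<omega>\<in>space M. cnt n \<omega> = a}"
  proof -
    have "cnt n -` {a} \<inter> space M = {\<omega>\<in>space M. cnt n \<omega> = a}" by auto
    then show ?thesis using a by (subst emeasure_distr[OF measurable_cnt]) simp_all
  qed
  also have "\<dots> = ennreal (\<Prod>A\<in>cells n. M.prob ((\<lambda>\<omega>. emeasure (\<eta> \<omega>) A) -` {of_nat (a A)} \<inter> space M))"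
  proof -
    have "M.indep_vars (\<lambda>_. borel) (\<lambda>A \<omega>. emeasure (\<eta> \<omega>) A) (cells n)"
    proof -
      have "cells n \<subseteq> sets borel" using cells_borel by (rule subsetI)
      then show ?thesis using poisson finite_cells[of n] cells_disjoint[of n] unfolding poisson_measure_def by simp
    qed
    moreover have "cells n \<noteq> {}" using nonempty_U by (simp add: cells_def)
    ultimately show ?thesis
      unfolding cnt_eq[OF a] M.emeasure_eq_measure using finite_cells[of n]
      by (subst M.indep_varsD_finite[where M'="\<lambda>_. borel"]) (assumption | rule borel_closed closed_singleton refl)+
  qed
  also have "\<dots> = ennreal (\<Prod>A\<in>cells n. pmf (pois (rate A)) (a A))"
  proof (intro arg_cong[where f=ennreal] prod.cong refl)
    fix A assume A: "A \<in> cells n"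
    have "(\<lambda>\<omega>. emeasure (\<eta> \<omega>) A) -` {of_nat (a A)} \<inter> space M = {\<omega>\<in>space M. emeasure (\<eta> \<omega>) A = of_nat (a A)}" by auto
    then show "M.prob ((\<lambda>\<omega>. emeasure (\<eta> \<omega>) A) -` {of_nat (a A)} \<inter> space M) = pmf (pois (rate A)) (a A)"
      using prob_count[OF A] by simp
  qed
  also have "\<dots> = ennreal (pmf (D.P n) a)"
    unfolding D.P_def using a by (subst pmf_Pi'[OF finite_cells]) (auto simp: supp_def)
  also have "\<dots> = emeasure (D.P n) {a}" by (simp add: emeasure_pmf_single)
  also have "\<dots> = emeasure (D.P n) (?g -` {a})"
    by (rule emeasure_eq_AE) (use supp a in \<open>auto simp: AE_measure_pmf_iff\<close>)
  also have "\<dots> = emeasure (distr (D.P n) (count_space (supp n)) ?g) {a}"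
    using a by (subst emeasure_distr) (auto simp: supp_def)
  finally show "emeasure (distr M (count_space (supp n)) (cnt n)) {a} = emeasure (distr (D.P n) (count_space (supp n)) ?g) {a}" .
qed (auto simp: countable_supp)

text \<open>\<open>H\<close> may be arbitrary because the counts live on a countable discrete space,
  where every function is measurable.\<close>

lemma expectation_cnt:
  fixes H :: "('a set \<Rightarrow> nat) \<Rightarrow> real"
  shows "(\<integral>\<omega>. H (cnt n \<omega>) \<partial>M) = D.E n H"
    and "integrable M (\<lambda>\<omega>. H (cnt n \<omega>)) \<longleftrightarrow> integrable (D.P n) H"
    and "(\<lambda>\<omega>. H (cnt n \<omega>)) \<in> borel_measurable M"
proof -
  let ?g = "\<lambda>N. if N \<in> supp n then N else (\<lambda>_. 0)"
  have g: "?g \<in> measure_pmf (D.P n) \<rightarrow>\<^sub>M count_space (supp n)" by (auto simp: supp_def)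
  have supp: "set_pmf (D.P n) \<subseteq> supp n"
    unfolding D.P_def supp_def by (rule set_Pi_pmf_subset[OF finite_cells])
  have "(\<integral>\<omega>. H (cnt n \<omega>) \<partial>M) = (\<integral>N. H N \<partial>distr M (count_space (supp n)) (cnt n))"
    by (rule integral_distr[symmetric, OF measurable_cnt]) simp
  also have "\<dots> = (\<integral>N. H (?g N) \<partial>D.P n)"
    unfolding distr_cnt by (rule integral_distr[OF g]) simp
  also have "\<dots> = D.E n H"
    by (rule integral_cong_AE) (use supp in \<open>auto simp: AE_measure_pmf_iff\<close>)
  finally show "(\<integral>\<omega>. H (cnt n \<omega>) \<partial>M) = D.E n H" .
  have "integrable M (\<lambda>\<omega>. H (cnt n \<omega>)) \<longleftrightarrow> integrable (distr M (count_space (supp n)) (cnt n)) H"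
    by (rule integrable_distr_eq[symmetric, OF measurable_cnt]) simp
  also have "\<dots> \<longleftrightarrow> integrable (D.P n) (\<lambda>N. H (?g N))"
    unfolding distr_cnt by (rule integrable_distr_eq[OF g]) simp
  also have "\<dots> \<longleftrightarrow> integrable (D.P n) H"
    by (rule integrable_cong_AE) (use supp in \<open>auto simp: AE_measure_pmf_iff\<close>)
  finally show "integrable M (\<lambda>\<omega>. H (cnt n \<omega>)) \<longleftrightarrow> integrable (D.P n) H" .
  show "(\<lambda>\<omega>. H (cnt n \<omega>)) \<in> borel_measurable M"
    by (rule measurable_compose[OF measurable_cnt]) simp
qed

section \<open>Convergence of the discretised functionals\<close>

definition Z :: "'m \<Rightarrow> 'w \<Rightarrow> real" where
  "Z i \<omega> = \<nu> * edge_functional \<alpha> r (W i) (\<eta> \<omega>)"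

text \<open>This is pathwise: for a fixed configuration, \<open>Q\<close> at its counts is half the
  double sum over cells, which increases to the double sum over points.\<close>

lemma Q_limit:
  assumes \<omega>: "\<omega> \<in> space M"
  shows "(\<lambda>n. D.Q n i (cnt n \<omega>)) \<longlonglongrightarrow> Z i \<omega>" and "incseq (\<lambda>n. D.Q n i (cnt n \<omega>))"
    and Z_nonneg: "0 \<le> Z i \<omega>"
proof -
  have pc: "point_configuration (\<eta> \<omega>)" by (rule point_configuration_\<eta>[OF \<omega>])
  then have sets: "sets (\<eta> \<omega>) = sets borel" by (simp add: point_configuration_def)
  have Q0: "0 \<le> D.Q n i N" for n N
    unfolding D.Q_def by (intro mult_nonneg_nonneg sum_nonneg D.S_nonneg) auto
  have eq: "(\<Sum>A\<in>cells n. emeasure (\<eta> \<omega>) A * (\<Sum>B\<in>cells n. emeasure (\<eta> \<omega>) B * ennreal (fn i A B))) = ennreal (2 * D.Q n i (cnt n \<omega>))" for n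
  proof -
    have "(\<Sum>B\<in>cells n. emeasure (\<eta> \<omega>) B * ennreal (fn i A B)) = ennreal (D.S n i A (cnt n \<omega>))" for A
      unfolding D.S_def
      by (simp add: emeasure_cnt[OF \<omega>] ennreal_of_nat_eq_real_of_nat ennreal_mult'[symmetric] fn_nonneg sum_ennreal mult.commute)
    then have "(\<Sum>A\<in>cells n. emeasure (\<eta> \<omega>) A * (\<Sum>B\<in>cells n. emeasure (\<eta> \<omega>) B * ennreal (fn i A B)))
        = (\<Sum>A\<in>cells n. ennreal (real (cnt n \<omega> A) * D.S n i A (cnt n \<omega>)))"
      by (simp add: emeasure_cnt[OF \<omega>] ennreal_of_nat_eq_real_of_nat ennreal_mult'[symmetric])
    then show ?thesis by (simp add: D.Q_def sum_ennreal D.S_nonneg)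
  qed
  show Z0: "0 \<le> Z i \<omega>"
    unfolding Z_def edge_functional_def using \<nu> by (auto intro!: mult_nonneg_nonneg sum_nonneg)
  have "(\<lambda>n. ennreal (2 * D.Q n i (cnt n \<omega>))) \<longlonglongrightarrow> ennreal (2 * Z i \<omega>)"
    using double_sum_limit(1)[OF sets, of i] unfolding eq edge_functional_eq[OF pc] by (simp add: Z_def mult.assoc)
  then have "(\<lambda>n. 2 * D.Q n i (cnt n \<omega>)) \<longlonglongrightarrow> 2 * Z i \<omega>"
    using Q0 Z0 by (subst (asm) tendsto_ennreal_iff) auto
  from tendsto_mult[OF tendsto_const[of "1/2"] this]
  show "(\<lambda>n. D.Q n i (cnt n \<omega>)) \<longlonglongrightarrow> Z i \<omega>" by simp
  have "incseq (\<lambda>n. ennreal (2 * D.Q n i (cnt n \<omega>)))"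
    using double_sum_limit(2)[OF sets, of i] unfolding eq .
  then show "incseq (\<lambda>n. D.Q n i (cnt n \<omega>))"
    using Q0 by (auto simp: incseq_def ennreal_le_iff)
qed

lemma measurable_Z [measurable]: "Z i \<in> borel_measurable M"
  by (rule borel_measurable_LIMSEQ_real[OF Q_limit(1)]) (auto intro: expectation_cnt(3))

context
  fixes g :: "'m \<Rightarrow> 'm \<Rightarrow> real" and e :: "'m \<Rightarrow> real"
  assumes g: "\<And>i k. (\<lambda>n. D.\<gamma> n i k) \<longlonglongrightarrow> g i k" and e: "\<And>i. (\<lambda>n. D.E n (D.Q n i)) \<longlonglongrightarrow> e i"
begin

text \<open>\<open>Q\<close> and products of its components are nonnegative and increase pathwise,
  so monotone convergence yields integrability together with the moments, from the limits
  \<open>e\<close> and \<open>g\<close> of the discrete means and covariances.\<close>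

lemma Z_moments:
  "integrable M (Z i)" "(\<integral>\<omega>. Z i \<omega> \<partial>M) = e i"
  "integrable M (\<lambda>\<omega>. Z i \<omega> * Z k \<omega>)" "(\<integral>\<omega>. Z i \<omega> * Z k \<omega> \<partial>M) = g i k + e i * e k"
proof -
  have Q0: "0 \<le> D.Q n i N" for n i N
    unfolding D.Q_def by (intro mult_nonneg_nonneg sum_nonneg D.S_nonneg) auto
  have 1: "integrable M (\<lambda>\<omega>. D.Q n i (cnt n \<omega>))" for n i
    using expectation_cnt(2) D.integrable_pbounded[OF D.pbounded_Q] by blast
  have 2: "integrable M (\<lambda>\<omega>. D.Q n i (cnt n \<omega>) * D.Q n k (cnt n \<omega>))" for n i k
    using expectation_cnt(2)[where n=n and H="\<lambda>N. D.Q n i N * D.Q n k N"] D.integrable_pbounded[OF D.pbounded_mult[OF D.pbounded_Q D.pbounded_Q]] by blast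
  have E2: "(\<integral>\<omega>. D.Q n i (cnt n \<omega>) * D.Q n k (cnt n \<omega>) \<partial>M) = D.\<gamma> n i k + D.E n (D.Q n i) * D.E n (D.Q n k)" for n
  proof -
    have "D.\<gamma> n i k = D.E n (\<lambda>N. D.Q n i N * D.Q n k N - D.E n (D.Q n k) * D.Q n i N - D.E n (D.Q n i) * D.Q n k N + D.E n (D.Q n i) * D.E n (D.Q n k))"
      unfolding D.E_V_V[symmetric] D.V_def by (simp add: algebra_simps)
    also have "\<dots> = D.E n (\<lambda>N. D.Q n i N * D.Q n k N) - D.E n (D.Q n i) * D.E n (D.Q n k)"
      by (simp add: D.E_add D.E_diff D.pbounded_intros D.pbounded_Q)
    finally show ?thesis using expectation_cnt(1)[where n=n and H="\<lambda>N. D.Q n i N * D.Q n k N"] by simp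
  qed
  have l1: "(\<lambda>n. \<integral>\<omega>. D.Q n i (cnt n \<omega>) \<partial>M) \<longlonglongrightarrow> e i" using e expectation_cnt(1) by simp
  have l2: "(\<lambda>n. \<integral>\<omega>. D.Q n i (cnt n \<omega>) * D.Q n k (cnt n \<omega>) \<partial>M) \<longlonglongrightarrow> g i k + e i * e k"
    unfolding E2 by (intro tendsto_intros g e)
  have m1: "AE \<omega> in M. mono (\<lambda>n. D.Q n i (cnt n \<omega>))" for i
    by (rule AE_I2) (rule Q_limit(2))
  have m2: "AE \<omega> in M. mono (\<lambda>n. D.Q n i (cnt n \<omega>) * D.Q n k (cnt n \<omega>))"
  proof (rule AE_I2)
    fix \<omega> assume "\<omega> \<in> space M"
    then show "mono (\<lambda>n. D.Q n i (cnt n \<omega>) * D.Q n k (cnt n \<omega>))"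
      using Q_limit(2)[of \<omega> i] Q_limit(2)[of \<omega> k] Q0 unfolding mono_def by (auto intro!: mult_mono)
  qed
  have t1: "AE \<omega> in M. (\<lambda>n. D.Q n i (cnt n \<omega>)) \<longlonglongrightarrow> Z i \<omega>" by (rule AE_I2) (rule Q_limit(1))
  have t2: "AE \<omega> in M. (\<lambda>n. D.Q n i (cnt n \<omega>) * D.Q n k (cnt n \<omega>)) \<longlonglongrightarrow> Z i \<omega> * Z k \<omega>"
    by (rule AE_I2) (intro tendsto_mult Q_limit(1))
  show "integrable M (Z i)" by (rule integrable_monotone_convergence[OF 1 m1 t1 l1 measurable_Z])
  show "(\<integral>\<omega>. Z i \<omega> \<partial>M) = e i" by (rule integral_monotone_convergence[OF 1 m1 t1 l1 measurable_Z])
  have mz: "(\<lambda>\<omega>. Z i \<omega> * Z k \<omega>) \<in> borel_measurable M" by measurable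
  show "integrable M (\<lambda>\<omega>. Z i \<omega> * Z k \<omega>)" by (rule integrable_monotone_convergence[OF 2 m2 t2 l2 mz])
  show "(\<integral>\<omega>. Z i \<omega> * Z k \<omega> \<partial>M) = g i k + e i * e k" by (rule integral_monotone_convergence[OF 2 m2 t2 l2 mz])
qed

lemma covariance_Z: "covariance M (\<lambda>\<omega>. Z i \<omega> - e i) (\<lambda>\<omega>. Z k \<omega> - e k) = g i k"
proof -
  note Zm = Z_moments
  have "(\<integral>\<omega>. Z i \<omega> - e i \<partial>M) = 0" for i using Zm(1,2)[of i] M.prob_space by simp
  then have "covariance M (\<lambda>\<omega>. Z i \<omega> - e i) (\<lambda>\<omega>. Z k \<omega> - e k)
      = (\<integral>\<omega>. Z i \<omega> * Z k \<omega> - e k * Z i \<omega> - e i * Z k \<omega> + e i * e k \<partial>M)"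
    unfolding covariance_def by (simp add: algebra_simps)
  also have "\<dots> = g i k" using Zm(1,2)[of i] Zm(1,2)[of k] Zm(3,4)[of i k] M.prob_space by simp
  finally show ?thesis .
qed

text \<open>Centring destroys monotonicity of \<open>V\<close>. But \<open>Q\<close> and its mean
  increase to \<open>Z\<close> and \<open>e\<close>, so every \<open>V\<close> is bounded by the sum
  of the Z_i + e_i; its square is integrable by the second moments, which matches the quadratic
  growth of \<open>h\<close>.\<close>

lemma expectation_limit:
  assumes h: "continuous_on UNIV h" "0 \<le> c" "\<And>x. \<bar>h x\<bar> \<le> c * (1 + norm x)\<^sup>2"
  shows "(\<lambda>n. D.E n (\<lambda>N. h (D.V n N))) \<longlonglongrightarrow> (\<integral>\<omega>. h (\<chi> i. Z i \<omega> - e i) \<partial>M)"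
proof -
  have e0: "0 \<le> e i" for i using Z_moments(2)[of i] Bochner_Integration.integral_nonneg[of M "Z i"] Z_nonneg by simp
  define G where "G \<omega> = 1 + (\<Sum>i\<in>UNIV. Z i \<omega> + e i)" for \<omega>
  have Q0: "0 \<le> D.Q n i N" for n i N
    unfolding D.Q_def by (intro mult_nonneg_nonneg sum_nonneg D.S_nonneg) auto
  have EQ0: "0 \<le> D.E n (D.Q n i)" for n i by (intro Bochner_Integration.integral_nonneg Q0)
  have Q_le: "D.Q n i (cnt n \<omega>) \<le> Z i \<omega>" if "\<omega> \<in> space M" for n i \<omega>
    by (rule incseq_le[OF Q_limit(2)[OF that] Q_limit(1)[OF that]])
  have EQ_le: "D.E n (D.Q n i) \<le> e i" for n i
  proof -
    have "D.E n (D.Q n i) = (\<integral>\<omega>. D.Q n i (cnt n \<omega>) \<partial>M)" by (rule expectation_cnt(1)[symmetric])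
    also have "\<dots> \<le> (\<integral>\<omega>. Z i \<omega> \<partial>M)"
      using expectation_cnt(2)[where n=n and H="D.Q n i"] D.integrable_pbounded[OF D.pbounded_Q]
      by (intro integral_mono Z_moments(1) Q_le) auto
    finally show ?thesis by (simp add: Z_moments(2))
  qed
  have "(\<lambda>n. \<integral>\<omega>. h (D.V n (cnt n \<omega>)) \<partial>M) \<longlonglongrightarrow> (\<integral>\<omega>. h (\<chi> i. Z i \<omega> - e i) \<partial>M)"
  proof (rule integral_dominated_convergence[where w="\<lambda>\<omega>. c * (G \<omega>)\<^sup>2"])
    have [measurable]: "h \<in> borel_measurable borel" using h(1) by (rule borel_measurable_continuous_onI)
    show lim: "AE \<omega> in M. (\<lambda>n. h (D.V n (cnt n \<omega>))) \<longlonglongrightarrow> h (\<chi> i. Z i \<omega> - e i)"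
    proof (rule AE_I2)
      fix \<omega> assume \<omega>: "\<omega> \<in> space M"
      have "(\<lambda>n. D.V n (cnt n \<omega>)) \<longlonglongrightarrow> (\<chi> i. Z i \<omega> - e i)"
        unfolding D.V_def by (intro tendsto_vec_lambda tendsto_diff Q_limit(1)[OF \<omega>] e)
      then show "(\<lambda>n. h (D.V n (cnt n \<omega>))) \<longlonglongrightarrow> h (\<chi> i. Z i \<omega> - e i)"
        using h(1) by (intro isCont_tendsto_compose[where g=h]) (auto simp: continuous_on_eq_continuous_at)
    qed
    show "(\<lambda>\<omega>. h (D.V n (cnt n \<omega>))) \<in> borel_measurable M" for n
      by (rule expectation_cnt(3))
    have "(\<lambda>\<omega>. (\<chi> i. Z i \<omega> - e i)) \<in> borel_measurable M"
      by (subst borel_measurable_euclidean_space) (auto simp: Basis_vec_def inner_axis)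
    then show "(\<lambda>\<omega>. h (\<chi> i. Z i \<omega> - e i)) \<in> borel_measurable M" by measurable
    have G_sq: "(G \<omega>)\<^sup>2 = (1 + (\<Sum>i\<in>UNIV. e i))\<^sup>2 + 2 * (1 + (\<Sum>i\<in>UNIV. e i)) * (\<Sum>i\<in>UNIV. Z i \<omega>) + (\<Sum>i\<in>UNIV. \<Sum>k\<in>UNIV. Z i \<omega> * Z k \<omega>)" for \<omega>
      unfolding G_def sum.distrib sum_product[symmetric] by (simp add: power2_eq_square algebra_simps)
    show "integrable M (\<lambda>\<omega>. c * (G \<omega>)\<^sup>2)"
      unfolding G_sq by (intro Bochner_Integration.integrable_mult_right Bochner_Integration.integrable_add
        Bochner_Integration.integrable_sum Z_moments M.integrable_const)
    show "AE \<omega> in M. norm (h (D.V n (cnt n \<omega>))) \<le> c * (G \<omega>)\<^sup>2" for n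
    proof (rule AE_I2)
      fix \<omega> assume \<omega>: "\<omega> \<in> space M"
      have "norm (D.V n (cnt n \<omega>)) \<le> (\<Sum>i\<in>UNIV. \<bar>D.V n (cnt n \<omega>) $ i\<bar>)" by (rule norm_le_l1_cart)
      also have "\<dots> \<le> (\<Sum>i\<in>UNIV. Z i \<omega> + e i)"
      proof (intro sum_mono)
        fix i show "\<bar>D.V n (cnt n \<omega>) $ i\<bar> \<le> Z i \<omega> + e i"
          using Q_le[OF \<omega>, of n i] EQ_le[of n i] Q0[of n i "cnt n \<omega>"] EQ0[of n i] Z_nonneg[OF \<omega>, of i] e0[of i]
          by (simp add: D.V_def abs_le_iff)
      qed
      finally have "1 + norm (D.V n (cnt n \<omega>)) \<le> G \<omega>" by (simp add: G_def)
      then have "c * (1 + norm (D.V n (cnt n \<omega>)))\<^sup>2 \<le> c * (G \<omega>)\<^sup>2"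
        using h(2) by (intro mult_left_mono power_mono) auto
      then show "norm (h (D.V n (cnt n \<omega>))) \<le> c * (G \<omega>)\<^sup>2" using h(3)[of "D.V n (cnt n \<omega>)"] by simp
    qed
  qed
  moreover have "(\<integral>\<omega>. h (D.V n (cnt n \<omega>)) \<partial>M) = D.E n (\<lambda>N. h (D.V n N))" for n
    by (rule expectation_cnt(1))
  ultimately show ?thesis by simp
qed

end

end

section \<open>Moments of the kernel and the limiting covariance\<close>

context poisson_edges
begin

definition radial :: "real \<Rightarrow> real" where
  "radial \<beta> = real DIM('a) * measure lborel (ball (0::'a) 1) / (real DIM('a) + \<beta>)"

text \<open>Integral against the intensity of the a-th power of the kernel around any point of the
  whole space. All row estimates reduce to it, because restriction to \<open>W i\<close> and passing
  to infima only decrease the kernel.\<close>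

definition mom :: "real \<Rightarrow> real" where
  "mom a = t * \<nu> powr a * radial (a * \<alpha>) * r powr (real DIM('a) + a * \<alpha>)"

lemma radial_nonneg: "- real DIM('a) < \<beta> \<Longrightarrow> 0 \<le> radial \<beta>"
  by (simp add: radial_def)

lemma mom_nonneg: "- real DIM('a) < a * \<alpha> \<Longrightarrow> 0 \<le> mom a"
  unfolding mom_def using t radial_nonneg by simp

text \<open>Reflection and translation invariance of Lebesgue measure remove x, and a radial
  integral remains.\<close>

lemma nn_integral_ker:
  assumes a: "0 < a" "- real DIM('a) < a * \<alpha>"
  shows "(\<integral>\<^sup>+y. ennreal ((\<nu> * ker x y) powr a) \<partial>\<Lambda>) = ennreal (mom a)"
proof -
  define G where "G z = ennreal (if 0 < norm (z::'a) \<and> norm z < r then norm z powr (a * \<alpha>) else 0)" for z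
  have [measurable]: "G \<in> borel_measurable borel" unfolding G_def by measurable
  have pw: "ennreal ((\<nu> * ker x y) powr a) = ennreal (\<nu> powr a) * G (x - y)" for y
  proof -
    have "(\<nu> * ker x y) powr a = \<nu> powr a * (if 0 < norm (x - y) \<and> norm (x - y) < r then norm (x - y) powr (a * \<alpha>) else 0)"
      by (simp add: ker_def powr_mult powr_powr mult.commute)
    then show ?thesis by (simp add: G_def ennreal_mult')
  qed
  have lb: "(lborel :: 'a measure) = density (distr lborel borel (\<lambda>z. x + (-1) *\<^sub>R z)) (\<lambda>_. ennreal (\<bar>- 1 :: real\<bar> ^ DIM('a)))"
    by (rule lborel_affine) simp
  have "(\<integral>\<^sup>+y. G (x - y) \<partial>lborel) = (\<integral>\<^sup>+y. G (x - y) \<partial>density (distr lborel borel (\<lambda>z. x + (-1) *\<^sub>R z)) (\<lambda>_. ennreal (\<bar>- 1 :: real\<bar> ^ DIM('a))))"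
    using lb by simp
  also have "\<dots> = (\<integral>\<^sup>+z. G z \<partial>lborel)"
    by (subst nn_integral_density, simp_all) (subst nn_integral_distr, simp_all)
  also have "\<dots> = ennreal (radial (a * \<alpha>) * r powr (real DIM('a) + a * \<alpha>))"
    unfolding G_def radial_def using nn_integral_radial_powr[OF a(2) r] by simp
  finally have 1: "(\<integral>\<^sup>+y. G (x - y) \<partial>lborel) = ennreal (radial (a * \<alpha>) * r powr (real DIM('a) + a * \<alpha>))" .
  have "(\<integral>\<^sup>+y. ennreal ((\<nu> * ker x y) powr a) \<partial>\<Lambda>) = ennreal t * (ennreal (\<nu> powr a) * (\<integral>\<^sup>+y. G (x - y) \<partial>lborel))"
    unfolding pw by (subst nn_integral_density, simp, simp) (simp add: nn_integral_cmult)
  also have "\<dots> = ennreal (mom a)"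
    unfolding 1 mom_def using t radial_nonneg[OF a(2)] by (simp add: ennreal_mult'[symmetric] mult.assoc)
  finally show ?thesis .
qed

lemma f_le: "f i x y \<le> \<nu> * ker x y"
  using \<nu> by (simp add: f_def ker_nonneg indicator_def)

lemma sum_cells_le:
  assumes x: "x \<in> A" and A: "A \<in> cells n" and a: "0 < a" "- real DIM('a) < a * \<alpha>"
    and \<psi>: "\<And>y. 0 \<le> \<psi> (cell n y)" "\<And>y. \<psi> (cell n y) \<le> (\<nu> * ker x y) powr a"
  shows "(\<Sum>B\<in>cells n. \<psi> B * rate B) \<le> mom a"
proof -
  have \<psi>0: "0 \<le> \<psi> B" if "B \<in> cells n" for B using \<psi>(1) that by (auto simp: cells_def)
  have "ennreal (\<Sum>B\<in>cells n. \<psi> B * rate B) = (\<Sum>B\<in>cells n. emeasure \<Lambda> B * ennreal (\<psi> B))"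
    using \<psi>0 by (simp add: sum_ennreal[symmetric] emeasure_\<Lambda>_cell ennreal_mult' rate_nonneg mult.commute del: sum_ennreal)
  also have "\<dots> = (\<integral>\<^sup>+y\<in>U. ennreal (\<psi> (cell n y)) \<partial>\<Lambda>)" by (rule sum_cells(1)) simp
  also have "\<dots> \<le> (\<integral>\<^sup>+y. ennreal ((\<nu> * ker x y) powr a) \<partial>\<Lambda>)"
    by (intro nn_integral_mono) (auto simp: indicator_def intro!: ennreal_leI \<psi>)
  also have "\<dots> = ennreal (mom a)" by (rule nn_integral_ker[OF a])
  finally show ?thesis using mom_nonneg[OF a(2)] by (simp add: ennreal_le_iff)
qed

lemma row_sum_le:
  assumes A: "A \<in> cells n" and a: "0 < a" "- real DIM('a) < a * \<alpha>"
  shows "(\<Sum>B\<in>cells n. fn i A B powr a * rate B) \<le> mom a"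
proof -
  obtain x where x: "x \<in> A" using cells_nonempty[OF A] by blast
  show ?thesis
  proof (rule sum_cells_le[OF x A a])
    fix y
    have "fn i A (cell n y) \<le> f i x y" by (rule fn_le[OF x cell_refl])
    then show "fn i A (cell n y) powr a \<le> (\<nu> * ker x y) powr a"
      using f_le[of i x y] fn_nonneg a by (intro powr_mono2) auto
  qed simp
qed

lemma sum_rate: "(\<Sum>A\<in>cells n. rate A) = t * measure lborel U"
proof -
  have "ennreal (\<Sum>A\<in>cells n. rate A) = (\<Sum>A\<in>cells n. emeasure \<Lambda> A * 1)"
    by (simp add: sum_ennreal[symmetric] emeasure_\<Lambda>_cell rate_nonneg del: sum_ennreal)
  also have "\<dots> = emeasure \<Lambda> U" by (subst sum_cells(1)) (simp_all add: nn_integral_indicator)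
  also have "\<dots> = ennreal (t * measure lborel U)" using emeasure_\<Lambda>[OF bounded_U borel_U] by (simp add: rate_def)
  finally show ?thesis using t by (simp add: ennreal_inj sum_nonneg rate_nonneg)
qed

lemma m_le:
  assumes "A \<in> cells n" "- real DIM('a) < \<alpha>" shows "D.m n i A \<le> mom 1"
  using row_sum_le[OF assms(1), of 1 i] assms(2) by (simp add: D.m_def fn_nonneg)

lemma m2_le:
  assumes "A \<in> cells n" "- real DIM('a) < 2 * \<alpha>"
  shows "(\<Sum>B\<in>cells n. (fn i A B)\<^sup>2 * rate B) \<le> mom 2"
  using row_sum_le[OF assms(1), of 2 i] assms(2) fn_nonneg by simp

text \<open>The Rosenthal-type bound for the row totals over all components. Every component is
  majorised by the same \<open>mom\<close>, so the number c of components enters through powers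
  only; their exponents are at most 4, and c ^ 5 is a common upper bound.\<close>

lemma remainder_le:
  assumes q: "0 < q" "q \<le> 1" and al: "- real DIM('a) < (2 + q) * \<alpha>"
  defines "c \<equiv> real CARD('m)"
  shows "(\<Sum>A\<in>cells n. rate A * D.E n (\<lambda>N. ((\<Sum>i\<in>UNIV. D.S n i A N) + (\<Sum>i\<in>UNIV. D.m n i A)) * (\<Sum>i\<in>UNIV. D.S n i A N) powr (1 + q)))
    \<le> t * measure lborel U * (10 * c ^ 5 * (mom 1 powr (2 + q) + mom 1 * mom (1 + q) + mom (2 + q)))"
proof -
  \<comment> \<open>For negative \<alpha> the largest exponent is the critical one; for \<alpha>
    \<ge> 0 all exponents are admissible.\<close>
  have al': "- real DIM('a) < a * \<alpha>" if "0 < a" "a \<le> 2 + q" for a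
  proof (cases "0 \<le> \<alpha>")
    case True
    then have "0 \<le> a * \<alpha>" using that by simp
    moreover have "0 < real DIM('a)" by simp
    ultimately show ?thesis by linarith
  next
    case False
    then have "(2 + q) * \<alpha> \<le> a * \<alpha>" using that by (intro mult_right_mono_neg) auto
    then show ?thesis using al by linarith
  qed
  have c1: "1 \<le> c" unfolding c_def by (simp add: Suc_le_eq)
  have "D.E n (\<lambda>N. ((\<Sum>i\<in>UNIV. D.S n i A N) + (\<Sum>i\<in>UNIV. D.m n i A)) * (\<Sum>i\<in>UNIV. D.S n i A N) powr (1 + q))
     \<le> 10 * c ^ 5 * (mom 1 powr (2 + q) + mom 1 * mom (1 + q) + mom (2 + q))" if A: "A \<in> cells n" for A
  proof -
    define b where "b B = (\<Sum>i\<in>UNIV. fn i A B)" for B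
    have b0: "0 \<le> b B" for B unfolding b_def by (intro sum_nonneg fn_nonneg)
    define \<mu> where "\<mu> = (\<Sum>B\<in>cells n. b B * rate B)"
    define \<rho> where "\<rho> a = (\<Sum>B\<in>cells n. b B powr a * rate B)" for a
    have S: "(\<Sum>i\<in>UNIV. D.S n i A N) = (\<Sum>B\<in>cells n. b B * real (N B))" for N
      unfolding D.S_def b_def sum_distrib_right by (rule sum.swap)
    have m: "(\<Sum>i\<in>UNIV. D.m n i A) = \<mu>"
      unfolding D.m_def b_def \<mu>_def sum_distrib_right by (rule sum.swap)
    have \<mu>0: "0 \<le> \<mu>" unfolding \<mu>_def by (intro sum_nonneg mult_nonneg_nonneg b0 rate_nonneg)
    have \<mu>: "\<mu> \<le> c * mom 1"
      unfolding m[symmetric] c_def using sum_bounded_above[of UNIV "\<lambda>i. D.m n i A" "mom 1"] m_le[OF A] al'[of 1] q by simp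
    have \<rho>: "\<rho> a \<le> c powr (a + 1) * mom a" if a: "0 < a" "a \<le> 2 + q" for a
    proof -
      \<comment> \<open>A sum of c terms is at most c times the largest, whose power is among the
        summands on the right.\<close>
      have "b B powr a \<le> c powr a * (\<Sum>i\<in>UNIV. fn i A B powr a)" for B
      proof -
        have "Max (range (\<lambda>i. fn i A B)) \<in> range (\<lambda>i. fn i A B)" by (rule Max_in) auto
        then obtain k where k: "Max (range (\<lambda>i. fn i A B)) = fn k A B" by (rule rangeE)
        have "fn i A B \<le> fn k A B" for i unfolding k[symmetric] by (rule Max_ge) auto
        then have "b B \<le> c * fn k A B"
          unfolding b_def c_def using sum_bounded_above[of UNIV "\<lambda>i. fn i A B" "fn k A B"] by simp
        then have "b B powr a \<le> (c * fn k A B) powr a" using a b0 by (intro powr_mono2) auto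
        also have "\<dots> = c powr a * fn k A B powr a" by (rule powr_mult)
        also have "\<dots> \<le> c powr a * (\<Sum>i\<in>UNIV. fn i A B powr a)"
          by (intro mult_left_mono member_le_sum) auto
        finally show ?thesis .
      qed
      then have "\<rho> a \<le> (\<Sum>B\<in>cells n. (c powr a * (\<Sum>i\<in>UNIV. fn i A B powr a)) * rate B)"
        unfolding \<rho>_def by (intro sum_mono mult_right_mono rate_nonneg)
      also have "\<dots> = c powr a * (\<Sum>B\<in>cells n. \<Sum>i\<in>UNIV. fn i A B powr a * rate B)"
        by (simp add: sum_distrib_left sum_distrib_right mult.assoc)
      also have "\<dots> = c powr a * (\<Sum>i\<in>UNIV. \<Sum>B\<in>cells n. fn i A B powr a * rate B)"
        by (subst sum.swap) simp
      also have "\<dots> \<le> c powr a * (c * mom a)"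
        unfolding c_def using sum_bounded_above[of UNIV "\<lambda>i. \<Sum>B\<in>cells n. fn i A B powr a * rate B" "mom a"]
          row_sum_le[OF A a(1) al'[OF a]] by (intro mult_left_mono) auto
      also have "\<dots> = c powr (a + 1) * mom a" using c1 by (simp add: powr_add)
      finally show ?thesis .
    qed
    have c_le: "c powr a \<le> c ^ 5" if "a \<le> 5" for a
    proof -
      have "c powr a \<le> c powr 5" using that c1 by (intro powr_mono) auto
      then show ?thesis using c1 by (simp add: powr_numeral)
    qed
    have m0: "0 \<le> mom a" if "0 < a" "a \<le> 2 + q" for a using mom_nonneg al'[OF that] by simp
    have "D.E n (\<lambda>N. ((\<Sum>i\<in>UNIV. D.S n i A N) + (\<Sum>i\<in>UNIV. D.m n i A)) * (\<Sum>i\<in>UNIV. D.S n i A N) powr (1 + q))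
      \<le> 10 * \<mu> powr (2 + q) + 5 * (\<mu> * \<rho> (1 + q)) + 4 * \<rho> (2 + q)"
      unfolding S m unfolding \<mu>_def \<rho>_def by (rule D.rosenthal_inequality[where n=n and b=b, OF b0 q])
    also have "\<mu> powr (2 + q) \<le> c ^ 5 * mom 1 powr (2 + q)"
    proof -
      have "\<mu> powr (2 + q) \<le> (c * mom 1) powr (2 + q)" using \<mu> \<mu>0 q by (intro powr_mono2) auto
      also have "\<dots> = c powr (2 + q) * mom 1 powr (2 + q)" by (rule powr_mult)
      also have "\<dots> \<le> c ^ 5 * mom 1 powr (2 + q)" using q by (intro mult_right_mono c_le) auto
      finally show ?thesis .
    qed
    also have "\<mu> * \<rho> (1 + q) \<le> c ^ 5 * (mom 1 * mom (1 + q))"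
    proof -
      have "\<mu> * \<rho> (1 + q) \<le> (c * mom 1) * (c powr (1 + q + 1) * mom (1 + q))"
      proof (rule mult_mono)
        show "\<mu> \<le> c * mom 1" by (rule \<mu>)
        show "\<rho> (1 + q) \<le> c powr (1 + q + 1) * mom (1 + q)" using q by (intro \<rho>) auto
        show "0 \<le> c * mom 1" using \<mu> \<mu>0 by linarith
        show "0 \<le> \<rho> (1 + q)" unfolding \<rho>_def by (intro sum_nonneg mult_nonneg_nonneg rate_nonneg) simp
      qed
      also have "\<dots> = (c * c powr (2 + q)) * (mom 1 * mom (1 + q))" by (simp add: ac_simps)
      also have "\<dots> = c powr (3 + q) * (mom 1 * mom (1 + q))"
        using powr_mult_base[of c "2 + q"] c1 by (simp add: add.assoc)
      also have "\<dots> \<le> c ^ 5 * (mom 1 * mom (1 + q))" using q m0[of 1] m0[of "1 + q"] by (intro mult_right_mono c_le) auto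
      finally show ?thesis .
    qed
    also have "\<rho> (2 + q) \<le> c ^ 5 * mom (2 + q)"
    proof -
      have "\<rho> (2 + q) \<le> c powr (2 + q + 1) * mom (2 + q)" using q by (intro \<rho>) auto
      also have "\<dots> \<le> c ^ 5 * mom (2 + q)" using q m0[of "2 + q"] by (intro mult_right_mono c_le) auto
      finally show ?thesis .
    qed
    finally have "D.E n (\<lambda>N. ((\<Sum>i\<in>UNIV. D.S n i A N) + (\<Sum>i\<in>UNIV. D.m n i A)) * (\<Sum>i\<in>UNIV. D.S n i A N) powr (1 + q))
      \<le> 10 * (c ^ 5 * mom 1 powr (2 + q)) + 5 * (c ^ 5 * (mom 1 * mom (1 + q))) + 4 * (c ^ 5 * mom (2 + q))" by simp
    moreover have "0 \<le> c ^ 5 * (mom 1 * mom (1 + q))" "0 \<le> c ^ 5 * mom (2 + q)"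
      using c1 m0[of 1] m0[of "1 + q"] m0[of "2 + q"] q by auto
    ultimately show ?thesis by (simp add: distrib_left)
  qed
  then have "(\<Sum>A\<in>cells n. rate A * D.E n (\<lambda>N. ((\<Sum>i\<in>UNIV. D.S n i A N) + (\<Sum>i\<in>UNIV. D.m n i A)) * (\<Sum>i\<in>UNIV. D.S n i A N) powr (1 + q)))
     \<le> (\<Sum>A\<in>cells n. rate A * (10 * c ^ 5 * (mom 1 powr (2 + q) + mom 1 * mom (1 + q) + mom (2 + q))))"
    by (intro sum_mono mult_left_mono rate_nonneg)
  then show ?thesis by (simp add: sum_distrib_right[symmetric] sum_rate)
qed

text \<open>Density of the limiting covariance with respect to the intensity: the limit of the
  summand of \<open>\<gamma>\<close> at the cell of x.\<close>

definition \<Theta> :: "'m \<Rightarrow> 'm \<Rightarrow> 'a \<Rightarrow> ennreal" where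
  "\<Theta> i k x = row \<Lambda> i x * row \<Lambda> k x + (\<integral>\<^sup>+y\<in>U. ennreal (1/2 * (f i x y * f k x y)) \<partial>\<Lambda>)"

definition g :: "'m \<Rightarrow> 'm \<Rightarrow> real" where
  "g i k = enn2real (\<integral>\<^sup>+x\<in>U. \<Theta> i k x \<partial>\<Lambda>)"

definition e :: "'m \<Rightarrow> real" where
  "e i = 1/2 * enn2real (\<integral>\<^sup>+x\<in>U. row \<Lambda> i x \<partial>\<Lambda>)"

text \<open>The value of the covariance density at points whose r-ball lies in both sets, the same
  for all pairs of sets; elsewhere it is an upper bound.\<close>

definition \<Phi> :: real where "\<Phi> = (mom 1)\<^sup>2 + 1/2 * mom 2"

context
  assumes alpha: "- real DIM('a) / 2 < \<alpha>"
begin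

lemma alpha1: "- real DIM('a) < \<alpha>" and alpha2: "- real DIM('a) < 2 * \<alpha>"
proof -
  have "0 < real DIM('a)" by simp
  then show "- real DIM('a) < \<alpha>" "- real DIM('a) < 2 * \<alpha>" using alpha by linarith+
qed

lemma mom12_nonneg: "0 \<le> mom 1" "0 \<le> mom 2"
  using alpha1 alpha2 by (auto intro!: mom_nonneg)

lemma row_le: "row \<Lambda> i x \<le> ennreal (mom 1) * indicator (W i) x"
proof (cases "x \<in> W i")
  case True
  have "row \<Lambda> i x \<le> (\<integral>\<^sup>+y. ennreal ((\<nu> * ker x y) powr 1) \<partial>\<Lambda>)"
    unfolding row_def using f_le[of i x] \<nu> ker_nonneg
    by (intro nn_integral_mono) (auto simp: indicator_def intro!: ennreal_leI)
  then show ?thesis using True nn_integral_ker[of 1 x] alpha1 by simp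
next
  case False
  then show ?thesis by (simp add: row_def f_def)
qed

lemma cross_le:
  "(\<integral>\<^sup>+y\<in>U. ennreal (1/2 * (f i x y * f k x y)) \<partial>\<Lambda>) \<le> ennreal (1/2 * mom 2) * indicator (W i \<inter> W k) x"
proof (cases "x \<in> W i \<inter> W k")
  case True
  have "(\<integral>\<^sup>+y\<in>U. ennreal (1/2 * (f i x y * f k x y)) \<partial>\<Lambda>) \<le> (\<integral>\<^sup>+y. ennreal (1/2) * ennreal ((\<nu> * ker x y) powr 2) \<partial>\<Lambda>)"
  proof (intro nn_integral_mono)
    fix y
    have "f i x y * f k x y \<le> (\<nu> * ker x y) * (\<nu> * ker x y)"
      using f_le[of i x y] f_le[of k x y] f_nonneg \<nu> ker_nonneg by (intro mult_mono) auto
    then have "1/2 * (f i x y * f k x y) \<le> 1/2 * (\<nu> * ker x y) powr 2"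
      using \<nu> ker_nonneg[of x y] by (simp add: power2_eq_square)
    then have "ennreal (1/2 * (f i x y * f k x y)) * indicator U y \<le> ennreal (1/2 * (\<nu> * ker x y) powr 2)"
      by (auto simp: indicator_def intro!: ennreal_leI)
    also have "\<dots> = ennreal (1/2) * ennreal ((\<nu> * ker x y) powr 2)" by (rule ennreal_mult') simp
    finally show "ennreal (1/2 * (f i x y * f k x y)) * indicator U y \<le> ennreal (1/2) * ennreal ((\<nu> * ker x y) powr 2)" .
  qed
  also have "\<dots> = ennreal (1/2) * ennreal (mom 2)"
    using nn_integral_ker[of 2 x] alpha2 by (subst nn_integral_cmult) simp_all
  also have "\<dots> = ennreal (1/2 * mom 2)" by (rule ennreal_mult'[symmetric]) simp
  finally show ?thesis using True by simp
next
  case False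
  then have "f i x y * f k x y = 0" for y by (auto simp: f_def)
  then show ?thesis by (simp only:) simp
qed

lemma \<Theta>_le: "\<Theta> i k x \<le> ennreal \<Phi> * indicator (W i \<inter> W k) x"
proof -
  have "row \<Lambda> i x * row \<Lambda> k x \<le> (ennreal (mom 1) * indicator (W i) x) * (ennreal (mom 1) * indicator (W k) x)"
    by (intro mult_mono row_le) auto
  also have "\<dots> = ennreal ((mom 1)\<^sup>2) * indicator (W i \<inter> W k) x"
    using mom12_nonneg by (auto simp: indicator_def ennreal_mult'[symmetric] power2_eq_square)
  finally have "\<Theta> i k x \<le> ennreal ((mom 1)\<^sup>2) * indicator (W i \<inter> W k) x + ennreal (1/2 * mom 2) * indicator (W i \<inter> W k) x"
    unfolding \<Theta>_def by (intro add_mono cross_le)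
  then show ?thesis using mom12_nonneg by (simp add: \<Phi>_def distrib_right[symmetric] ennreal_plus[symmetric] del: ennreal_plus)
qed

lemma \<Theta>_eq:
  assumes x: "ball x r \<subseteq> W i \<inter> W k" shows "\<Theta> i k x = ennreal \<Phi>"
proof -
  have xW: "x \<in> W i" "x \<in> W k" using x r by auto
  have f: "f i x y * indicator U y = \<nu> * ker x y" "f k x y * indicator U y = \<nu> * ker x y" for y
  proof -
    have "y \<in> W i \<and> y \<in> W k \<and> y \<in> U" if "ker x y \<noteq> 0"
    proof -
      have "y \<in> ball x r" using that by (auto simp: ker_def dist_norm split: if_splits)
      then show ?thesis using x by (auto simp: U_def)
    qed
    then show "f i x y * indicator U y = \<nu> * ker x y" "f k x y * indicator U y = \<nu> * ker x y"
      using xW by (cases "ker x y = 0", auto simp: f_def)+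
  qed
  have row: "row \<Lambda> j x = ennreal (mom 1)" if "\<And>y. f j x y * indicator U y = \<nu> * ker x y" for j
  proof -
    have "row \<Lambda> j x = (\<integral>\<^sup>+y. ennreal ((\<nu> * ker x y) powr 1) \<partial>\<Lambda>)"
      unfolding row_def
    proof (intro nn_integral_cong)
      fix y
      have "ennreal (f j x y) * indicator U y = ennreal (f j x y * indicator U y)" by (simp add: indicator_def)
      then show "ennreal (f j x y) * indicator U y = ennreal ((\<nu> * ker x y) powr 1)"
        using that \<nu> ker_nonneg[of x y] by simp
    qed
    then show ?thesis using nn_integral_ker[of 1 x] alpha1 by simp
  qed
  have "(\<integral>\<^sup>+y\<in>U. ennreal (1/2 * (f i x y * f k x y)) \<partial>\<Lambda>) = (\<integral>\<^sup>+y. ennreal (1/2) * ennreal ((\<nu> * ker x y) powr 2) \<partial>\<Lambda>)"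
  proof (intro nn_integral_cong)
    fix y
    have "ennreal (1/2 * (f i x y * f k x y)) * indicator U y = ennreal (1/2 * ((f i x y * indicator U y) * (f k x y * indicator U y)))"
      by (simp add: indicator_def)
    also have "\<dots> = ennreal (1/2 * (\<nu> * ker x y) powr 2)"
      unfolding f using \<nu> ker_nonneg[of x y] by (simp add: power2_eq_square)
    also have "\<dots> = ennreal (1/2) * ennreal ((\<nu> * ker x y) powr 2)" by (rule ennreal_mult') simp
    finally show "ennreal (1/2 * (f i x y * f k x y)) * indicator U y = ennreal (1/2) * ennreal ((\<nu> * ker x y) powr 2)" .
  qed
  also have "\<dots> = ennreal (1/2) * ennreal (mom 2)"
    using nn_integral_ker[of 2 x] alpha2 by (subst nn_integral_cmult) simp_all
  also have "\<dots> = ennreal (1/2 * mom 2)" by (rule ennreal_mult'[symmetric]) simp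
  finally show ?thesis
    using mom12_nonneg row[OF f(1)] row[OF f(2)]
    by (simp add: \<Theta>_def \<Phi>_def ennreal_mult'[symmetric] power2_eq_square ennreal_plus[symmetric] del: ennreal_plus)
qed

lemma emeasure_\<Lambda>_U: "emeasure \<Lambda> U < \<infinity>"
  using emeasure_\<Lambda>[OF bounded_U borel_U] by simp

text \<open>Monotone convergence over the inner and the outer cell. Finiteness of the row integrals
  makes the product of two limits in the extended reals unproblematic.\<close>

lemma \<gamma>_limit: "(\<lambda>n. ennreal (D.\<gamma> n i k)) \<longlonglongrightarrow> (\<integral>\<^sup>+x\<in>U. \<Theta> i k x \<partial>\<Lambda>)"
proof -
  have sets: "sets \<Lambda> = sets borel" by simp
  define \<psi> where "\<psi> n A = (\<Sum>B\<in>cells n. emeasure \<Lambda> B * ennreal (fn i A B)) * (\<Sum>B\<in>cells n. emeasure \<Lambda> B * ennreal (fn k A B))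
      + (\<Sum>B\<in>cells n. emeasure \<Lambda> B * ennreal (1/2 * (fn i A B * fn k A B)))" for n A
  have eq: "ennreal (D.\<gamma> n i k) = (\<Sum>A\<in>cells n. emeasure \<Lambda> A * \<psi> n A)" for n
  proof -
    have 1: "(\<Sum>B\<in>cells n. emeasure \<Lambda> B * ennreal (fn j A B)) = ennreal (D.m n j A)" for j A
      unfolding D.m_def
      by (simp add: emeasure_\<Lambda>_cell ennreal_mult'[symmetric] rate_nonneg fn_nonneg sum_ennreal mult.commute)
    have 2: "(\<Sum>B\<in>cells n. emeasure \<Lambda> B * ennreal (1/2 * (fn i A B * fn k A B))) = ennreal (1/2 * (\<Sum>B\<in>cells n. fn i A B * fn k A B * rate B))" for A
    proof -
      have "(\<Sum>B\<in>cells n. emeasure \<Lambda> B * ennreal (1/2 * (fn i A B * fn k A B))) = (\<Sum>B\<in>cells n. ennreal (rate B * (1/2 * (fn i A B * fn k A B))))"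
      proof (intro sum.cong refl)
        fix B assume "B \<in> cells n"
        then show "emeasure \<Lambda> B * ennreal (1/2 * (fn i A B * fn k A B)) = ennreal (rate B * (1/2 * (fn i A B * fn k A B)))"
          unfolding ennreal_mult'[OF rate_nonneg] by (simp only: emeasure_\<Lambda>_cell)
      qed
      also have "\<dots> = ennreal (\<Sum>B\<in>cells n. rate B * (1/2 * (fn i A B * fn k A B)))"
        by (intro sum_ennreal) (simp add: rate_nonneg fn_nonneg)
      finally show ?thesis by (simp add: sum_distrib_left ac_simps)
    qed
    have "\<psi> n A = ennreal (D.m n i A * D.m n k A + 1/2 * (\<Sum>B\<in>cells n. fn i A B * fn k A B * rate B))" for A
      unfolding \<psi>_def 1 2
      by (subst ennreal_mult'[symmetric], simp add: D.m_nonneg, subst ennreal_plus[symmetric])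
         (auto intro!: mult_nonneg_nonneg sum_nonneg fn_nonneg rate_nonneg D.m_nonneg)
    then have "(\<Sum>A\<in>cells n. emeasure \<Lambda> A * \<psi> n A) = (\<Sum>A\<in>cells n. ennreal (rate A * (D.m n i A * D.m n k A + 1/2 * (\<Sum>B\<in>cells n. fn i A B * fn k A B * rate B))))"
      by (intro sum.cong refl) (simp add: emeasure_\<Lambda>_cell ennreal_mult' rate_nonneg)
    also have "\<dots> = ennreal (D.\<gamma> n i k)"
      unfolding D.\<gamma>_def
      by (intro sum_ennreal mult_nonneg_nonneg add_nonneg_nonneg sum_nonneg) (auto simp: rate_nonneg fn_nonneg D.m_nonneg)
    finally show ?thesis ..
  qed
  have c1: "incseq (\<lambda>n. ennreal (1/2 * (fn i (cell n x) (cell n y) * fn k (cell n x) (cell n y))))" for x y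
    using fn_incseq[of i x y] fn_incseq[of k x y] fn_nonneg unfolding incseq_def
    by (auto intro!: ennreal_leI mult_mono divide_right_mono)
  have c2: "(\<lambda>n. ennreal (1/2 * (fn i (cell n x) (cell n y) * fn k (cell n x) (cell n y)))) \<longlonglongrightarrow> ennreal (1/2 * (f i x y * f k x y))" for x y
    by (intro tendsto_ennrealI tendsto_intros fn_tendsto)
  have c3: "(\<lambda>n. \<Sum>B\<in>cells n. emeasure \<Lambda> B * ennreal (1/2 * (fn i (cell n x) B * fn k (cell n x) B))) \<longlonglongrightarrow> (\<integral>\<^sup>+y\<in>U. ennreal (1/2 * (f i x y * f k x y)) \<partial>\<Lambda>)"
    and c4: "incseq (\<lambda>n. \<Sum>B\<in>cells n. emeasure \<Lambda> B * ennreal (1/2 * (fn i (cell n x) B * fn k (cell n x) B)))" for x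
    using sum_cells_limit(1,2)[OF sets, where \<psi>="\<lambda>n B. ennreal (1/2 * (fn i (cell n x) B * fn k (cell n x) B))" and \<Psi>="\<lambda>y. ennreal (1/2 * (f i x y * f k x y))"] c1 c2
    by blast+
  have fin: "row \<Lambda> j x \<noteq> \<top>" for j x
  proof -
    have "row \<Lambda> j x \<le> ennreal (mom 1) * 1" by (rule order.trans[OF row_le]) (intro mult_left_mono, auto simp: indicator_def)
    then show ?thesis by (auto simp: top_unique)
  qed
  have inc: "incseq (\<lambda>n. \<psi> n (cell n x))" for x
    using row_limit(2)[OF sets, of i x] row_limit(2)[OF sets, of k x] c4[of x]
    unfolding \<psi>_def incseq_def by (auto intro!: add_mono mult_mono)
  have lim: "(\<lambda>n. \<psi> n (cell n x)) \<longlonglongrightarrow> \<Theta> i k x" for x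
    unfolding \<psi>_def \<Theta>_def
    by (intro tendsto_add tendsto_mult_ennreal row_limit(1)[OF sets] c3) (auto simp: fin)
  note L = sum_cells_limit[OF sets, where \<psi>=\<psi> and \<Psi>="\<Theta> i k", OF inc lim]
  show "(\<lambda>n. ennreal (D.\<gamma> n i k)) \<longlonglongrightarrow> (\<integral>\<^sup>+x\<in>U. \<Theta> i k x \<partial>\<Lambda>)" unfolding eq by (rule L(1))
qed

lemma \<gamma>_nonneg: "0 \<le> D.\<gamma> n i k"
  unfolding D.\<gamma>_def by (intro sum_nonneg mult_nonneg_nonneg add_nonneg_nonneg) (auto intro!: sum_nonneg simp: rate_nonneg fn_nonneg D.m_nonneg)

lemma \<Phi>_nonneg: "0 \<le> \<Phi>" using mom12_nonneg by (simp add: \<Phi>_def)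

lemma \<Theta>_integral_le: "(\<integral>\<^sup>+x\<in>U. \<Theta> i k x \<partial>\<Lambda>) \<le> ennreal (t * \<Phi> * measure lborel (W i \<inter> W k))"
proof -
  have Wb: "W i \<inter> W k \<in> sets borel" "bounded (W i \<inter> W k)" using borel_W bounded_W by (auto simp: bounded_Int)
  have "(\<integral>\<^sup>+x\<in>U. \<Theta> i k x \<partial>\<Lambda>) \<le> (\<integral>\<^sup>+x. ennreal \<Phi> * indicator (W i \<inter> W k) x \<partial>\<Lambda>)"
  proof (intro nn_integral_mono)
    fix x
    have "\<Theta> i k x * indicator U x \<le> \<Theta> i k x * 1" by (intro mult_left_mono) (auto simp: indicator_def)
    then show "\<Theta> i k x * indicator U x \<le> ennreal \<Phi> * indicator (W i \<inter> W k) x"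
      using \<Theta>_le[of i k x] by simp
  qed
  also have "\<dots> = ennreal \<Phi> * emeasure \<Lambda> (W i \<inter> W k)" using Wb by (subst nn_integral_cmult_indicator) auto
  also have "\<dots> = ennreal (t * \<Phi> * measure lborel (W i \<inter> W k))"
    using emeasure_\<Lambda>[OF Wb(2,1)] \<Phi>_nonneg t by (simp add: rate_def ennreal_mult'[symmetric] ac_simps)
  finally show ?thesis .
qed

lemma \<gamma>_tendsto: "(\<lambda>n. D.\<gamma> n i k) \<longlonglongrightarrow> g i k"
proof -
  have fin: "(\<integral>\<^sup>+x\<in>U. \<Theta> i k x \<partial>\<Lambda>) \<noteq> \<top>"
    using le_less_trans[OF \<Theta>_integral_le[of i k] ennreal_less_top] by simp
  then have "(\<lambda>n. ennreal (D.\<gamma> n i k)) \<longlonglongrightarrow> ennreal (g i k)"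
    using \<gamma>_limit[of i k] by (simp add: g_def less_top)
  then show ?thesis by (subst (asm) tendsto_ennreal_iff) (auto simp: \<gamma>_nonneg g_def)
qed

lemma EQ_tendsto: "(\<lambda>n. D.E n (D.Q n i)) \<longlonglongrightarrow> e i"
proof -
  have sets: "sets \<Lambda> = sets borel" by simp
  have eq: "(\<Sum>A\<in>cells n. emeasure \<Lambda> A * (\<Sum>B\<in>cells n. emeasure \<Lambda> B * ennreal (fn i A B))) = ennreal (2 * D.E n (D.Q n i))" for n
  proof -
    have "(\<Sum>B\<in>cells n. emeasure \<Lambda> B * ennreal (fn i A B)) = ennreal (D.m n i A)" for A
      unfolding D.m_def
      by (simp add: emeasure_\<Lambda>_cell ennreal_mult'[symmetric] rate_nonneg fn_nonneg sum_ennreal mult.commute)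
    then have "(\<Sum>A\<in>cells n. emeasure \<Lambda> A * (\<Sum>B\<in>cells n. emeasure \<Lambda> B * ennreal (fn i A B))) = (\<Sum>A\<in>cells n. ennreal (rate A * D.m n i A))"
      by (simp add: emeasure_\<Lambda>_cell ennreal_mult' rate_nonneg)
    then show ?thesis by (simp add: D.E_Q sum_ennreal rate_nonneg D.m_nonneg)
  qed
  have EQ0: "0 \<le> D.E n (D.Q n i)" for n
    unfolding D.E_Q by (intro mult_nonneg_nonneg sum_nonneg) (auto simp: rate_nonneg D.m_nonneg)
  have "(\<integral>\<^sup>+x\<in>U. row \<Lambda> i x \<partial>\<Lambda>) \<le> (\<integral>\<^sup>+x. ennreal (mom 1) * indicator U x \<partial>\<Lambda>)"
  proof (intro nn_integral_mono)
    fix x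
    have "row \<Lambda> i x \<le> ennreal (mom 1) * 1" by (rule order.trans[OF row_le]) (intro mult_left_mono, auto simp: indicator_def)
    then show "row \<Lambda> i x * indicator U x \<le> ennreal (mom 1) * indicator U x" by (simp add: mult_right_mono)
  qed
  also have "\<dots> = ennreal (mom 1) * emeasure \<Lambda> U" by (subst nn_integral_cmult_indicator) auto
  also have "\<dots> < \<infinity>" using emeasure_\<Lambda>_U by (simp add: ennreal_mult_less_top)
  finally have fin: "(\<integral>\<^sup>+x\<in>U. row \<Lambda> i x \<partial>\<Lambda>) < \<top>" by simp
  have "(\<lambda>n. ennreal (2 * D.E n (D.Q n i))) \<longlonglongrightarrow> ennreal (2 * e i)"
    using double_sum_limit(1)[OF sets, of i] fin unfolding eq by (simp add: e_def)
  then have "(\<lambda>n. 2 * D.E n (D.Q n i)) \<longlonglongrightarrow> 2 * e i"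
    using EQ0 by (subst (asm) tendsto_ennreal_iff) (auto simp: e_def)
  from tendsto_mult[OF tendsto_const[of "1/2"] this] show ?thesis by simp
qed

text \<open>The covariance density equals \<open>\<Phi>\<close> on the inner set \<open>G\<close>,
  is at most \<open>\<Phi>\<close> on the intersection and vanishes outside; so only points near the
  boundary cause an error.\<close>

lemma g_bounds:
  assumes G: "G \<in> sets borel" "G \<subseteq> W i \<inter> W k" "\<And>x. x \<in> G \<Longrightarrow> ball x r \<subseteq> W i \<inter> W k"
  shows "g i k \<le> t * \<Phi> * measure lborel (W i \<inter> W k)" "t * \<Phi> * measure lborel G \<le> g i k"
proof -
  show "g i k \<le> t * \<Phi> * measure lborel (W i \<inter> W k)"
    unfolding g_def using t \<Phi>_nonneg by (intro enn2real_leI \<Theta>_integral_le) simp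
  have Gb: "bounded G" using bounded_W[of i] G(2) by (meson bounded_subset inf.boundedE)
  have fin: "(\<integral>\<^sup>+x\<in>U. \<Theta> i k x \<partial>\<Lambda>) < \<top>"
    by (rule le_less_trans[OF \<Theta>_integral_le ennreal_less_top])
  have "ennreal (t * \<Phi> * measure lborel G) = ennreal \<Phi> * emeasure \<Lambda> G"
    using emeasure_\<Lambda>[OF Gb G(1)] \<Phi>_nonneg t by (simp add: rate_def ennreal_mult'[symmetric] ac_simps)
  also have "\<dots> = (\<integral>\<^sup>+x. ennreal \<Phi> * indicator G x \<partial>\<Lambda>)" using G(1) by (subst nn_integral_cmult_indicator) auto
  also have "\<dots> \<le> (\<integral>\<^sup>+x\<in>U. \<Theta> i k x \<partial>\<Lambda>)"
  proof (intro nn_integral_mono)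
    fix x show "ennreal \<Phi> * indicator G x \<le> \<Theta> i k x * indicator U x"
      using G(2) \<Theta>_eq[OF G(3), of x] by (auto simp: indicator_def U_def)
  qed
  also have "\<dots> = ennreal (g i k)" unfolding g_def using fin by simp
  finally show "t * \<Phi> * measure lborel G \<le> g i k" by (simp add: ennreal_le_iff g_def)
qed

text \<open>Apart from the covariance error, whose limit is known, the bound for the finite model is
  uniform in the level n; so n tends to infinity on both sides.\<close>

lemma normal_approximation:
  fixes A C :: "real ^ 'm ^ 'm"
  assumes reg: "regular c A h" and C: "\<And>i j. C $ i $ j = (\<Sum>p\<in>UNIV. A $ i $ p * A $ j $ p)"
    and q: "0 < q" "q \<le> 1" and al: "- real DIM('a) < (2 + q) * \<alpha>" and c: "0 \<le> c"
  shows "\<bar>(\<integral>\<omega>. h (\<chi> i. Z i \<omega> - e i) \<partial>M) - (\<integral>z. h (A *v z) \<partial>gauss)\<bar>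
    \<le> pi / 2 * ((\<Sum>i\<in>UNIV. \<Sum>k\<in>UNIV. sqrt (t * measure lborel U) * (3/2 * (mom 1)\<^sup>2 + mom 1 * sqrt (mom 2) + mom 2) + \<bar>g i k - C $ i $ k\<bar>)
        + c powr q * (t * measure lborel U * (10 * real CARD('m) ^ 5 * (mom 1 powr (2 + q) + mom 1 * mom (1 + q) + mom (2 + q)))))"
    (is "_ \<le> pi / 2 * ((\<Sum>i\<in>UNIV. \<Sum>k\<in>UNIV. ?b + \<bar>g i k - C $ i $ k\<bar>) + c powr q * ?R)")
proof -
  obtain c' where c': "0 \<le> c'" "\<And>x. \<bar>h x\<bar> \<le> c' * (1 + norm x)\<^sup>2" using regular_growth(2)[OF reg] by blast
  show ?thesis
  proof (rule tendsto_le[OF sequentially_bot])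
    show "(\<lambda>n. \<bar>D.E n (\<lambda>N. h (D.V n N)) - (\<integral>z. h (A *v z) \<partial>gauss)\<bar>) \<longlonglongrightarrow> \<bar>(\<integral>\<omega>. h (\<chi> i. Z i \<omega> - e i) \<partial>M) - (\<integral>z. h (A *v z) \<partial>gauss)\<bar>"
      by (intro tendsto_intros expectation_limit[OF \<gamma>_tendsto EQ_tendsto regular_growth(1)[OF reg] c'])
    show "(\<lambda>n. pi / 2 * ((\<Sum>i\<in>UNIV. \<Sum>k\<in>UNIV. ?b + \<bar>D.\<gamma> n i k - C $ i $ k\<bar>) + c powr q * ?R))
        \<longlonglongrightarrow> pi / 2 * ((\<Sum>i\<in>UNIV. \<Sum>k\<in>UNIV. ?b + \<bar>g i k - C $ i $ k\<bar>) + c powr q * ?R)"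
      by (intro tendsto_intros \<gamma>_tendsto)
    \<comment> \<open>Eventually all cells have rate at most 1, which the bound on the fluctuation
      of \<open>\<Gamma>\<close> demands.\<close>
    have "\<forall>\<^sub>F n in sequentially. \<forall>A\<in>cells n. measure lborel A \<le> 1 / t" using t by (intro measure_cells_null) simp
    then show "\<forall>\<^sub>F n in sequentially. \<bar>D.E n (\<lambda>N. h (D.V n N)) - (\<integral>z. h (A *v z) \<partial>gauss)\<bar>
       \<le> pi / 2 * ((\<Sum>i\<in>UNIV. \<Sum>k\<in>UNIV. ?b + \<bar>D.\<gamma> n i k - C $ i $ k\<bar>) + c powr q * ?R)"
    proof eventually_elim
      case (elim n)
      have le1: "rate A \<le> 1" if "A \<in> cells n" for A
        using elim that t by (simp add: rate_def field_simps)
      have 1: "D.E n (\<lambda>N. \<bar>D.\<Gamma> n i k N - D.\<gamma> n i k\<bar>) \<le> ?b" for i k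
        using D.E_abs_\<Gamma>_le[where n=n and M="mom 1" and ?M2.0="mom 2" and i=i and k=k] m_le[OF _ alpha1] m2_le[OF _ alpha2] mom12_nonneg le1
        by (simp add: sum_rate)
      have "\<bar>D.E n (\<lambda>N. h (D.V n N)) - (\<integral>z. h (A *v z) \<partial>gauss)\<bar>
        \<le> pi / 2 * ((\<Sum>i\<in>UNIV. \<Sum>k\<in>UNIV. D.E n (\<lambda>N. \<bar>D.\<Gamma> n i k N - D.\<gamma> n i k\<bar>) + \<bar>D.\<gamma> n i k - C $ i $ k\<bar>)
        + c powr q * (\<Sum>j\<in>cells n. rate j * D.E n (\<lambda>N. ((\<Sum>i\<in>UNIV. D.S n i j N) + (\<Sum>i\<in>UNIV. D.m n i j)) * (\<Sum>i\<in>UNIV. D.S n i j N) powr (1 + q))))"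
        by (rule D.normal_approximation[OF reg C q c])
      also have "\<dots> \<le> pi / 2 * ((\<Sum>i\<in>UNIV. \<Sum>k\<in>UNIV. ?b + \<bar>D.\<gamma> n i k - C $ i $ k\<bar>) + c powr q * ?R)"
        by (intro mult_left_mono add_mono sum_mono 1 order.refl remainder_le[OF q al]) auto
      finally show ?case .
    qed
  qed
qed

end

end

section \<open>Rates of convergence\<close>

text \<open>In the next two lemmas \<open>u\<close> stands for \<open>t * r ^ d\<close> and \<open>w\<close> for \<open>\<nu> * r powr \<alpha>\<close>, the size of the
  normalised kernel at distance \<open>r\<close>.\<close>

lemma variance_rate:
  fixes s t u w K1 K2 v :: real
  assumes pos: "0 < s" "0 < t" "0 < u" "0 \<le> w" "0 \<le> K1" "0 \<le> K2" "0 \<le> v"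
    and w: "w\<^sup>2 \<le> 1 / (s * (t * u * (1 + u)))"
  shows "sqrt (t * v) * (3/2 * (K1 * u * w)\<^sup>2 + (K1 * u * w) * sqrt (K2 * u * w\<^sup>2) + K2 * u * w\<^sup>2)
    \<le> sqrt v * (3/2 * K1\<^sup>2 + K1 * sqrt K2 + K2) / s * t powr (-1/2)"
proof -
  \<comment> \<open>The factor 1 + u in the bound for w^2 serves in two ways: u / (1 + u) \<le> 1
    here and 1 / (1 + u) \<le> 1 in the next estimate. So the rate is uniform in u.\<close>
  have 1: "(u * w)\<^sup>2 \<le> 1 / (s * t)"
  proof -
    have "(u * w)\<^sup>2 \<le> u\<^sup>2 * (1 / (s * (t * u * (1 + u))))" unfolding power_mult_distrib by (rule mult_left_mono[OF w]) simp
    also have "\<dots> = (u * u) / (u * (s * t * (1 + u)))" by (simp add: power2_eq_square ac_simps)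
    also have "\<dots> = 1 / (s * t) * (u / (1 + u))" using pos by simp
    also have "\<dots> \<le> 1 / (s * t) * 1" using pos by (intro mult_left_mono) auto
    finally show ?thesis by simp
  qed
  have 2: "u * w\<^sup>2 \<le> 1 / (s * t)"
  proof -
    have "u * w\<^sup>2 \<le> u * (1 / (s * (t * u * (1 + u))))" using w pos by (intro mult_left_mono) auto
    also have "\<dots> = (u * 1) / (u * (s * t * (1 + u)))" by (simp add: ac_simps)
    also have "\<dots> = 1 / (s * t) * (1 / (1 + u))" using pos by simp
    also have "\<dots> \<le> 1 / (s * t) * 1" using pos by (intro mult_left_mono) auto
    finally show ?thesis by simp
  qed
  have 3: "u * w \<le> sqrt (1 / (s * t))" using 1 pos by (intro real_le_rsqrt)
  have 4: "sqrt (K2 * u * w\<^sup>2) \<le> sqrt K2 * sqrt (1 / (s * t))"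
    unfolding real_sqrt_mult[symmetric] unfolding mult.assoc by (intro real_sqrt_le_mono mult_left_mono 2 pos)
  have "3/2 * (K1 * u * w)\<^sup>2 + (K1 * u * w) * sqrt (K2 * u * w\<^sup>2) + K2 * u * w\<^sup>2
     \<le> 3/2 * (K1\<^sup>2 * (1 / (s * t))) + (K1 * sqrt (1 / (s * t))) * (sqrt K2 * sqrt (1 / (s * t))) + K2 * (1 / (s * t))"
  proof (rule add_mono[OF add_mono])
    show "3/2 * (K1 * u * w)\<^sup>2 \<le> 3/2 * (K1\<^sup>2 * (1 / (s * t)))"
      using mult_left_mono[OF 1, of "K1\<^sup>2"] by (simp add: power_mult_distrib mult.assoc)
    have "K1 * u * w \<le> K1 * sqrt (1 / (s * t))" unfolding mult.assoc by (rule mult_left_mono[OF 3 pos(5)])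
    then show "(K1 * u * w) * sqrt (K2 * u * w\<^sup>2) \<le> (K1 * sqrt (1 / (s * t))) * (sqrt K2 * sqrt (1 / (s * t)))"
      by (rule mult_mono) (use 4 pos in auto)
    show "K2 * u * w\<^sup>2 \<le> K2 * (1 / (s * t))" unfolding mult.assoc by (rule mult_left_mono[OF 2 pos(6)])
  qed
  also have "(K1 * sqrt (1 / (s * t))) * (sqrt K2 * sqrt (1 / (s * t))) = K1 * sqrt K2 * (1 / (s * t))"
  proof -
    have "sqrt (1 / (s * t)) * sqrt (1 / (s * t)) = 1 / (s * t)" using pos by simp
    then show ?thesis by (metis (no_types, lifting) mult.assoc mult.commute)
  qed
  finally have "sqrt (t * v) * (3/2 * (K1 * u * w)\<^sup>2 + (K1 * u * w) * sqrt (K2 * u * w\<^sup>2) + K2 * u * w\<^sup>2)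
    \<le> sqrt (t * v) * (3/2 * (K1\<^sup>2 * (1 / (s * t))) + K1 * sqrt K2 * (1 / (s * t)) + K2 * (1 / (s * t)))"
    using pos by (intro mult_left_mono) auto
  also have "\<dots> = (sqrt v * (3/2 * K1\<^sup>2 + K1 * sqrt K2 + K2) / s) * (sqrt t / t)"
    using pos by (simp add: real_sqrt_mult field_simps)
  also have "sqrt t / t = t powr (-1/2)"
  proof -
    have "t powr (-1/2) = t powr (1/2 - 1)" by simp
    also have "\<dots> = t powr (1/2) / t powr 1" by (rule powr_diff)
    also have "\<dots> = sqrt t / t" using pos by (simp add: powr_half_sqrt)
    finally show ?thesis by simp
  qed
  finally show ?thesis .
qed

lemma remainder_rate:
  fixes s t u w K q :: real
  assumes pos: "0 < s" "0 < t" "0 < u" "0 \<le> w" and q: "0 < q" "q \<le> 1"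
    and w: "w\<^sup>2 \<le> 1 / (s * (t * u * (1 + u)))"
  shows "t * ((u + u powr (2 + q)) * w powr (2 + q)) \<le> 2 * s powr (- (1 + q / 2)) * max (t powr (- (q / 2))) ((t * u) powr (- (q / 2)))"
proof -
  \<comment> \<open>b = (2 + q) / 2 turns the power of w into a power of w^2, for which the bound is
    given.\<close>
  define b where "b = 1 + q / 2"
  have w2: "w powr (2 + q) = (w\<^sup>2) powr b"
  proof (cases "w = 0")
    case False
    have "w powr (2 + q) = (w powr 2) powr b" unfolding powr_powr by (simp add: b_def)
    also have "w powr 2 = w\<^sup>2" using pos(4) False by (simp add: powr_numeral)
    finally show ?thesis .
  qed simp
  also have "\<dots> \<le> (1 / (s * (t * u * (1 + u)))) powr b"
    using w q by (intro powr_mono2) (auto simp: b_def)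
  also have "\<dots> = s powr - b * ((t * u) powr - b * (1 + u) powr - b)"
    using pos by (simp add: powr_divide powr_mult powr_minus_divide)
  finally have "t * ((u + u powr (2 + q)) * w powr (2 + q))
     \<le> t * ((u + u powr (2 + q)) * (s powr - b * ((t * u) powr - b * (1 + u) powr - b)))"
    using pos by (intro mult_left_mono) auto
  also have "\<dots> = s powr - b * ((t * u) powr (- (q / 2)) * ((1 + u powr (1 + q)) * (1 + u) powr - b))"
  proof -
    have "1 + - b = - (q / 2)" by (simp add: b_def)
    then have "(t * u) powr (- (q / 2)) = (t * u) powr 1 * (t * u) powr - b"
      by (metis powr_add)
    also have "(t * u) powr 1 = t * u" using pos by simp
    finally have tu: "(t * u) powr (- (q / 2)) = (t * u) * (t * u) powr - b" .
    have "u powr (2 + q) = u * u powr (1 + q)"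
      using pos powr_mult_base[of u "1 + q"] by (simp add: add.assoc)
    then have "u + u powr (2 + q) = u * (1 + u powr (1 + q))" by (simp add: algebra_simps)
    then show ?thesis unfolding tu by (simp add: ac_simps)
  qed
  also have "\<dots> \<le> s powr - b * (2 * max (t powr (- (q / 2))) ((t * u) powr (- (q / 2))))"
  proof (intro mult_left_mono)
    show "(t * u) powr (- (q / 2)) * ((1 + u powr (1 + q)) * (1 + u) powr - b) \<le> 2 * max (t powr (- (q / 2))) ((t * u) powr (- (q / 2)))"
    \<comment> \<open>Two regimes: for u \<le> 1 the remaining factor is bounded and the power of t
      u is left; for u > 1 it grows like u powr (q / 2), which cancels u and leaves the power of t.
      These are the two terms of the maximum, as t u = t^2 r^d.\<close>
    proof (cases "u \<le> 1")
      case True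
      have "u powr (1 + q) \<le> 1" using True pos q by (intro powr_le1) auto
      moreover have "(1 + u) powr - b \<le> (1 + u) powr 0" using pos q by (intro powr_mono) (auto simp: b_def)
      ultimately have "(1 + u powr (1 + q)) * (1 + u) powr - b \<le> 2 * 1" using pos by (intro mult_mono) auto
      then have "(t * u) powr (- (q / 2)) * ((1 + u powr (1 + q)) * (1 + u) powr - b) \<le> (t * u) powr (- (q / 2)) * 2"
        by (intro mult_left_mono) auto
      then show ?thesis by simp
    next
      case False
      have "1 \<le> u powr (1 + q)" using False q by (intro ge_one_powr_ge_zero) auto
      moreover have "(1 + u) powr - b \<le> u powr - b" using pos q by (intro powr_mono2') (auto simp: b_def)
      ultimately have "(1 + u powr (1 + q)) * (1 + u) powr - b \<le> (2 * u powr (1 + q)) * u powr - b" using pos by (intro mult_mono) auto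
      also have "\<dots> = 2 * u powr (q / 2)" by (simp add: powr_add[symmetric] b_def)
      finally have "(t * u) powr (- (q / 2)) * ((1 + u powr (1 + q)) * (1 + u) powr - b) \<le> (t * u) powr (- (q / 2)) * (2 * u powr (q / 2))"
        by (intro mult_left_mono) auto
      also have "\<dots> = 2 * t powr (- (q / 2)) * (u powr (- (q / 2)) * u powr (q / 2))" by (simp add: powr_mult ac_simps)
      also have "u powr (- (q / 2)) * u powr (q / 2) = 1" using pos by (simp add: powr_add[symmetric])
      finally show ?thesis by simp
    qed
  qed simp
  finally show ?thesis by (simp add: b_def ac_simps)
qed

lemma sum_powers_le:
  fixes u q :: real
  assumes "0 < u" "0 < q" shows "u\<^sup>2 \<le> u + u powr (2 + q)"
proof (cases "u \<le> 1")
  case True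
  then have "u * u \<le> u * 1" using assms by (intro mult_left_mono) auto
  moreover have "0 \<le> u powr (2 + q)" by simp
  ultimately show ?thesis unfolding power2_eq_square by linarith
next
  case False
  have "u powr 2 \<le> u powr (2 + q)" using False assms by (intro powr_mono) auto
  then show ?thesis using assms by (simp add: powr_numeral)
qed

section \<open>The normalised functionals as the intensity grows\<close>

locale edge_setting =
  fixes \<alpha> :: real and W :: "'m::finite \<Rightarrow> 'a::euclidean_space set" and \<epsilon> :: "real \<Rightarrow> real"
    and M :: "real \<Rightarrow> 'w measure" and \<eta> :: "real \<Rightarrow> 'w \<Rightarrow> 'a measure"
  assumes alpha: "- real DIM('a) / 2 < \<alpha>"
    and W: "\<And>i. convex_body (W i)"
    and eps_pos: "\<And>t. t > 0 \<Longrightarrow> \<epsilon> t > 0"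
    and eps_lim: "(\<epsilon> \<longlongrightarrow> 0) at_top"
    and poisson: "\<And>t. t > 0 \<Longrightarrow> poisson_measure (M t) (\<eta> t) (density lborel (\<lambda>_. ennreal t))"
begin

definition \<sigma>1 :: real where "\<sigma>1 = sigma1 TYPE('a) \<alpha>"
definition \<sigma>2 :: real where "\<sigma>2 = sigma2 TYPE('a) \<alpha>"

definition nu :: "real \<Rightarrow> real" where
  "nu t = t powr (-1) * \<epsilon> t powr (- \<alpha> - real DIM('a) / 2) * (1 / 2 * \<sigma>1 + \<sigma>2 * t * \<epsilon> t ^ DIM('a)) powr (-1 / 2)"

definition F :: "real \<Rightarrow> 'w \<Rightarrow> real ^ 'm" where
  "F t = normalized_edge_vector (M t) (\<eta> t) \<alpha> t (\<epsilon> t) W"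

definition cov :: "real \<Rightarrow> 'm \<Rightarrow> 'm \<Rightarrow> real" where
  "cov t i k = covariance (M t) (\<lambda>\<omega>. F t \<omega> $ i) (\<lambda>\<omega>. F t \<omega> $ k)"

lemma alphas: "0 < real DIM('a) + \<alpha>" "0 < real DIM('a) + 2 * \<alpha>"
proof -
  have "0 < real DIM('a)" by simp
  then show "0 < real DIM('a) + \<alpha>" "0 < real DIM('a) + 2 * \<alpha>" using alpha by linarith+
qed

lemma sigma_pos: "0 < \<sigma>1" "0 < \<sigma>2"
proof -
  have "0 < measure lborel (ball (0::'a) 1)" by (rule content_ball_pos) simp
  then show "0 < \<sigma>1" "0 < \<sigma>2"
    using alphas by (auto simp: \<sigma>1_def sigma1_def \<sigma>2_def sigma2_def add.commute)
qed

lemma edges: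
  assumes "0 < t" shows "poisson_edges W (nu t) (\<epsilon> t) t (M t) (\<eta> t)"
proof
  fix i
  have "compact (W i)" "interior (W i) \<noteq> {}" using W[of i] by (auto simp: convex_body_def)
  then show "bounded (W i)" "W i \<in> sets borel" "W i \<noteq> {}"
    by (auto simp: compact_imp_bounded compact_imp_closed)
qed (use assms eps_pos poisson in \<open>auto simp: nu_def\<close>)

context
  fixes t :: real
  assumes t: "0 < t"
begin

interpretation P: poisson_edges W "nu t" \<alpha> "\<epsilon> t" t "M t" "\<eta> t"
  by (rule edges[OF t])

lemma radial: "P.radial (2 * \<alpha>) = \<sigma>1" "(P.radial \<alpha>)\<^sup>2 = \<sigma>2"
  by (simp_all add: P.radial_def \<sigma>1_def sigma1_def \<sigma>2_def sigma2_def add.commute)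

lemma F_eq: "F t \<omega> = (\<chi> i. P.Z i \<omega> - P.e i)"
proof -
  have "P.e i = nu t * (\<integral>\<omega>'. edge_functional \<alpha> (\<epsilon> t) (W i) (\<eta> t \<omega>') \<partial>M t)" for i
    using P.Z_moments(2)[OF P.\<gamma>_tendsto[OF alpha] P.EQ_tendsto[OF alpha], of i]
    by (simp add: P.Z_def[abs_def])
  moreover have "normalized_edge_functional (M t) (\<eta> t) \<alpha> t (\<epsilon> t) (W i) \<omega>
      = nu t * (edge_functional \<alpha> (\<epsilon> t) (W i) (\<eta> t \<omega>) - (\<integral>\<omega>'. edge_functional \<alpha> (\<epsilon> t) (W i) (\<eta> t \<omega>') \<partial>M t))" for i
    by (simp only: normalized_edge_functional_def nu_def \<sigma>1_def \<sigma>2_def)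
  ultimately show ?thesis
    by (simp add: F_def normalized_edge_vector_def P.Z_def right_diff_distrib)
qed

lemma cov_eq: "cov t i k = P.g i k"
  using P.covariance_Z[OF P.\<gamma>_tendsto[OF alpha] P.EQ_tendsto[OF alpha], of i k]
  by (simp add: cov_def F_eq)

text \<open>Intensity, radius and normalisation enter all moments through u and w alone, and w^2 is
  the inverse of t u times the variance factor; this is the form used by the rate estimates.\<close>

lemma w_facts:
  defines "u \<equiv> t * \<epsilon> t ^ DIM('a)" and "w \<equiv> nu t * \<epsilon> t powr \<alpha>"
  shows "0 < u" "0 < w" "w\<^sup>2 = 1 / (t * u * (1/2 * \<sigma>1 + \<sigma>2 * u))"
    and "P.mom a = P.radial (a * \<alpha>) * u * w powr a"
proof -
  have r: "0 < \<epsilon> t" using eps_pos[OF t] .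
  show u: "0 < u" unfolding u_def using t r by simp
  define D where "D = 1/2 * \<sigma>1 + \<sigma>2 * u"
  have D: "0 < D" unfolding D_def using sigma_pos u by (simp add: add_pos_pos)
  have D': "1 / 2 * \<sigma>1 + \<sigma>2 * t * \<epsilon> t ^ DIM('a) = D" by (simp add: D_def u_def)
  have nu: "0 < nu t" unfolding nu_def D' using t r D by simp
  show w: "0 < w" unfolding w_def using nu r by simp
  have "w = t powr (-1) * (\<epsilon> t powr (- \<alpha> - real DIM('a) / 2) * \<epsilon> t powr \<alpha>) * D powr (-1/2)"
    unfolding w_def nu_def D' by (simp only: mult_ac)
  also have "\<epsilon> t powr (- \<alpha> - real DIM('a) / 2) * \<epsilon> t powr \<alpha> = \<epsilon> t powr (- real DIM('a) / 2)"
    by (simp add: powr_add[symmetric])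
  finally have weq: "w = t powr (-1) * \<epsilon> t powr (- real DIM('a) / 2) * D powr (-1/2)" .
  have "w\<^sup>2 = (t powr (-1))\<^sup>2 * (\<epsilon> t powr (- real DIM('a) / 2))\<^sup>2 * (D powr (-1/2))\<^sup>2"
    unfolding weq power_mult_distrib by (rule refl)
  also have "(t powr (-1))\<^sup>2 = 1 / (t * t)" using t by (simp add: power2_eq_square powr_minus_divide)
  also have "(\<epsilon> t powr (- real DIM('a) / 2))\<^sup>2 = 1 / \<epsilon> t ^ DIM('a)"
    using r by (simp add: power2_eq_square powr_add[symmetric] powr_minus_divide powr_realpow)
  also have "(D powr (-1/2))\<^sup>2 = 1 / D"
    using D by (simp add: power2_eq_square powr_add[symmetric] powr_minus_divide)
  finally show "w\<^sup>2 = 1 / (t * u * (1/2 * \<sigma>1 + \<sigma>2 * u))"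
    unfolding D_def[symmetric] by (simp add: u_def)
  have "\<epsilon> t powr (real DIM('a) + a * \<alpha>) = \<epsilon> t ^ DIM('a) * (\<epsilon> t powr \<alpha>) powr a"
    using r by (simp add: powr_add powr_realpow powr_powr mult.commute)
  then show "P.mom a = P.radial (a * \<alpha>) * u * w powr a"
    by (simp add: P.mom_def u_def w_def powr_mult)
qed

text \<open>The reason for the normalising factor: t times \<open>\<Phi>\<close> is the covariance
  per unit volume away from the boundary, so the covariance differs from the volume of the
  intersection by a boundary effect only.\<close>

lemma normalisation: "t * P.\<Phi> = 1"
proof -
  define u where "u = t * \<epsilon> t ^ DIM('a)"
  define w where "w = nu t * \<epsilon> t powr \<alpha>"
  note wf = w_facts[folded u_def w_def]
  have "t * P.\<Phi> = (t * u * (1/2 * \<sigma>1 + \<sigma>2 * u)) * w\<^sup>2"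
    using wf(2) by (simp add: P.\<Phi>_def wf(4) radial[symmetric] power_mult_distrib power2_eq_square algebra_simps)
  also have "\<dots> = 1"
  proof -
    have "0 < 1/2 * \<sigma>1 + \<sigma>2 * u" using sigma_pos wf(1) by (simp add: add_pos_pos)
    then have "t * u * (1/2 * \<sigma>1 + \<sigma>2 * u) \<noteq> 0" using t wf(1) by simp
    then show ?thesis unfolding wf(3) by simp
  qed
  finally show ?thesis .
qed

lemma cov_bounds:
  assumes "G \<in> sets borel" "G \<subseteq> W i \<inter> W k" "\<And>x. x \<in> G \<Longrightarrow> ball x (\<epsilon> t) \<subseteq> W i \<inter> W k"
  shows "cov t i k \<le> measure lborel (W i \<inter> W k)" "measure lborel G \<le> cov t i k"
  using P.g_bounds[OF alpha assms] by (simp_all add: cov_eq normalisation)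

text \<open>The coefficients do not depend on t. The constant s is chosen such that s (1 + u) is at
  most \<open>1/2 * \<sigma>1 + \<sigma>2 * u\<close>, which reduces the normalisation to the bound
  on w^2 that the rate estimates expect.\<close>

lemma approximation:
  fixes A C :: "real ^ 'm ^ 'm"
  assumes reg: "regular c A h" and C: "\<And>i j. C $ i $ j = (\<Sum>p\<in>UNIV. A $ i $ p * A $ j $ p)"
    and q: "0 < q" "q \<le> 1" and al: "- real DIM('a) < (2 + q) * \<alpha>" and c: "0 \<le> c"
  defines "v \<equiv> measure lborel (\<Union>i. W i)" and "s \<equiv> min (1/2 * \<sigma>1) \<sigma>2"
    and "rad \<equiv> \<lambda>\<beta>. real DIM('a) * measure lborel (ball (0::'a) 1) / (real DIM('a) + \<beta>)"
  shows "\<bar>(\<integral>\<omega>. h (F t \<omega>) \<partial>M t) - (\<integral>z. h (A *v z) \<partial>gauss)\<bar>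
    \<le> pi / 2 * ((\<Sum>i\<in>(UNIV :: 'm set). \<Sum>k\<in>(UNIV :: 'm set). sqrt v * (3/2 * (rad \<alpha>)\<^sup>2 + rad \<alpha> * sqrt (rad (2 * \<alpha>)) + rad (2 * \<alpha>)) / s * t powr (-1/2) + \<bar>cov t i k - C $ i $ k\<bar>)
      + c powr q * (v * (10 * real CARD('m) ^ 5 * ((rad \<alpha>) powr (2 + q) + rad \<alpha> * rad ((1 + q) * \<alpha>) + rad ((2 + q) * \<alpha>)) *
         (2 * s powr (- (1 + q / 2)) * max (t powr (- (q / 2))) ((t\<^sup>2 * \<epsilon> t ^ DIM('a)) powr (- (q / 2)))))))"
proof -
  define u where "u = t * \<epsilon> t ^ DIM('a)"
  define w where "w = nu t * \<epsilon> t powr \<alpha>"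
  note wf = w_facts[folded u_def w_def]
  have rad: "rad = P.radial" by (simp add: rad_def P.radial_def fun_eq_iff)
  have s: "0 < s" unfolding s_def using sigma_pos by simp
  have v0: "0 \<le> v" by (simp add: v_def)
  have v: "v = measure lborel P.U" by (simp add: v_def P.U_def)
  have w2: "w\<^sup>2 \<le> 1 / (s * (t * u * (1 + u)))"
  proof -
    have "s * (1 + u) \<le> 1/2 * \<sigma>1 + \<sigma>2 * u"
      unfolding distrib_left using wf(1) by (intro add_mono mult_right_mono) (auto simp: s_def)
    then have "s * (t * u * (1 + u)) \<le> t * u * (1/2 * \<sigma>1 + \<sigma>2 * u)"
      using mult_left_mono[of "s * (1 + u)" "1/2 * \<sigma>1 + \<sigma>2 * u" "t * u"] t wf(1) by (simp add: ac_simps)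
    moreover have "0 < s * (t * u * (1 + u))" using s t wf(1) by simp
    ultimately show ?thesis unfolding wf(3) by (intro frac_le) auto
  qed
  have dpos: "0 < real DIM('a)" by simp
  have radpos: "0 \<le> rad (a * \<alpha>)" if "0 < a" "a \<le> 2 + q" for a
  proof -
    have "- real DIM('a) < a * \<alpha>"
    proof (cases "0 \<le> \<alpha>")
      case True
      then have "0 \<le> a * \<alpha>" using that by simp
      then show ?thesis using dpos by linarith
    next
      case False
      then have "(2 + q) * \<alpha> \<le> a * \<alpha>" using that by (intro mult_right_mono_neg) auto
      then show ?thesis using al by linarith
    qed
    then show ?thesis unfolding rad by (rule P.radial_nonneg)
  qed
  have r1: "0 \<le> rad \<alpha>" and r2: "0 \<le> rad (2 * \<alpha>)" and rq1: "0 \<le> rad ((1 + q) * \<alpha>)" and rq2: "0 \<le> rad ((2 + q) * \<alpha>)"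
    using radpos[of 1] radpos[of 2] radpos[of "1 + q"] radpos[of "2 + q"] q by simp_all
  have m1: "P.mom 1 = rad \<alpha> * u * w" and m2: "P.mom 2 = rad (2 * \<alpha>) * u * w\<^sup>2"
    using wf(2) by (simp_all add: wf(4) rad)
  have R1: "sqrt (t * measure lborel P.U) * (3/2 * (P.mom 1)\<^sup>2 + P.mom 1 * sqrt (P.mom 2) + P.mom 2)
      \<le> sqrt v * (3/2 * (rad \<alpha>)\<^sup>2 + rad \<alpha> * sqrt (rad (2 * \<alpha>)) + rad (2 * \<alpha>)) / s * t powr (-1/2)"
    unfolding m1 m2 v[symmetric] using wf(2)
    by (intro variance_rate[OF s t wf(1) _ r1 r2 v0 w2]) simp
  define K where "K = (rad \<alpha>) powr (2 + q) + rad \<alpha> * rad ((1 + q) * \<alpha>) + rad ((2 + q) * \<alpha>)"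
  have K0: "0 \<le> K" unfolding K_def using r1 rq1 rq2 by (intro add_nonneg_nonneg mult_nonneg_nonneg) auto
  have R2: "P.mom 1 powr (2 + q) + P.mom 1 * P.mom (1 + q) + P.mom (2 + q) \<le> K * ((u + u powr (2 + q)) * w powr (2 + q))"
  proof -
    define B where "B = (u + u powr (2 + q)) * w powr (2 + q)"
    have "P.mom 1 powr (2 + q) = (rad \<alpha>) powr (2 + q) * (u powr (2 + q) * w powr (2 + q))"
      unfolding m1 by (simp add: powr_mult)
    also have "\<dots> \<le> (rad \<alpha>) powr (2 + q) * B"
      unfolding B_def using wf(1) by (intro mult_left_mono mult_right_mono) auto
    finally have 1: "P.mom 1 powr (2 + q) \<le> (rad \<alpha>) powr (2 + q) * B" .
    have "P.mom 1 * P.mom (1 + q) = rad \<alpha> * rad ((1 + q) * \<alpha>) * (u\<^sup>2 * (w * w powr (1 + q)))"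
      using wf(2) by (simp add: m1 wf(4) rad power2_eq_square)
    also have "w * w powr (1 + q) = w powr (2 + q)" using wf(2) powr_mult_base[of w "1 + q"] by (simp add: add.assoc)
    also have "rad \<alpha> * rad ((1 + q) * \<alpha>) * (u\<^sup>2 * w powr (2 + q)) \<le> rad \<alpha> * rad ((1 + q) * \<alpha>) * B"
      unfolding B_def using sum_powers_le[OF wf(1) q(1)] r1 rq1 by (intro mult_left_mono mult_right_mono) auto
    finally have 2: "P.mom 1 * P.mom (1 + q) \<le> rad \<alpha> * rad ((1 + q) * \<alpha>) * B" .
    have "P.mom (2 + q) = rad ((2 + q) * \<alpha>) * (u * w powr (2 + q))"
      by (simp add: wf(4) rad)
    also have "\<dots> \<le> rad ((2 + q) * \<alpha>) * B"
      unfolding B_def using rq2 by (intro mult_left_mono mult_right_mono) auto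
    finally have "P.mom (2 + q) \<le> rad ((2 + q) * \<alpha>) * B" .
    moreover have "(x + y + z) * B = x * B + y * B + z * B" for x y z by (simp add: algebra_simps)
    ultimately show ?thesis unfolding K_def B_def[symmetric] using 1 2 by simp
  qed
  have tu: "t * u = t\<^sup>2 * \<epsilon> t ^ DIM('a)" by (simp add: u_def power2_eq_square)
  have "t * (P.mom 1 powr (2 + q) + P.mom 1 * P.mom (1 + q) + P.mom (2 + q)) \<le> t * (K * ((u + u powr (2 + q)) * w powr (2 + q)))"
    using R2 t by (intro mult_left_mono) auto
  also have "\<dots> = K * (t * ((u + u powr (2 + q)) * w powr (2 + q)))" by simp
  also have "\<dots> \<le> K * (2 * s powr (- (1 + q / 2)) * max (t powr (- (q / 2))) ((t * u) powr (- (q / 2))))"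
    using wf(2) by (intro mult_left_mono K0 remainder_rate[OF s t wf(1) _ q w2]) simp
  finally have R3: "t * (P.mom 1 powr (2 + q) + P.mom 1 * P.mom (1 + q) + P.mom (2 + q))
     \<le> K * (2 * s powr (- (1 + q / 2)) * max (t powr (- (q / 2))) ((t\<^sup>2 * \<epsilon> t ^ DIM('a)) powr (- (q / 2))))"
    unfolding tu .
  have R4: "t * measure lborel P.U * (10 * real CARD('m) ^ 5 * (P.mom 1 powr (2 + q) + P.mom 1 * P.mom (1 + q) + P.mom (2 + q)))
     \<le> v * (10 * real CARD('m) ^ 5 * K * (2 * s powr (- (1 + q / 2)) * max (t powr (- (q / 2))) ((t\<^sup>2 * \<epsilon> t ^ DIM('a)) powr (- (q / 2)))))"
    using mult_left_mono[OF R3, of "v * (10 * real CARD('m) ^ 5)"] v0 unfolding v[symmetric] by (simp add: ac_simps)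
  have "\<bar>(\<integral>\<omega>. h (F t \<omega>) \<partial>M t) - (\<integral>z. h (A *v z) \<partial>gauss)\<bar>
    \<le> pi / 2 * ((\<Sum>i\<in>UNIV. \<Sum>k\<in>UNIV. sqrt (t * measure lborel P.U) * (3/2 * (P.mom 1)\<^sup>2 + P.mom 1 * sqrt (P.mom 2) + P.mom 2) + \<bar>P.g i k - C $ i $ k\<bar>)
        + c powr q * (t * measure lborel P.U * (10 * real CARD('m) ^ 5 * (P.mom 1 powr (2 + q) + P.mom 1 * P.mom (1 + q) + P.mom (2 + q)))))"
    unfolding F_eq by (rule P.normal_approximation[OF alpha reg C q al c])
  also have "\<dots> \<le> pi / 2 * ((\<Sum>i\<in>(UNIV :: 'm set). \<Sum>k\<in>(UNIV :: 'm set). sqrt v * (3/2 * (rad \<alpha>)\<^sup>2 + rad \<alpha> * sqrt (rad (2 * \<alpha>)) + rad (2 * \<alpha>)) / s * t powr (-1/2) + \<bar>cov t i k - C $ i $ k\<bar>)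
      + c powr q * (v * (10 * real CARD('m) ^ 5 * K * (2 * s powr (- (1 + q / 2)) * max (t powr (- (q / 2))) ((t\<^sup>2 * \<epsilon> t ^ DIM('a)) powr (- (q / 2)))))))"
    unfolding cov_eq by (intro mult_left_mono add_mono sum_mono R1 R4 order.refl) auto
  finally show ?thesis unfolding K_def .
qed

end

text \<open>The part of the intersection near its boundary has volume of order \<epsilon>. Two
  convex bodies may intersect in a set with empty interior; this is a null set, and then the empty
  set serves as inner set with constant 0.\<close>

lemma cov_rate: "\<exists>c\<ge>0. \<forall>\<^sub>F t in at_top. \<bar>cov t i k - measure lborel (W i \<inter> W k)\<bar> \<le> c * \<epsilon> t"
proof -
  define K where "K = W i \<inter> W k"
  have K: "compact K" "convex K" using W unfolding K_def convex_body_def by (auto intro: compact_Int convex_Int)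
  then have Kb: "K \<in> sets borel" by (simp add: compact_imp_closed)
  have "\<exists>c r0. 0 \<le> c \<and> 0 < r0 \<and> (\<forall>e. 0 < e \<longrightarrow> e < r0 \<longrightarrow> (\<exists>G\<in>sets lborel. G \<subseteq> K \<and> (\<forall>x\<in>G. ball x e \<subseteq> K) \<and> measure lborel (K - G) \<le> c * e))"
  proof (cases "interior K = {}")
    case True
    then have "negligible K" using K by (simp add: negligible_convex_interior)
    then have "measure lebesgue K = 0" by (rule negligible_imp_measure0)
    then have "measure lborel K = 0" using Kb by (simp add: measure_completion)
    then show ?thesis by (intro exI[of _ 0] exI[of _ 1]) (auto intro!: bexI[of _ "{}"])
  next
    case False
    from inner_parallel_convex[OF K False] show ?thesis by metis
  qed
  then obtain c r0 where c: "0 \<le> c" "0 < r0"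
    and G: "\<And>e. 0 < e \<Longrightarrow> e < r0 \<Longrightarrow> \<exists>G\<in>sets lborel. G \<subseteq> K \<and> (\<forall>x\<in>G. ball x e \<subseteq> K) \<and> measure lborel (K - G) \<le> c * e"
    by blast
  have "\<forall>\<^sub>F t in at_top. \<epsilon> t < r0" using eps_lim c(2) by (rule order_tendstoD)
  then have "\<forall>\<^sub>F t in at_top. \<bar>cov t i k - measure lborel K\<bar> \<le> c * \<epsilon> t"
    using eventually_gt_at_top[of "0::real"]
  proof eventually_elim
    case (elim t)
    obtain G where G: "G \<in> sets lborel" "G \<subseteq> K" "\<And>x. x \<in> G \<Longrightarrow> ball x (\<epsilon> t) \<subseteq> K" "measure lborel (K - G) \<le> c * \<epsilon> t"
      using G[OF eps_pos[OF elim(2)] elim(1)] by blast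
    have "measure lborel (K - G) = measure lborel K - measure lborel G"
      using Kb G emeasure_compact_finite[OF K(1)] by (intro measure_Diff) auto
    moreover have "cov t i k \<le> measure lborel K" "measure lborel G \<le> cov t i k"
      using cov_bounds[OF elim(2), of G i k] G unfolding K_def by auto
    ultimately show ?case using G(4) by linarith
  qed
  then show ?thesis using c(1) unfolding K_def by blast
qed

lemma cov_tendsto: "((\<lambda>t. cov t i k) \<longlongrightarrow> measure lborel (W i \<inter> W k)) at_top"
proof -
  obtain c where "0 \<le> c" and c: "\<forall>\<^sub>F t in at_top. \<bar>cov t i k - measure lborel (W i \<inter> W k)\<bar> \<le> c * \<epsilon> t"
    using cov_rate by blast
  have "((\<lambda>t. cov t i k - measure lborel (W i \<inter> W k)) \<longlongrightarrow> 0) at_top"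
  proof (rule Lim_null_comparison)
    show "\<forall>\<^sub>F t in at_top. norm (cov t i k - measure lborel (W i \<inter> W k)) \<le> c * \<epsilon> t" using c by simp
    show "((\<lambda>t. c * \<epsilon> t) \<longlongrightarrow> 0) at_top" using tendsto_mult[OF tendsto_const[of c] eps_lim] by simp
  qed
  then show ?thesis by (simp add: LIM_zero_iff)
qed

text \<open>The class of test functions and q are left open, to serve both distances and both ranges
  of \<alpha>. An exponent \<open>\<delta>\<close> below q / 2 is allowed because t and t^2
  \<epsilon>^d are eventually at least 1, the latter by \<open>dense\<close>, so that smaller
  exponents give larger bounds.\<close>

lemma distance_rate:
  fixes A :: "real ^ 'm ^ 'm"
  assumes dense: "filterlim (\<lambda>t. t\<^sup>2 * \<epsilon> t ^ DIM('a)) at_top at_top"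
    and C: "\<And>i j. intersection_matrix W $ i $ j = (\<Sum>p\<in>UNIV. A $ i $ p * A $ j $ p)"
    and reg: "\<And>h. h \<in> \<H> \<Longrightarrow> regular c A h" and c: "0 \<le> c"
    and X: "\<And>h. h \<in> \<H> \<Longrightarrow> (\<integral>\<omega>. h (X \<omega>) \<partial>N) = (\<integral>z. h (A *v z) \<partial>gauss)"
    and q: "0 < q" "q \<le> 1" and al: "- real DIM('a) < (2 + q) * \<alpha>" and \<delta>: "0 \<le> \<delta>" "\<delta> \<le> q / 2"
  shows "\<exists>K>0. \<forall>\<^sub>F t in at_top. dist_wrt \<H> (M t) (F t) N X
    \<le> ennreal (K * (\<epsilon> t + max (t powr (- \<delta>)) ((t\<^sup>2 * \<epsilon> t ^ DIM('a)) powr (- \<delta>))))"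
proof -
  let ?C = "intersection_matrix W"
  define v where "v = measure lborel (\<Union>i. W i)"
  define s where "s = min (1/2 * \<sigma>1) \<sigma>2"
  define rad where "rad \<beta> = real DIM('a) * measure lborel (ball (0::'a) 1) / (real DIM('a) + \<beta>)" for \<beta>
  define B1 where "B1 = sqrt v * (3/2 * (rad \<alpha>)\<^sup>2 + rad \<alpha> * sqrt (rad (2 * \<alpha>)) + rad (2 * \<alpha>)) / s"
  define B2 where "B2 = c powr q * (v * (10 * real CARD('m) ^ 5 * ((rad \<alpha>) powr (2 + q) + rad \<alpha> * rad ((1 + q) * \<alpha>) + rad ((2 + q) * \<alpha>)) * (2 * s powr (- (1 + q / 2)))))"
  have "\<exists>c. \<forall>i k. 0 \<le> c i k \<and> (\<forall>\<^sub>F t in at_top. \<bar>cov t i k - measure lborel (W i \<inter> W k)\<bar> \<le> c i k * \<epsilon> t)"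
    using cov_rate by metis
  then obtain b where b: "\<And>i k. 0 \<le> b i k" "\<And>i k. \<forall>\<^sub>F t in at_top. \<bar>cov t i k - measure lborel (W i \<inter> W k)\<bar> \<le> b i k * \<epsilon> t"
    by blast
  define B0 where "B0 = (\<Sum>i\<in>UNIV. \<Sum>k\<in>UNIV. b i k)"
  have B0: "0 \<le> B0" unfolding B0_def by (intro sum_nonneg b)
  define m2 where "m2 = real (CARD('m) * CARD('m))"
  define K where "K = 1 + pi / 2 * (B0 + (m2 * \<bar>B1\<bar> + \<bar>B2\<bar>))"
  have K: "0 < K" unfolding K_def m2_def using B0 pi_gt_zero by (intro add_pos_nonneg mult_nonneg_nonneg add_nonneg_nonneg) auto
  have ev: "\<forall>\<^sub>F t in at_top. \<forall>i k. \<bar>cov t i k - measure lborel (W i \<inter> W k)\<bar> \<le> b i k * \<epsilon> t"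
    using b(2) by (simp add: eventually_all_finite)
  have ev2: "\<forall>\<^sub>F t in at_top. 1 \<le> t\<^sup>2 * \<epsilon> t ^ DIM('a)" using dense unfolding filterlim_at_top by blast
  show ?thesis
  proof (intro exI[of _ K] conjI)
    show "0 < K" by (rule K)
    show "\<forall>\<^sub>F t in at_top. dist_wrt \<H> (M t) (F t) N X
      \<le> ennreal (K * (\<epsilon> t + max (t powr (- \<delta>)) ((t\<^sup>2 * \<epsilon> t ^ DIM('a)) powr (- \<delta>))))"
      using ev ev2 eventually_ge_at_top[of "1::real"]
    proof eventually_elim
      case (elim t)
      then have t: "0 < t" by simp
      have \<epsilon>: "0 < \<epsilon> t" using eps_pos[OF t] .
      define \<mu> where "\<mu> = max (t powr (- \<delta>)) ((t\<^sup>2 * \<epsilon> t ^ DIM('a)) powr (- \<delta>))"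
      have \<mu>0: "0 \<le> \<mu>" by (simp add: \<mu>_def le_max_iff_disj)
      have mono: "x powr (- a) \<le> x powr (- \<delta>)" if "1 \<le> x" "\<delta> \<le> a" for x a using that by (intro powr_mono) auto
      have \<mu>1: "t powr (-1/2) \<le> \<mu>"
        using mono[OF elim(3), of "1/2"] \<delta> q by (simp add: \<mu>_def le_max_iff_disj)
      have \<mu>2: "max (t powr (- (q / 2))) ((t\<^sup>2 * \<epsilon> t ^ DIM('a)) powr (- (q / 2))) \<le> \<mu>"
        unfolding \<mu>_def using elim(2,3) \<delta> by (intro max.mono mono) auto
      have covC: "\<bar>cov t i k - ?C $ i $ k\<bar> \<le> b i k * \<epsilon> t" for i k
        using elim(1) by (simp add: intersection_matrix_def)
      have "\<bar>(\<integral>\<omega>. h (F t \<omega>) \<partial>M t) - (\<integral>\<omega>. h (X \<omega>) \<partial>N)\<bar> \<le> K * (\<epsilon> t + \<mu>)" if h: "h \<in> \<H>" for h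
      proof -
        have "\<bar>(\<integral>\<omega>. h (F t \<omega>) \<partial>M t) - (\<integral>z. h (A *v z) \<partial>gauss)\<bar>
          \<le> pi / 2 * ((\<Sum>i\<in>(UNIV :: 'm set). \<Sum>k\<in>(UNIV :: 'm set). B1 * t powr (-1/2) + \<bar>cov t i k - ?C $ i $ k\<bar>)
            + B2 * max (t powr (- (q / 2))) ((t\<^sup>2 * \<epsilon> t ^ DIM('a)) powr (- (q / 2))))"
          using approximation[OF t reg[OF h] C q al c]
          unfolding v_def[symmetric] s_def[symmetric] rad_def[symmetric] B1_def B2_def by (simp add: mult.assoc)
        also have "\<dots> \<le> pi / 2 * ((\<Sum>i\<in>(UNIV :: 'm set). \<Sum>k\<in>(UNIV :: 'm set). \<bar>B1\<bar> * \<mu> + b i k * \<epsilon> t) + \<bar>B2\<bar> * \<mu>)"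
        proof (intro mult_left_mono add_mono sum_mono covC)
          show "B1 * t powr (-1/2) \<le> \<bar>B1\<bar> * \<mu>" using \<mu>1 by (intro mult_mono) auto
          show "B2 * max (t powr (- (q / 2))) ((t\<^sup>2 * \<epsilon> t ^ DIM('a)) powr (- (q / 2))) \<le> \<bar>B2\<bar> * \<mu>"
            using \<mu>2 by (intro mult_mono) (auto simp: le_max_iff_disj)
        qed auto
        also have "\<dots> = pi / 2 * B0 * \<epsilon> t + pi / 2 * (m2 * \<bar>B1\<bar> + \<bar>B2\<bar>) * \<mu>"
        proof -
          have "(\<Sum>i\<in>(UNIV :: 'm set). \<Sum>k\<in>(UNIV :: 'm set). \<bar>B1\<bar> * \<mu> + b i k * \<epsilon> t) = m2 * (\<bar>B1\<bar> * \<mu>) + B0 * \<epsilon> t"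
            by (simp add: sum.distrib B0_def m2_def sum_distrib_right)
          then show ?thesis by (simp only:) (simp add: algebra_simps)
        qed
        also have "\<dots> \<le> K * \<epsilon> t + K * \<mu>"
        proof (intro add_mono mult_right_mono)
          have "0 \<le> pi / 2 * (m2 * \<bar>B1\<bar> + \<bar>B2\<bar>)" "0 \<le> pi / 2 * B0" using B0 by (simp_all add: m2_def)
          then show "pi / 2 * B0 \<le> K" "pi / 2 * (m2 * \<bar>B1\<bar> + \<bar>B2\<bar>) \<le> K"
            unfolding K_def distrib_left by linarith+
        qed (use \<epsilon> \<mu>0 in auto)
        finally show ?thesis unfolding X[OF h] by (simp add: distrib_left)
      qed
      then show ?case
        unfolding dist_wrt_def \<mu>_def[symmetric] by (intro SUP_least ennreal_leI)
    qed
  qed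
qed

end

theorem theorem3:
  fixes \<alpha> :: real
    and W :: "'m::finite \<Rightarrow> 'a::euclidean_space set"
    and \<epsilon> :: "real \<Rightarrow> real"
    and M :: "real \<Rightarrow> 'w measure"
    and \<eta> :: "real \<Rightarrow> 'w \<Rightarrow> 'a measure"
  defines "d \<equiv> real DIM('a)"
    and "F \<equiv> \<lambda>t. normalized_edge_vector (M t) (\<eta> t) \<alpha> t (\<epsilon> t) W"
    and "C \<equiv> intersection_matrix W"
  assumes alpha: "\<alpha> > - d / 2"
    and W: "\<And>i. convex_body (W i)"
    and eps_pos: "\<And>t. t > 0 \<Longrightarrow> \<epsilon> t > 0"
    and eps_lim: "(\<epsilon> \<longlongrightarrow> 0) at_top"
    and poisson: "\<And>t. t > 0 \<Longrightarrow> poisson_measure (M t) (\<eta> t) (density lborel (\<lambda>_. ennreal t))"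
  shows
    "(\<forall>i j. ((\<lambda>t. covariance (M t) (\<lambda>\<omega>. F t \<omega> $ i) (\<lambda>\<omega>. F t \<omega> $ j))
               \<longlongrightarrow> measure lborel (W i \<inter> W j)) at_top) \<and>
     (filterlim (\<lambda>t. t\<^sup>2 * \<epsilon> t ^ DIM('a)) at_top at_top \<longrightarrow>
      (\<forall>(N :: 'v measure) X. centred_gaussian_vector N X C \<longrightarrow>
        (\<alpha> > - d / 4 \<longrightarrow>
          (\<exists>c1>0. \<forall>\<^sub>F t in at_top. d3 (M t) (F t) N X \<le>
             ennreal (c1 * (\<epsilon> t + max (t powr (-1/2)) ((t\<^sup>2 * \<epsilon> t ^ DIM('a)) powr (-1/2)))))) \<and>
        (\<alpha> \<le> - d / 4 \<longrightarrow>
          (\<forall>p. 1 < p \<and> p < - d / (2 * \<alpha>) \<longrightarrow>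
            (\<exists>c2>0. \<forall>\<^sub>F t in at_top. d3 (M t) (F t) N X \<le>
               ennreal (c2 * (\<epsilon> t + max (t powr (-1 + 1/p)) ((t\<^sup>2 * \<epsilon> t ^ DIM('a)) powr (-1 + 1/p))))))) \<and>
        (positive_definite C \<longrightarrow>
          (\<alpha> > - d / 4 \<longrightarrow>
            (\<exists>c1>0. \<forall>\<^sub>F t in at_top. d2 (M t) (F t) N X \<le>
               ennreal (c1 * (\<epsilon> t + max (t powr (-1/2)) ((t\<^sup>2 * \<epsilon> t ^ DIM('a)) powr (-1/2)))))) \<and>
          (\<alpha> \<le> - d / 4 \<longrightarrow>
            (\<forall>p. 1 < p \<and> p < - d / (2 * \<alpha>) \<longrightarrow>
              (\<exists>c2>0. \<forall>\<^sub>F t in at_top. d2 (M t) (F t) N X \<le>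
                 ennreal (c2 * (\<epsilon> t + max (t powr (-1 + 1/p)) ((t\<^sup>2 * \<epsilon> t ^ DIM('a)) powr (-1 + 1/p))))))))))"
proof -
  interpret S: edge_setting \<alpha> W \<epsilon> M \<eta>
    by unfold_locales (use alpha W eps_pos eps_lim poisson in \<open>simp_all add: d_def\<close>)
  have F: "F = S.F" by (simp add: F_def S.F_def fun_eq_iff)
  have d: "0 < d" by (simp add: d_def)
  have main: "\<exists>K>0. \<forall>\<^sub>F t in at_top. dist_wrt \<H> (M t) (F t) N X \<le>
       ennreal (K * (\<epsilon> t + max (t powr - \<delta>) ((t\<^sup>2 * \<epsilon> t ^ DIM('a)) powr - \<delta>)))"
    if dense: "filterlim (\<lambda>t. t\<^sup>2 * \<epsilon> t ^ DIM('a)) at_top at_top"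
      and X: "centred_gaussian_vector N X C"
      and \<H>: "\<H> = H3 \<or> \<H> = H2 \<and> positive_definite C"
      and q: "0 < q" "q \<le> 1" "- d < (2 + q) * \<alpha>" "0 \<le> \<delta>" "\<delta> \<le> q / 2"
    for N :: "'v measure" and X \<H> q \<delta>
  proof -
    obtain A :: "real ^ 'm ^ 'm" where A': "\<forall>i j. C $ i $ j = (\<Sum>p\<in>UNIV. A $ i $ p * A $ j $ p)"
      and law': "\<forall>h c. continuous_on UNIV h \<longrightarrow> (\<forall>x. \<bar>h x\<bar> \<le> c * (1 + norm x)\<^sup>2) \<longrightarrow> (\<integral>\<omega>. h (X \<omega>) \<partial>N) = (\<integral>z. h (A *v z) \<partial>gauss)"
    proof (rule centred_gaussian_vector_representation[OF X])
      fix A :: "real ^ 'm ^ 'm"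
      assume 1: "\<And>i j. C $ i $ j = (\<Sum>p\<in>UNIV. A $ i $ p * A $ j $ p)"
        and 2: "\<And>h c. continuous_on UNIV h \<Longrightarrow> (\<And>x. \<bar>h x\<bar> \<le> c * (1 + norm x)\<^sup>2) \<Longrightarrow> (\<integral>\<omega>. h (X \<omega>) \<partial>N) = (\<integral>z. h (A *v z) \<partial>gauss)"
      show thesis
      proof (rule that[of A])
        show "\<forall>i j. C $ i $ j = (\<Sum>p\<in>UNIV. A $ i $ p * A $ j $ p)" by (intro allI 1)
        show "\<forall>h c. continuous_on UNIV h \<longrightarrow> (\<forall>x. \<bar>h x\<bar> \<le> c * (1 + norm x)\<^sup>2) \<longrightarrow> (\<integral>\<omega>. h (X \<omega>) \<partial>N) = (\<integral>z. h (A *v z) \<partial>gauss)"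
        proof (intro allI impI)
          fix h :: "real ^ 'm \<Rightarrow> real" and c assume "continuous_on UNIV h" "\<forall>x. \<bar>h x\<bar> \<le> c * (1 + norm x)\<^sup>2"
          then show "(\<integral>\<omega>. h (X \<omega>) \<partial>N) = (\<integral>z. h (A *v z) \<partial>gauss)" by (intro 2[of h c]) auto
        qed
      qed
    qed
    note A = A'[rule_format] and law = law'[rule_format]
    have "\<exists>c\<ge>0. \<forall>h\<in>\<H>. regular c A h"
    proof (cases "\<H> = H3")
      case True
      then show ?thesis using H3_regular[of _ A] by (intro exI[of _ 1]) auto
    next
      case False
      then have pd: "positive_definite C" and "\<H> = H2" using \<H> by auto
      obtain B where "A ** B = mat 1" using positive_definite_factor_invertible[OF pd A] by blast
      then show ?thesis using H2_regular[of _ A B] \<open>\<H> = H2\<close>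
        by (intro exI[of _ "2 * onorm ((*v) B)"]) (auto intro!: onorm_pos_le matrix_vector_mul_bounded_linear)
    qed
    then obtain c where c: "0 \<le> c" "\<And>h. h \<in> \<H> \<Longrightarrow> regular c A h" by blast
    have EX: "(\<integral>\<omega>. h (X \<omega>) \<partial>N) = (\<integral>z. h (A *v z) \<partial>gauss)" if "h \<in> \<H>" for h
    proof -
      from regular_growth(2)[OF c(2)[OF that]]
      obtain c' where "\<And>x. \<bar>h x\<bar> \<le> c' * (1 + norm x)\<^sup>2" by blast
      then show ?thesis by (rule law[OF regular_growth(1)[OF c(2)[OF that]]])
    qed
    show ?thesis
      unfolding F
      by (rule S.distance_rate[OF dense A[unfolded C_def] c(2,1) EX q(1,2) q(3)[unfolded d_def] q(4,5)])
  qed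
  \<comment> \<open>Here q = 1 and the rate exponent is 1/2; \<alpha> > -d / 4 implies 3 \<alpha> >
    -d.\<close>
  have case1: "0 < (1::real)" "(1::real) \<le> 1" "- d < (2 + 1) * \<alpha>" "0 \<le> (1/2 :: real)" "1/2 \<le> (1::real) / 2"
    if "\<alpha> > - d / 4" using that d by simp_all
  have case2: "\<exists>q>0. q \<le> 1 \<and> - d < (2 + q) * \<alpha> \<and> 0 \<le> 1 - 1 / p \<and> 1 - 1 / p \<le> q / 2"
    if "\<alpha> \<le> - d / 4" "1 < p" "p < - d / (2 * \<alpha>)" for p
  proof -
    have neg: "\<alpha> < 0" using that(1) d by linarith
    have pa: "- d < 2 * p * \<alpha>" using that(3) neg by (simp add: field_simps)
    have "2 * p * (d / 4) \<le> 2 * p * (- \<alpha>)" using that(1,2) by (intro mult_left_mono) auto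
    also have "\<dots> < d" using pa by simp
    finally have p2: "p < 2" using d by simp
    \<comment> \<open>Two conditions on q: 2 + q \<le> 2 p, so that (2 + q) \<alpha> > -d follows
      from the bound on p, and q / 2 \<ge> 1 - 1 / p. The value 2 p - 2 satisfies both, and the cap
      at 1 respects the second because p < 2.\<close>
    define q where "q = min 1 (2 * p - 2)"
    have q: "0 < q" "q \<le> 1" "2 + q \<le> 2 * p" using that(2) by (auto simp: q_def)
    have "2 * p * \<alpha> \<le> (2 + q) * \<alpha>" using q neg by (intro mult_right_mono_neg) auto
    then have 1: "- d < (2 + q) * \<alpha>" using pa by linarith
    have 2: "0 \<le> 1 - 1 / p" using that(2) by simp
    have "1 - 1 / p \<le> 1 / 2" using p2 that(2) by (simp add: field_simps)
    moreover have "1 - 1 / p \<le> p - 1"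
    proof -
      have "(p - 1) * 1 \<le> (p - 1) * p" using that(2) by (intro mult_left_mono) auto
      then show ?thesis using that(2) by (simp add: field_simps)
    qed
    ultimately have "1 - 1 / p \<le> q / 2" by (simp add: q_def min_def)
    then show ?thesis using q 1 2 by blast
  qed
  have half: "(-1/2 :: real) = - (1/2)" and expo: "-1 + 1/p = - (1 - 1/p)" for p :: real by simp_all
  show ?thesis
    unfolding d2_def d3_def half expo
  proof (intro conjI allI impI)
    fix i k
    show "((\<lambda>t. covariance (M t) (\<lambda>\<omega>. F t \<omega> $ i) (\<lambda>\<omega>. F t \<omega> $ k)) \<longlongrightarrow> measure lborel (W i \<inter> W k)) at_top"
      using S.cov_tendsto[of i k] unfolding S.cov_def F .
  next
    fix N :: "'v measure" and X
    assume dense: "filterlim (\<lambda>t. t\<^sup>2 * \<epsilon> t ^ DIM('a)) at_top at_top" and X: "centred_gaussian_vector N X C"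
    show "\<exists>c1>0. \<forall>\<^sub>F t in at_top. dist_wrt H3 (M t) (F t) N X \<le>
        ennreal (c1 * (\<epsilon> t + max (t powr - (1/2)) ((t\<^sup>2 * \<epsilon> t ^ DIM('a)) powr - (1/2))))" if "- d / 4 < \<alpha>"
      by (rule main[OF dense X _ case1[OF that]]) simp
    show "\<exists>c2>0. \<forall>\<^sub>F t in at_top. dist_wrt H3 (M t) (F t) N X \<le>
        ennreal (c2 * (\<epsilon> t + max (t powr - (1 - 1/p)) ((t\<^sup>2 * \<epsilon> t ^ DIM('a)) powr - (1 - 1/p))))"
      if "\<alpha> \<le> - d / 4" "1 < p \<and> p < - d / (2 * \<alpha>)" for p
    proof -
      from case2[OF that(1), of p] that(2)
      obtain q where q: "0 < q" "q \<le> 1" "- d < (2 + q) * \<alpha>" "0 \<le> 1 - 1 / p" "1 - 1 / p \<le> q / 2" by blast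
      show ?thesis by (rule main[OF dense X _ q]) simp
    qed
    show "\<exists>c1>0. \<forall>\<^sub>F t in at_top. dist_wrt H2 (M t) (F t) N X \<le>
        ennreal (c1 * (\<epsilon> t + max (t powr - (1/2)) ((t\<^sup>2 * \<epsilon> t ^ DIM('a)) powr - (1/2))))"
      if "positive_definite C" "- d / 4 < \<alpha>"
      by (rule main[OF dense X _ case1[OF that(2)]]) (simp add: that(1))
    show "\<exists>c2>0. \<forall>\<^sub>F t in at_top. dist_wrt H2 (M t) (F t) N X \<le>
        ennreal (c2 * (\<epsilon> t + max (t powr - (1 - 1/p)) ((t\<^sup>2 * \<epsilon> t ^ DIM('a)) powr - (1 - 1/p))))"
      if "positive_definite C" "\<alpha> \<le> - d / 4" "1 < p \<and> p < - d / (2 * \<alpha>)" for p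
    proof -
      from case2[OF that(2), of p] that(3)
      obtain q where q: "0 < q" "q \<le> 1" "- d < (2 + q) * \<alpha>" "0 \<le> 1 - 1 / p" "1 - 1 / p \<le> q / 2" by blast
      show ?thesis by (rule main[OF dense X _ q]) (simp add: that(1))
    qed
  qed
qed

end
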